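(* Let $\mathcal{T}$ and $\mathcal{S}_i$ ($i\in I$, with $I$ an arbitrary, possibly infinite, indexing set) be rigidly-compactly generated tensor triangulated categories. If $\{f_i^*\colon \mathcal{T} \to \mathcal{S}_i\}_{i\in I}$ is a jointly nil-conservative family of geometric functors, then the induced map on Balmer spectra $$\varphi\colon \bigsqcup_{i\in I} \mathrm{Spc}(\mathcal{S}_i^c) \to \mathrm{Spc}(\mathcal{T}^c)$$ is surjective.
   Context: A tensor triangulated (tt-) category is a triangulated category with a compatible closed symmetric monoidal structure $(\otimes,\mathbb{1})$. It is rigidly-compactly generated if it has small coproducts, is compactly generated as a triangulated category, and its compact objects coincide with its dualizable objects (in particular $\mathbb{1}$ is compact). $\mathcal{T}^c$ denotes the essentially small full tensor triangulated subcategory of compact (= dualizable) objects. The Balmer spectrum $\mathrm{Spc}(\mathcal{T}^c)$ is the set of prime thick tensor ideals $\mathcal{P}\subsetneq \mathcal{T}^c$ (if $a\otimes b\in\mathcal{P}$ then $a\in \mathcal{P}$ or $b\in\mathcal{P}$), with the topology having as a basis of closed sets the sets $\mathrm{supp}(a)=\{\mathcal{P} : a\notin\mathcal{P}\}$ for $a\in\mathcal{T}^c$. A geometric functor $f^*\colon\mathcal{T}\to\mathcal{S}$ is a coproduct-preserving tensor triangulated (exact, strong symmetric monoidal) functor between rigidly-compactly generated tt-categories. It preserves compact objects and so induces a continuous map $\mathrm{Spc}(\mathcal{S}^c)\to\mathrm{Spc}(\mathcal{T}^c)$, $\mathcal{Q}\mapsto \{a\in\mathcal{T}^c : f^*(a)\in\mathcal{Q}\}$.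 The map $\varphi$ is the one given on the $i$-th summand by the map induced by $f_i^*$. Coproducts of spaces are taken in the category of topological spaces (so the underlying set is the disjoint union), not in the category of spectral spaces. A weak ring in $\mathcal{T}$ is an object $R\in\mathcal{T}$ equipped with a map $\eta\colon\mathbb{1}\to R$ such that $R\otimes\eta\colon R\to R\otimes R$ is a split monomorphism. A family $\{f_i^*\colon\mathcal{T}\to\mathcal{S}_i\}_{i\in I}$ of geometric functors is jointly nil-conservative if for any weak ring $R\in\mathcal{T}$, $f_i^*(R)=0$ for all $i\in I$ implies $R=0$. *)

theory Defs
  imports "HOL-Algebra.FiniteProduct" "HOL-Analysis.Sum_Topology"
begin

unbundle cardinal_syntax

section \<open>Smallness\<close>

text \<open>
  "Small" is read relative to a Grothendieck universe, that is, to an uncountable inaccessible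
  cardinal \<open>\<kappa>\<close>: a set of any type is small if its cardinality is below \<open>\<kappa>\<close>.
  In the strong limit condition it suffices to consider sets of the type carrying \<open>\<kappa>\<close>,
  because every set of cardinality below \<open>\<kappa>\<close> has an equipotent copy there. For the same reason
  small families are below always indexed by subsets of that type.
\<close>

definition inaccessible :: "'u rel \<Rightarrow> bool" where
  "inaccessible \<kappa> \<longleftrightarrow> Card_order \<kappa> \<and> natLeq <o \<kappa> \<and> regularCard \<kappa> \<and>
     (\<forall>A :: 'u set. |A| <o \<kappa> \<longrightarrow> |Pow A| <o \<kappa>)"

definition small :: "'u rel \<Rightarrow> 'a set \<Rightarrow> bool" where
  "small \<kappa> A \<longleftrightarrow> |A| <o \<kappa>"


section \<open>Categories and functors\<close>

record ('o, 'm) cat_data =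
  obj :: "'o set"
  arr :: "'m set"
  src :: "'m \<Rightarrow> 'o"
  tgt :: "'m \<Rightarrow> 'o"
  idn :: "'o \<Rightarrow> 'm"
  cmp :: "'m \<Rightarrow> 'm \<Rightarrow> 'm"  (infixr \<open>\<cdot>\<index>\<close> 70)

definition Hom :: "('o, 'm, 'x) cat_data_scheme \<Rightarrow> 'o \<Rightarrow> 'o \<Rightarrow> 'm set" where
  "Hom C X Y = {f \<in> arr C. src C f = X \<and> tgt C f = Y}"

locale category =
  fixes C :: "('o, 'm, 'x) cat_data_scheme" (structure)
  assumes src_obj: "f \<in> arr C \<Longrightarrow> src C f \<in> obj C"
    and tgt_obj: "f \<in> arr C \<Longrightarrow> tgt C f \<in> obj C"
    and idn_Hom: "X \<in> obj C \<Longrightarrow> idn C X \<in> Hom C X X"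
    and cmp_Hom: "\<lbrakk>f \<in> Hom C X Y; g \<in> Hom C Y Z\<rbrakk> \<Longrightarrow> g \<cdot> f \<in> Hom C X Z"
    and idn_left: "f \<in> Hom C X Y \<Longrightarrow> idn C Y \<cdot> f = f"
    and idn_right: "f \<in> Hom C X Y \<Longrightarrow> f \<cdot> idn C X = f"
    and cmp_assoc: "\<lbrakk>f \<in> Hom C W X; g \<in> Hom C X Y; h \<in> Hom C Y Z\<rbrakk>
      \<Longrightarrow> (h \<cdot> g) \<cdot> f = h \<cdot> (g \<cdot> f)"

definition inverse_arrows :: "('o, 'm, 'x) cat_data_scheme \<Rightarrow> 'm \<Rightarrow> 'm \<Rightarrow> bool" where
  "inverse_arrows C f g \<longleftrightarrow>
     f \<in> arr C \<and> g \<in> Hom C (tgt C f) (src C f) \<and>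
     g \<cdot>\<^bsub>C\<^esub> f = idn C (src C f) \<and> f \<cdot>\<^bsub>C\<^esub> g = idn C (tgt C f)"

definition iso_arr :: "('o, 'm, 'x) cat_data_scheme \<Rightarrow> 'm \<Rightarrow> bool" where
  "iso_arr C f \<longleftrightarrow> (\<exists>g. inverse_arrows C f g)"

definition inv_arr :: "('o, 'm, 'x) cat_data_scheme \<Rightarrow> 'm \<Rightarrow> 'm" where
  "inv_arr C f = (THE g. inverse_arrows C f g)"

definition isos :: "('o, 'm, 'x) cat_data_scheme \<Rightarrow> 'o \<Rightarrow> 'o \<Rightarrow> 'm set" where
  "isos C X Y = {f \<in> Hom C X Y. iso_arr C f}"

definition split_mono :: "('o, 'm, 'x) cat_data_scheme \<Rightarrow> 'm \<Rightarrow> bool" where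
  "split_mono C f \<longleftrightarrow> f \<in> arr C \<and>
     (\<exists>r \<in> Hom C (tgt C f) (src C f). r \<cdot>\<^bsub>C\<^esub> f = idn C (src C f))"

definition zero_object :: "('o, 'm, 'x) cat_data_scheme \<Rightarrow> 'o \<Rightarrow> bool" where
  "zero_object C Z \<longleftrightarrow> Z \<in> obj C \<and>
     (\<forall>X \<in> obj C. (\<exists>!f. f \<in> Hom C X Z) \<and> (\<exists>!f. f \<in> Hom C Z X))"

definition is_coproduct ::
    "('o, 'm, 'x) cat_data_scheme \<Rightarrow> 'j set \<Rightarrow> ('j \<Rightarrow> 'o) \<Rightarrow> 'o \<Rightarrow> ('j \<Rightarrow> 'm) \<Rightarrow> bool" where
  "is_coproduct C J X Q \<iota> \<longleftrightarrow>
     Q \<in> obj C \<and> (\<forall>j \<in> J. X j \<in> obj C \<and> \<iota> j \<in> Hom C (X j) Q) \<and>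
     (\<forall>Y \<in> obj C. \<forall>f. (\<forall>j \<in> J. f j \<in> Hom C (X j) Y) \<longrightarrow>
        (\<exists>!u. u \<in> Hom C Q Y \<and> (\<forall>j \<in> J. u \<cdot>\<^bsub>C\<^esub> \<iota> j = f j)))"

definition has_small_coproducts :: "'u rel \<Rightarrow> ('o, 'm, 'x) cat_data_scheme \<Rightarrow> bool" where
  "has_small_coproducts \<kappa> C \<longleftrightarrow>
     (\<forall>(J :: 'u set) X. small \<kappa> J \<and> X ` J \<subseteq> obj C \<longrightarrow> (\<exists>Q \<iota>. is_coproduct C J X Q \<iota>))"

definition locally_small :: "'u rel \<Rightarrow> ('o, 'm, 'x) cat_data_scheme \<Rightarrow> bool" where
  "locally_small \<kappa> C \<longleftrightarrow> (\<forall>X \<in> obj C. \<forall>Y \<in> obj C. small \<kappa> (Hom C X Y))"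

record ('o, 'm, 'p, 'n) fctr =
  fobj :: "'o \<Rightarrow> 'p"
  farr :: "'m \<Rightarrow> 'n"

definition is_functor ::
    "('o, 'm, 'x) cat_data_scheme \<Rightarrow> ('p, 'n, 'y) cat_data_scheme \<Rightarrow> ('o, 'm, 'p, 'n) fctr \<Rightarrow> bool" where
  "is_functor C D F \<longleftrightarrow>
     (\<forall>X \<in> obj C. fobj F X \<in> obj D \<and> farr F (idn C X) = idn D (fobj F X)) \<and>
     (\<forall>X \<in> obj C. \<forall>Y \<in> obj C. \<forall>f \<in> Hom C X Y. farr F f \<in> Hom D (fobj F X) (fobj F Y)) \<and>
     (\<forall>X \<in> obj C. \<forall>Y \<in> obj C. \<forall>Z \<in> obj C. \<forall>f \<in> Hom C X Y. \<forall>g \<in> Hom C Y Z.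
        farr F (g \<cdot>\<^bsub>C\<^esub> f) = farr F g \<cdot>\<^bsub>D\<^esub> farr F f)"

definition is_equivalence ::
    "('o, 'm, 'x) cat_data_scheme \<Rightarrow> ('p, 'n, 'y) cat_data_scheme \<Rightarrow> ('o, 'm, 'p, 'n) fctr \<Rightarrow> bool" where
  "is_equivalence C D F \<longleftrightarrow> is_functor C D F \<and>
     (\<forall>X \<in> obj C. \<forall>Y \<in> obj C. bij_betw (farr F) (Hom C X Y) (Hom D (fobj F X) (fobj F Y))) \<and>
     (\<forall>Y \<in> obj D. \<exists>X \<in> obj C. isos D (fobj F X) Y \<noteq> {})"

definition preserves_small_coproducts ::
    "'u rel \<Rightarrow> ('o, 'm, 'x) cat_data_scheme \<Rightarrow> ('p, 'n, 'y) cat_data_scheme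
      \<Rightarrow> ('o, 'm, 'p, 'n) fctr \<Rightarrow> bool" where
  "preserves_small_coproducts \<kappa> C D F \<longleftrightarrow>
     (\<forall>(J :: 'u set) X Q \<iota>. small \<kappa> J \<and> is_coproduct C J X Q \<iota> \<longrightarrow>
        is_coproduct D J (\<lambda>j. fobj F (X j)) (fobj F Q) (\<lambda>j. farr F (\<iota> j)))"


section \<open>Additive categories\<close>

record ('o, 'm) add_data = "('o, 'm) cat_data" +
  plus_arr :: "'m \<Rightarrow> 'm \<Rightarrow> 'm"
  zero_arr :: "'o \<Rightarrow> 'o \<Rightarrow> 'm"

definition Hom_group :: "('o, 'm, 'x) add_data_scheme \<Rightarrow> 'o \<Rightarrow> 'o \<Rightarrow> 'm monoid" where
  "Hom_group C X Y = \<lparr>carrier = Hom C X Y, mult = plus_arr C, one = zero_arr C X Y\<rparr>"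

definition neg_arr :: "('o, 'm, 'x) add_data_scheme \<Rightarrow> 'm \<Rightarrow> 'm" where
  "neg_arr C f = inv\<^bsub>Hom_group C (src C f) (tgt C f)\<^esub> f"

definition is_biproduct ::
    "('o, 'm, 'x) add_data_scheme \<Rightarrow> 'o \<Rightarrow> 'o \<Rightarrow> 'o \<Rightarrow> 'm \<Rightarrow> 'm \<Rightarrow> 'm \<Rightarrow> 'm \<Rightarrow> bool" where
  "is_biproduct C X Y B i j p q \<longleftrightarrow>
     B \<in> obj C \<and> i \<in> Hom C X B \<and> j \<in> Hom C Y B \<and> p \<in> Hom C B X \<and> q \<in> Hom C B Y \<and>
     p \<cdot>\<^bsub>C\<^esub> i = idn C X \<and> q \<cdot>\<^bsub>C\<^esub> j = idn C Y \<and>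
     q \<cdot>\<^bsub>C\<^esub> i = zero_arr C X Y \<and> p \<cdot>\<^bsub>C\<^esub> j = zero_arr C Y X \<and>
     plus_arr C (i \<cdot>\<^bsub>C\<^esub> p) (j \<cdot>\<^bsub>C\<^esub> q) = idn C B"

locale additive_category = category C
  for C :: "('o, 'm, 'x) add_data_scheme" (structure) +
  assumes Hom_comm_group: "\<lbrakk>X \<in> obj C; Y \<in> obj C\<rbrakk> \<Longrightarrow> comm_group (Hom_group C X Y)"
    and cmp_plus_left: "\<lbrakk>f \<in> Hom C X Y; g \<in> Hom C Y Z; g' \<in> Hom C Y Z\<rbrakk>
      \<Longrightarrow> plus_arr C g g' \<cdot> f = plus_arr C (g \<cdot> f) (g' \<cdot> f)"
    and cmp_plus_right: "\<lbrakk>f \<in> Hom C X Y; f' \<in> Hom C X Y; g \<in> Hom C Y Z\<rbrakk>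
      \<Longrightarrow> g \<cdot> plus_arr C f f' = plus_arr C (g \<cdot> f) (g \<cdot> f')"
    and ex_zero_object: "\<exists>Z. zero_object C Z"
    and ex_biproduct: "\<lbrakk>X \<in> obj C; Y \<in> obj C\<rbrakk> \<Longrightarrow> \<exists>B i j p q. is_biproduct C X Y B i j p q"

definition additive_functor ::
    "('o, 'm, 'x) add_data_scheme \<Rightarrow> ('p, 'n, 'y) add_data_scheme \<Rightarrow> ('o, 'm, 'p, 'n) fctr \<Rightarrow> bool" where
  "additive_functor C D F \<longleftrightarrow> is_functor C D F \<and>
     (\<forall>X \<in> obj C. \<forall>Y \<in> obj C. \<forall>f \<in> Hom C X Y. \<forall>g \<in> Hom C X Y.
        farr F (plus_arr C f g) = plus_arr D (farr F f) (farr F g))"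

text \<open>
  \<open>X\<close> is compact if the canonical map from the direct sum of the groups \<open>Hom(X, Y j)\<close>, i.e. from
  the finitely supported families, to \<open>Hom(X, Q)\<close> is bijective for every small coproduct \<open>Q\<close> of
  the \<open>Y j\<close>. The finite sum of arrows is \<open>finprod\<close> in the (multiplicatively written) \<open>Hom\<close>-group.
\<close>

definition compact_object :: "'u rel \<Rightarrow> ('o, 'm, 'x) add_data_scheme \<Rightarrow> 'o \<Rightarrow> bool" where
  "compact_object \<kappa> C X \<longleftrightarrow> X \<in> obj C \<and>
     (\<forall>(J :: 'u set) Y Q \<iota>. small \<kappa> J \<and> is_coproduct C J Y Q \<iota> \<longrightarrow>
        bij_betw
          (\<lambda>a. finprod (Hom_group C X Q) (\<lambda>j. \<iota> j \<cdot>\<^bsub>C\<^esub> a j) {j \<in> J. a j \<noteq> zero_arr C X (Y j)})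
          {a \<in> \<Pi>\<^sub>E j \<in> J. Hom C X (Y j). finite {j \<in> J. a j \<noteq> zero_arr C X (Y j)}}
          (Hom C X Q))"

definition compactly_generated :: "'u rel \<Rightarrow> ('o, 'm, 'x) add_data_scheme \<Rightarrow> bool" where
  "compactly_generated \<kappa> C \<longleftrightarrow>
     (\<exists>G. small \<kappa> G \<and> (\<forall>g \<in> G. compact_object \<kappa> C g) \<and>
        (\<forall>X \<in> obj C. (\<forall>g \<in> G. Hom C g X = {zero_arr C g X}) \<longrightarrow> zero_object C X))"


section \<open>Triangulated categories\<close>

text \<open>The shift is allowed to be an auto-equivalence rather than an automorphism.\<close>

record ('o, 'm) tri_data = "('o, 'm) add_data" +
  shift :: "('o, 'm, 'o, 'm) fctr"
  tri :: "('m \<times> 'm \<times> 'm) set"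

abbreviation shift_obj :: "('o, 'm, 'x) tri_data_scheme \<Rightarrow> 'o \<Rightarrow> 'o"  (\<open>\<Sigma>\<^sub>o\<index>\<close>) where
  "shift_obj C \<equiv> fobj (shift C)"

abbreviation shift_arr :: "('o, 'm, 'x) tri_data_scheme \<Rightarrow> 'm \<Rightarrow> 'm"  (\<open>\<Sigma>\<^sub>m\<index>\<close>) where
  "shift_arr C \<equiv> farr (shift C)"

locale triangulated_category = additive_category C
  for C :: "('o, 'm, 'x) tri_data_scheme" (structure) +
  assumes shift_additive: "additive_functor C C (shift C)"
    and shift_equivalence: "is_equivalence C C (shift C)"
    and tri_type: "(f, g, h) \<in> tri C \<Longrightarrow>
      \<exists>X \<in> obj C. \<exists>Y \<in> obj C. \<exists>Z \<in> obj C. f \<in> Hom C X Y \<and> g \<in> Hom C Y Z \<and> h \<in> Hom C Z (\<Sigma>\<^sub>o X)"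
    and tri_iso: "\<lbrakk>(f, g, h) \<in> tri C;
        f \<in> Hom C X Y; g \<in> Hom C Y Z; h \<in> Hom C Z (\<Sigma>\<^sub>o X);
        f' \<in> Hom C X' Y'; g' \<in> Hom C Y' Z'; h' \<in> Hom C Z' (\<Sigma>\<^sub>o X');
        u \<in> isos C X X'; v \<in> isos C Y Y'; w \<in> isos C Z Z';
        v \<cdot> f = f' \<cdot> u; w \<cdot> g = g' \<cdot> v; \<Sigma>\<^sub>m u \<cdot> h = h' \<cdot> w\<rbrakk> \<Longrightarrow> (f', g', h') \<in> tri C"
    and tri_idn: "\<lbrakk>X \<in> obj C; zero_object C Z\<rbrakk>
      \<Longrightarrow> (idn C X, zero_arr C X Z, zero_arr C Z (\<Sigma>\<^sub>o X)) \<in> tri C"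
    and tri_cone: "f \<in> arr C \<Longrightarrow> \<exists>g h. (f, g, h) \<in> tri C"
    and tri_rotate: "\<lbrakk>f \<in> Hom C X Y; g \<in> Hom C Y Z; h \<in> Hom C Z (\<Sigma>\<^sub>o X)\<rbrakk>
      \<Longrightarrow> (f, g, h) \<in> tri C \<longleftrightarrow> (g, h, neg_arr C (\<Sigma>\<^sub>m f)) \<in> tri C"
    and tri_fill: "\<lbrakk>(f, g, h) \<in> tri C; (f', g', h') \<in> tri C;
        f \<in> Hom C X Y; g \<in> Hom C Y Z; f' \<in> Hom C X' Y'; g' \<in> Hom C Y' Z';
        u \<in> Hom C X X'; v \<in> Hom C Y Y'; v \<cdot> f = f' \<cdot> u\<rbrakk>
      \<Longrightarrow> \<exists>w \<in> Hom C Z Z'. w \<cdot> g = g' \<cdot> v \<and> \<Sigma>\<^sub>m u \<cdot> h = h' \<cdot> w"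
    and tri_octahedron: "\<lbrakk>f \<in> Hom C X Y; g \<in> Hom C Y Z;
        (f, f\<^sub>1, f\<^sub>2) \<in> tri C; f\<^sub>1 \<in> Hom C Y U;
        (g, g\<^sub>1, g\<^sub>2) \<in> tri C; g\<^sub>1 \<in> Hom C Z V;
        (g \<cdot> f, k\<^sub>1, k\<^sub>2) \<in> tri C; k\<^sub>1 \<in> Hom C Z W\<rbrakk>
      \<Longrightarrow> \<exists>u \<in> Hom C U W. \<exists>v \<in> Hom C W V. (u, v, \<Sigma>\<^sub>m f\<^sub>1 \<cdot> g\<^sub>2) \<in> tri C \<and>
            u \<cdot> f\<^sub>1 = k\<^sub>1 \<cdot> g \<and> v \<cdot> k\<^sub>1 = g\<^sub>1 \<and> k\<^sub>2 \<cdot> u = f\<^sub>2 \<and> g\<^sub>2 \<cdot> v = \<Sigma>\<^sub>m f \<cdot> k\<^sub>2"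

definition exact_functor ::
    "('o, 'm, 'x) tri_data_scheme \<Rightarrow> ('p, 'n, 'y) tri_data_scheme \<Rightarrow> ('o, 'm, 'p, 'n) fctr \<Rightarrow> bool" where
  "exact_functor C D F \<longleftrightarrow> additive_functor C D F \<and>
     (\<exists>\<phi>. (\<forall>X \<in> obj C. \<phi> X \<in> isos D (fobj F (\<Sigma>\<^sub>o\<^bsub>C\<^esub> X)) (\<Sigma>\<^sub>o\<^bsub>D\<^esub> (fobj F X))) \<and>
        (\<forall>X \<in> obj C. \<forall>Y \<in> obj C. \<forall>f \<in> Hom C X Y.
           \<Sigma>\<^sub>m\<^bsub>D\<^esub> (farr F f) \<cdot>\<^bsub>D\<^esub> \<phi> X = \<phi> Y \<cdot>\<^bsub>D\<^esub> farr F (\<Sigma>\<^sub>m\<^bsub>C\<^esub> f)) \<and>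
        (\<forall>f g h. (f, g, h) \<in> tri C \<longrightarrow>
           (farr F f, farr F g, \<phi> (src C f) \<cdot>\<^bsub>D\<^esub> farr F h) \<in> tri D))"


section \<open>Tensor triangulated categories\<close>

text \<open>
  Besides the symmetric monoidal structure the data contain the internal hom \<open>ihom X Y\<close> with its
  evaluation \<open>ihom X Y \<odot> X \<rightarrow> Y\<close> and the comparison \<open>e\<^sub>X\<^sub>,\<^sub>Y : \<Sigma>X \<odot> Y \<rightarrow> \<Sigma>(X \<odot> Y)\<close>.
\<close>

record ('o, 'm) tt_data = "('o, 'm) tri_data" +
  tensor_obj :: "'o \<Rightarrow> 'o \<Rightarrow> 'o"  (infixr \<open>\<odot>\<index>\<close> 75)
  tensor_arr :: "'m \<Rightarrow> 'm \<Rightarrow> 'm"  (infixr \<open>\<odot>\<^sub>m\<index>\<close> 75)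
  unit :: 'o
  assoc :: "'o \<Rightarrow> 'o \<Rightarrow> 'o \<Rightarrow> 'm"
  lunit :: "'o \<Rightarrow> 'm"
  runit :: "'o \<Rightarrow> 'm"
  swap :: "'o \<Rightarrow> 'o \<Rightarrow> 'm"
  ihom :: "'o \<Rightarrow> 'o \<Rightarrow> 'o"
  ihom_ev :: "'o \<Rightarrow> 'o \<Rightarrow> 'm"
  shift_tensor :: "'o \<Rightarrow> 'o \<Rightarrow> 'm"

locale symmetric_monoidal_category = category C
  for C :: "('o, 'm, 'x) tt_data_scheme" (structure) +
  assumes unit_obj: "unit C \<in> obj C"
    and tensor_obj: "\<lbrakk>X \<in> obj C; Y \<in> obj C\<rbrakk> \<Longrightarrow> X \<odot> Y \<in> obj C"
    and tensor_Hom: "\<lbrakk>f \<in> Hom C X X'; g \<in> Hom C Y Y'\<rbrakk> \<Longrightarrow> f \<odot>\<^sub>m g \<in> Hom C (X \<odot> Y) (X' \<odot> Y')"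
    and tensor_idn: "\<lbrakk>X \<in> obj C; Y \<in> obj C\<rbrakk> \<Longrightarrow> idn C X \<odot>\<^sub>m idn C Y = idn C (X \<odot> Y)"
    and tensor_cmp: "\<lbrakk>f \<in> Hom C X X'; f' \<in> Hom C X' X''; g \<in> Hom C Y Y'; g' \<in> Hom C Y' Y''\<rbrakk>
      \<Longrightarrow> (f' \<cdot> f) \<odot>\<^sub>m (g' \<cdot> g) = (f' \<odot>\<^sub>m g') \<cdot> (f \<odot>\<^sub>m g)"
    and assoc_iso: "\<lbrakk>X \<in> obj C; Y \<in> obj C; Z \<in> obj C\<rbrakk>
      \<Longrightarrow> assoc C X Y Z \<in> isos C ((X \<odot> Y) \<odot> Z) (X \<odot> (Y \<odot> Z))"
    and assoc_natural: "\<lbrakk>f \<in> Hom C X X'; g \<in> Hom C Y Y'; h \<in> Hom C Z Z'\<rbrakk>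
      \<Longrightarrow> (f \<odot>\<^sub>m (g \<odot>\<^sub>m h)) \<cdot> assoc C X Y Z = assoc C X' Y' Z' \<cdot> ((f \<odot>\<^sub>m g) \<odot>\<^sub>m h)"
    and lunit_iso: "X \<in> obj C \<Longrightarrow> lunit C X \<in> isos C (unit C \<odot> X) X"
    and lunit_natural: "f \<in> Hom C X X' \<Longrightarrow> f \<cdot> lunit C X = lunit C X' \<cdot> (idn C (unit C) \<odot>\<^sub>m f)"
    and runit_iso: "X \<in> obj C \<Longrightarrow> runit C X \<in> isos C (X \<odot> unit C) X"
    and runit_natural: "f \<in> Hom C X X' \<Longrightarrow> f \<cdot> runit C X = runit C X' \<cdot> (f \<odot>\<^sub>m idn C (unit C))"
    and swap_Hom: "\<lbrakk>X \<in> obj C; Y \<in> obj C\<rbrakk> \<Longrightarrow> swap C X Y \<in> Hom C (X \<odot> Y) (Y \<odot> X)"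
    and swap_natural: "\<lbrakk>f \<in> Hom C X X'; g \<in> Hom C Y Y'\<rbrakk>
      \<Longrightarrow> (g \<odot>\<^sub>m f) \<cdot> swap C X Y = swap C X' Y' \<cdot> (f \<odot>\<^sub>m g)"
    and swap_swap: "\<lbrakk>X \<in> obj C; Y \<in> obj C\<rbrakk> \<Longrightarrow> swap C Y X \<cdot> swap C X Y = idn C (X \<odot> Y)"
    and pentagon: "\<lbrakk>W \<in> obj C; X \<in> obj C; Y \<in> obj C; Z \<in> obj C\<rbrakk>
      \<Longrightarrow> assoc C W X (Y \<odot> Z) \<cdot> assoc C (W \<odot> X) Y Z =
          (idn C W \<odot>\<^sub>m assoc C X Y Z) \<cdot> assoc C W (X \<odot> Y) Z \<cdot> (assoc C W X Y \<odot>\<^sub>m idn C Z)"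
    and unit_triangle: "\<lbrakk>X \<in> obj C; Y \<in> obj C\<rbrakk>
      \<Longrightarrow> (idn C X \<odot>\<^sub>m lunit C Y) \<cdot> assoc C X (unit C) Y = runit C X \<odot>\<^sub>m idn C Y"
    and hexagon: "\<lbrakk>X \<in> obj C; Y \<in> obj C; Z \<in> obj C\<rbrakk>
      \<Longrightarrow> assoc C Y Z X \<cdot> swap C X (Y \<odot> Z) \<cdot> assoc C X Y Z =
          (idn C Y \<odot>\<^sub>m swap C X Z) \<cdot> assoc C Y X Z \<cdot> (swap C X Y \<odot>\<^sub>m idn C Z)"

locale closed_symmetric_monoidal_category = symmetric_monoidal_category C
  for C :: "('o, 'm, 'x) tt_data_scheme" (structure) +
  assumes ihom_obj: "\<lbrakk>X \<in> obj C; Y \<in> obj C\<rbrakk> \<Longrightarrow> ihom C X Y \<in> obj C"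
    and ihom_ev_Hom: "\<lbrakk>X \<in> obj C; Y \<in> obj C\<rbrakk> \<Longrightarrow> ihom_ev C X Y \<in> Hom C (ihom C X Y \<odot> X) Y"
    and ihom_ev_universal: "\<lbrakk>X \<in> obj C; Y \<in> obj C; Z \<in> obj C; f \<in> Hom C (Z \<odot> X) Y\<rbrakk>
      \<Longrightarrow> \<exists>!g. g \<in> Hom C Z (ihom C X Y) \<and> ihom_ev C X Y \<cdot> (g \<odot>\<^sub>m idn C X) = f"

text \<open>\<open>ihom_arr C u k : ihom X Y \<rightarrow> ihom X' Y'\<close> is induced by \<open>u : X' \<rightarrow> X\<close> and \<open>k : Y \<rightarrow> Y'\<close>.\<close>

definition ihom_arr :: "('o, 'm, 'x) tt_data_scheme \<Rightarrow> 'm \<Rightarrow> 'm \<Rightarrow> 'm" where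
  "ihom_arr C u k =
     (let X' = src C u; X = tgt C u; Y = src C k; Y' = tgt C k in
      (THE g. g \<in> Hom C (ihom C X Y) (ihom C X' Y') \<and>
         ihom_ev C X' Y' \<cdot>\<^bsub>C\<^esub> (g \<odot>\<^sub>m\<^bsub>C\<^esub> idn C X') =
         k \<cdot>\<^bsub>C\<^esub> ihom_ev C X Y \<cdot>\<^bsub>C\<^esub> (idn C (ihom C X Y) \<odot>\<^sub>m\<^bsub>C\<^esub> u)))"

text \<open>
  Compatibility of the two structures follows Hovey, Palmieri and Strickland, Axiomatic stable
  homotopy theory, Definition A.2.1. For \<open>shift_unit_sign\<close>, the twist on \<open>\<Sigma>\<^sup>r 1 \<odot> \<Sigma>\<^sup>s 1\<close> is
  \<open>(-1)\<^sup>r\<^sup>s\<close> for all \<open>r\<close>, \<open>s\<close> as soon as this holds for \<open>r = s = 1\<close>. In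
  \<open>ihom_exact_contravariant\<close> the natural isomorphism \<open>\<theta>\<close> absorbs the customary sign.
\<close>

locale tt_category = triangulated_category C + closed_symmetric_monoidal_category C
  for C :: "('o, 'm, 'x) tt_data_scheme" (structure) +
  assumes tensor_plus: "\<lbrakk>f \<in> Hom C X X'; f' \<in> Hom C X X'; g \<in> Hom C Y Y'\<rbrakk>
      \<Longrightarrow> plus_arr C f f' \<odot>\<^sub>m g = plus_arr C (f \<odot>\<^sub>m g) (f' \<odot>\<^sub>m g)"
    and shift_tensor_iso: "\<lbrakk>X \<in> obj C; Y \<in> obj C\<rbrakk>
      \<Longrightarrow> shift_tensor C X Y \<in> isos C (\<Sigma>\<^sub>o X \<odot> Y) (\<Sigma>\<^sub>o (X \<odot> Y))"
    and shift_tensor_natural: "\<lbrakk>f \<in> Hom C X X'; g \<in> Hom C Y Y'\<rbrakk>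
      \<Longrightarrow> \<Sigma>\<^sub>m (f \<odot>\<^sub>m g) \<cdot> shift_tensor C X Y = shift_tensor C X' Y' \<cdot> (\<Sigma>\<^sub>m f \<odot>\<^sub>m g)"
    and shift_tensor_unit: "X \<in> obj C
      \<Longrightarrow> \<Sigma>\<^sub>m (runit C X) \<cdot> shift_tensor C X (unit C) = runit C (\<Sigma>\<^sub>o X)"
    and shift_tensor_assoc: "\<lbrakk>X \<in> obj C; Y \<in> obj C; Z \<in> obj C\<rbrakk>
      \<Longrightarrow> \<Sigma>\<^sub>m (assoc C X Y Z) \<cdot> shift_tensor C (X \<odot> Y) Z \<cdot> (shift_tensor C X Y \<odot>\<^sub>m idn C Z) =
          shift_tensor C X (Y \<odot> Z) \<cdot> assoc C (\<Sigma>\<^sub>o X) Y Z"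
    and tensor_exact: "\<lbrakk>(f, g, h) \<in> tri C; W \<in> obj C\<rbrakk>
      \<Longrightarrow> (f \<odot>\<^sub>m idn C W, g \<odot>\<^sub>m idn C W, shift_tensor C (src C f) W \<cdot> (h \<odot>\<^sub>m idn C W)) \<in> tri C"
    and shift_unit_sign: "swap C (\<Sigma>\<^sub>o (unit C)) (\<Sigma>\<^sub>o (unit C)) =
      neg_arr C (idn C (\<Sigma>\<^sub>o (unit C) \<odot> \<Sigma>\<^sub>o (unit C)))"
    and ihom_exact_covariant: "W \<in> obj C
      \<Longrightarrow> exact_functor C C \<lparr>fobj = ihom C W, farr = ihom_arr C (idn C W)\<rparr>"
    and ihom_exact_contravariant: "W \<in> obj C \<Longrightarrow>
      \<exists>\<theta>. (\<forall>X \<in> obj C. \<theta> X \<in> isos C (ihom C X W) (\<Sigma>\<^sub>o (ihom C (\<Sigma>\<^sub>o X) W))) \<and>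
        (\<forall>X \<in> obj C. \<forall>Y \<in> obj C. \<forall>f \<in> Hom C X Y.
           \<Sigma>\<^sub>m (ihom_arr C (\<Sigma>\<^sub>m f) (idn C W)) \<cdot> \<theta> Y = \<theta> X \<cdot> ihom_arr C f (idn C W)) \<and>
        (\<forall>f g h. (f, g, h) \<in> tri C \<longrightarrow>
           (ihom_arr C h (idn C W), ihom_arr C g (idn C W),
            \<theta> (src C f) \<cdot> ihom_arr C f (idn C W)) \<in> tri C)"

definition dualizable :: "('o, 'm, 'x) tt_data_scheme \<Rightarrow> 'o \<Rightarrow> bool" where
  "dualizable C X \<longleftrightarrow> X \<in> obj C \<and>
     (\<exists>Y \<in> obj C.
       \<exists>ev \<in> Hom C (Y \<odot>\<^bsub>C\<^esub> X) (unit C). \<exists>coev \<in> Hom C (unit C) (X \<odot>\<^bsub>C\<^esub> Y).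
         runit C X \<cdot>\<^bsub>C\<^esub> (idn C X \<odot>\<^sub>m\<^bsub>C\<^esub> ev) \<cdot>\<^bsub>C\<^esub> assoc C X Y X \<cdot>\<^bsub>C\<^esub> (coev \<odot>\<^sub>m\<^bsub>C\<^esub> idn C X) = lunit C X \<and>
         lunit C Y \<cdot>\<^bsub>C\<^esub> (ev \<odot>\<^sub>m\<^bsub>C\<^esub> idn C Y) \<cdot>\<^bsub>C\<^esub> inv_arr C (assoc C Y X Y) \<cdot>\<^bsub>C\<^esub> (idn C Y \<odot>\<^sub>m\<^bsub>C\<^esub> coev)
           = runit C Y)"

definition rigidly_compactly_generated :: "'u rel \<Rightarrow> ('o, 'm, 'x) tt_data_scheme \<Rightarrow> bool" where
  "rigidly_compactly_generated \<kappa> C \<longleftrightarrow>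
     tt_category C \<and> locally_small \<kappa> C \<and> has_small_coproducts \<kappa> C \<and>
     compactly_generated \<kappa> C \<and> (\<forall>X. compact_object \<kappa> C X \<longleftrightarrow> dualizable C X)"

definition strong_symmetric_monoidal_functor ::
    "('o, 'm, 'x) tt_data_scheme \<Rightarrow> ('p, 'n, 'y) tt_data_scheme \<Rightarrow> ('o, 'm, 'p, 'n) fctr \<Rightarrow> bool" where
  "strong_symmetric_monoidal_functor C D F \<longleftrightarrow> is_functor C D F \<and>
     (\<exists>\<epsilon> \<mu>. \<epsilon> \<in> isos D (unit D) (fobj F (unit C)) \<and>
        (\<forall>X \<in> obj C. \<forall>Y \<in> obj C.
           \<mu> X Y \<in> isos D (fobj F X \<odot>\<^bsub>D\<^esub> fobj F Y) (fobj F (X \<odot>\<^bsub>C\<^esub> Y))) \<and>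
        (\<forall>X \<in> obj C. \<forall>X' \<in> obj C. \<forall>Y \<in> obj C. \<forall>Y' \<in> obj C. \<forall>f \<in> Hom C X X'. \<forall>g \<in> Hom C Y Y'.
           farr F (f \<odot>\<^sub>m\<^bsub>C\<^esub> g) \<cdot>\<^bsub>D\<^esub> \<mu> X Y = \<mu> X' Y' \<cdot>\<^bsub>D\<^esub> (farr F f \<odot>\<^sub>m\<^bsub>D\<^esub> farr F g)) \<and>
        (\<forall>X \<in> obj C. \<forall>Y \<in> obj C. \<forall>Z \<in> obj C.
           farr F (assoc C X Y Z) \<cdot>\<^bsub>D\<^esub> \<mu> (X \<odot>\<^bsub>C\<^esub> Y) Z \<cdot>\<^bsub>D\<^esub> (\<mu> X Y \<odot>\<^sub>m\<^bsub>D\<^esub> idn D (fobj F Z)) =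
           \<mu> X (Y \<odot>\<^bsub>C\<^esub> Z) \<cdot>\<^bsub>D\<^esub> (idn D (fobj F X) \<odot>\<^sub>m\<^bsub>D\<^esub> \<mu> Y Z) \<cdot>\<^bsub>D\<^esub>
             assoc D (fobj F X) (fobj F Y) (fobj F Z)) \<and>
        (\<forall>X \<in> obj C.
           farr F (lunit C X) \<cdot>\<^bsub>D\<^esub> \<mu> (unit C) X \<cdot>\<^bsub>D\<^esub> (\<epsilon> \<odot>\<^sub>m\<^bsub>D\<^esub> idn D (fobj F X)) = lunit D (fobj F X) \<and>
           farr F (runit C X) \<cdot>\<^bsub>D\<^esub> \<mu> X (unit C) \<cdot>\<^bsub>D\<^esub> (idn D (fobj F X) \<odot>\<^sub>m\<^bsub>D\<^esub> \<epsilon>) = runit D (fobj F X)) \<and>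
        (\<forall>X \<in> obj C. \<forall>Y \<in> obj C.
           farr F (swap C X Y) \<cdot>\<^bsub>D\<^esub> \<mu> X Y = \<mu> Y X \<cdot>\<^bsub>D\<^esub> swap D (fobj F X) (fobj F Y)))"

definition geometric_functor ::
    "'u rel \<Rightarrow> ('o, 'm, 'x) tt_data_scheme \<Rightarrow> ('p, 'n, 'y) tt_data_scheme
      \<Rightarrow> ('o, 'm, 'p, 'n) fctr \<Rightarrow> bool" where
  "geometric_functor \<kappa> C D F \<longleftrightarrow>
     rigidly_compactly_generated \<kappa> C \<and> rigidly_compactly_generated \<kappa> D \<and>
     exact_functor C D F \<and> strong_symmetric_monoidal_functor C D F \<and>
     preserves_small_coproducts \<kappa> C D F"

text \<open>The arrow \<open>R \<rightarrow> R \<odot> R\<close> is \<open>R \<odot> \<eta>\<close> precomposed with the inverse right unitor \<open>R \<rightarrow> R \<odot> 1\<close>.\<close>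

definition weak_ring :: "('o, 'm, 'x) tt_data_scheme \<Rightarrow> 'o \<Rightarrow> 'm \<Rightarrow> bool" where
  "weak_ring C R \<eta> \<longleftrightarrow> R \<in> obj C \<and> \<eta> \<in> Hom C (unit C) R \<and>
     split_mono C ((idn C R \<odot>\<^sub>m\<^bsub>C\<^esub> \<eta>) \<cdot>\<^bsub>C\<^esub> inv_arr C (runit C R))"

definition jointly_nil_conservative ::
    "('o, 'm, 'x) tt_data_scheme \<Rightarrow> 'i set \<Rightarrow> ('i \<Rightarrow> ('p, 'n, 'y) tt_data_scheme)
      \<Rightarrow> ('i \<Rightarrow> ('o, 'm, 'p, 'n) fctr) \<Rightarrow> bool" where
  "jointly_nil_conservative C I D F \<longleftrightarrow>
     (\<forall>R \<eta>. weak_ring C R \<eta> \<and> (\<forall>i \<in> I. zero_object (D i) (fobj (F i) R)) \<longrightarrow> zero_object C R)"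


section \<open>The Balmer spectrum\<close>

definition compact_part :: "'u rel \<Rightarrow> ('o, 'm, 'x) tt_data_scheme \<Rightarrow> ('o, 'm, 'x) tt_data_scheme" where
  "compact_part \<kappa> C = C\<lparr>
     obj := {X. compact_object \<kappa> C X},
     arr := {f \<in> arr C. compact_object \<kappa> C (src C f) \<and> compact_object \<kappa> C (tgt C f)},
     tri := {(f, g, h) \<in> tri C. compact_object \<kappa> C (src C f) \<and> compact_object \<kappa> C (tgt C f) \<and>
              compact_object \<kappa> C (tgt C g)}\<rparr>"

definition thick_tensor_ideal :: "('o, 'm, 'x) tt_data_scheme \<Rightarrow> 'o set \<Rightarrow> bool" where
  "thick_tensor_ideal K P \<longleftrightarrow> P \<subseteq> obj K \<and>
     (\<forall>Z. zero_object K Z \<longrightarrow> Z \<in> P) \<and>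
     (\<forall>X \<in> obj K. \<Sigma>\<^sub>o\<^bsub>K\<^esub> X \<in> P \<longleftrightarrow> X \<in> P) \<and>
     (\<forall>X Y Z f g h. (f, g, h) \<in> tri K \<and> f \<in> Hom K X Y \<and> g \<in> Hom K Y Z \<and> X \<in> P \<and> Y \<in> P \<longrightarrow> Z \<in> P) \<and>
     (\<forall>X \<in> obj K. \<forall>Y \<in> obj K. \<forall>B i j p q. is_biproduct K X Y B i j p q \<and> B \<in> P \<longrightarrow> X \<in> P) \<and>
     (\<forall>X \<in> obj K. \<forall>Y \<in> P. X \<odot>\<^bsub>K\<^esub> Y \<in> P)"

definition prime_ideals :: "('o, 'm, 'x) tt_data_scheme \<Rightarrow> 'o set set" where
  "prime_ideals K = {P. thick_tensor_ideal K P \<and> P \<subset> obj K \<and>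
     (\<forall>X \<in> obj K. \<forall>Y \<in> obj K. X \<odot>\<^bsub>K\<^esub> Y \<in> P \<longrightarrow> X \<in> P \<or> Y \<in> P)}"

definition supp :: "('o, 'm, 'x) tt_data_scheme \<Rightarrow> 'o \<Rightarrow> 'o set set" where
  "supp K X = {P \<in> prime_ideals K. X \<notin> P}"

text \<open>
  The complements of the supports are closed under finite intersections, since the support of a
  biproduct is the union of the supports; so the topology they generate has them as a basis of
  open sets.
\<close>

definition Spc :: "('o, 'm, 'x) tt_data_scheme \<Rightarrow> 'o set topology" where
  "Spc K = topology_generated_by {prime_ideals K - supp K X | X. X \<in> obj K}"

lemma topspace_Spc:
  assumes "zero_object K Z"
  shows "topspace (Spc K) = prime_ideals K"
proof -
  have "Z \<in> obj K" using assms by (simp add: zero_object_def)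
  moreover have "prime_ideals K - supp K Z = prime_ideals K"
    using assms by (auto simp: supp_def prime_ideals_def thick_tensor_ideal_def)
  ultimately show ?thesis
    unfolding Spc_def topology_generated_by_topspace by blast
qed

definition Spc_map ::
    "('o, 'm, 'x) tt_data_scheme \<Rightarrow> ('o, 'm, 'p, 'n) fctr \<Rightarrow> 'p set \<Rightarrow> 'o set" where
  "Spc_map K F Q = {X \<in> obj K. fobj F X \<in> Q}"

end

theory Submission
  imports Defs
begin

text \<open>
  Let \<open>P\<close> be a prime of the compact part of \<open>T\<close> that is not in the image. Then, for every \<open>i\<close>, Zorn's lemma gives
  an object \<open>a\<^sub>i \<notin> P\<close> whose image lies in every thick ideal containing the image of \<open>P\<close>. Hence it
  suffices to find a nonzero weak ring \<open>R\<close> such that \<open>R \<odot> b = 0\<close> for \<open>b \<in> P\<close> and such that, for every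
  \<open>a \<notin> P\<close>, \<open>R\<close> is a retract of \<open>(a \<odot> D) \<odot> R\<close> for some \<open>D\<close>: the ideal of those \<open>x\<close> with
  \<open>F\<^sub>i R \<odot> x = 0\<close> contains the image of \<open>P\<close>, hence that of \<open>a\<^sub>i\<close>, and so \<open>F\<^sub>i R = 0\<close> for all \<open>i\<close>.

  Both properties of \<open>R\<close> hold once \<open>R \<rightarrow> A \<odot> R\<close> splits for the following maps \<open>1 \<rightarrow> A\<close>: the
  coevaluation \<open>1 \<rightarrow> a \<odot> Da\<close> for \<open>a \<notin> P\<close>, and the map from \<open>1\<close> to the cone of the evaluation
  \<open>Db \<odot> b \<rightarrow> 1\<close> for \<open>b \<in> P\<close>. It is enough to use \<open>a\<close> and \<open>b\<close> in a small core of compact objects of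
  which all other compact objects are retracts. No finite tensor product of these maps is zero: each of
  them preserves the maps that are not negligible at \<open>P\<close>.

  Let \<open>E X\<close> be the colimit of \<open>Hom(1, A\<^sub>1 \<odot> \<dots> \<odot> A\<^sub>n \<odot> X)\<close> over the finite families of such maps.
  Since the family can always be enlarged by a fresh copy of \<open>A\<close>, the map \<open>X \<rightarrow> A \<odot> X\<close> is injective on
  \<open>E\<close>. The characters of \<open>E X\<close> with values in the divisible group of roots of unity form a cohomological
  functor of \<open>X\<close>, which is represented by an object \<open>I\<close> by Brown representability; \<open>I\<close> is nonzero because
  \<open>E 1\<close> is. The universal character extends along the injection of \<open>E I\<close> into \<open>E (A \<odot> I)\<close>, and its
  extension is a retraction of \<open>I \<rightarrow> A \<odot> I\<close>. The internal endomorphism object \<open>R\<close> of \<open>I\<close> inherits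
  these retractions.
\<close>

section \<open>Categories, additive categories, triangles\<close>

text \<open>The family of coaugmentations may be uncountable, and a triangulated category has no
  functorial homotopy colimits, so the tensor product of all the \<open>A\<close> cannot be formed
  as an object. What survives is the homological functor it would represent, the colimit
  \<open>E\<close>. Dualizing \<open>E\<close> into an injective group makes it contravariant, and
  then representability applies: \<open>I\<close> is a Brown-Comenetz dual of the missing object.
  The roots of unity are a copy of Q/Z. They are divisible, so characters extend; they have torsion
  of every order, so characters separate; they are countable, so the characters of a small group
  form a small set. The same concern for smallness confines the indices to a core of
  representatives. No multiplication on the missing object is ever constructed: unit and product
  come from the internal endomorphism object of \<open>I\<close>, and the only property of
  \<open>I\<close> passed on, besides being nonzero, is that the coaugmentations split on
  it.\<close>

lemma Hom_iff [simp]: "f \<in> Hom C X Y \<longleftrightarrow> f \<in> arr C \<and> src C f = X \<and> tgt C f = Y"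
  by (simp add: Hom_def)

text \<open>Retracts take the place of isomorphisms below: zero objects, compact objects and thick
  classes are closed under them, every functor preserves them, and a chain of them composes without
  naming inverse arrows.\<close>

definition retract :: "('o, 'm, 'x) cat_data_scheme \<Rightarrow> 'o \<Rightarrow> 'o \<Rightarrow> bool" where
  "retract C X Y \<longleftrightarrow> (\<exists>i \<in> Hom C X Y. \<exists>r \<in> Hom C Y X. r \<cdot>\<^bsub>C\<^esub> i = idn C X)"

context category
begin

declare src_obj [simp] tgt_obj [simp]

lemma idn_simps [simp]:
  assumes "X \<in> obj C"
  shows "idn C X \<in> arr C" "src C (idn C X) = X" "tgt C (idn C X) = X"
  using idn_Hom[OF assms] by auto

lemma cmp_simps [simp]:
  assumes "f \<in> arr C" "g \<in> arr C" "tgt C f = src C g"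
  shows "g \<cdot> f \<in> arr C" "src C (g \<cdot> f) = src C f" "tgt C (g \<cdot> f) = tgt C g"
  using cmp_Hom[of f "src C f" "tgt C f" g "tgt C g"] assms by auto

lemma cmp_idn_left [simp]: "f \<in> arr C \<Longrightarrow> tgt C f = Y \<Longrightarrow> idn C Y \<cdot> f = f"
  using idn_left[of f "src C f" Y] by auto

lemma cmp_idn_right [simp]: "f \<in> arr C \<Longrightarrow> src C f = X \<Longrightarrow> f \<cdot> idn C X = f"
  using idn_right[of f X "tgt C f"] by auto

lemma cmp_assoc_arr [simp]:
  "\<lbrakk>f \<in> arr C; g \<in> arr C; h \<in> arr C; tgt C f = src C g; tgt C g = src C h\<rbrakk>
    \<Longrightarrow> (h \<cdot> g) \<cdot> f = h \<cdot> (g \<cdot> f)"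
  using cmp_assoc[of f "src C f" "src C g" g "src C h" h "tgt C h"] by auto

lemma inverse_arrows_unique:
  assumes "inverse_arrows C f g" "inverse_arrows C f g'"
  shows "g = g'"
proof -
  have e: "f \<in> arr C" "g \<in> arr C" "g' \<in> arr C" "src C g = tgt C f" "tgt C g = src C f"
    "src C g' = tgt C f" "tgt C g' = src C f" "g \<cdot> f = idn C (src C f)" "f \<cdot> g' = idn C (tgt C f)"
    using assms by (auto simp: inverse_arrows_def)
  have "g = g \<cdot> (f \<cdot> g')" using e(1-7) by (simp add: e(9))
  also have "\<dots> = (g \<cdot> f) \<cdot> g'" using e(1-7) by simp
  also have "\<dots> = g'" using e(1-7) by (simp add: e(8))
  finally show ?thesis .
qed

lemma inv_arr_simps [simp]:
  assumes "iso_arr C f"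
  shows "f \<in> arr C" "inv_arr C f \<in> arr C" "src C (inv_arr C f) = tgt C f"
    "tgt C (inv_arr C f) = src C f" "inv_arr C f \<cdot> f = idn C (src C f)"
    "f \<cdot> inv_arr C f = idn C (tgt C f)"
proof -
  have "\<exists>!g. inverse_arrows C f g"
    using assms inverse_arrows_unique unfolding iso_arr_def by blast
  then have "inverse_arrows C f (inv_arr C f)" unfolding inv_arr_def by (rule theI')
  then show "f \<in> arr C" "inv_arr C f \<in> arr C" "src C (inv_arr C f) = tgt C f"
    "tgt C (inv_arr C f) = src C f" "inv_arr C f \<cdot> f = idn C (src C f)"
    "f \<cdot> inv_arr C f = idn C (tgt C f)"
    unfolding inverse_arrows_def Hom_iff by blast+
qed

lemma inv_arr_cmp_simps [simp]:
  assumes "iso_arr C f" "h \<in> arr C"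
  shows "tgt C h = src C f \<Longrightarrow> inv_arr C f \<cdot> (f \<cdot> h) = h"
    "tgt C h = tgt C f \<Longrightarrow> f \<cdot> (inv_arr C f \<cdot> h) = h"
proof -
  assume h: "tgt C h = src C f"
  have "inv_arr C f \<cdot> (f \<cdot> h) = (inv_arr C f \<cdot> f) \<cdot> h"
    by (rule cmp_assoc_arr[symmetric]) (use assms h in auto)
  also have "\<dots> = h" by (simp only: inv_arr_simps(5)[OF assms(1)]) (simp add: assms h)
  finally show "inv_arr C f \<cdot> (f \<cdot> h) = h" .
next
  assume h: "tgt C h = tgt C f"
  have "f \<cdot> (inv_arr C f \<cdot> h) = (f \<cdot> inv_arr C f) \<cdot> h"
    by (rule cmp_assoc_arr[symmetric]) (use assms h in auto)
  also have "\<dots> = h" by (simp only: inv_arr_simps(6)[OF assms(1)]) (simp add: assms h)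
  finally show "f \<cdot> (inv_arr C f \<cdot> h) = h" .
qed

lemma isos_iff: "f \<in> isos C X Y \<longleftrightarrow> iso_arr C f \<and> src C f = X \<and> tgt C f = Y"
  by (auto simp: isos_def)

lemma iso_arrI:
  assumes "f \<in> arr C" "g \<in> arr C" "src C g = tgt C f" "tgt C g = src C f"
    "g \<cdot> f = idn C (src C f)" "f \<cdot> g = idn C (tgt C f)"
  shows "iso_arr C f"
  using assms unfolding iso_arr_def inverse_arrows_def Hom_iff by blast

lemma iso_inv [simp]: "iso_arr C f \<Longrightarrow> iso_arr C (inv_arr C f)"
  by (rule iso_arrI[of _ f]) auto

lemma iso_idn [simp]: "X \<in> obj C \<Longrightarrow> iso_arr C (idn C X)"
  by (rule iso_arrI[of _ "idn C X"]) auto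

lemma iso_cmp [simp]:
  "\<lbrakk>iso_arr C f; iso_arr C g; tgt C f = src C g\<rbrakk> \<Longrightarrow> iso_arr C (g \<cdot> f)"
  by (rule iso_arrI[of _ "inv_arr C f \<cdot> inv_arr C g"]) auto

lemma iso_mono:
  "\<lbrakk>iso_arr C f; g \<in> arr C; h \<in> arr C; tgt C g = src C f; tgt C h = src C f; f \<cdot> g = f \<cdot> h\<rbrakk>
    \<Longrightarrow> g = h"
  by (metis inv_arr_cmp_simps(1))

lemma iso_epi:
  assumes "iso_arr C f" "g \<in> arr C" "h \<in> arr C" "src C g = tgt C f" "src C h = tgt C f"
    "g \<cdot> f = h \<cdot> f"
  shows "g = h"
proof -
  have "(g \<cdot> f) \<cdot> inv_arr C f = (h \<cdot> f) \<cdot> inv_arr C f" using assms(6) by simp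
  then show ?thesis using assms(1-5) by simp
qed

text \<open>Composites are normalized to the right, so \<open>a \<cdot> b\<close> is no longer a
  subterm once something is composed on its right; this form still rewrites it there.\<close>

lemma cmp_reassoc:
  assumes "a \<cdot> b = d" "x \<in> arr C" "b \<in> arr C" "a \<in> arr C" "tgt C x = src C b" "tgt C b = src C a"
  shows "a \<cdot> (b \<cdot> x) = d \<cdot> x"
  using assms cmp_assoc_arr by metis

lemma retractI:
  "\<lbrakk>i \<in> arr C; r \<in> arr C; src C i = X; tgt C i = Y; src C r = Y; tgt C r = X; r \<cdot> i = idn C X\<rbrakk>
    \<Longrightarrow> retract C X Y"
  unfolding retract_def by (rule bexI[of _ i], rule bexI[of _ r]) auto

lemma retractE:
  assumes "retract C X Y"
  obtains i r where "i \<in> arr C" "r \<in> arr C" "src C i = X" "tgt C i = Y" "src C r = Y" "tgt C r = X"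
    "r \<cdot> i = idn C X" "X \<in> obj C" "Y \<in> obj C"
  using assms unfolding retract_def by auto

lemma retract_refl [simp]: "X \<in> obj C \<Longrightarrow> retract C X X"
  by (rule retractI[of "idn C X" "idn C X"]) auto

lemma retract_trans [trans]:
  assumes "retract C X Y" "retract C Y Z" shows "retract C X Z"
proof -
  obtain i r where 1: "i \<in> arr C" "r \<in> arr C" "src C i = X" "tgt C i = Y" "src C r = Y" "tgt C r = X"
    "r \<cdot> i = idn C X" by (rule retractE[OF assms(1)])
  obtain j s where 2: "j \<in> arr C" "s \<in> arr C" "src C j = Y" "tgt C j = Z" "src C s = Z" "tgt C s = Y"
    "s \<cdot> j = idn C Y" by (rule retractE[OF assms(2)])
  have "s \<cdot> (j \<cdot> i) = i" using 1 2 by (simp add: cmp_reassoc[OF 2(7)])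
  then show ?thesis using 1 2 by (intro retractI[of "j \<cdot> i" "r \<cdot> s"]) auto
qed

lemma iso_retract:
  assumes "iso_arr C f" shows "retract C (src C f) (tgt C f)" "retract C (tgt C f) (src C f)"
  by (rule retractI[of f "inv_arr C f"], use assms in simp_all)
    (rule retractI[of "inv_arr C f" f], use assms in simp_all)

lemma zero_objectI_retract:
  assumes "retract C X Z" "zero_object C Z" shows "zero_object C X"
proof -
  obtain i r where 1: "i \<in> arr C" "r \<in> arr C" "src C i = X" "tgt C i = Z" "src C r = Z" "tgt C r = X"
    "r \<cdot> i = idn C X" "X \<in> obj C" "Z \<in> obj C" by (rule retractE[OF assms(1)])
  show ?thesis unfolding zero_object_def
  proof (intro conjI ballI)
    show "X \<in> obj C" by fact
    fix W assume W: "W \<in> obj C"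
    have "\<exists>!a. a \<in> Hom C W Z" "\<exists>!b. b \<in> Hom C Z W"
      using assms(2) W unfolding zero_object_def by blast+
    then obtain a b where a: "a \<in> Hom C W Z" "\<And>b. b \<in> Hom C W Z \<Longrightarrow> b = a"
      and b: "b \<in> Hom C Z W" "\<And>a. a \<in> Hom C Z W \<Longrightarrow> a = b" by blast
    show "\<exists>!f. f \<in> Hom C W X"
    proof (rule ex1I[of _ "r \<cdot> a"])
      show "r \<cdot> a \<in> Hom C W X" using 1 a(1) by auto
      fix f assume f: "f \<in> Hom C W X"
      have "f = r \<cdot> (i \<cdot> f)" using 1 f by (simp add: cmp_reassoc[OF 1(7)])
      also have "i \<cdot> f = a" by (rule a(2)) (use 1 f in auto)
      finally show "f = r \<cdot> a" .
    qed
    show "\<exists>!f. f \<in> Hom C X W"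
    proof (rule ex1I[of _ "b \<cdot> i"])
      show "b \<cdot> i \<in> Hom C X W" using 1 b(1) by auto
      fix f assume f: "f \<in> Hom C X W"
      have "f = (f \<cdot> r) \<cdot> i" using 1 f by (simp only: cmp_assoc_arr Hom_iff) simp
      also have "f \<cdot> r = b" by (rule b(2)) (use 1 f in auto)
      finally show "f = b \<cdot> i" .
    qed
  qed
qed

end

text \<open>Weak kernels and cokernels only apply to zero composites, so equations between
  composites are turned into vanishing differences.\<close>

definition minus_arr :: "('o, 'm, 'x) add_data_scheme \<Rightarrow> 'm \<Rightarrow> 'm \<Rightarrow> 'm" where
  "minus_arr C f g = plus_arr C f (neg_arr C g)"

section \<open>Calculation in the Hom groups\<close>

context additive_category
begin

lemma zero_simps [simp]:
  assumes "X \<in> obj C" "Y \<in> obj C"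
  shows "zero_arr C X Y \<in> arr C" "src C (zero_arr C X Y) = X" "tgt C (zero_arr C X Y) = Y"
proof -
  interpret comm_group "Hom_group C X Y" using assms by (rule Hom_comm_group)
  show "zero_arr C X Y \<in> arr C" "src C (zero_arr C X Y) = X" "tgt C (zero_arr C X Y) = Y"
    using one_closed by (auto simp: Hom_group_def)
qed

lemma plus_simps [simp]:
  assumes "f \<in> arr C" "g \<in> arr C" "src C f = src C g" "tgt C f = tgt C g"
  shows "plus_arr C f g \<in> arr C" "src C (plus_arr C f g) = src C g" "tgt C (plus_arr C f g) = tgt C g"
proof -
  interpret comm_group "Hom_group C (src C g) (tgt C g)" using assms by (intro Hom_comm_group) auto
  show "plus_arr C f g \<in> arr C" "src C (plus_arr C f g) = src C g" "tgt C (plus_arr C f g) = tgt C g"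
    using m_closed[of f g] assms by (auto simp: Hom_group_def)
qed

lemma neg_simps [simp]:
  assumes "f \<in> arr C"
  shows "neg_arr C f \<in> arr C" "src C (neg_arr C f) = src C f" "tgt C (neg_arr C f) = tgt C f"
proof -
  interpret comm_group "Hom_group C (src C f) (tgt C f)" using assms by (intro Hom_comm_group) auto
  show "neg_arr C f \<in> arr C" "src C (neg_arr C f) = src C f" "tgt C (neg_arr C f) = tgt C f"
    using inv_closed[of f] assms by (auto simp: Hom_group_def neg_arr_def)
qed

lemma minus_simps [simp]:
  assumes "f \<in> arr C" "g \<in> arr C" "src C f = src C g" "tgt C f = tgt C g"
  shows "minus_arr C f g \<in> arr C" "src C (minus_arr C f g) = src C g" "tgt C (minus_arr C f g) = tgt C g"
  using assms by (simp_all add: minus_arr_def)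

lemma plus_group:
  assumes "f \<in> arr C" "g \<in> arr C" "src C f = src C g" "tgt C f = tgt C g"
  shows plus_comm: "plus_arr C f g = plus_arr C g f"
    and plus_neg: "plus_arr C f (neg_arr C f) = zero_arr C (src C f) (tgt C f)"
    and plus_zero: "plus_arr C f (zero_arr C (src C f) (tgt C f)) = f"
    and zero_plus: "plus_arr C (zero_arr C (src C f) (tgt C f)) f = f"
    and plus_left_cancel: "plus_arr C f g = f \<longleftrightarrow> g = zero_arr C (src C f) (tgt C f)"
    and minus_plus: "plus_arr C (minus_arr C f g) g = f"
    and minus_eq_zero_iff: "minus_arr C f g = zero_arr C (src C f) (tgt C f) \<longleftrightarrow> f = g"
proof -
  interpret comm_group "Hom_group C (src C f) (tgt C f)" using assms by (intro Hom_comm_group) auto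
  have c: "f \<in> carrier (Hom_group C (src C f) (tgt C f))" "g \<in> carrier (Hom_group C (src C f) (tgt C f))"
    using assms by (auto simp: Hom_group_def)
  have n: "neg_arr C f = inv\<^bsub>Hom_group C (src C f) (tgt C f)\<^esub> f"
    "neg_arr C g = inv\<^bsub>Hom_group C (src C f) (tgt C f)\<^esub> g"
    using assms by (simp_all add: neg_arr_def)
  have e: "plus_arr C = mult (Hom_group C (src C f) (tgt C f))"
    "zero_arr C (src C f) (tgt C f) = one (Hom_group C (src C f) (tgt C f))"
    by (simp_all add: Hom_group_def)
  show "plus_arr C f g = plus_arr C g f" "plus_arr C f (neg_arr C f) = zero_arr C (src C f) (tgt C f)"
    "plus_arr C f (zero_arr C (src C f) (tgt C f)) = f"
    "plus_arr C (zero_arr C (src C f) (tgt C f)) f = f"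
    "plus_arr C f g = f \<longleftrightarrow> g = zero_arr C (src C f) (tgt C f)"
    unfolding n e using c by (auto simp: m_comm)
  show "plus_arr C (minus_arr C f g) g = f"
    unfolding minus_arr_def n e using c by (simp add: m_assoc)
  show "minus_arr C f g = zero_arr C (src C f) (tgt C f) \<longleftrightarrow> f = g"
    unfolding minus_arr_def n e using c inv_equality inv_comm by (metis inv_closed inv_inv r_inv)
qed

lemma plus_assoc:
  assumes "f \<in> arr C" "g \<in> arr C" "h \<in> arr C" "src C f = src C h" "tgt C f = tgt C h"
    "src C g = src C h" "tgt C g = tgt C h"
  shows "plus_arr C (plus_arr C f g) h = plus_arr C f (plus_arr C g h)"
proof -
  interpret comm_group "Hom_group C (src C f) (tgt C f)" using assms by (intro Hom_comm_group) auto
  show ?thesis using m_assoc[of f g h] assms by (auto simp: Hom_group_def)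
qed

lemma cmp_plus_arr:
  assumes "f \<in> arr C" "g \<in> arr C" "src C f = src C g" "tgt C f = tgt C g" "h \<in> arr C"
  shows "src C h = tgt C g \<Longrightarrow> h \<cdot> plus_arr C f g = plus_arr C (h \<cdot> f) (h \<cdot> g)"
    and "tgt C h = src C g \<Longrightarrow> plus_arr C f g \<cdot> h = plus_arr C (f \<cdot> h) (g \<cdot> h)"
  using assms cmp_plus_right[of f "src C f" "tgt C f" g h "tgt C h"]
    cmp_plus_left[of h "src C h" "tgt C h" f "tgt C g" g] by auto

lemma plus_zero_simps [simp]:
  assumes "f \<in> arr C" "X = src C f" "Y = tgt C f"
  shows "plus_arr C f (zero_arr C X Y) = f" "plus_arr C (zero_arr C X Y) f = f"
  using plus_zero[of f f] zero_plus[of f f] assms by auto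

text \<open>By bilinearity the composite equals its own double, and cancellation makes it
  zero.\<close>

lemma cmp_zero [simp]:
  assumes "h \<in> arr C" "X \<in> obj C"
  shows "src C h = Y \<Longrightarrow> h \<cdot> zero_arr C X Y = zero_arr C X (tgt C h)"
    and "tgt C h = Y \<Longrightarrow> zero_arr C Y X \<cdot> h = zero_arr C (src C h) X"
proof -
  show "h \<cdot> zero_arr C X Y = zero_arr C X (tgt C h)" if "src C h = Y"
  proof -
    have Y: "Y \<in> obj C" using assms that by auto
    have "h \<cdot> zero_arr C X Y = plus_arr C (h \<cdot> zero_arr C X Y) (h \<cdot> zero_arr C X Y)"
      using assms that Y cmp_plus_arr(1)[of "zero_arr C X Y" "zero_arr C X Y" h] by simp
    then show ?thesis
      using plus_left_cancel[of "h \<cdot> zero_arr C X Y" "h \<cdot> zero_arr C X Y"] assms that Y by auto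
  qed
  show "zero_arr C Y X \<cdot> h = zero_arr C (src C h) X" if "tgt C h = Y"
  proof -
    have Y: "Y \<in> obj C" using assms that by auto
    have "zero_arr C Y X \<cdot> h = plus_arr C (zero_arr C Y X \<cdot> h) (zero_arr C Y X \<cdot> h)"
      using assms that Y cmp_plus_arr(2)[of "zero_arr C Y X" "zero_arr C Y X" h] by simp
    then show ?thesis
      using plus_left_cancel[of "zero_arr C Y X \<cdot> h" "zero_arr C Y X \<cdot> h"] assms that Y by auto
  qed
qed

lemma neg_unique:
  assumes "f \<in> arr C" "g \<in> arr C" "src C f = src C g" "tgt C f = tgt C g"
    "plus_arr C f g = zero_arr C (src C f) (tgt C f)"
  shows "g = neg_arr C f"
proof -
  interpret comm_group "Hom_group C (src C f) (tgt C f)" using assms by (intro Hom_comm_group) auto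
  have "inv\<^bsub>Hom_group C (src C f) (tgt C f)\<^esub> f = g"
    by (rule inv_equality[of g f, simplified])
      (use assms plus_comm[of f g] in \<open>auto simp: Hom_group_def\<close>)
  then show ?thesis by (simp add: neg_arr_def)
qed

lemma neg_neg [simp]: "f \<in> arr C \<Longrightarrow> neg_arr C (neg_arr C f) = f"
  using neg_unique[of "neg_arr C f" f] plus_comm[of f "neg_arr C f"] plus_neg[of f f] by auto

lemma cmp_neg:
  assumes "f \<in> arr C" "h \<in> arr C"
  shows "src C h = tgt C f \<Longrightarrow> h \<cdot> neg_arr C f = neg_arr C (h \<cdot> f)"
    and "tgt C h = src C f \<Longrightarrow> neg_arr C f \<cdot> h = neg_arr C (f \<cdot> h)"
proof -
  show "h \<cdot> neg_arr C f = neg_arr C (h \<cdot> f)" if "src C h = tgt C f"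
    using that assms cmp_plus_arr(1)[of f "neg_arr C f" h] plus_neg[of f f]
    by (intro neg_unique) auto
  show "neg_arr C f \<cdot> h = neg_arr C (f \<cdot> h)" if "tgt C h = src C f"
    using that assms cmp_plus_arr(2)[of f "neg_arr C f" h] plus_neg[of f f]
    by (intro neg_unique) auto
qed

lemma neg_zero [simp]:
  "X \<in> obj C \<Longrightarrow> Y \<in> obj C \<Longrightarrow> neg_arr C (zero_arr C X Y) = zero_arr C X Y"
  using neg_unique[of "zero_arr C X Y" "zero_arr C X Y"] by auto

lemma neg_eq_zero_iff [simp]:
  "\<lbrakk>f \<in> arr C; X = src C f; Y = tgt C f\<rbrakk> \<Longrightarrow> neg_arr C f = zero_arr C X Y \<longleftrightarrow> f = zero_arr C X Y"
  by (metis neg_neg neg_zero src_obj tgt_obj)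

lemma cmp_minus:
  assumes "f \<in> arr C" "g \<in> arr C" "src C f = src C g" "tgt C f = tgt C g" "h \<in> arr C"
  shows "src C h = tgt C g \<Longrightarrow> h \<cdot> minus_arr C f g = minus_arr C (h \<cdot> f) (h \<cdot> g)"
    and "tgt C h = src C g \<Longrightarrow> minus_arr C f g \<cdot> h = minus_arr C (f \<cdot> h) (g \<cdot> h)"
  using assms by (auto simp: minus_arr_def cmp_plus_arr cmp_neg)

lemma minus_self [simp]:
  "\<lbrakk>f \<in> arr C\<rbrakk> \<Longrightarrow> minus_arr C f f = zero_arr C (src C f) (tgt C f)"
  using minus_eq_zero_iff[of f f] by auto

lemma minus_zero [simp]:
  "\<lbrakk>f \<in> arr C; X = src C f; Y = tgt C f\<rbrakk> \<Longrightarrow> minus_arr C f (zero_arr C X Y) = f"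
  by (simp add: minus_arr_def)

lemma zero_objectI:
  assumes "X \<in> obj C" "idn C X = zero_arr C X X" shows "zero_object C X"
  unfolding zero_object_def
proof (intro conjI ballI)
  show "X \<in> obj C" by fact
  fix W assume W: "W \<in> obj C"
  show "\<exists>!f. f \<in> Hom C W X"
  proof (rule ex1I[of _ "zero_arr C W X"])
    fix f assume f: "f \<in> Hom C W X"
    then have "f = idn C X \<cdot> f" by auto
    then show "f = zero_arr C W X" using f assms by auto
  qed (use W assms in auto)
  show "\<exists>!f. f \<in> Hom C X W"
  proof (rule ex1I[of _ "zero_arr C X W"])
    fix f assume f: "f \<in> Hom C X W"
    then have "f = f \<cdot> idn C X" by auto
    then show "f = zero_arr C X W" using f assms by auto
  qed (use W assms in auto)
qed

lemma zero_objectD: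
  assumes "zero_object C Z"
  shows "Z \<in> obj C" "f \<in> arr C \<Longrightarrow> src C f = Z \<Longrightarrow> f = zero_arr C Z (tgt C f)"
    "f \<in> arr C \<Longrightarrow> tgt C f = Z \<Longrightarrow> f = zero_arr C (src C f) Z"
proof -
  show Z: "Z \<in> obj C" using assms by (simp add: zero_object_def)
  have *: "f = g" if "f \<in> Hom C X Y" "g \<in> Hom C X Y" "X = Z \<or> Y = Z" for f g X Y
  proof -
    have "X \<in> obj C" "Y \<in> obj C" using that by auto
    then have "\<exists>!f. f \<in> Hom C X Y" using assms that(3) unfolding zero_object_def by blast
    then show ?thesis using that by blast
  qed
  show "f \<in> arr C \<Longrightarrow> src C f = Z \<Longrightarrow> f = zero_arr C Z (tgt C f)"
    by (rule *[of _ Z "tgt C f"]) (use Z in auto)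
  show "f \<in> arr C \<Longrightarrow> tgt C f = Z \<Longrightarrow> f = zero_arr C (src C f) Z"
    by (rule *[of _ "src C f" Z]) (use Z in auto)
qed

lemma zero_object_iff: "zero_object C X \<longleftrightarrow> X \<in> obj C \<and> idn C X = zero_arr C X X"
  using zero_objectI zero_objectD(1) zero_objectD(2)[of X "idn C X"] by auto

end

section \<open>Functors and additive functors\<close>

lemma functor_arr:
  assumes "is_functor C D F" "category C" "f \<in> arr C"
  shows "farr F f \<in> arr D" "src D (farr F f) = fobj F (src C f)" "tgt D (farr F f) = fobj F (tgt C f)"
proof -
  interpret category C by fact
  have "src C f \<in> obj C" "tgt C f \<in> obj C" "f \<in> Hom C (src C f) (tgt C f)" using assms by auto
  then have "farr F f \<in> Hom D (fobj F (src C f)) (fobj F (tgt C f))"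
    using assms(1) unfolding is_functor_def by blast
  then show "farr F f \<in> arr D" "src D (farr F f) = fobj F (src C f)" "tgt D (farr F f) = fobj F (tgt C f)"
    by auto
qed

lemma functor_obj: "is_functor C D F \<Longrightarrow> X \<in> obj C \<Longrightarrow> fobj F X \<in> obj D"
  by (auto simp: is_functor_def)

lemma functor_idn: "is_functor C D F \<Longrightarrow> X \<in> obj C \<Longrightarrow> farr F (idn C X) = idn D (fobj F X)"
  by (auto simp: is_functor_def)

lemma functor_cmp:
  assumes "is_functor C D F" "category C" "f \<in> arr C" "g \<in> arr C" "tgt C f = src C g"
  shows "farr F (g \<cdot>\<^bsub>C\<^esub> f) = farr F g \<cdot>\<^bsub>D\<^esub> farr F f"
proof -
  interpret category C by fact
  have *: "src C f \<in> obj C" "src C g \<in> obj C" "tgt C g \<in> obj C" "f \<in> Hom C (src C f) (src C g)"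
    "g \<in> Hom C (src C g) (tgt C g)" using assms by auto
  show ?thesis using assms(1) * unfolding is_functor_def by blast
qed

lemma functor_retract:
  assumes "is_functor C D F" "category C" "retract C X Y"
  shows "retract D (fobj F X) (fobj F Y)"
proof -
  interpret category C by fact
  obtain i r where 1: "i \<in> arr C" "r \<in> arr C" "src C i = X" "tgt C i = Y" "src C r = Y" "tgt C r = X"
    "r \<cdot>\<^bsub>C\<^esub> i = idn C X" "X \<in> obj C" "Y \<in> obj C" by (rule retractE[OF assms(3)])
  have "farr F r \<cdot>\<^bsub>D\<^esub> farr F i = idn D (fobj F X)"
    using functor_cmp[OF assms(1,2), of i r] functor_idn[OF assms(1), of X] 1 by simp
  then show ?thesis
    unfolding retract_def using functor_arr[OF assms(1,2) 1(1)] functor_arr[OF assms(1,2) 1(2)] 1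
    by (intro bexI[of _ "farr F i"] bexI[of _ "farr F r"]) auto
qed

lemma additive_functor_functor: "additive_functor C D F \<Longrightarrow> is_functor C D F"
  by (simp add: additive_functor_def)

lemma additive_functor_plus:
  assumes "additive_functor C D F" "category C" "f \<in> arr C" "g \<in> arr C" "src C f = src C g" "tgt C f = tgt C g"
  shows "farr F (plus_arr C f g) = plus_arr D (farr F f) (farr F g)"
proof -
  interpret category C by fact
  have *: "src C g \<in> obj C" "tgt C g \<in> obj C" "f \<in> Hom C (src C g) (tgt C g)"
    "g \<in> Hom C (src C g) (tgt C g)" using assms by auto
  show ?thesis using assms(1) * unfolding additive_functor_def by blast
qed

lemma additive_functor_zero:
  assumes "additive_functor C D F" "additive_category C" "additive_category D" "X \<in> obj C" "Y \<in> obj C"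
  shows "farr F (zero_arr C X Y) = zero_arr D (fobj F X) (fobj F Y)"
proof -
  interpret C: additive_category C by fact
  interpret D: additive_category D by fact
  note F = additive_functor_functor[OF assms(1)]
  let ?z = "farr F (zero_arr C X Y)"
  have z: "?z \<in> arr D" "src D ?z = fobj F X" "tgt D ?z = fobj F Y"
    using functor_arr[OF F C.category_axioms, of "zero_arr C X Y"] assms by auto
  have "?z = plus_arr D ?z ?z"
    using additive_functor_plus[OF assms(1) C.category_axioms, of "zero_arr C X Y" "zero_arr C X Y"] assms
    by simp
  then show ?thesis using D.plus_left_cancel[of ?z ?z] z by auto
qed

section \<open>Triangles: weak kernels, weak cokernels and splittings\<close>

context triangulated_category
begin

lemma shift_functor: "is_functor C C (shift C)"
  using shift_additive by (rule additive_functor_functor)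

lemma shift_simps [simp]:
  "X \<in> obj C \<Longrightarrow> \<Sigma>\<^sub>o X \<in> obj C"
  "f \<in> arr C \<Longrightarrow> \<Sigma>\<^sub>m f \<in> arr C"
  "f \<in> arr C \<Longrightarrow> src C (\<Sigma>\<^sub>m f) = \<Sigma>\<^sub>o (src C f)"
  "f \<in> arr C \<Longrightarrow> tgt C (\<Sigma>\<^sub>m f) = \<Sigma>\<^sub>o (tgt C f)"
  "X \<in> obj C \<Longrightarrow> \<Sigma>\<^sub>m (idn C X) = idn C (\<Sigma>\<^sub>o X)"
  "X \<in> obj C \<Longrightarrow> Y \<in> obj C \<Longrightarrow> \<Sigma>\<^sub>m (zero_arr C X Y) = zero_arr C (\<Sigma>\<^sub>o X) (\<Sigma>\<^sub>o Y)"
  using functor_obj[OF shift_functor] functor_arr[OF shift_functor category_axioms]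
    functor_idn[OF shift_functor]
    additive_functor_zero[OF shift_additive additive_category_axioms additive_category_axioms]
  by auto

lemma shift_cmp:
  "f \<in> arr C \<Longrightarrow> g \<in> arr C \<Longrightarrow> tgt C f = src C g \<Longrightarrow> \<Sigma>\<^sub>m (g \<cdot> f) = \<Sigma>\<^sub>m g \<cdot> \<Sigma>\<^sub>m f"
  by (rule functor_cmp[OF shift_functor category_axioms])

lemma shift_bij:
  "X \<in> obj C \<Longrightarrow> Y \<in> obj C \<Longrightarrow> bij_betw (farr (shift C)) (Hom C X Y) (Hom C (\<Sigma>\<^sub>o X) (\<Sigma>\<^sub>o Y))"
  using shift_equivalence unfolding is_equivalence_def by blast

lemma shift_faithful:
  assumes "f \<in> arr C" "g \<in> arr C" "src C f = src C g" "tgt C f = tgt C g" "\<Sigma>\<^sub>m f = \<Sigma>\<^sub>m g"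
  shows "f = g"
  using shift_bij[of "src C g" "tgt C g"] assms unfolding bij_betw_def inj_on_def by auto

lemma shift_full:
  assumes "k \<in> arr C" "src C k = \<Sigma>\<^sub>o X" "tgt C k = \<Sigma>\<^sub>o Y" "X \<in> obj C" "Y \<in> obj C"
  obtains f where "f \<in> arr C" "src C f = X" "tgt C f = Y" "\<Sigma>\<^sub>m f = k"
proof -
  have "k \<in> Hom C (\<Sigma>\<^sub>o X) (\<Sigma>\<^sub>o Y)" using assms by simp
  then have "k \<in> farr (shift C) ` Hom C X Y" using shift_bij[OF assms(4,5)] unfolding bij_betw_def by simp
  then obtain f where "f \<in> Hom C X Y" "k = \<Sigma>\<^sub>m f" by (rule imageE) blast
  then show ?thesis using that[of f] by simp
qed

text \<open>The shift is only an equivalence, so a desuspension exists up to an isomorphism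
  \<open>\<theta>\<close>, which has to be carried along wherever an object is desuspended.\<close>

lemma desuspension:
  assumes "Y \<in> obj C"
  obtains X \<theta> where "X \<in> obj C" "iso_arr C \<theta>" "src C \<theta> = \<Sigma>\<^sub>o X" "tgt C \<theta> = Y"
proof -
  have "\<exists>X \<in> obj C. isos C (\<Sigma>\<^sub>o X) Y \<noteq> {}"
    using shift_equivalence assms unfolding is_equivalence_def by blast
  then obtain X \<theta> where "X \<in> obj C" "\<theta> \<in> isos C (\<Sigma>\<^sub>o X) Y" by blast
  then show ?thesis using that[of X \<theta>] by (simp add: isos_iff)
qed

lemma triD:
  assumes "(f, g, h) \<in> tri C"
  shows "f \<in> arr C" "g \<in> arr C" "h \<in> arr C" "src C g = tgt C f" "src C h = tgt C g" "tgt C h = \<Sigma>\<^sub>o (src C f)"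
  using tri_type[OF assms] by auto

lemma tri_fill_arr:
  assumes "(f, g, h) \<in> tri C" "(f', g', h') \<in> tri C" "u \<in> arr C" "v \<in> arr C"
    "src C u = src C f" "tgt C u = src C f'" "src C v = tgt C f" "tgt C v = tgt C f'" "v \<cdot> f = f' \<cdot> u"
  obtains w where "w \<in> arr C" "src C w = tgt C g" "tgt C w = tgt C g'" "w \<cdot> g = g' \<cdot> v"
    "\<Sigma>\<^sub>m u \<cdot> h = h' \<cdot> w"
proof -
  note t = triD[OF assms(1)] triD[OF assms(2)]
  have "\<exists>w \<in> Hom C (tgt C g) (tgt C g'). w \<cdot> g = g' \<cdot> v \<and> \<Sigma>\<^sub>m u \<cdot> h = h' \<cdot> w"
    by (rule tri_fill[OF assms(1,2), where X = "src C f" and Y = "tgt C f" and X' = "src C f'"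
          and Y' = "tgt C f'"]) (use assms t in simp_all)
  then show ?thesis using that by auto
qed

lemma tri_iso_arr:
  assumes "(f, g, h) \<in> tri C" "iso_arr C u" "iso_arr C v" "iso_arr C w"
    "src C u = src C f" "src C v = tgt C f" "src C w = tgt C g"
    "f' \<in> arr C" "g' \<in> arr C" "h' \<in> arr C"
    "tgt C u = src C f'" "tgt C v = tgt C f'" "src C g' = tgt C f'" "tgt C w = tgt C g'"
    "src C h' = tgt C g'" "tgt C h' = \<Sigma>\<^sub>o (src C f')"
    "v \<cdot> f = f' \<cdot> u" "w \<cdot> g = g' \<cdot> v" "\<Sigma>\<^sub>m u \<cdot> h = h' \<cdot> w"
  shows "(f', g', h') \<in> tri C"
  by (rule tri_iso[OF assms(1), where X = "src C f" and Y = "tgt C f" and Z = "tgt C g"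
        and X' = "src C f'" and Y' = "tgt C f'" and Z' = "tgt C g'"])
    (use assms triD[OF assms(1)] in \<open>simp_all add: isos_iff\<close>)

lemma tri_rot: "(f, g, h) \<in> tri C \<Longrightarrow> (g, h, neg_arr C (\<Sigma>\<^sub>m f)) \<in> tri C"
  using tri_rotate[of f "src C f" "tgt C f" g "tgt C g" h] triD[of f g h] by auto

text \<open>The identity triangle of \<open>src C f\<close> maps to the given triangle by the
  identity and \<open>f\<close>; commutativity of the next square sends \<open>g \<cdot> f\<close>
  through a zero object.\<close>

lemma tri_gf:
  assumes "(f, g, h) \<in> tri C" shows "g \<cdot> f = zero_arr C (src C f) (tgt C g)"
proof -
  note t = triD[OF assms]
  obtain Z where Z: "zero_object C Z" using ex_zero_object by blast
  note Z' = zero_objectD(1)[OF Z]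
  have X: "src C f \<in> obj C" using t by auto
  obtain w where w: "w \<in> arr C" "src C w = Z" "tgt C w = tgt C g" "w \<cdot> zero_arr C (src C f) Z = g \<cdot> f"
    by (rule tri_fill_arr[OF tri_idn[OF X Z] assms, where u = "idn C (src C f)" and v = f])
      (use t X Z' in auto)
  then have "g \<cdot> f = w \<cdot> zero_arr C (src C f) Z" by simp
  also have "\<dots> = zero_arr C (src C f) (tgt C g)" using w(1-3) X by simp
  finally show ?thesis .
qed

lemma tri_hg: "(f, g, h) \<in> tri C \<Longrightarrow> h \<cdot> g = zero_arr C (tgt C f) (\<Sigma>\<^sub>o (src C f))"
  using tri_gf[OF tri_rot, of f g h] triD[of f g h] by simp

lemma tri_shift_zero: "(f, g, h) \<in> tri C \<Longrightarrow> \<Sigma>\<^sub>m f \<cdot> h = zero_arr C (tgt C g) (\<Sigma>\<^sub>o (tgt C f))"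
  using tri_hg[OF tri_rot, of f g h] triD[of f g h] by (simp add: cmp_neg)

text \<open>\<open>tri_fill\<close> only produces the third map of a morphism of triangles. So
  \<open>k\<close> is completed to a morphism into the triangle \<open>0, idn, 0\<close> on its
  target, where the third map is the desired factorization.\<close>

lemma weak_cokernel:
  assumes "(f, g, h) \<in> tri C" "k \<in> arr C" "src C k = tgt C f" "k \<cdot> f = zero_arr C (src C f) (tgt C k)"
  obtains w where "w \<in> arr C" "src C w = tgt C g" "tgt C w = tgt C k" "w \<cdot> g = k"
proof -
  note t = triD[OF assms(1)]
  obtain Z where Z: "zero_object C Z" using ex_zero_object by blast
  note Z' = zero_objectD(1)[OF Z]
  let ?W = "tgt C k"
  have W: "?W \<in> obj C" using assms by auto
  have SZ: "zero_object C (\<Sigma>\<^sub>o Z)"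
    using Z by (auto simp: zero_object_iff dest: arg_cong[of _ _ "farr (shift C)"])
  \<comment> \<open>This triangle is to be rotated backwards, so its zero object must be presented
    as a suspension.\<close>
  have "(idn C ?W, zero_arr C ?W (\<Sigma>\<^sub>o Z), zero_arr C (\<Sigma>\<^sub>o Z) (\<Sigma>\<^sub>o ?W)) \<in> tri C"
    using W SZ by (rule tri_idn)
  then have T: "(zero_arr C Z ?W, idn C ?W, zero_arr C ?W (\<Sigma>\<^sub>o Z)) \<in> tri C"
    using tri_rotate[of "zero_arr C Z ?W" Z ?W "idn C ?W" ?W "zero_arr C ?W (\<Sigma>\<^sub>o Z)"] W Z' by simp
  obtain w where w: "w \<in> arr C" "src C w = tgt C g" "tgt C w = tgt C (idn C ?W)" "w \<cdot> g = idn C ?W \<cdot> k"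
    by (rule tri_fill_arr[OF assms(1) T, where u = "zero_arr C (src C f) Z" and v = k])
      (use t W Z' assms in auto)
  show ?thesis by (rule that[of w]) (use w assms in auto)
qed

text \<open>After rotation \<open>m\<close> is, up to suspension, the third map of a morphism of
  triangles. Fullness of the shift removes the suspension, faithfulness transfers the equation, and
  the two signs from rotation cancel.\<close>

lemma weak_kernel:
  assumes "(f, g, h) \<in> tri C" "l \<in> arr C" "tgt C l = tgt C f" "g \<cdot> l = zero_arr C (src C l) (tgt C g)"
  obtains m where "m \<in> arr C" "src C m = src C l" "tgt C m = src C f" "f \<cdot> m = l"
proof -
  note t = triD[OF assms(1)]
  obtain Z where Z: "zero_object C Z" using ex_zero_object by blast
  note Z' = zero_objectD(1)[OF Z]
  let ?V = "src C l"
  have V: "?V \<in> obj C" using assms by auto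
  have T: "(zero_arr C ?V Z, zero_arr C Z (\<Sigma>\<^sub>o ?V), neg_arr C (idn C (\<Sigma>\<^sub>o ?V))) \<in> tri C"
    using tri_rot[OF tri_idn[OF V Z]] V by simp
  obtain w where w: "w \<in> arr C" "src C w = tgt C (zero_arr C Z (\<Sigma>\<^sub>o ?V))" "tgt C w = tgt C h"
      "\<Sigma>\<^sub>m l \<cdot> neg_arr C (idn C (\<Sigma>\<^sub>o ?V)) = neg_arr C (\<Sigma>\<^sub>m f) \<cdot> w"
    by (rule tri_fill_arr[OF T tri_rot[OF assms(1)], where u = l and v = "zero_arr C Z (tgt C g)"])
      (use t V Z' assms in auto)
  obtain m where m: "m \<in> arr C" "src C m = ?V" "tgt C m = src C f" "\<Sigma>\<^sub>m m = w"
    by (rule shift_full[of w ?V "src C f"]) (use w t V Z' in auto)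
  have "neg_arr C (\<Sigma>\<^sub>m l) = neg_arr C (\<Sigma>\<^sub>m (f \<cdot> m))"
    using w m t V assms by (simp add: cmp_neg shift_cmp)
  then have "neg_arr C (neg_arr C (\<Sigma>\<^sub>m l)) = neg_arr C (neg_arr C (\<Sigma>\<^sub>m (f \<cdot> m)))" by simp
  then have "\<Sigma>\<^sub>m l = \<Sigma>\<^sub>m (f \<cdot> m)"
    using m(1-3) t assms(2) by simp
  then have "l = f \<cdot> m" using m t assms by - (rule shift_faithful, auto)
  then show ?thesis using that[OF m(1-3)] by simp
qed

text \<open>The arrow \<open>k\<close> is the desuspension of \<open>h \<cdot> \<theta>\<close> with
  a sign that undoes the one in \<open>tri_rotate\<close>.\<close>

lemma tri_desuspend:
  assumes T: "(f, g, h) \<in> tri C" and W: "W \<in> obj C" "iso_arr C \<theta>" "src C \<theta> = \<Sigma>\<^sub>o W" "tgt C \<theta> = tgt C g"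
  obtains k where "(k, f, inv_arr C \<theta> \<cdot> g) \<in> tri C" "src C k = W"
proof -
  note t = triD[OF T]
  have th: "\<theta> \<in> arr C" using W by simp
  obtain k where k: "k \<in> arr C" "src C k = W" "tgt C k = src C f" "\<Sigma>\<^sub>m k = neg_arr C (h \<cdot> \<theta>)"
    by (rule shift_full[of "neg_arr C (h \<cdot> \<theta>)" W "src C f"]) (use t W th in auto)
  have "(f, inv_arr C \<theta> \<cdot> g, h \<cdot> \<theta>) \<in> tri C"
    by (rule tri_iso_arr[OF T, of "idn C (src C f)" "idn C (tgt C f)" "inv_arr C \<theta>"])
      (use t W th in auto)
  then have "(k, f, inv_arr C \<theta> \<cdot> g) \<in> tri C"
    using tri_rotate[of k W "src C f" f "tgt C f" "inv_arr C \<theta> \<cdot> g"] k t W th by simp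
  then show ?thesis using k(2) by (rule that)
qed

lemma fibre:
  assumes "f \<in> arr C"
  obtains k g where "(k, f, g) \<in> tri C"
proof -
  obtain g h where T: "(f, g, h) \<in> tri C" using tri_cone assms by blast
  have "tgt C g \<in> obj C" using triD[OF T] by auto
  then obtain W \<theta> where W: "W \<in> obj C" "iso_arr C \<theta>" "src C \<theta> = \<Sigma>\<^sub>o W" "tgt C \<theta> = tgt C g"
    by (rule desuspension)
  show ?thesis by (rule tri_desuspend[OF T W]) (rule that)
qed

lemma left_inverse_of_zero_cone:
  assumes "(e, g, h) \<in> tri C" "zero_object C (tgt C g)"
  obtains s where "s \<in> arr C" "src C s = tgt C e" "tgt C s = src C e" "s \<cdot> e = idn C (src C e)"
proof -
  note t = triD[OF assms(1)]
  have h0: "h = zero_arr C (tgt C g) (\<Sigma>\<^sub>o (src C e))" using zero_objectD(2)[OF assms(2), of h] t by simp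
  have X: "src C e \<in> obj C" using t by auto
  obtain w where w: "w \<in> arr C" "src C w = \<Sigma>\<^sub>o (tgt C e)" "tgt C w = \<Sigma>\<^sub>o (src C e)"
      "w \<cdot> neg_arr C (\<Sigma>\<^sub>m e) = idn C (\<Sigma>\<^sub>o (src C e))"
    by (rule weak_cokernel[OF tri_rot[OF tri_rot[OF assms(1)]], of "idn C (\<Sigma>\<^sub>o (src C e))"])
      (use t X h0 assms(2) in \<open>auto simp: zero_objectD(1)\<close>)
  obtain s where s: "s \<in> arr C" "src C s = tgt C e" "tgt C s = src C e" "\<Sigma>\<^sub>m s = neg_arr C w"
    by (rule shift_full[of "neg_arr C w" "tgt C e" "src C e"]) (use w t in auto)
  have "\<Sigma>\<^sub>m (s \<cdot> e) = \<Sigma>\<^sub>m (idn C (src C e))"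
    using s w t X by (simp add: shift_cmp cmp_neg)
  then have "s \<cdot> e = idn C (src C e)" using s t X by - (rule shift_faithful, auto)
  then show ?thesis using that[of s] s by simp
qed

text \<open>A weak cokernel provides a left inverse, a weak kernel a right inverse, and the two
  coincide.\<close>

lemma iso_of_zero_cone:
  assumes "(e, g, h) \<in> tri C" "zero_object C (tgt C g)"
  shows "iso_arr C e"
proof -
  note t = triD[OF assms(1)]
  obtain s where s: "s \<in> arr C" "src C s = tgt C e" "tgt C s = src C e" "s \<cdot> e = idn C (src C e)"
    by (rule left_inverse_of_zero_cone[OF assms])
  have Y: "tgt C e \<in> obj C" using t by auto
  have g0: "g = zero_arr C (tgt C e) (tgt C g)" using zero_objectD(3)[OF assms(2), of g] t by simp
  have "g \<cdot> idn C (tgt C e) = zero_arr C (tgt C e) (tgt C g)" using t Y g0 by simp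
  then obtain m where m: "m \<in> arr C" "src C m = tgt C e" "tgt C m = src C e" "e \<cdot> m = idn C (tgt C e)"
    using weak_kernel[OF assms(1), of "idn C (tgt C e)"] Y by auto
  have "m = s" using m s t Y cmp_reassoc[OF s(4) m(1) t(1) s(1)] by simp
  then show ?thesis using s m t by (intro iso_arrI[of e s]) auto
qed

text \<open>The complement of a split monomorphism is its cone: the retraction forces the connecting
  map \<open>h\<close> to vanish, so \<open>g\<close> has a section, and a corrected section
  satisfies the biproduct equations.\<close>

lemma retract_triangle:
  assumes "i \<in> arr C" "r \<in> arr C" "src C i = X" "tgt C i = Y" "src C r = Y" "tgt C r = X" "r \<cdot> i = idn C X"
  obtains Z j q h where "is_biproduct C X Z Y i j r q" "(i, q, h) \<in> tri C"
proof -
  obtain g h where T: "(i, g, h) \<in> tri C" using tri_cone assms by blast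
  note t = triD[OF T]
  let ?Z = "tgt C g"
  have o: "X \<in> obj C" "Y \<in> obj C" "?Z \<in> obj C" using assms t by auto
  have "\<Sigma>\<^sub>m r \<cdot> (\<Sigma>\<^sub>m i \<cdot> h) = \<Sigma>\<^sub>m (r \<cdot> i) \<cdot> h"
    using assms(1-6) t by (simp add: shift_cmp)
  then have h0: "h = zero_arr C ?Z (\<Sigma>\<^sub>o X)"
    using tri_shift_zero[OF T] assms t o by simp
  obtain j0 where j0: "j0 \<in> arr C" "src C j0 = ?Z" "tgt C j0 = Y" "g \<cdot> j0 = idn C ?Z"
    by (rule weak_kernel[OF tri_rot[OF T], of "idn C ?Z"]) (use t o assms h0 in auto)
  \<comment> \<open>Removing the part of \<open>j0\<close> that lies in \<open>X\<close> makes
    \<open>r \<cdot> j\<close> vanish and leaves \<open>g \<cdot> j\<close> unchanged, since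
    \<open>g \<cdot> i\<close> is zero.\<close>
  define j where "j = minus_arr C j0 (i \<cdot> (r \<cdot> j0))"
  have gi: "g \<cdot> i = zero_arr C X ?Z" using tri_gf[OF T] assms by simp
  have j: "j \<in> arr C" "src C j = ?Z" "tgt C j = Y" using j0 assms by (auto simp: j_def)
  have gj: "g \<cdot> j = idn C ?Z"
    unfolding j_def using j0 assms t o gi
    by (simp add: cmp_minus cmp_reassoc[OF gi])
  have rj: "r \<cdot> j = zero_arr C ?Z X"
    unfolding j_def using j0 assms t o by (simp add: cmp_minus cmp_reassoc[OF assms(7)])
  let ?s = "plus_arr C (i \<cdot> r) (j \<cdot> g)"
  have s: "?s \<in> arr C" "src C ?s = Y" "tgt C ?s = Y" using assms j t by auto
  \<comment> \<open>The defect \<open>d\<close> of the last biproduct equation is killed by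
    \<open>g\<close>, so it has the form \<open>i \<cdot> m\<close>; it is also killed by
    \<open>r\<close>, which forces \<open>m\<close> to be zero.\<close>
  define d where "d = minus_arr C (idn C Y) ?s"
  have d: "d \<in> arr C" "src C d = Y" "tgt C d = Y" using s o by (auto simp: d_def)
  have gs: "g \<cdot> ?s = g"
    using assms(1-6) j t o by (simp add: cmp_plus_arr cmp_reassoc[OF gi] cmp_reassoc[OF gj])
  have gd: "g \<cdot> d = zero_arr C Y ?Z"
    unfolding d_def using s t o assms by (simp add: cmp_minus gs)
  have rs: "r \<cdot> ?s = r"
    using assms(1-6) j t o by (simp add: cmp_plus_arr cmp_reassoc[OF assms(7)] cmp_reassoc[OF rj])
  have rd: "r \<cdot> d = zero_arr C Y X"
    unfolding d_def using s t o assms by (simp add: cmp_minus rs)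
  obtain m where m: "m \<in> arr C" "src C m = Y" "tgt C m = X" "i \<cdot> m = d"
    by (rule weak_kernel[OF T, of d]) (use d gd assms in auto)
  have "r \<cdot> (i \<cdot> m) = m" using m(1-3) assms(1-6) by (simp add: cmp_reassoc[OF assms(7)])
  then have "m = zero_arr C Y X" using m rd by simp
  then have "d = zero_arr C Y Y" using m(4) assms o by simp
  then have "?s = idn C Y" unfolding d_def using minus_eq_zero_iff[of "idn C Y" ?s] s o by auto
  then show ?thesis
    by (intro that[of ?Z j g h]) (use T assms j t o gj rj gi in \<open>auto simp: is_biproduct_def\<close>)
qed

lemma retract_biproduct:
  assumes "i \<in> arr C" "r \<in> arr C" "src C i = X" "tgt C i = Y" "src C r = Y" "tgt C r = X" "r \<cdot> i = idn C X"
  obtains Z j q where "is_biproduct C X Z Y i j r q"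
  by (rule retract_triangle[OF assms]) (rule that)

text \<open>The cross terms vanish by the biproduct equations. In the core this merges a finite sum
  of factorizations into a single one.\<close>

lemma sum_factors:
  assumes "is_biproduct C X Y B i j p q"
    "a \<in> Hom C W X" "b \<in> Hom C W Y" "c \<in> Hom C X Z" "d \<in> Hom C Y Z"
  obtains u v where "u \<in> Hom C W B" "v \<in> Hom C B Z" "v \<cdot> u = plus_arr C (c \<cdot> a) (d \<cdot> b)"
proof -
  have B: "B \<in> obj C" "i \<in> Hom C X B" "j \<in> Hom C Y B" "p \<in> Hom C B X" "q \<in> Hom C B Y"
    and e: "p \<cdot> i = idn C X" "q \<cdot> j = idn C Y" "q \<cdot> i = zero_arr C X Y" "p \<cdot> j = zero_arr C Y X"
    using assms(1) unfolding is_biproduct_def by blast+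
  have o: "X \<in> obj C" "Y \<in> obj C" "Z \<in> obj C" "W \<in> obj C" using assms(2-5) by auto
  let ?u = "plus_arr C (i \<cdot> a) (j \<cdot> b)" let ?v = "plus_arr C (c \<cdot> p) (d \<cdot> q)"
  have "p \<cdot> ?u = a" "q \<cdot> ?u = b"
    using B assms(2-5) o by (simp_all add: cmp_plus_arr cmp_reassoc[OF e(1)] cmp_reassoc[OF e(2)]
        cmp_reassoc[OF e(3)] cmp_reassoc[OF e(4)])
  then have "?v \<cdot> ?u = plus_arr C (c \<cdot> a) (d \<cdot> b)"
    using B assms(2-5) by (subst cmp_plus_arr(2)) auto
  then show ?thesis by (rule that[rotated 2]) (use B assms(2-5) in auto)
qed

end

section \<open>Small sets\<close>

lemma small_subset: "small \<kappa> A \<Longrightarrow> B \<subseteq> A \<Longrightarrow> small \<kappa> B"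
  unfolding small_def by (meson card_of_mono1 ordLeq_ordLess_trans)

lemma small_image: "small \<kappa> A \<Longrightarrow> small \<kappa> (f ` A)"
  unfolding small_def by (meson card_of_image ordLeq_ordLess_trans)

lemma small_inj:
  assumes "small \<kappa> B" "inj_on f A" "f ` A \<subseteq> B"
  shows "small \<kappa> A"
  using assms unfolding small_def by (meson card_of_ordLeq ordLeq_ordLess_trans)

locale small_universe =
  fixes \<kappa> :: "'u rel"
  assumes inaccessible: "inaccessible \<kappa>"
begin

lemma small_stable: "stable \<kappa>"
proof (rule regularCard_stable)
  show "regularCard \<kappa>" using inaccessible by (simp add: inaccessible_def)
  have "natLeq \<le>o \<kappa>" and co: "Card_order \<kappa>"
    using inaccessible ordLess_imp_ordLeq by (auto simp: inaccessible_def)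
  then have "natLeq \<le>o |Field \<kappa>|"
    using card_of_Field_ordIso[OF co] ordIso_symmetric ordLeq_ordIso_trans by blast
  then show "\<not> finite (Field \<kappa>)" using infinite_iff_natLeq_ordLeq by blast
  show "Card_order \<kappa>" by (rule co)
qed

lemma small_Sigma: "small \<kappa> A \<Longrightarrow> (\<And>a. a \<in> A \<Longrightarrow> small \<kappa> (B a)) \<Longrightarrow> small \<kappa> (Sigma A B)"
  unfolding small_def by (rule stable_elim[OF small_stable]) auto

lemma small_UN: "small \<kappa> A \<Longrightarrow> (\<And>a. a \<in> A \<Longrightarrow> small \<kappa> (B a)) \<Longrightarrow> small \<kappa> (\<Union>a\<in>A. B a)"
proof -
  assume "small \<kappa> A" "\<And>a. a \<in> A \<Longrightarrow> small \<kappa> (B a)"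
  then have "small \<kappa> (snd ` Sigma A B)" by (intro small_image small_Sigma)
  then show ?thesis by (rule small_subset) force
qed

lemma small_countable: "countable A \<Longrightarrow> small \<kappa> A"
proof -
  assume "countable A"
  then have "|A| \<le>o natLeq"
    by (metis card_of_nat card_of_ordLeq countable_def ordLeq_ordIso_trans subset_UNIV)
  then show ?thesis using inaccessible unfolding small_def inaccessible_def
    by (meson ordLeq_ordLess_trans)
qed

text \<open>Coproducts and compactness are postulated only for index sets of type \<open>'u\<close>;
  an equipotent copy carries them over to small index sets of any type.\<close>

lemma small_copy:
  assumes "small \<kappa> A"
  obtains J :: "'u set" and e where "bij_betw e J A" "small \<kappa> J"
proof -
  have c: "Card_order \<kappa>" using inaccessible by (simp add: inaccessible_def)
  have "|A| \<le>o |Field \<kappa>|"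
    using assms c unfolding small_def
    by (meson card_of_Field_ordIso ordIso_symmetric ordLess_imp_ordLeq ordLeq_ordIso_trans)
  then obtain f where f: "inj_on f A" "f ` A \<subseteq> Field \<kappa>"
    using card_of_ordLeq[of A "Field \<kappa>"] by blast
  have "bij_betw f A (f ` A)" using f(1) by (rule inj_on_imp_bij_betw)
  then have "bij_betw (inv_into A f) (f ` A) A" by (rule bij_betw_inv_into)
  then show ?thesis using small_image[OF assms] by (rule that)
qed

lemma small_Pow:
  assumes "small \<kappa> A" shows "small \<kappa> (Pow A)"
proof -
  obtain J :: "'u set" and e where J: "bij_betw e J A" "small \<kappa> J" using assms by (rule small_copy)
  have "small \<kappa> (Pow J)" using J(2) inaccessible unfolding small_def inaccessible_def by blast
  then have "small \<kappa> ((`) e ` Pow J)" by (rule small_image)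
  moreover have "(`) e ` Pow J = Pow A"
    by (rule bij_betw_imp_surj_on[OF bij_betw_Pow[OF J(1)]])
  ultimately show ?thesis by simp
qed

lemma small_extensional_funcset:
  assumes "small \<kappa> A" "small \<kappa> B" shows "small \<kappa> (A \<rightarrow>\<^sub>E B)"
proof (rule small_inj)
  show "small \<kappa> (Pow (A \<times> B))" using assms by (intro small_Pow small_Sigma)
  show "inj_on (\<lambda>f. {(a, f a) | a. a \<in> A}) (A \<rightarrow>\<^sub>E B)"
  proof (rule inj_onI)
    fix f g assume fg: "f \<in> A \<rightarrow>\<^sub>E B" "g \<in> A \<rightarrow>\<^sub>E B" "{(a, f a) | a. a \<in> A} = {(a, g a) | a. a \<in> A}"
    show "f = g"
    proof (rule PiE_ext[OF fg(1,2)])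
      fix a assume "a \<in> A"
      then have "(a, f a) \<in> {(a, g a) | a. a \<in> A}" using fg(3) by blast
      then show "f a = g a" by blast
    qed
  qed
  show "(\<lambda>f. {(a, f a) | a. a \<in> A}) ` (A \<rightarrow>\<^sub>E B) \<subseteq> Pow (A \<times> B)" by (auto simp: PiE_def)
qed

end

section \<open>Coproducts and compact objects\<close>

context category
begin

lemma coproductD:
  assumes "is_coproduct C J X Q \<iota>"
  shows "Q \<in> obj C" "j \<in> J \<Longrightarrow> X j \<in> obj C" "j \<in> J \<Longrightarrow> \<iota> j \<in> arr C" "j \<in> J \<Longrightarrow> src C (\<iota> j) = X j"
    "j \<in> J \<Longrightarrow> tgt C (\<iota> j) = Q"
  using assms by (auto simp: is_coproduct_def)

lemma coproduct_ex:
  assumes "is_coproduct C J X Q \<iota>" "Y \<in> obj C" "\<And>j. j \<in> J \<Longrightarrow> f j \<in> Hom C (X j) Y"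
  obtains u where "u \<in> arr C" "src C u = Q" "tgt C u = Y" "\<And>j. j \<in> J \<Longrightarrow> u \<cdot> \<iota> j = f j"
proof -
  have "\<exists>!u. u \<in> Hom C Q Y \<and> (\<forall>j \<in> J. u \<cdot> \<iota> j = f j)"
    using assms unfolding is_coproduct_def by blast
  then show ?thesis using that by auto
qed

lemma coproduct_uniq:
  assumes "is_coproduct C J X Q \<iota>" "u \<in> arr C" "v \<in> arr C" "src C u = Q" "src C v = Q" "tgt C u = tgt C v"
    "\<And>j. j \<in> J \<Longrightarrow> u \<cdot> \<iota> j = v \<cdot> \<iota> j"
  shows "u = v"
proof -
  have "\<forall>j \<in> J. v \<cdot> \<iota> j \<in> Hom C (X j) (tgt C v)" using assms coproductD[OF assms(1)] by auto
  moreover have "\<forall>Y \<in> obj C. \<forall>f. (\<forall>j \<in> J. f j \<in> Hom C (X j) Y) \<longrightarrow>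
      (\<exists>!w. w \<in> Hom C Q Y \<and> (\<forall>j \<in> J. w \<cdot> \<iota> j = f j))"
    using assms(1) unfolding is_coproduct_def by (elim conjE)
  then have "\<forall>f. (\<forall>j \<in> J. f j \<in> Hom C (X j) (tgt C v)) \<longrightarrow>
      (\<exists>!w. w \<in> Hom C Q (tgt C v) \<and> (\<forall>j \<in> J. w \<cdot> \<iota> j = f j))"
    by (rule bspec[OF _ tgt_obj[OF assms(3)]])
  then have "(\<forall>j \<in> J. v \<cdot> \<iota> j \<in> Hom C (X j) (tgt C v)) \<longrightarrow>
      (\<exists>!w. w \<in> Hom C Q (tgt C v) \<and> (\<forall>j \<in> J. w \<cdot> \<iota> j = v \<cdot> \<iota> j))"
    by (rule spec)
  ultimately have "\<exists>!w. w \<in> Hom C Q (tgt C v) \<and> (\<forall>j \<in> J. w \<cdot> \<iota> j = v \<cdot> \<iota> j)"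
    by (rule mp[rotated])
  moreover have "u \<in> Hom C Q (tgt C v)" "v \<in> Hom C Q (tgt C v)" using assms by auto
  ultimately show ?thesis using assms(7) by blast
qed

lemma is_coproductI:
  assumes "Q \<in> obj C" "\<And>j. j \<in> J \<Longrightarrow> X j \<in> obj C" "\<And>j. j \<in> J \<Longrightarrow> \<iota> j \<in> Hom C (X j) Q"
    "\<And>Y f. Y \<in> obj C \<Longrightarrow> (\<And>j. j \<in> J \<Longrightarrow> f j \<in> Hom C (X j) Y) \<Longrightarrow>
      \<exists>u \<in> Hom C Q Y. \<forall>j \<in> J. u \<cdot> \<iota> j = f j"
    "\<And>u v. u \<in> arr C \<Longrightarrow> v \<in> arr C \<Longrightarrow> src C u = Q \<Longrightarrow> src C v = Q \<Longrightarrow> tgt C u = tgt C v \<Longrightarrow>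
      (\<And>j. j \<in> J \<Longrightarrow> u \<cdot> \<iota> j = v \<cdot> \<iota> j) \<Longrightarrow> u = v"
  shows "is_coproduct C J X Q \<iota>"
  unfolding is_coproduct_def
proof (intro conjI ballI allI impI)
  show "Q \<in> obj C" "\<And>j. j \<in> J \<Longrightarrow> X j \<in> obj C" "\<And>j. j \<in> J \<Longrightarrow> \<iota> j \<in> Hom C (X j) Q" by fact+
  fix Y f assume Y: "Y \<in> obj C" and f: "\<forall>j \<in> J. f j \<in> Hom C (X j) Y"
  obtain u where u: "u \<in> Hom C Q Y" "\<And>j. j \<in> J \<Longrightarrow> u \<cdot> \<iota> j = f j" using assms(4)[OF Y, of f] f by blast
  show "\<exists>!u. u \<in> Hom C Q Y \<and> (\<forall>j \<in> J. u \<cdot> \<iota> j = f j)"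
  proof (rule ex1I)
    show "u \<in> Hom C Q Y \<and> (\<forall>j \<in> J. u \<cdot> \<iota> j = f j)" using u by blast
    fix v assume v: "v \<in> Hom C Q Y \<and> (\<forall>j \<in> J. v \<cdot> \<iota> j = f j)"
    show "v = u" by (rule assms(5)) (use u v in auto)
  qed
qed

lemma coproduct_reindex:
  assumes "bij_betw e J A" "is_coproduct C A X Q \<iota>" "\<And>j. j \<in> J \<Longrightarrow> X' j = X (e j)"
    "\<And>j. j \<in> J \<Longrightarrow> \<iota>' j = \<iota> (e j)"
  shows "is_coproduct C J X' Q \<iota>'"
proof (rule is_coproductI)
  have e: "e j \<in> A" if "j \<in> J" for j using that assms(1) bij_betwE by blast
  have e': "inv_into J e a \<in> J" "e (inv_into J e a) = a" if "a \<in> A" for a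
    using that assms(1) by (auto simp: bij_betw_def inv_into_into f_inv_into_f)
  note c = coproductD[OF assms(2)]
  show "Q \<in> obj C" "\<And>j. j \<in> J \<Longrightarrow> X' j \<in> obj C" "\<And>j. j \<in> J \<Longrightarrow> \<iota>' j \<in> Hom C (X' j) Q"
    using c e assms(3,4) by auto
  show "\<exists>u \<in> Hom C Q Y. \<forall>j \<in> J. u \<cdot> \<iota>' j = f j"
    if Y: "Y \<in> obj C" and f: "\<And>j. j \<in> J \<Longrightarrow> f j \<in> Hom C (X' j) Y" for Y f
  proof -
    have "f (inv_into J e a) \<in> Hom C (X a) Y" if "a \<in> A" for a
      using f[OF e'(1)[OF that]] assms(3)[OF e'(1)[OF that]] e'(2)[OF that] by simp
    then obtain u where u: "u \<in> arr C" "src C u = Q" "tgt C u = Y"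
        "\<And>a. a \<in> A \<Longrightarrow> u \<cdot> \<iota> a = f (inv_into J e a)"
      using coproduct_ex[OF assms(2) Y, of "\<lambda>a. f (inv_into J e a)"] by blast
    have "u \<cdot> \<iota>' j = f j" if "j \<in> J" for j
      using u(4)[OF e[OF that]] assms(4)[OF that] that assms(1) by (simp add: bij_betw_def)
    then show ?thesis by (intro bexI[of _ u]) (use u(1-3) in auto)
  qed
  show "u = v" if uv: "u \<in> arr C" "v \<in> arr C" "src C u = Q" "src C v = Q" "tgt C u = tgt C v"
    "\<And>j. j \<in> J \<Longrightarrow> u \<cdot> \<iota>' j = v \<cdot> \<iota>' j" for u v
  proof (rule coproduct_uniq[OF assms(2) uv(1-5)])
    fix a assume a: "a \<in> A"
    show "u \<cdot> \<iota> a = v \<cdot> \<iota> a"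
      using uv(6)[OF e'(1)[OF a]] assms(4)[OF e'(1)[OF a]] e'(2)[OF a] by simp
  qed
qed

lemma has_small_coproducts_any:
  fixes \<kappa> :: "'u rel" and A :: "'c set"
  assumes "inaccessible \<kappa>" "has_small_coproducts \<kappa> C" "small \<kappa> A" "X ` A \<subseteq> obj C"
  obtains Q \<iota> where "is_coproduct C A X Q \<iota>"
proof -
  interpret small_universe \<kappa> by standard fact
  obtain J and e :: "'u \<Rightarrow> 'c" where J: "bij_betw e J A" "small \<kappa> J"
    by (rule small_copy[OF assms(3)]) blast
  have "(\<lambda>j. X (e j)) ` J \<subseteq> obj C" using assms(4) J(1) bij_betwE by blast
  then obtain Q \<iota> where "is_coproduct C J (\<lambda>j. X (e j)) Q \<iota>"
    using assms(2) J(2) unfolding has_small_coproducts_def by blast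
  then have "is_coproduct C A X Q (\<lambda>a. \<iota> (inv_into J e a))"
    by (rule coproduct_reindex[OF bij_betw_inv_into[OF J(1)]])
      (use J(1) in \<open>auto simp: bij_betw_inv_into_right\<close>)
  then show ?thesis by (rule that)
qed

end

text \<open>The definition of compactness speaks of finitely supported families and their finite
  products in a Hom group. This closure turns arguments about arrows into a coproduct into
  inductions; \<open>compact_finsum\<close> and \<open>compactI\<close> translate between the
  two.\<close>

inductive_set finsum ::
    "('o, 'm, 'x) add_data_scheme \<Rightarrow> 'j set \<Rightarrow> ('j \<Rightarrow> 'o) \<Rightarrow> 'o \<Rightarrow> ('j \<Rightarrow> 'm) \<Rightarrow> 'o \<Rightarrow> 'm set"
  for C J X Q \<iota> W where
  finsum_zero: "zero_arr C W Q \<in> finsum C J X Q \<iota> W"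
| finsum_insert: "\<lbrakk>j \<in> J; a \<in> Hom C W (X j); f \<in> finsum C J X Q \<iota> W\<rbrakk>
    \<Longrightarrow> plus_arr C (\<iota> j \<cdot>\<^bsub>C\<^esub> a) f \<in> finsum C J X Q \<iota> W"

section \<open>Finite sums into a coproduct, and compactness\<close>

context additive_category
begin

lemma finsum_Hom:
  assumes "f \<in> finsum C J X Q \<iota> W" "is_coproduct C J X Q \<iota>" "W \<in> obj C"
  shows "f \<in> arr C \<and> src C f = W \<and> tgt C f = Q"
  using assms(1) by induction (use assms(2,3) coproductD[OF assms(2)] in auto)

lemma finsum_plus:
  assumes "f \<in> finsum C J X Q \<iota> W" "g \<in> finsum C J X Q \<iota> W" "is_coproduct C J X Q \<iota>" "W \<in> obj C"
  shows "plus_arr C f g \<in> finsum C J X Q \<iota> W"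
  using assms(1)
proof induction
  case finsum_zero
  then show ?case using finsum_Hom[OF assms(2-4)] assms by simp
next
  case (finsum_insert j a f)
  have "plus_arr C (plus_arr C (\<iota> j \<cdot> a) f) g = plus_arr C (\<iota> j \<cdot> a) (plus_arr C f g)"
    by (rule plus_assoc) (use finsum_Hom[OF finsum_insert(3) assms(3,4)] finsum_Hom[OF assms(2-4)]
        coproductD[OF assms(3)] finsum_insert(1,2) in auto)
  then show ?case using finsum.finsum_insert[OF finsum_insert(1,2,4)] by simp
qed

lemma finsum_cmp:
  assumes "f \<in> finsum C J X Q \<iota> W" "is_coproduct C J X Q \<iota>" "W \<in> obj C" "b \<in> arr C" "tgt C b = W"
  shows "f \<cdot> b \<in> finsum C J X Q \<iota> (src C b)"
  using assms(1)
proof induction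
  case finsum_zero
  show ?case using finsum.finsum_zero assms coproductD(1)[OF assms(2)] by simp
next
  case (finsum_insert j a f)
  have "plus_arr C (\<iota> j \<cdot> a) f \<cdot> b = plus_arr C (\<iota> j \<cdot> (a \<cdot> b)) (f \<cdot> b)"
    using finsum_Hom[OF finsum_insert(3) assms(2,3)] coproductD[OF assms(2)] finsum_insert(1,2) assms(4,5)
    by (simp add: cmp_plus_arr)
  then show ?case using finsum.finsum_insert[OF finsum_insert(1) _ finsum_insert(4), of "a \<cdot> b"]
      finsum_insert(2) assms(4,5) by auto
qed

lemma finsum_single:
  assumes "is_coproduct C J X Q \<iota>" "j \<in> J" "a \<in> Hom C W (X j)"
  shows "\<iota> j \<cdot> a \<in> finsum C J X Q \<iota> W"
proof -
  have "W \<in> obj C" using assms(3) by auto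
  then show ?thesis
    using finsum_insert[OF assms(2,3) finsum_zero[of C W Q J X \<iota>]] assms coproductD[OF assms(1)] by simp
qed

lemma finsum_minus:
  assumes "f \<in> finsum C J X Q \<iota> W" "g \<in> finsum C J X Q \<iota> W" "is_coproduct C J X Q \<iota>" "W \<in> obj C"
  shows "minus_arr C f g \<in> finsum C J X Q \<iota> W"
proof -
  have "neg_arr C g = g \<cdot> neg_arr C (idn C W)"
    using finsum_Hom[OF assms(2-4)] assms(4) by (simp add: cmp_neg)
  then have "neg_arr C g \<in> finsum C J X Q \<iota> W"
    using finsum_cmp[OF assms(2-4), of "neg_arr C (idn C W)"] assms(4) by simp
  then show ?thesis unfolding minus_arr_def using assms finsum_plus by blast
qed

lemma coproduct_proj:
  assumes "is_coproduct C J X Q \<iota>"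
  obtains \<pi> where "\<And>j. j \<in> J \<Longrightarrow> \<pi> j \<in> arr C" "\<And>j. j \<in> J \<Longrightarrow> src C (\<pi> j) = Q"
    "\<And>j. j \<in> J \<Longrightarrow> tgt C (\<pi> j) = X j" "\<And>j. j \<in> J \<Longrightarrow> \<pi> j \<cdot> \<iota> j = idn C (X j)"
    "\<And>j k. j \<in> J \<Longrightarrow> k \<in> J \<Longrightarrow> k \<noteq> j \<Longrightarrow> \<pi> j \<cdot> \<iota> k = zero_arr C (X k) (X j)"
proof -
  have "\<exists>u. u \<in> arr C \<and> src C u = Q \<and> tgt C u = X j \<and>
      (\<forall>k \<in> J. u \<cdot> \<iota> k = (if k = j then idn C (X j) else zero_arr C (X k) (X j)))" if "j \<in> J" for j
    by (rule coproduct_ex[OF assms coproductD(2)[OF assms that],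
          of "\<lambda>k. if k = j then idn C (X j) else zero_arr C (X k) (X j)"])
      (use coproductD(2)[OF assms] that in auto)
  then obtain \<pi> where "\<And>j. j \<in> J \<Longrightarrow> \<pi> j \<in> arr C \<and> src C (\<pi> j) = Q \<and> tgt C (\<pi> j) = X j \<and>
      (\<forall>k \<in> J. \<pi> j \<cdot> \<iota> k = (if k = j then idn C (X j) else zero_arr C (X k) (X j)))" by metis
  then show ?thesis by (intro that[of \<pi>]) auto
qed

text \<open>\<open>e\<close> below is the projection of the coproduct onto the summands in the finite set \<open>F\<close>.\<close>

lemma finite_part:
  assumes cop: "is_coproduct C J X Q \<iota>" and "finite F" "F \<subseteq> J" "e \<in> Hom C Q Q"
    and "\<And>j. j \<in> F \<Longrightarrow> e \<cdot> \<iota> j = \<iota> j" "\<And>j. j \<in> J - F \<Longrightarrow> e \<cdot> \<iota> j = zero_arr C (X j) Q"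
    and "k \<in> arr C" "tgt C k = Q"
  shows "e \<cdot> k \<in> finsum C J X Q \<iota> (src C k)"
    and "\<lbrakk>\<And>j p. j \<in> F \<Longrightarrow> p \<in> Hom C Q (X j) \<Longrightarrow> p \<cdot> \<iota> j = idn C (X j) \<Longrightarrow>
        (\<And>i. i \<in> J \<Longrightarrow> i \<noteq> j \<Longrightarrow> p \<cdot> \<iota> i = zero_arr C (X i) (X j)) \<Longrightarrow> p \<cdot> k = zero_arr C (src C k) (X j)\<rbrakk>
      \<Longrightarrow> e \<cdot> k = zero_arr C (src C k) Q"
proof -
  note c = coproductD[OF cop]
  obtain \<pi> where \<pi>: "\<And>j. j \<in> J \<Longrightarrow> \<pi> j \<in> arr C" "\<And>j. j \<in> J \<Longrightarrow> src C (\<pi> j) = Q"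
    "\<And>j. j \<in> J \<Longrightarrow> tgt C (\<pi> j) = X j" "\<And>j. j \<in> J \<Longrightarrow> \<pi> j \<cdot> \<iota> j = idn C (X j)"
    "\<And>j k. j \<in> J \<Longrightarrow> k \<in> J \<Longrightarrow> k \<noteq> j \<Longrightarrow> \<pi> j \<cdot> \<iota> k = zero_arr C (X k) (X j)"
    by (rule coproduct_proj[OF cop]) blast
  have main: "e \<cdot> k \<in> finsum C J X Q \<iota> (src C k) \<and>
      ((\<forall>j \<in> F. \<pi> j \<cdot> k = zero_arr C (src C k) (X j)) \<longrightarrow> e \<cdot> k = zero_arr C (src C k) Q)"
    using assms(2-6)
  proof (induction F arbitrary: e)
    case empty
    have "e = zero_arr C Q Q"
      by (rule coproduct_uniq[OF cop]) (use empty c in auto)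
    then show ?case using assms(7,8) c finsum_zero by auto
  next
    case (insert j F)
    have j: "j \<in> J" using insert by auto
    obtain e' where e': "e' \<in> arr C" "src C e' = Q" "tgt C e' = Q"
      "\<And>i. i \<in> J \<Longrightarrow> e' \<cdot> \<iota> i = (if i \<in> F then \<iota> i else zero_arr C (X i) Q)"
      by (rule coproduct_ex[OF cop c(1), of "\<lambda>i. if i \<in> F then \<iota> i else zero_arr C (X i) Q"])
        (use c in auto)
    \<comment> \<open>The projection onto \<open>insert j F\<close> is the projection onto
      \<open>F\<close> plus the idempotent of the summand \<open>j\<close>; the two sides are
      compared on each summand.\<close>
    have ee: "e = plus_arr C e' (\<iota> j \<cdot> \<pi> j)"
    proof (rule coproduct_uniq[OF cop])
      fix i assume i: "i \<in> J"
      have "plus_arr C e' (\<iota> j \<cdot> \<pi> j) \<cdot> \<iota> i = plus_arr C (e' \<cdot> \<iota> i) (\<iota> j \<cdot> (\<pi> j \<cdot> \<iota> i))"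
        using c i j e'(1-3) \<pi>(1-3) by (simp add: cmp_plus_arr)
      also have "\<dots> = e \<cdot> \<iota> i"
        using e'(4)[OF i] \<pi>(4)[OF j] \<pi>(5)[OF j i] insert.hyps insert.prems(3)[of i] insert.prems(4)[of i] i j c
        by (cases "i = j") auto
      finally show "e \<cdot> \<iota> i = plus_arr C e' (\<iota> j \<cdot> \<pi> j) \<cdot> \<iota> i" by simp
    qed (use insert.prems(2) e'(1-3) j c \<pi>(1-3) in auto)
    have IH: "e' \<cdot> k \<in> finsum C J X Q \<iota> (src C k) \<and>
      ((\<forall>j \<in> F. \<pi> j \<cdot> k = zero_arr C (src C k) (X j)) \<longrightarrow> e' \<cdot> k = zero_arr C (src C k) Q)"
      by (rule insert.IH) (use insert.prems e' in auto)
    have ek: "e \<cdot> k = plus_arr C (e' \<cdot> k) (\<iota> j \<cdot> (\<pi> j \<cdot> k))"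
      unfolding ee using c j e'(1-3) \<pi>(1-3) assms(7,8) by (simp add: cmp_plus_arr)
    have "\<iota> j \<cdot> (\<pi> j \<cdot> k) \<in> finsum C J X Q \<iota> (src C k)"
      by (rule finsum_single[OF cop j]) (use j \<pi>(1-3) assms(7,8) in auto)
    then have "e \<cdot> k \<in> finsum C J X Q \<iota> (src C k)"
      unfolding ek using IH finsum_plus[OF _ _ cop] assms(7) by auto
    moreover have "e \<cdot> k = zero_arr C (src C k) Q"
      if "\<forall>i \<in> insert j F. \<pi> i \<cdot> k = zero_arr C (src C k) (X i)"
      unfolding ek using IH that c j assms(7) by auto
    ultimately show ?case by blast
  qed
  then show "e \<cdot> k \<in> finsum C J X Q \<iota> (src C k)" by blast
  assume a: "\<And>j p. j \<in> F \<Longrightarrow> p \<in> Hom C Q (X j) \<Longrightarrow> p \<cdot> \<iota> j = idn C (X j) \<Longrightarrow>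
        (\<And>i. i \<in> J \<Longrightarrow> i \<noteq> j \<Longrightarrow> p \<cdot> \<iota> i = zero_arr C (X i) (X j)) \<Longrightarrow> p \<cdot> k = zero_arr C (src C k) (X j)"
  have "\<pi> j \<cdot> k = zero_arr C (src C k) (X j)" if "j \<in> F" for j
    by (rule a[OF that]) (use that assms(3) \<pi> in auto)
  then show "e \<cdot> k = zero_arr C (src C k) Q" using main by blast
qed

lemma finsum_support:
  assumes cop: "is_coproduct C J X Q \<iota>" and W: "W \<in> obj C" and f: "f \<in> finsum C J X Q \<iota> W"
  obtains F e where "finite F" "F \<subseteq> J" "e \<in> Hom C Q Q" "\<And>j. j \<in> F \<Longrightarrow> e \<cdot> \<iota> j = \<iota> j"
    "\<And>j. j \<in> J - F \<Longrightarrow> e \<cdot> \<iota> j = zero_arr C (X j) Q" "e \<cdot> f = f"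
proof -
  note c = coproductD[OF cop]
  \<comment> \<open>Quantifying over all \<open>e\<close> that fix the summands in \<open>F\<close>
    lets \<open>F\<close> grow in the induction; an actual projection is constructed only once, at
    the end.\<close>
  have "\<exists>F. finite F \<and> F \<subseteq> J \<and> (\<forall>e \<in> Hom C Q Q. (\<forall>j \<in> F. e \<cdot> \<iota> j = \<iota> j) \<longrightarrow> e \<cdot> f = f)"
    using f
  proof induction
    case finsum_zero
    show ?case by (rule exI[of _ "{}"]) (use W c in auto)
  next
    case (finsum_insert j a f)
    from finsum_insert.IH obtain F where F: "finite F" "F \<subseteq> J"
      and F3: "\<forall>e \<in> Hom C Q Q. (\<forall>j \<in> F. e \<cdot> \<iota> j = \<iota> j) \<longrightarrow> e \<cdot> f = f" by (elim exE conjE)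
    show ?case
    proof (intro exI[of _ "insert j F"] conjI ballI impI)
      show "finite (insert j F)" "insert j F \<subseteq> J" using F(1,2) finsum_insert(1) by auto
      fix e assume e: "e \<in> Hom C Q Q" "\<forall>i \<in> insert j F. e \<cdot> \<iota> i = \<iota> i"
      have 1: "e \<cdot> f = f" by (rule F3[rule_format]) (use e in auto)
      have 2: "e \<cdot> \<iota> j = \<iota> j" using e by auto
      show "e \<cdot> plus_arr C (\<iota> j \<cdot> a) f = plus_arr C (\<iota> j \<cdot> a) f"
        using 1 e(1) finsum_Hom[OF finsum_insert(3) cop W] c finsum_insert(1,2)
        by (simp add: cmp_plus_arr cmp_reassoc[OF 2])
    qed
  qed
  then obtain F where F: "finite F" "F \<subseteq> J"
    and F3: "\<forall>e \<in> Hom C Q Q. (\<forall>j \<in> F. e \<cdot> \<iota> j = \<iota> j) \<longrightarrow> e \<cdot> f = f" by (elim exE conjE)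
  obtain e where e: "e \<in> arr C" "src C e = Q" "tgt C e = Q"
    "\<And>i. i \<in> J \<Longrightarrow> e \<cdot> \<iota> i = (if i \<in> F then \<iota> i else zero_arr C (X i) Q)"
    by (rule coproduct_ex[OF cop c(1), of "\<lambda>i. if i \<in> F then \<iota> i else zero_arr C (X i) Q"])
      (use c in auto)
  have "e \<cdot> f = f" by (rule F3[rule_format]) (use e F(2) in auto)
  then show ?thesis
    by (rule that[OF F(1,2), of e, rotated 3]) (use e F(2) in auto)
qed

text \<open>For an infinite coproduct the projections need not detect zero arrows. For a finite sum
  they do, since it equals its composite with the projection onto finitely many summands.\<close>

lemma finsum_eq_zero:
  assumes cop: "is_coproduct C J X Q \<iota>" and W: "W \<in> obj C" and f: "f \<in> finsum C J X Q \<iota> W"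
    and "\<And>j p. j \<in> J \<Longrightarrow> p \<in> Hom C Q (X j) \<Longrightarrow> p \<cdot> \<iota> j = idn C (X j) \<Longrightarrow>
        (\<And>i. i \<in> J \<Longrightarrow> i \<noteq> j \<Longrightarrow> p \<cdot> \<iota> i = zero_arr C (X i) (X j)) \<Longrightarrow> p \<cdot> f = zero_arr C W (X j)"
  shows "f = zero_arr C W Q"
proof -
  obtain F e where F: "finite F" "F \<subseteq> J" "e \<in> Hom C Q Q" "\<And>j. j \<in> F \<Longrightarrow> e \<cdot> \<iota> j = \<iota> j"
    "\<And>j. j \<in> J - F \<Longrightarrow> e \<cdot> \<iota> j = zero_arr C (X j) Q" "e \<cdot> f = f"
    using finsum_support[OF cop W f] by blast
  have fH: "f \<in> arr C" "src C f = W" "tgt C f = Q" using finsum_Hom[OF f cop W] by auto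
  have "e \<cdot> f = zero_arr C (src C f) Q"
    by (rule finite_part(2)[OF cop F(1-5) fH(1,3)]) (use assms(4) F(2) fH(2) in auto)
  then show ?thesis using F(6) fH by simp
qed

lemma finprod_finsum:
  assumes cop: "is_coproduct C J X Q \<iota>" and W: "W \<in> obj C"
    and "finite F" "F \<subseteq> J" "\<And>j. j \<in> F \<Longrightarrow> a j \<in> Hom C W (X j)"
  shows "finprod (Hom_group C W Q) (\<lambda>j. \<iota> j \<cdot> a j) F \<in> finsum C J X Q \<iota> W"
    and "\<lbrakk>k \<in> J; p \<in> Hom C Q (X k); p \<cdot> \<iota> k = idn C (X k);
        \<And>i. i \<in> J \<Longrightarrow> i \<noteq> k \<Longrightarrow> p \<cdot> \<iota> i = zero_arr C (X i) (X k)\<rbrakk>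
      \<Longrightarrow> p \<cdot> finprod (Hom_group C W Q) (\<lambda>j. \<iota> j \<cdot> a j) F = (if k \<in> F then a k else zero_arr C W (X k))"
proof -
  note c = coproductD[OF cop]
  interpret G: comm_group "Hom_group C W Q" by (rule Hom_comm_group[OF W c(1)])
  have car: "\<iota> j \<cdot> a j \<in> carrier (Hom_group C W Q)" if "j \<in> F" for j
    using that assms(4) assms(5)[OF that] c by (auto simp: Hom_group_def)
  have main: "finprod (Hom_group C W Q) (\<lambda>j. \<iota> j \<cdot> a j) F' \<in> finsum C J X Q \<iota> W \<and>
     (k \<in> J \<and> p \<in> Hom C Q (X k) \<and> p \<cdot> \<iota> k = idn C (X k) \<and>
      (\<forall>i \<in> J. i \<noteq> k \<longrightarrow> p \<cdot> \<iota> i = zero_arr C (X i) (X k)) \<longrightarrow>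
      p \<cdot> finprod (Hom_group C W Q) (\<lambda>j. \<iota> j \<cdot> a j) F' = (if k \<in> F' then a k else zero_arr C W (X k)))"
    if "F' \<subseteq> F" for k p F'
    using finite_subset[OF that assms(3)] that
  proof (induction F')
    case empty
    have "finprod (Hom_group C W Q) (\<lambda>j. \<iota> j \<cdot> a j) {} = zero_arr C W Q"
      unfolding G.finprod_empty by (simp add: Hom_group_def)
    then show ?case using finsum_zero[of C W Q J X \<iota>] W by auto
  next
    case (insert j F')
    have j: "j \<in> J" "j \<in> F" using insert assms(4) by auto
    have aj: "a j \<in> arr C" "src C (a j) = W" "tgt C (a j) = X j" using assms(5)[OF j(2)] by auto
    let ?r = "finprod (Hom_group C W Q) (\<lambda>j. \<iota> j \<cdot> a j) F'"
    have e: "finprod (Hom_group C W Q) (\<lambda>j. \<iota> j \<cdot> a j) (insert j F') = plus_arr C (\<iota> j \<cdot> a j) ?r"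
      using insert car by (subst G.finprod_insert) (auto simp: Hom_group_def)
    have r: "?r \<in> finsum C J X Q \<iota> W" using insert by blast
    have rH: "?r \<in> arr C" "src C ?r = W" "tgt C ?r = Q" using finsum_Hom[OF r cop W] by auto
    have "plus_arr C (\<iota> j \<cdot> a j) ?r \<in> finsum C J X Q \<iota> W"
      by (rule finsum_insert) (use j aj r in auto)
    moreover have "p \<cdot> plus_arr C (\<iota> j \<cdot> a j) ?r = (if k \<in> insert j F' then a k else zero_arr C W (X k))"
      if k: "k \<in> J" and p: "p \<in> Hom C Q (X k)" "p \<cdot> \<iota> k = idn C (X k)"
        "\<forall>i \<in> J. i \<noteq> k \<longrightarrow> p \<cdot> \<iota> i = zero_arr C (X i) (X k)"
    proof -
      have IH: "p \<cdot> ?r = (if k \<in> F' then a k else zero_arr C W (X k))" using insert k p by blast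
      have kX: "X k \<in> obj C" using c k by auto
      show ?thesis
      proof (cases "j = k")
        case True
        then show ?thesis using IH insert(2) p(1) aj rH c j kX
          by (simp add: cmp_plus_arr cmp_reassoc[OF p(2)])
      next
        case False
        have z: "p \<cdot> \<iota> j = zero_arr C (X j) (X k)" using p(3) j False by auto
        have "tgt C (a k) = X k \<and> src C (a k) = W \<and> a k \<in> arr C" if "k \<in> F'"
          using assms(5)[of k] that insert(4) by auto
        then show ?thesis using IH False p(1) aj rH c j kX
          by (auto simp add: cmp_plus_arr cmp_reassoc[OF z])
      qed
    qed
    ultimately show ?case unfolding e by blast
  qed
  show "finprod (Hom_group C W Q) (\<lambda>j. \<iota> j \<cdot> a j) F \<in> finsum C J X Q \<iota> W" using main[of F] by blast
  show "\<lbrakk>k \<in> J; p \<in> Hom C Q (X k); p \<cdot> \<iota> k = idn C (X k);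
        \<And>i. i \<in> J \<Longrightarrow> i \<noteq> k \<Longrightarrow> p \<cdot> \<iota> i = zero_arr C (X i) (X k)\<rbrakk>
      \<Longrightarrow> p \<cdot> finprod (Hom_group C W Q) (\<lambda>j. \<iota> j \<cdot> a j) F = (if k \<in> F then a k else zero_arr C W (X k))"
    using main[of F k p] by blast
qed

lemma compact_finsum_univ:
  fixes \<kappa> :: "'u rel" and J :: "'u set"
  assumes "compact_object \<kappa> C W" "small \<kappa> J" "is_coproduct C J X Q \<iota>" "f \<in> Hom C W Q"
  shows "f \<in> finsum C J X Q \<iota> W"
proof -
  have W: "W \<in> obj C" using assms(1) by (simp add: compact_object_def)
  let ?A = "{a \<in> \<Pi>\<^sub>E j \<in> J. Hom C W (X j). finite {j \<in> J. a j \<noteq> zero_arr C W (X j)}}"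
  have "bij_betw
          (\<lambda>a. finprod (Hom_group C W Q) (\<lambda>j. \<iota> j \<cdot> a j) {j \<in> J. a j \<noteq> zero_arr C W (X j)}) ?A (Hom C W Q)"
    using assms(1-3) unfolding compact_object_def by blast
  then have "f \<in> (\<lambda>a. finprod (Hom_group C W Q) (\<lambda>j. \<iota> j \<cdot> a j) {j \<in> J. a j \<noteq> zero_arr C W (X j)}) ` ?A"
    using assms(4) unfolding bij_betw_def by simp
  then obtain a where a: "a \<in> ?A"
    "f = finprod (Hom_group C W Q) (\<lambda>j. \<iota> j \<cdot> a j) {j \<in> J. a j \<noteq> zero_arr C W (X j)}" by blast
  have "a j \<in> Hom C W (X j)" if "j \<in> J" for j using a(1) that by blast
  then show ?thesis unfolding a(2) using a(1) by (intro finprod_finsum(1)[OF assms(3) W]) auto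
qed

lemma compact_finsum:
  fixes \<kappa> :: "'u rel"
  assumes "inaccessible \<kappa>" "compact_object \<kappa> C W" "small \<kappa> J" "is_coproduct C J X Q \<iota>" "f \<in> Hom C W Q"
  shows "f \<in> finsum C J X Q \<iota> W"
proof -
  interpret small_universe \<kappa> by standard fact
  obtain K :: "'u set" and e where K: "bij_betw e K J" "small \<kappa> K" using assms(3) by (rule small_copy)
  have cop: "is_coproduct C K (\<lambda>k. X (e k)) Q (\<lambda>k. \<iota> (e k))"
    by (rule coproduct_reindex[OF K(1) assms(4)]) auto
  have "f \<in> finsum C K (\<lambda>k. X (e k)) Q (\<lambda>k. \<iota> (e k)) W"
    by (rule compact_finsum_univ[OF assms(2) K(2) cop assms(5)])
  then show ?thesis
  proof induction
    case finsum_zero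
    show ?case by (rule finsum.finsum_zero)
  next
    case (finsum_insert j a f)
    have "e j \<in> J" using K(1) finsum_insert(1) bij_betwE by blast
    then show ?case using finsum_insert by (intro finsum.finsum_insert) auto
  qed
qed

text \<open>Only surjectivity of the canonical map has to be assumed: the projections of the
  coproduct recover a family from its sum, so injectivity is automatic.\<close>

lemma compactI:
  fixes \<kappa> :: "'u rel"
  assumes W: "W \<in> obj C"
    and fs: "\<And>(J :: 'u set) X Q \<iota> f. small \<kappa> J \<Longrightarrow> is_coproduct C J X Q \<iota> \<Longrightarrow> f \<in> Hom C W Q \<Longrightarrow>
      f \<in> finsum C J X Q \<iota> W"
  shows "compact_object \<kappa> C W"
  unfolding compact_object_def
proof (intro conjI allI impI)
  show "W \<in> obj C" by fact
  fix J :: "'u set" and X Q \<iota>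
  assume "small \<kappa> J \<and> is_coproduct C J X Q \<iota>"
  then have J: "small \<kappa> J" and cop: "is_coproduct C J X Q \<iota>" by auto
  note c = coproductD[OF cop]
  obtain \<pi> where \<pi>: "\<And>j. j \<in> J \<Longrightarrow> \<pi> j \<in> arr C" "\<And>j. j \<in> J \<Longrightarrow> src C (\<pi> j) = Q"
    "\<And>j. j \<in> J \<Longrightarrow> tgt C (\<pi> j) = X j" "\<And>j. j \<in> J \<Longrightarrow> \<pi> j \<cdot> \<iota> j = idn C (X j)"
    "\<And>j k. j \<in> J \<Longrightarrow> k \<in> J \<Longrightarrow> k \<noteq> j \<Longrightarrow> \<pi> j \<cdot> \<iota> k = zero_arr C (X k) (X j)"
    by (rule coproduct_proj[OF cop]) blast
  let ?S = "\<lambda>a. {j \<in> J. a j \<noteq> zero_arr C W (X j)}"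
  let ?A = "{a \<in> \<Pi>\<^sub>E j \<in> J. Hom C W (X j). finite (?S a)}"
  let ?P = "\<lambda>a. finprod (Hom_group C W Q) (\<lambda>j. \<iota> j \<cdot> a j) (?S a)"
  have P: "?P a \<in> finsum C J X Q \<iota> W" "\<And>k. k \<in> J \<Longrightarrow> \<pi> k \<cdot> ?P a = a k" if "a \<in> ?A" for a
  proof -
    have a: "finite (?S a)" "\<And>j. j \<in> J \<Longrightarrow> a j \<in> Hom C W (X j)" using that by auto
    show "?P a \<in> finsum C J X Q \<iota> W"
      by (rule finprod_finsum(1)[OF cop W a(1)]) (use a(2) in auto)
    fix k assume k: "k \<in> J"
    have "\<pi> k \<cdot> ?P a = (if k \<in> ?S a then a k else zero_arr C W (X k))"
      by (rule finprod_finsum(2)[OF cop W a(1)]) (use a(2) k \<pi> in auto)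
    then show "\<pi> k \<cdot> ?P a = a k" using k by auto
  qed
  show "bij_betw ?P ?A (Hom C W Q)"
    unfolding bij_betw_def
  proof
    show "inj_on ?P ?A"
    proof (rule inj_onI)
      fix a b assume ab: "a \<in> ?A" "b \<in> ?A" "?P a = ?P b"
      have "a k = b k" if "k \<in> J" for k using P(2)[OF ab(1) that] P(2)[OF ab(2) that] ab(3) by simp
      then show "a = b" using ab(1,2) by (intro PiE_ext[of a J "\<lambda>j. Hom C W (X j)" b]) auto
    qed
    show "?P ` ?A = Hom C W Q"
    proof
      show "?P ` ?A \<subseteq> Hom C W Q" using P(1) finsum_Hom[OF _ cop W] by fastforce
      show "Hom C W Q \<subseteq> ?P ` ?A"
      proof
        fix f assume f: "f \<in> Hom C W Q"
        have ff: "f \<in> finsum C J X Q \<iota> W" by (rule fs[OF J cop f])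
        have fin: "finite {j \<in> J. \<pi> j \<cdot> f \<noteq> zero_arr C W (X j)}"
          using ff
        proof induction
          case finsum_zero
          have "{j \<in> J. \<pi> j \<cdot> zero_arr C W Q \<noteq> zero_arr C W (X j)} = {}" using \<pi>(1-3) W by auto
          then show ?case by (simp only: finite.emptyI)
        next
          case (finsum_insert i a f)
          have fH: "f \<in> arr C" "src C f = W" "tgt C f = Q" using finsum_Hom[OF finsum_insert(3) cop W] by auto
          have "\<pi> j \<cdot> plus_arr C (\<iota> i \<cdot> a) f = zero_arr C W (X j)"
            if j: "j \<in> J" "j \<noteq> i" "\<pi> j \<cdot> f = zero_arr C W (X j)" for j
            using finsum_insert(1,2) fH \<pi>(1-3) c j W
            by (simp add: cmp_plus_arr cmp_reassoc[OF \<pi>(5)[OF j(1) finsum_insert(1) j(2)[symmetric]]])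
          then have "{j \<in> J. \<pi> j \<cdot> plus_arr C (\<iota> i \<cdot> a) f \<noteq> zero_arr C W (X j)} \<subseteq>
              insert i {j \<in> J. \<pi> j \<cdot> f \<noteq> zero_arr C W (X j)}" by blast
          then show ?case using finsum_insert.IH finite_subset by blast
        qed
        \<comment> \<open>The projections read off the candidate family; it has finite support
          because \<open>f\<close> is a finite sum.\<close>
        define a where "a = (\<lambda>j \<in> J. \<pi> j \<cdot> f)"
        have "{j \<in> J. a j \<noteq> zero_arr C W (X j)} = {j \<in> J. \<pi> j \<cdot> f \<noteq> zero_arr C W (X j)}"
          by (auto simp: a_def)
        then have aA: "a \<in> ?A" using fin f \<pi>(1-3) by (auto simp: a_def)
        \<comment> \<open>The difference is again a finite sum, so the vanishing of all its
          projections makes it zero.\<close>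
        let ?d = "minus_arr C f (?P a)"
        have PH: "?P a \<in> arr C" "src C (?P a) = W" "tgt C (?P a) = Q"
          using finsum_Hom[OF P(1)[OF aA] cop W] by auto
        have "?d = zero_arr C W Q"
        proof (rule finsum_eq_zero[OF cop W])
          show "?d \<in> finsum C J X Q \<iota> W" by (rule finsum_minus[OF ff P(1)[OF aA] cop W])
          fix j p assume j: "j \<in> J" and p: "p \<in> Hom C Q (X j)" "p \<cdot> \<iota> j = idn C (X j)"
            "\<And>i. i \<in> J \<Longrightarrow> i \<noteq> j \<Longrightarrow> p \<cdot> \<iota> i = zero_arr C (X i) (X j)"
          have "p = \<pi> j"
          proof (rule coproduct_uniq[OF cop])
            fix i assume "i \<in> J"
            then show "p \<cdot> \<iota> i = \<pi> j \<cdot> \<iota> i" using p(2,3) \<pi>(4,5) j by (cases "i = j") auto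
          qed (use p(1) \<pi>(1-3) j in auto)
          then show "p \<cdot> ?d = zero_arr C W (X j)"
            using P(2)[OF aA j] PH f j \<pi>(1-3) W c by (simp add: cmp_minus a_def)
        qed
        then have "f = ?P a" using minus_eq_zero_iff[of f "?P a"] f PH by auto
        then show "f \<in> ?P ` ?A" using aA by blast
      qed
    qed
  qed
qed

lemma compact_obj [simp]: "compact_object \<kappa> C W \<Longrightarrow> W \<in> obj C"
  by (simp add: compact_object_def)

lemma compact_retract:
  fixes \<kappa> :: "'u rel"
  assumes "compact_object \<kappa> C W" "retract C V W" shows "compact_object \<kappa> C V"
proof -
  obtain i r where 1: "i \<in> arr C" "r \<in> arr C" "src C i = V" "tgt C i = W" "src C r = W" "tgt C r = V"
    "r \<cdot> i = idn C V" "V \<in> obj C" "W \<in> obj C" by (rule retractE[OF assms(2)])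
  show ?thesis
  proof (rule compactI)
    show "V \<in> obj C" by fact
    fix J :: "'u set" and X Q \<iota> f
    assume J: "small \<kappa> J" and cop: "is_coproduct C J X Q \<iota>" and f: "f \<in> Hom C V Q"
    have "f \<cdot> r \<in> finsum C J X Q \<iota> W"
      by (rule compact_finsum_univ[OF assms(1) J cop]) (use f 1 in auto)
    then have "(f \<cdot> r) \<cdot> i \<in> finsum C J X Q \<iota> V" using finsum_cmp[OF _ cop 1(9) 1(1)] 1 by auto
    then show "f \<in> finsum C J X Q \<iota> V" using f 1 by simp
  qed
qed

lemma compact_zero: "zero_object C Z \<Longrightarrow> compact_object \<kappa> C Z"
proof (rule compactI)
  assume Z: "zero_object C Z"
  show "Z \<in> obj C" using Z by (rule zero_objectD)
  fix J X Q \<iota> f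
  assume f: "f \<in> Hom C Z Q"
  then have "f = zero_arr C Z Q" using zero_objectD(2)[OF Z, of f] by auto
  then show "f \<in> finsum C J X Q \<iota> Z" using finsum_zero by metis
qed

lemma compact_biproduct:
  fixes \<kappa> :: "'u rel"
  assumes "is_biproduct C X Y B i j p q" "compact_object \<kappa> C X" "compact_object \<kappa> C Y"
  shows "compact_object \<kappa> C B"
proof -
  have B: "B \<in> obj C" "i \<in> Hom C X B" "j \<in> Hom C Y B" "p \<in> Hom C B X" "q \<in> Hom C B Y"
    "plus_arr C (i \<cdot> p) (j \<cdot> q) = idn C B" using assms(1) unfolding is_biproduct_def by blast+
  show ?thesis
  proof (rule compactI)
    show "B \<in> obj C" by fact
    fix J :: "'u set" and X' Q \<iota> f
    assume J: "small \<kappa> J" and cop: "is_coproduct C J X' Q \<iota>" and f: "f \<in> Hom C B Q"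
    have "f \<cdot> i \<in> finsum C J X' Q \<iota> X"
      by (rule compact_finsum_univ[OF assms(2) J cop]) (use f B in auto)
    moreover have "f \<cdot> j \<in> finsum C J X' Q \<iota> Y"
      by (rule compact_finsum_univ[OF assms(3) J cop]) (use f B in auto)
    ultimately    have "(f \<cdot> i) \<cdot> p \<in> finsum C J X' Q \<iota> B" "(f \<cdot> j) \<cdot> q \<in> finsum C J X' Q \<iota> B"
      using finsum_cmp[OF _ cop _ , of "f \<cdot> i" X p] finsum_cmp[OF _ cop _ , of "f \<cdot> j" Y q] assms B by auto
    then have "plus_arr C ((f \<cdot> i) \<cdot> p) ((f \<cdot> j) \<cdot> q) \<in> finsum C J X' Q \<iota> B"
      using finsum_plus[OF _ _ cop B(1)] by blast
    moreover have "plus_arr C ((f \<cdot> i) \<cdot> p) ((f \<cdot> j) \<cdot> q) = f \<cdot> plus_arr C (i \<cdot> p) (j \<cdot> q)"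
      using f B(1-5) by (simp add: cmp_plus_arr)
    ultimately show "f \<in> finsum C J X' Q \<iota> B" using B(6) f by simp
  qed
qed

end

section \<open>Compact objects under shift and cones\<close>

context triangulated_category
begin

lemma shift_coproduct:
  assumes cop: "is_coproduct C J X Q \<iota>"
  shows "is_coproduct C J (\<lambda>j. \<Sigma>\<^sub>o (X j)) (\<Sigma>\<^sub>o Q) (\<lambda>j. \<Sigma>\<^sub>m (\<iota> j))"
proof (rule is_coproductI)
  note c = coproductD[OF cop]
  show "\<Sigma>\<^sub>o Q \<in> obj C" "\<And>j. j \<in> J \<Longrightarrow> \<Sigma>\<^sub>o (X j) \<in> obj C"
    "\<And>j. j \<in> J \<Longrightarrow> \<Sigma>\<^sub>m (\<iota> j) \<in> Hom C (\<Sigma>\<^sub>o (X j)) (\<Sigma>\<^sub>o Q)" using c by auto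
  show "\<exists>u \<in> Hom C (\<Sigma>\<^sub>o Q) Y. \<forall>j \<in> J. u \<cdot> \<Sigma>\<^sub>m (\<iota> j) = f j"
    if Y: "Y \<in> obj C" and f: "\<And>j. j \<in> J \<Longrightarrow> f j \<in> Hom C (\<Sigma>\<^sub>o (X j)) Y" for Y f
  proof -
    obtain Y' \<theta> where Y': "Y' \<in> obj C" "iso_arr C \<theta>" "src C \<theta> = \<Sigma>\<^sub>o Y'" "tgt C \<theta> = Y"
      by (rule desuspension[OF Y])
    have "\<forall>j \<in> J. \<exists>g. g \<in> Hom C (X j) Y' \<and> \<Sigma>\<^sub>m g = inv_arr C \<theta> \<cdot> f j"
    proof
      fix j assume j: "j \<in> J"
      obtain g where "g \<in> arr C" "src C g = X j" "tgt C g = Y'" "\<Sigma>\<^sub>m g = inv_arr C \<theta> \<cdot> f j"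
        by (rule shift_full[of "inv_arr C \<theta> \<cdot> f j" "X j" Y']) (use f[OF j] Y' c(2)[OF j] in auto)
      then show "\<exists>g. g \<in> Hom C (X j) Y' \<and> \<Sigma>\<^sub>m g = inv_arr C \<theta> \<cdot> f j" by auto
    qed
    from bchoice[OF this] obtain f' where
      f': "\<forall>j \<in> J. f' j \<in> Hom C (X j) Y' \<and> \<Sigma>\<^sub>m (f' j) = inv_arr C \<theta> \<cdot> f j" by (rule exE)
    obtain u where u: "u \<in> arr C" "src C u = Q" "tgt C u = Y'" "\<And>j. j \<in> J \<Longrightarrow> u \<cdot> \<iota> j = f' j"
      by (rule coproduct_ex[OF cop Y'(1), of f']) (use f' in auto)
    have "(\<theta> \<cdot> \<Sigma>\<^sub>m u) \<cdot> \<Sigma>\<^sub>m (\<iota> j) = f j" if j: "j \<in> J" for j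
    proof -
      have "(\<theta> \<cdot> \<Sigma>\<^sub>m u) \<cdot> \<Sigma>\<^sub>m (\<iota> j) = \<theta> \<cdot> \<Sigma>\<^sub>m (u \<cdot> \<iota> j)"
        using Y' u(1-3) c j by (simp add: shift_cmp)
      also have "\<dots> = f j" using u(4)[OF j] f' f[OF j] j Y' by simp
      finally show ?thesis .
    qed
    then show ?thesis by (intro bexI[of _ "\<theta> \<cdot> \<Sigma>\<^sub>m u"]) (use Y' u(1-3) in auto)
  qed
  show "u = v" if uv: "u \<in> arr C" "v \<in> arr C" "src C u = \<Sigma>\<^sub>o Q" "src C v = \<Sigma>\<^sub>o Q" "tgt C u = tgt C v"
    "\<And>j. j \<in> J \<Longrightarrow> u \<cdot> \<Sigma>\<^sub>m (\<iota> j) = v \<cdot> \<Sigma>\<^sub>m (\<iota> j)" for u v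
  proof -
    obtain Y' \<theta> where Y': "Y' \<in> obj C" "iso_arr C \<theta>" "src C \<theta> = \<Sigma>\<^sub>o Y'" "tgt C \<theta> = tgt C v"
      by (rule desuspension[of "tgt C v"]) (use uv in auto)
    obtain u' where u': "u' \<in> arr C" "src C u' = Q" "tgt C u' = Y'" "\<Sigma>\<^sub>m u' = inv_arr C \<theta> \<cdot> u"
      by (rule shift_full[of "inv_arr C \<theta> \<cdot> u" Q Y']) (use uv(1-5) Y' c(1) in auto)
    obtain v' where v': "v' \<in> arr C" "src C v' = Q" "tgt C v' = Y'" "\<Sigma>\<^sub>m v' = inv_arr C \<theta> \<cdot> v"
      by (rule shift_full[of "inv_arr C \<theta> \<cdot> v" Q Y']) (use uv(1-5) Y' c(1) in auto)
    have "u' = v'"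
    proof (rule coproduct_uniq[OF cop])
      fix j assume j: "j \<in> J"
      have "\<Sigma>\<^sub>m (u' \<cdot> \<iota> j) = inv_arr C \<theta> \<cdot> (u \<cdot> \<Sigma>\<^sub>m (\<iota> j))"
        using u' Y' uv(1-5) c j by (simp add: shift_cmp)
      also have "\<dots> = inv_arr C \<theta> \<cdot> (v \<cdot> \<Sigma>\<^sub>m (\<iota> j))" using uv(6)[OF j] by simp
      also have "\<dots> = \<Sigma>\<^sub>m (v' \<cdot> \<iota> j)"
        using v' Y' uv(1-5) c j by (simp add: shift_cmp)
      finally show "u' \<cdot> \<iota> j = v' \<cdot> \<iota> j" using u' v' c j by - (rule shift_faithful, auto)
    qed (use u' v' in auto)
    then have "inv_arr C \<theta> \<cdot> u = inv_arr C \<theta> \<cdot> v" using u'(4) v'(4) by simp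
    then show "u = v"
      by (rule iso_mono[OF iso_inv[OF Y'(2)], rotated -1]) (use Y' uv(1-5) in auto)
  qed
qed

text \<open>The isomorphisms \<open>\<theta>\<close> and \<open>\<xi>\<close> appear because a
  cocone can be desuspended only up to isomorphism.\<close>

lemma unshift_coproduct:
  assumes cop: "is_coproduct C J X Q \<iota>" and Q': "Q' \<in> obj C" "iso_arr C \<theta>" "src C \<theta> = \<Sigma>\<^sub>o Q'" "tgt C \<theta> = Q"
    and X': "\<And>j. j \<in> J \<Longrightarrow> X' j \<in> obj C" "\<And>j. j \<in> J \<Longrightarrow> iso_arr C (\<xi> j)"
      "\<And>j. j \<in> J \<Longrightarrow> src C (\<xi> j) = \<Sigma>\<^sub>o (X' j)" "\<And>j. j \<in> J \<Longrightarrow> tgt C (\<xi> j) = X j"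
    and i: "\<And>j. j \<in> J \<Longrightarrow> \<iota>' j \<in> Hom C (X' j) Q'" "\<And>j. j \<in> J \<Longrightarrow> \<theta> \<cdot> \<Sigma>\<^sub>m (\<iota>' j) = \<iota> j \<cdot> \<xi> j"
  shows "is_coproduct C J X' Q' \<iota>'"
proof (rule is_coproductI)
  note c = coproductD[OF cop]
  show "Q' \<in> obj C" "\<And>j. j \<in> J \<Longrightarrow> X' j \<in> obj C" "\<And>j. j \<in> J \<Longrightarrow> \<iota>' j \<in> Hom C (X' j) Q'" by fact+
  have i': "\<iota>' j \<in> arr C" "src C (\<iota>' j) = X' j" "tgt C (\<iota>' j) = Q'" if "j \<in> J" for j
    using i(1)[OF that] by auto
  have inv: "\<Sigma>\<^sub>m (\<iota>' j) \<cdot> inv_arr C (\<xi> j) = inv_arr C \<theta> \<cdot> \<iota> j" if j: "j \<in> J" for j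
  proof -
    have "\<theta> \<cdot> (\<Sigma>\<^sub>m (\<iota>' j) \<cdot> inv_arr C (\<xi> j)) = (\<iota> j \<cdot> \<xi> j) \<cdot> inv_arr C (\<xi> j)"
      using j i' Q' X' by (simp add: cmp_reassoc[OF i(2)[OF j]])
    also have "\<dots> = \<theta> \<cdot> (inv_arr C \<theta> \<cdot> \<iota> j)" using j Q' X' c by simp
    finally show ?thesis
      by (rule iso_mono[OF Q'(2), rotated -1]) (use j Q' X' c i' in auto)
  qed
  show "\<exists>u \<in> Hom C Q' Y. \<forall>j \<in> J. u \<cdot> \<iota>' j = f j"
    if Y: "Y \<in> obj C" and f: "\<And>j. j \<in> J \<Longrightarrow> f j \<in> Hom C (X' j) Y" for Y f
  proof -
    have fj: "f j \<in> arr C" "src C (f j) = X' j" "tgt C (f j) = Y" if "j \<in> J" for j using f[OF that] by auto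
    obtain w where w: "w \<in> arr C" "src C w = Q" "tgt C w = \<Sigma>\<^sub>o Y"
        "\<And>j. j \<in> J \<Longrightarrow> w \<cdot> \<iota> j = \<Sigma>\<^sub>m (f j) \<cdot> inv_arr C (\<xi> j)"
      by (rule coproduct_ex[OF cop, of "\<Sigma>\<^sub>o Y" "\<lambda>j. \<Sigma>\<^sub>m (f j) \<cdot> inv_arr C (\<xi> j)"])
        (use Y fj X' in auto)
    obtain u where u: "u \<in> arr C" "src C u = Q'" "tgt C u = Y" "\<Sigma>\<^sub>m u = w \<cdot> \<theta>"
      by (rule shift_full[of "w \<cdot> \<theta>" Q' Y]) (use w(1-3) Q' Y in auto)
    have "u \<cdot> \<iota>' j = f j" if j: "j \<in> J" for j
    proof -
      have "\<Sigma>\<^sub>m (u \<cdot> \<iota>' j) = w \<cdot> (\<iota> j \<cdot> \<xi> j)"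
        using u i'[OF j] w(1-3) Q' i(2)[OF j] by (simp add: shift_cmp)
      also have "\<dots> = (w \<cdot> \<iota> j) \<cdot> \<xi> j" using w(1-3) c X' j by simp
      also have "\<dots> = \<Sigma>\<^sub>m (f j)" unfolding w(4)[OF j] using fj X' j by simp
      finally show ?thesis using u(1-3) i'[OF j] fj[OF j] by - (rule shift_faithful, auto)
    qed
    then show ?thesis by (intro bexI[of _ u]) (use u(1-3) in auto)
  qed
  show "u = v" if uv: "u \<in> arr C" "v \<in> arr C" "src C u = Q'" "src C v = Q'" "tgt C u = tgt C v"
    "\<And>j. j \<in> J \<Longrightarrow> u \<cdot> \<iota>' j = v \<cdot> \<iota>' j" for u v
  proof -
    have "\<Sigma>\<^sub>m u \<cdot> inv_arr C \<theta> = \<Sigma>\<^sub>m v \<cdot> inv_arr C \<theta>"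
    proof (rule coproduct_uniq[OF cop])
      fix j assume j: "j \<in> J"
      have *: "(\<Sigma>\<^sub>m z \<cdot> inv_arr C \<theta>) \<cdot> \<iota> j = \<Sigma>\<^sub>m (z \<cdot> \<iota>' j) \<cdot> inv_arr C (\<xi> j)"
        if "z \<in> arr C" "src C z = Q'" for z
        using that Q' X' c i' j by (simp add: shift_cmp inv)
      show "(\<Sigma>\<^sub>m u \<cdot> inv_arr C \<theta>) \<cdot> \<iota> j = (\<Sigma>\<^sub>m v \<cdot> inv_arr C \<theta>) \<cdot> \<iota> j"
        unfolding *[OF uv(1,3)] *[OF uv(2,4)] uv(6)[OF j] ..
    qed (use uv(1-5) Q' in auto)
    then have "\<Sigma>\<^sub>m u = \<Sigma>\<^sub>m v"
      by (rule iso_epi[OF iso_inv[OF Q'(2)], rotated -1]) (use uv(1-5) Q' in auto)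
    then show "u = v" using uv(1-5) by - (rule shift_faithful, auto)
  qed
qed

text \<open>The whole coproduct is desuspended, compactness of \<open>W\<close> is used there, and
  the resulting finite sum is suspended again term by term.\<close>

lemma compact_shift:
  fixes \<kappa> :: "'u rel"
  assumes "compact_object \<kappa> C W" shows "compact_object \<kappa> C (\<Sigma>\<^sub>o W)"
proof (rule compactI)
  have W: "W \<in> obj C" using assms by simp
  then show "\<Sigma>\<^sub>o W \<in> obj C" by simp
  fix J :: "'u set" and X Q \<iota> f
  assume J: "small \<kappa> J" and cop: "is_coproduct C J X Q \<iota>" and f: "f \<in> Hom C (\<Sigma>\<^sub>o W) Q"
  note c = coproductD[OF cop]
  obtain Q' \<theta> where Q': "Q' \<in> obj C" "iso_arr C \<theta>" "src C \<theta> = \<Sigma>\<^sub>o Q'" "tgt C \<theta> = Q"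
    by (rule desuspension[OF c(1)])
  have "\<forall>j \<in> J. \<exists>x. fst x \<in> obj C \<and> iso_arr C (snd x) \<and> src C (snd x) = \<Sigma>\<^sub>o (fst x) \<and> tgt C (snd x) = X j"
  proof
    fix j assume "j \<in> J"
    then obtain Y \<xi> where "Y \<in> obj C" "iso_arr C \<xi>" "src C \<xi> = \<Sigma>\<^sub>o Y" "tgt C \<xi> = X j"
      using desuspension[OF c(2)[of j]] by blast
    then show "\<exists>x. fst x \<in> obj C \<and> iso_arr C (snd x) \<and> src C (snd x) = \<Sigma>\<^sub>o (fst x) \<and> tgt C (snd x) = X j"
      by (intro exI[of _ "(Y, \<xi>)"]) simp
  qed
  from bchoice[OF this] obtain x where x: "\<forall>j \<in> J. fst (x j) \<in> obj C \<and> iso_arr C (snd (x j)) \<and>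
      src C (snd (x j)) = \<Sigma>\<^sub>o (fst (x j)) \<and> tgt C (snd (x j)) = X j" by (rule exE)
  define X' \<xi> where "X' = (\<lambda>j. fst (x j))" and "\<xi> = (\<lambda>j. snd (x j))"
  have X': "X' j \<in> obj C" "iso_arr C (\<xi> j)" "src C (\<xi> j) = \<Sigma>\<^sub>o (X' j)" "tgt C (\<xi> j) = X j" if "j \<in> J" for j
    using x that by (auto simp: X'_def \<xi>_def)
  have "\<forall>j \<in> J. \<exists>g. g \<in> Hom C (X' j) Q' \<and> \<Sigma>\<^sub>m g = inv_arr C \<theta> \<cdot> (\<iota> j \<cdot> \<xi> j)"
  proof
    fix j assume j: "j \<in> J"
    obtain g where "g \<in> arr C" "src C g = X' j" "tgt C g = Q'" "\<Sigma>\<^sub>m g = inv_arr C \<theta> \<cdot> (\<iota> j \<cdot> \<xi> j)"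
      by (rule shift_full[of "inv_arr C \<theta> \<cdot> (\<iota> j \<cdot> \<xi> j)" "X' j" Q']) (use j X'[OF j] Q' c in auto)
    then show "\<exists>g. g \<in> Hom C (X' j) Q' \<and> \<Sigma>\<^sub>m g = inv_arr C \<theta> \<cdot> (\<iota> j \<cdot> \<xi> j)" by auto
  qed
  from bchoice[OF this] obtain \<iota>' where
    i: "\<forall>j \<in> J. \<iota>' j \<in> Hom C (X' j) Q' \<and> \<Sigma>\<^sub>m (\<iota>' j) = inv_arr C \<theta> \<cdot> (\<iota> j \<cdot> \<xi> j)" by (rule exE)
  have i': "\<iota>' j \<in> arr C" "src C (\<iota>' j) = X' j" "tgt C (\<iota>' j) = Q'" "\<theta> \<cdot> \<Sigma>\<^sub>m (\<iota>' j) = \<iota> j \<cdot> \<xi> j"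
    if "j \<in> J" for j
    using i that Q' c X'[OF that] by auto
  have cop': "is_coproduct C J X' Q' \<iota>'"
    by (rule unshift_coproduct[OF cop Q', of X' \<xi>]) (use X' i' in auto)
  obtain f' where f': "f' \<in> arr C" "src C f' = W" "tgt C f' = Q'" "\<Sigma>\<^sub>m f' = inv_arr C \<theta> \<cdot> f"
    by (rule shift_full[of "inv_arr C \<theta> \<cdot> f" W Q']) (use W f Q' in auto)
  have "f' \<in> finsum C J X' Q' \<iota>' W"
    by (rule compact_finsum_univ[OF assms J cop']) (use f' in auto)
  then have "\<theta> \<cdot> \<Sigma>\<^sub>m f' \<in> finsum C J X Q \<iota> (\<Sigma>\<^sub>o W)"
  proof induction
    case finsum_zero
    have "\<theta> \<cdot> \<Sigma>\<^sub>m (zero_arr C W Q') = zero_arr C (\<Sigma>\<^sub>o W) Q" using W Q' by simp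
    then show ?case using finsum.finsum_zero by metis
  next
    case (finsum_insert j a g)
    have g: "g \<in> arr C" "src C g = W" "tgt C g = Q'" using finsum_Hom[OF finsum_insert(3) cop' W] by auto
    have a: "a \<in> arr C" "src C a = W" "tgt C a = X' j" using finsum_insert(2) by auto
    note j = finsum_insert(1)
    have "\<theta> \<cdot> \<Sigma>\<^sub>m (plus_arr C (\<iota>' j \<cdot> a) g) = plus_arr C (\<theta> \<cdot> \<Sigma>\<^sub>m (\<iota>' j \<cdot> a)) (\<theta> \<cdot> \<Sigma>\<^sub>m g)"
      using g a j i'(1-3)[OF j] Q'
      by (simp add: additive_functor_plus[OF shift_additive category_axioms] cmp_plus_arr)
    also have "\<theta> \<cdot> \<Sigma>\<^sub>m (\<iota>' j \<cdot> a) = \<iota> j \<cdot> (\<xi> j \<cdot> \<Sigma>\<^sub>m a)"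
      using a j i'(1-3)[OF j] Q' X'[OF j] c by (simp add: shift_cmp cmp_reassoc[OF i'(4)[OF j]])
    finally show ?case
      using finsum.finsum_insert[OF j _ finsum_insert.IH, of "\<xi> j \<cdot> \<Sigma>\<^sub>m a"] a X'[OF j] by simp
  qed
  then show "f \<in> finsum C J X Q \<iota> (\<Sigma>\<^sub>o W)" using f' f Q' by simp
qed

lemma compact_unshift:
  fixes \<kappa> :: "'u rel"
  assumes "compact_object \<kappa> C (\<Sigma>\<^sub>o W)" "W \<in> obj C" shows "compact_object \<kappa> C W"
proof (rule compactI)
  show "W \<in> obj C" by fact
  fix J :: "'u set" and X Q \<iota> f
  assume J: "small \<kappa> J" and cop: "is_coproduct C J X Q \<iota>" and f: "f \<in> Hom C W Q"
  note c = coproductD[OF cop] and copS = shift_coproduct[OF cop]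
  have "\<Sigma>\<^sub>m f \<in> finsum C J (\<lambda>j. \<Sigma>\<^sub>o (X j)) (\<Sigma>\<^sub>o Q) (\<lambda>j. \<Sigma>\<^sub>m (\<iota> j)) (\<Sigma>\<^sub>o W)"
    by (rule compact_finsum_univ[OF assms(1) J copS]) (use f in auto)
  then have "\<exists>f' \<in> finsum C J X Q \<iota> W. \<Sigma>\<^sub>m f' = \<Sigma>\<^sub>m f"
  proof induction
    case finsum_zero
    show ?case
      by (rule bexI[of _ "zero_arr C W Q"]) (use assms(2) c in \<open>auto intro: finsum.finsum_zero\<close>)
  next
    case (finsum_insert j a g)
    then obtain g' where g': "g' \<in> finsum C J X Q \<iota> W" "\<Sigma>\<^sub>m g' = g" by blast
    have gH: "g' \<in> arr C" "src C g' = W" "tgt C g' = Q" using finsum_Hom[OF g'(1) cop assms(2)] by auto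
    note j = finsum_insert(1)
    obtain a' where a': "a' \<in> arr C" "src C a' = W" "tgt C a' = X j" "\<Sigma>\<^sub>m a' = a"
      by (rule shift_full[of a W "X j"]) (use finsum_insert(2) assms(2) c j in auto)
    have "\<Sigma>\<^sub>m (plus_arr C (\<iota> j \<cdot> a') g') = plus_arr C (\<Sigma>\<^sub>m (\<iota> j) \<cdot> a) g"
      unfolding g'(2)[symmetric] a'(4)[symmetric] using a'(1-3) gH c j
      by (simp add: additive_functor_plus[OF shift_additive category_axioms] shift_cmp)
    then show ?case using finsum.finsum_insert[OF j _ g'(1), of a'] a'(1-3) by (auto intro!: bexI)
  qed
  then obtain f' where f': "f' \<in> finsum C J X Q \<iota> W" "\<Sigma>\<^sub>m f' = \<Sigma>\<^sub>m f" by blast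
  have "f' = f" by (rule shift_faithful) (use f' f finsum_Hom[OF f'(1) cop assms(2)] in auto)
  then show "f \<in> finsum C J X Q \<iota> W" using f'(1) by simp
qed

text \<open>The arrow \<open>k \<cdot> g\<close> involves finitely many summands; let
  \<open>e\<close> be the projection onto them. The difference of \<open>k\<close> and
  \<open>e \<cdot> k\<close> kills \<open>g\<close>, hence factors through the suspension of the
  source of \<open>f\<close>, which is compact. Both pieces of \<open>k\<close> are then finite
  sums.\<close>

lemma compact_cone:
  fixes \<kappa> :: "'u rel"
  assumes T: "(f, g, h) \<in> tri C" and "compact_object \<kappa> C (src C f)" "compact_object \<kappa> C (tgt C f)"
  shows "compact_object \<kappa> C (tgt C g)"
proof (rule compactI)
  note t = triD[OF T]
  show Z: "tgt C g \<in> obj C" using t by auto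
  have SX: "compact_object \<kappa> C (\<Sigma>\<^sub>o (src C f))" by (rule compact_shift[OF assms(2)])
  fix J :: "'u set" and X Q \<iota> k
  assume J: "small \<kappa> J" and cop: "is_coproduct C J X Q \<iota>" and k: "k \<in> Hom C (tgt C g) Q"
  note c = coproductD[OF cop]
  have k': "k \<in> arr C" "src C k = tgt C g" "tgt C k = Q" using k by auto
  have kg: "k \<cdot> g \<in> finsum C J X Q \<iota> (tgt C f)"
    by (rule compact_finsum_univ[OF assms(3) J cop]) (use k' t in auto)
  obtain F e where F: "finite F" "F \<subseteq> J" "e \<in> Hom C Q Q" "\<And>j. j \<in> F \<Longrightarrow> e \<cdot> \<iota> j = \<iota> j"
    "\<And>j. j \<in> J - F \<Longrightarrow> e \<cdot> \<iota> j = zero_arr C (X j) Q" "e \<cdot> (k \<cdot> g) = k \<cdot> g"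
    using finsum_support[OF cop _ kg] t by (metis tgt_obj)
  have e: "e \<in> arr C" "src C e = Q" "tgt C e = Q" using F(3) by auto
  have ek: "e \<cdot> k \<in> finsum C J X Q \<iota> (tgt C g)"
    using finite_part(1)[OF cop F(1-5) k'(1,3)] k' by simp
  define d where "d = minus_arr C k (e \<cdot> k)"
  have d: "d \<in> arr C" "src C d = tgt C g" "tgt C d = Q" using k' e by (auto simp: d_def)
  have "d \<cdot> g = zero_arr C (tgt C f) Q"
    unfolding d_def using k' e t F(6) by (simp add: cmp_minus)
  then obtain m where m: "m \<in> arr C" "src C m = \<Sigma>\<^sub>o (src C f)" "tgt C m = Q" "m \<cdot> h = d"
    using weak_cokernel[OF tri_rot[OF T], of d] d t by auto
  have "m \<in> finsum C J X Q \<iota> (\<Sigma>\<^sub>o (src C f))"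
    by (rule compact_finsum_univ[OF SX J cop]) (use m in auto)
  then have "d \<in> finsum C J X Q \<iota> (tgt C g)"
    using finsum_cmp[OF _ cop _ t(3)] m t SX by fastforce
  then have "plus_arr C d (e \<cdot> k) \<in> finsum C J X Q \<iota> (tgt C g)"
    using finsum_plus[OF _ ek cop Z] by blast
  moreover have "plus_arr C d (e \<cdot> k) = k"
    unfolding d_def using k' e by (intro minus_plus) auto
  ultimately show "k \<in> finsum C J X Q \<iota> (tgt C g)" by simp
qed

end

section \<open>A small triangulated core\<close>

locale big_triangulated_category = triangulated_category C + small_universe \<kappa>
  for C :: "('o, 'm, 'x) tri_data_scheme" (structure) and \<kappa> :: "'u rel" +
  assumes small_coproducts: "has_small_coproducts \<kappa> C"
    and locally_small: "locally_small \<kappa> C"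

text \<open>Closure holds only for some choice of cone, desuspension and biproduct. Closing under
  all isomorphic copies, or under retracts, could make the set large.\<close>

locale triangulated_core = big_triangulated_category C \<kappa>
  for C :: "('o, 'm, 'x) tri_data_scheme" (structure) and \<kappa> :: "'u rel" +
  fixes T0 :: "'o set"
  assumes core_small: "small \<kappa> T0"
    and core_compact: "t \<in> T0 \<Longrightarrow> compact_object \<kappa> C t"
    and core_generates: "\<lbrakk>X \<in> obj C; \<And>f. f \<in> arr C \<Longrightarrow> src C f \<in> T0 \<Longrightarrow> tgt C f = X \<Longrightarrow>
        f = zero_arr C (src C f) X\<rbrakk> \<Longrightarrow> zero_object C X"
    and core_zero: "\<exists>Z \<in> T0. zero_object C Z"
    and core_shift: "t \<in> T0 \<Longrightarrow> \<Sigma>\<^sub>o t \<in> T0"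
    and core_unshift: "t \<in> T0 \<Longrightarrow> \<exists>X \<in> T0. \<exists>\<theta>. iso_arr C \<theta> \<and> src C \<theta> = \<Sigma>\<^sub>o X \<and> tgt C \<theta> = t"
    and core_cone: "\<lbrakk>f \<in> arr C; src C f \<in> T0; tgt C f \<in> T0\<rbrakk> \<Longrightarrow> \<exists>g h. (f, g, h) \<in> tri C \<and> tgt C g \<in> T0"
    and core_biproduct: "\<lbrakk>X \<in> T0; Y \<in> T0\<rbrakk> \<Longrightarrow> \<exists>B \<in> T0. \<exists>i j p q. is_biproduct C X Y B i j p q"

context big_triangulated_category
begin

lemma small_arrows:
  assumes "small \<kappa> A" "A \<subseteq> obj C"
  shows "small \<kappa> {f \<in> arr C. src C f \<in> A \<and> tgt C f \<in> A}"
proof (rule small_subset)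
  show "small \<kappa> (\<Union>X\<in>A. \<Union>Y\<in>A. Hom C X Y)"
    using locally_small assms unfolding locally_small_def by (intro small_UN) auto
qed auto

text \<open>Cones, desuspensions and biproducts are chosen once and for all, and the generators are
  closed under these choices in countably many stages. A stage stays small because a small set of
  objects has only a small set of arrows between its members.\<close>

lemma ex_core:
  assumes G: "small \<kappa> G" "\<And>g. g \<in> G \<Longrightarrow> compact_object \<kappa> C g"
    and gen: "\<And>X. X \<in> obj C \<Longrightarrow> \<forall>g \<in> G. Hom C g X = {zero_arr C g X} \<Longrightarrow> zero_object C X"
  obtains T0 where "triangulated_core C \<kappa> T0"
proof -
  obtain Z where Z: "zero_object C Z" using ex_zero_object by blast
  define V where "V t = (SOME X. X \<in> obj C \<and> (\<exists>\<theta>. iso_arr C \<theta> \<and> src C \<theta> = \<Sigma>\<^sub>o X \<and> tgt C \<theta> = t))" for t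
  define cn where "cn f = (SOME c. \<exists>g h. (f, g, h) \<in> tri C \<and> tgt C g = c)" for f
  define bp where "bp z = (SOME B. \<exists>i j p q. is_biproduct C (fst z) (snd z) B i j p q)" for z
  have V: "V t \<in> obj C \<and> (\<exists>\<theta>. iso_arr C \<theta> \<and> src C \<theta> = \<Sigma>\<^sub>o (V t) \<and> tgt C \<theta> = t)" if "t \<in> obj C" for t
  proof -
    obtain X \<theta> where "X \<in> obj C" "iso_arr C \<theta>" "src C \<theta> = \<Sigma>\<^sub>o X" "tgt C \<theta> = t"
      by (rule desuspension[OF \<open>t \<in> obj C\<close>])
    then have "\<exists>X. X \<in> obj C \<and> (\<exists>\<theta>. iso_arr C \<theta> \<and> src C \<theta> = \<Sigma>\<^sub>o X \<and> tgt C \<theta> = t)" by blast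
    then show ?thesis unfolding V_def by (rule someI_ex)
  qed
  have cn: "\<exists>g h. (f, g, h) \<in> tri C \<and> tgt C g = cn f" if "f \<in> arr C" for f
  proof -
    have "\<exists>c. \<exists>g h. (f, g, h) \<in> tri C \<and> tgt C g = c" using tri_cone[OF that] by blast
    then show ?thesis unfolding cn_def by (rule someI_ex)
  qed
  have bp: "\<exists>i j p q. is_biproduct C X Y (bp (X, Y)) i j p q" if "X \<in> obj C" "Y \<in> obj C" for X Y
  proof -
    have "\<exists>B. \<exists>i j p q. is_biproduct C X Y B i j p q" using ex_biproduct[OF that] by blast
    then show ?thesis unfolding bp_def fst_conv snd_conv by (rule someI_ex)
  qed
  define st where "st A = A \<union> fobj (shift C) ` A \<union> V ` A \<union> cn ` {f \<in> arr C. src C f \<in> A \<and> tgt C f \<in> A}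
    \<union> bp ` (A \<times> A)" for A
  define A where "A n = (st ^^ n) (insert Z G)" for n
  have A0: "A 0 = insert Z G" and AS: "A (Suc n) = st (A n)" for n by (simp_all add: A_def)
  have inv: "small \<kappa> (A n) \<and> (\<forall>t \<in> A n. compact_object \<kappa> C t)" for n
  proof (induction n)
    case 0
    have "small \<kappa> ({Z} \<union> G)"
      using small_UN[of "UNIV :: bool set" "\<lambda>b. if b then {Z} else G"] G(1)
        small_countable[of "UNIV :: bool set"] small_countable[of "{Z}"]
      by (simp add: UNIV_bool Un_commute)
    then show ?case using A0 G(2) compact_zero[OF Z] by auto
  next
    case (Suc n)
    then have s: "small \<kappa> (A n)" and c: "\<And>t. t \<in> A n \<Longrightarrow> compact_object \<kappa> C t" by blast+
    have o: "A n \<subseteq> obj C" using c compact_obj by blast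
    define P where "P = [A n, fobj (shift C) ` A n, V ` A n,
      cn ` {f \<in> arr C. src C f \<in> A n \<and> tgt C f \<in> A n}, bp ` (A n \<times> A n)]"
    have st: "A (Suc n) = \<Union> (set P)" unfolding AS st_def P_def by auto
    have "small \<kappa> B" if "B \<in> set P" for B
      using that s small_arrows[OF s o] by (auto simp: P_def intro!: small_image small_Sigma)
    then have "small \<kappa> (A (Suc n))"
      unfolding st using small_UN[of "set P" "\<lambda>B. B"] small_countable[OF countable_finite[OF finite_set[of P]]] by simp
    moreover have "compact_object \<kappa> C t" if tA: "t \<in> A (Suc n)" for t
    proof -
      consider "t \<in> A n" | u where "u \<in> A n" "t = \<Sigma>\<^sub>o u" | u where "u \<in> A n" "t = V u"
        | f where "f \<in> arr C" "src C f \<in> A n" "tgt C f \<in> A n" "t = cn f"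
        | u v where "u \<in> A n" "v \<in> A n" "t = bp (u, v)"
        using tA unfolding AS st_def by auto
      then show ?thesis
      proof cases
        case 1 then show ?thesis by (rule c)
      next
        case 2 then show ?thesis using compact_shift c by blast
      next
        case 3
        obtain \<theta> where th: "V u \<in> obj C" "iso_arr C \<theta>" "src C \<theta> = \<Sigma>\<^sub>o (V u)" "tgt C \<theta> = u" using V[of u] 3 o by auto
        have "retract C (\<Sigma>\<^sub>o (V u)) u" using iso_retract(1)[OF th(2)] th by simp
        then have "compact_object \<kappa> C (\<Sigma>\<^sub>o (V u))" using compact_retract c 3 by blast
        then show ?thesis using compact_unshift th(1) 3 by blast
      next
        case 4
        then obtain g h where "(f, g, h) \<in> tri C" "tgt C g = cn f" using cn by blast
        then show ?thesis using compact_cone[of f g h] c 4 by metis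
      next
        case 5
        then obtain i j p q where "is_biproduct C u v (bp (u, v)) i j p q" using bp o by blast
        then show ?thesis using compact_biproduct c 5 by blast
      qed
    qed
    ultimately show ?case by blast
  qed
  have mono: "A m \<subseteq> A n" if "m \<le> n" for m n
    using that
  proof (induction n rule: dec_induct)
    case (step n)
    have "A n \<subseteq> A (Suc n)" unfolding AS st_def by auto
    then show ?case using step by blast
  qed simp
  define T0 where "T0 = (\<Union>n. A n)"
  have c: "compact_object \<kappa> C t" if "t \<in> T0" for t using that inv by (auto simp: T0_def)
  have two: "\<exists>n. X \<in> A n \<and> Y \<in> A n" if XY: "X \<in> T0" "Y \<in> T0" for X Y
  proof -
    obtain m n where "X \<in> A m" "Y \<in> A n" using XY by (auto simp: T0_def)
    then have "X \<in> A (max m n) \<and> Y \<in> A (max m n)" using mono[of m "max m n"] mono[of n "max m n"] by auto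
    then show ?thesis by blast
  qed
  have "triangulated_core C \<kappa> T0"
  proof unfold_locales
    show "small \<kappa> T0" unfolding T0_def
      by (rule small_UN) (use inv small_countable[of "UNIV :: nat set"] in auto)
    show "compact_object \<kappa> C t" if "t \<in> T0" for t by (rule c[OF that])
    show "zero_object C X" if X: "X \<in> obj C" "\<And>f. f \<in> arr C \<Longrightarrow> src C f \<in> T0 \<Longrightarrow> tgt C f = X \<Longrightarrow>
        f = zero_arr C (src C f) X" for X
    proof (rule gen[OF X(1)], rule ballI)
      fix g assume g: "g \<in> G"
      have "G \<subseteq> A 0" by (auto simp: A0)
      then have "g \<in> T0" using g by (auto simp: T0_def)
      then have "f = zero_arr C g X" if "f \<in> Hom C g X" for f using X(2)[of f] that by auto
      moreover have "zero_arr C g X \<in> Hom C g X" using compact_obj[OF G(2)[OF g]] X(1) by simp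
      ultimately show "Hom C g X = {zero_arr C g X}" by blast
    qed
    have "Z \<in> A 0" by (simp add: A0)
    then show "\<exists>Z \<in> T0. zero_object C Z" using Z by (auto simp: T0_def)
    have sub: "st (A n) \<subseteq> T0" for n unfolding AS[symmetric] by (auto simp: T0_def)
    show "\<Sigma>\<^sub>o t \<in> T0" if t: "t \<in> T0" for t
    proof -
      obtain n where "t \<in> A n" using t by (auto simp: T0_def)
      then have "\<Sigma>\<^sub>o t \<in> st (A n)" by (auto simp: st_def)
      then show ?thesis using sub by blast
    qed
    show "\<exists>X \<in> T0. \<exists>\<theta>. iso_arr C \<theta> \<and> src C \<theta> = \<Sigma>\<^sub>o X \<and> tgt C \<theta> = t" if t: "t \<in> T0" for t
    proof -
      obtain n where "t \<in> A n" using t by (auto simp: T0_def)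
      then have "V t \<in> st (A n)" by (auto simp: st_def)
      then show ?thesis using sub V[of t] compact_obj[OF c[OF t]] by blast
    qed
    show "\<exists>g h. (f, g, h) \<in> tri C \<and> tgt C g \<in> T0" if f: "f \<in> arr C" "src C f \<in> T0" "tgt C f \<in> T0" for f
    proof -
      obtain n where "src C f \<in> A n" "tgt C f \<in> A n" using two[OF f(2,3)] by blast
      then have "cn f \<in> st (A n)" using f by (auto simp: st_def)
      then have "cn f \<in> T0" using sub by blast
      then show ?thesis using cn[OF f(1)] by metis
    qed
    show "\<exists>B \<in> T0. \<exists>i j p q. is_biproduct C X Y B i j p q" if XY: "X \<in> T0" "Y \<in> T0" for X Y
    proof -
      obtain n where "X \<in> A n" "Y \<in> A n" using two[OF XY] by blast
      then have "bp (X, Y) \<in> st (A n)" by (auto simp: st_def)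
      then show ?thesis using sub bp[of X Y] compact_obj[OF c[OF XY(1)]] compact_obj[OF c[OF XY(2)]] by blast
    qed
  qed
  then show ?thesis by (rule that)
qed

end

section \<open>Factoring arrows from compact objects through the core\<close>

context triangulated_core
begin

lemma core_obj: "t \<in> T0 \<Longrightarrow> t \<in> obj C"
  using compact_obj core_compact by blast

lemma core_fibre:
  assumes "f \<in> arr C" "src C f \<in> T0" "tgt C f \<in> T0"
  obtains k g where "(k, f, g) \<in> tri C" "src C k \<in> T0"
proof -
  obtain g h where T: "(f, g, h) \<in> tri C" "tgt C g \<in> T0" using core_cone[OF assms] by blast
  obtain W \<theta> where W: "W \<in> T0" "iso_arr C \<theta>" "src C \<theta> = \<Sigma>\<^sub>o W" "tgt C \<theta> = tgt C g"
    using core_unshift[OF T(2)] by blast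
  show ?thesis
    by (rule tri_desuspend[OF T(1) core_obj[OF W(1)] W(2-4)]) (use that W(1) in blast)
qed

text \<open>The approximable objects turn out to be closed under everything that is needed to build a
  compact object from the core, so that each compact object is a retract of an object of the core.\<close>

definition approximable :: "'o \<Rightarrow> bool" where
  "approximable Y \<longleftrightarrow> Y \<in> obj C \<and> (\<forall>f. f \<in> arr C \<and> compact_object \<kappa> C (src C f) \<and> tgt C f = Y \<longrightarrow>
     (\<exists>a b. a \<in> arr C \<and> b \<in> arr C \<and> src C a = src C f \<and> tgt C a \<in> T0 \<and> src C b = tgt C a \<and>
        tgt C b = Y \<and> b \<cdot> a = f))"

lemma approximableE:
  assumes "approximable Y" "f \<in> arr C" "compact_object \<kappa> C (src C f)" "tgt C f = Y"
  obtains a b where "a \<in> arr C" "b \<in> arr C" "src C a = src C f" "tgt C a \<in> T0" "src C b = tgt C a"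
    "tgt C b = Y" "b \<cdot> a = f"
  using assms unfolding approximable_def by blast

lemma approximableI:
  assumes "Y \<in> obj C"
    and "\<And>f. f \<in> arr C \<Longrightarrow> compact_object \<kappa> C (src C f) \<Longrightarrow> tgt C f = Y \<Longrightarrow>
     \<exists>a b. a \<in> arr C \<and> b \<in> arr C \<and> src C a = src C f \<and> tgt C a \<in> T0 \<and> src C b = tgt C a \<and>
        tgt C b = Y \<and> b \<cdot> a = f"
  shows "approximable Y"
  unfolding approximable_def using assms by blast

lemma approximable_core:
  assumes "t \<in> T0" shows "approximable t"
proof (rule approximableI)
  show "t \<in> obj C" using assms by (rule core_obj)
  fix f assume "f \<in> arr C" "tgt C f = t"
  then show "\<exists>a b. a \<in> arr C \<and> b \<in> arr C \<and> src C a = src C f \<and> tgt C a \<in> T0 \<and> src C b = tgt C a \<and>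
        tgt C b = t \<and> b \<cdot> a = f"
    using assms core_obj[OF assms] by (intro exI[of _ f] exI[of _ "idn C t"]) auto
qed

lemma factor_sum:
  assumes a: "a \<in> arr C" "b \<in> arr C" "tgt C a \<in> T0" "src C b = tgt C a"
    and c: "c \<in> arr C" "d \<in> arr C" "tgt C c \<in> T0" "src C d = tgt C c"
    and e: "src C c = src C a" "tgt C b = tgt C d"
  shows "\<exists>u v. u \<in> arr C \<and> v \<in> arr C \<and> src C u = src C a \<and> tgt C u \<in> T0 \<and> src C v = tgt C u \<and>
      tgt C v = tgt C d \<and> v \<cdot> u = plus_arr C (b \<cdot> a) (d \<cdot> c)"
proof -
  obtain B i j p q where B: "B \<in> T0" "is_biproduct C (tgt C a) (tgt C c) B i j p q"
    using core_biproduct[OF a(3) c(3)] by blast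
  obtain u v where "u \<in> Hom C (src C a) B" "v \<in> Hom C B (tgt C d)" "v \<cdot> u = plus_arr C (b \<cdot> a) (d \<cdot> c)"
    by (rule sum_factors[OF B(2), of a "src C a" c b "tgt C d" d]) (use assms in auto)
  then show ?thesis using B(1) by auto
qed

text \<open>An arrow from a compact object is a finite sum, and finitely many factorizations through
  the core merge into one because the core has biproducts.\<close>

lemma approximable_coproduct:
  assumes "small \<kappa> J" and cop: "is_coproduct C J X Q \<iota>" and X: "\<And>j. j \<in> J \<Longrightarrow> approximable (X j)"
  shows "approximable Q"
proof (rule approximableI)
  note c = coproductD[OF cop]
  show "Q \<in> obj C" by (rule c)
  fix f assume f: "f \<in> arr C" "compact_object \<kappa> C (src C f)" "tgt C f = Q"
  define W where "W = src C f"
  have W: "W \<in> obj C" "compact_object \<kappa> C W" using f by (auto simp: W_def)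
  have "f \<in> finsum C J X Q \<iota> W"
    by (rule compact_finsum[OF inaccessible W(2) assms(1) cop]) (use f W_def in auto)
  then have "\<exists>a b. a \<in> arr C \<and> b \<in> arr C \<and> src C a = W \<and> tgt C a \<in> T0 \<and> src C b = tgt C a \<and>
        tgt C b = Q \<and> b \<cdot> a = f"
  proof induction
    case finsum_zero
    obtain Z where Z: "Z \<in> T0" using core_zero by blast
    show ?case
      by (rule exI[of _ "zero_arr C W Z"], rule exI[of _ "zero_arr C Z Q"])
        (use Z core_obj[OF Z] W(1) c(1) in auto)
  next
    case (finsum_insert j a g)
    note j = finsum_insert(1)
    have a: "a \<in> arr C" "src C a = W" "tgt C a = X j" using finsum_insert(2) by auto
    obtain a1 b1 where 1: "a1 \<in> arr C" "b1 \<in> arr C" "src C a1 = src C a" "tgt C a1 \<in> T0"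
      "src C b1 = tgt C a1" "tgt C b1 = X j" "b1 \<cdot> a1 = a"
      by (rule approximableE[OF X[OF j] a(1) _ a(3)]) (use a W in auto)
    from finsum_insert.IH obtain a2 b2 where 2: "a2 \<in> arr C" "b2 \<in> arr C" "src C a2 = W"
      "tgt C a2 \<in> T0" "src C b2 = tgt C a2" "tgt C b2 = Q" "b2 \<cdot> a2 = g" by (elim exE conjE)
    have e: "(\<iota> j \<cdot> b1) \<cdot> a1 = \<iota> j \<cdot> a"
      using 1(1-6) c(3,4)[OF j] by (simp add: 1(7))
    have "\<exists>u v. u \<in> arr C \<and> v \<in> arr C \<and> src C u = src C a1 \<and> tgt C u \<in> T0 \<and> src C v = tgt C u \<and>
        tgt C v = tgt C b2 \<and> v \<cdot> u = plus_arr C ((\<iota> j \<cdot> b1) \<cdot> a1) (b2 \<cdot> a2)"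
      by (rule factor_sum) (use 1(1-6) 2(1-6) c(3-5)[OF j] a in simp_all)
    then show ?case by (simp only: e 2(6,7) 1(3) a(2))
  qed
  then show "\<exists>a b. a \<in> arr C \<and> b \<in> arr C \<and> src C a = src C f \<and> tgt C a \<in> T0 \<and> src C b = tgt C a \<and>
        tgt C b = Q \<and> b \<cdot> a = f" by (simp only: W_def)
qed

lemma approximable_shift:
  assumes "approximable Y" shows "approximable (\<Sigma>\<^sub>o Y)"
proof (rule approximableI)
  have Y: "Y \<in> obj C" using assms by (simp add: approximable_def)
  then show "\<Sigma>\<^sub>o Y \<in> obj C" by simp
  fix f assume f: "f \<in> arr C" "compact_object \<kappa> C (src C f)" "tgt C f = \<Sigma>\<^sub>o Y"
  obtain W \<theta> where W: "W \<in> obj C" "iso_arr C \<theta>" "src C \<theta> = \<Sigma>\<^sub>o W" "tgt C \<theta> = src C f"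
    by (rule desuspension[of "src C f"]) (use f in auto)
  have "retract C (\<Sigma>\<^sub>o W) (src C f)" using iso_retract(1)[OF W(2)] W by simp
  then have Wc: "compact_object \<kappa> C W" using compact_unshift[OF compact_retract[OF f(2)] W(1)] by blast
  obtain k where k: "k \<in> arr C" "src C k = W" "tgt C k = Y" "\<Sigma>\<^sub>m k = f \<cdot> \<theta>"
    by (rule shift_full[of "f \<cdot> \<theta>" W Y]) (use f W Y in auto)
  obtain a b where ab: "a \<in> arr C" "b \<in> arr C" "src C a = src C k" "tgt C a \<in> T0" "src C b = tgt C a"
    "tgt C b = Y" "b \<cdot> a = k" by (rule approximableE[OF assms k(1) _ k(3)]) (use Wc k(2) in auto)
  have "\<Sigma>\<^sub>m b \<cdot> \<Sigma>\<^sub>m a = f \<cdot> \<theta>" using ab k(4) shift_cmp[of a b] by simp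
  then have "\<Sigma>\<^sub>m b \<cdot> (\<Sigma>\<^sub>m a \<cdot> inv_arr C \<theta>) = (f \<cdot> \<theta>) \<cdot> inv_arr C \<theta>"
    using ab W k by (intro cmp_reassoc) auto
  then have "\<Sigma>\<^sub>m b \<cdot> (\<Sigma>\<^sub>m a \<cdot> inv_arr C \<theta>) = f" using f W by simp
  then show "\<exists>a b. a \<in> arr C \<and> b \<in> arr C \<and> src C a = src C f \<and> tgt C a \<in> T0 \<and> src C b = tgt C a \<and>
        tgt C b = \<Sigma>\<^sub>o Y \<and> b \<cdot> a = f"
    using ab W k core_shift by (intro exI[of _ "\<Sigma>\<^sub>m a \<cdot> inv_arr C \<theta>"] exI[of _ "\<Sigma>\<^sub>m b"]) auto
qed

text \<open>The composite \<open>h \<cdot> f\<close> factors through a core object as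
  \<open>q \<cdot> p\<close>, but \<open>q\<close> itself need not lift along \<open>h\<close> to
  the cone. The core object is replaced by the fibre of an arrow \<open>v2\<close> that captures the
  obstruction of \<open>q\<close> and vanishes on \<open>p\<close>. There the lift exists, and what
  remains of \<open>f\<close> comes from the target of \<open>x\<close>.\<close>

lemma approximable_cone:
  assumes T: "(x, g, h) \<in> tri C" and A: "approximable (src C x)" and Y: "approximable (tgt C x)"
  shows "approximable (tgt C g)"
proof (rule approximableI)
  note t = triD[OF T]
  show "tgt C g \<in> obj C" using t by auto
  fix f assume f: "f \<in> arr C" "compact_object \<kappa> C (src C f)" "tgt C f = tgt C g"
  let ?W = "src C f" let ?n = "neg_arr C (\<Sigma>\<^sub>m x)"
  have n: "?n \<in> arr C" "src C ?n = \<Sigma>\<^sub>o (src C x)" "tgt C ?n = \<Sigma>\<^sub>o (tgt C x)" using t by auto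
  obtain p q where pq: "p \<in> arr C" "q \<in> arr C" "src C p = ?W" "tgt C p \<in> T0" "src C q = tgt C p"
    "tgt C q = \<Sigma>\<^sub>o (src C x)" "q \<cdot> p = h \<cdot> f"
    using approximableE[OF approximable_shift[OF A], of "h \<cdot> f"] f t by auto
  obtain v w where vw: "v \<in> arr C" "w \<in> arr C" "src C v = tgt C p" "tgt C v \<in> T0" "src C w = tgt C v"
    "tgt C w = \<Sigma>\<^sub>o (tgt C x)" "w \<cdot> v = ?n \<cdot> q"
    using approximableE[OF approximable_shift[OF Y], of "?n \<cdot> q"] pq n core_compact[OF pq(4)] by auto
  have nh: "?n \<cdot> h = zero_arr C (tgt C g) (\<Sigma>\<^sub>o (tgt C x))"
    using tri_gf[OF tri_rot[OF tri_rot[OF T]]] t by simp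
  have "w \<cdot> (v \<cdot> p) = ?n \<cdot> (q \<cdot> p)" using vw(1-6) pq(1-6) n by (simp add: cmp_reassoc[OF vw(7)])
  also have "\<dots> = (?n \<cdot> h) \<cdot> f" unfolding pq(7) using f t n by simp
  also have "\<dots> = zero_arr C ?W (\<Sigma>\<^sub>o (tgt C x))" unfolding nh using f t by simp
  finally have wvp: "w \<cdot> (v \<cdot> p) = zero_arr C ?W (\<Sigma>\<^sub>o (tgt C x))" .
  \<comment> \<open>Only \<open>w\<close> is known to kill \<open>v \<cdot> p\<close>, whereas an
    arrow into the core that kills \<open>p\<close> is wanted. The cone of
    \<open>v \<cdot> p\<close> makes the composite vanish; it is compact but may lie outside the
    core, so its arrow \<open>w'\<close> is factored through the core once more.\<close>
  obtain m m' where M: "(v \<cdot> p, m, m') \<in> tri C" using tri_cone[of "v \<cdot> p"] vw pq by auto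
  have m: "m \<in> arr C" "src C m = tgt C v" using triD[OF M] vw pq by auto
  have Nc: "compact_object \<kappa> C (tgt C m)"
    using compact_cone[OF M] f(2) core_compact[OF vw(4)] vw pq by auto
  obtain w' where w': "w' \<in> arr C" "src C w' = tgt C m" "tgt C w' = \<Sigma>\<^sub>o (tgt C x)" "w' \<cdot> m = w"
    using weak_cokernel[OF M, of w] vw pq wvp by auto
  obtain m2 w2 where 2: "m2 \<in> arr C" "w2 \<in> arr C" "src C m2 = tgt C m" "tgt C m2 \<in> T0" "src C w2 = tgt C m2"
    "tgt C w2 = \<Sigma>\<^sub>o (tgt C x)" "w2 \<cdot> m2 = w'"
    using approximableE[OF approximable_shift[OF Y], of w'] w' Nc by auto
  define v2 where "v2 = m2 \<cdot> (m \<cdot> v)"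
  have v2: "v2 \<in> arr C" "src C v2 = tgt C p" "tgt C v2 = tgt C m2" using 2 m vw by (auto simp: v2_def)
  have "m \<cdot> (v \<cdot> p) = zero_arr C ?W (tgt C m)" using tri_gf[OF M] vw pq by simp
  then have v2p: "v2 \<cdot> p = zero_arr C ?W (tgt C m2)"
    unfolding v2_def using 2 m vw pq f by simp
  have w2v2: "w2 \<cdot> v2 = ?n \<cdot> q"
  proof -
    have "w2 \<cdot> v2 = w' \<cdot> (m \<cdot> v)" unfolding v2_def using 2(1-6) m vw by (simp add: cmp_reassoc[OF 2(7)])
    also have "\<dots> = w \<cdot> v" using w' m vw by (simp add: cmp_reassoc[OF w'(4)])
    finally show ?thesis using vw(7) by simp
  qed
  \<comment> \<open>On the fibre of \<open>v2\<close> the obstruction of \<open>q\<close> vanishes,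
    and \<open>p\<close> lifts to it because \<open>v2\<close> kills \<open>p\<close>.\<close>
  obtain e e' where E: "(e, v2, e') \<in> tri C" "src C e \<in> T0"
    by (rule core_fibre[of v2]) (use v2 pq(4) 2(4) in auto)
  have e: "e \<in> arr C" "tgt C e = tgt C p" using triD[OF E(1)] v2 by auto
  obtain p' where p': "p' \<in> arr C" "src C p' = ?W" "tgt C p' = src C e" "e \<cdot> p' = p"
    using weak_kernel[OF E(1), of p] pq e v2p v2 by auto
  have v2e: "v2 \<cdot> e = zero_arr C (src C e) (tgt C m2)" using tri_gf[OF E(1)] v2 by simp
  have "?n \<cdot> (q \<cdot> e) = w2 \<cdot> (v2 \<cdot> e)"
    using n pq(1-6) e 2(1-6) v2 cmp_reassoc[OF w2v2[symmetric] e(1)] by simp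
  also have "\<dots> = zero_arr C (src C e) (\<Sigma>\<^sub>o (tgt C x))" unfolding v2e using 2 e by simp
  finally have "?n \<cdot> (q \<cdot> e) = zero_arr C (src C e) (\<Sigma>\<^sub>o (tgt C x))" .
  then obtain z where z: "z \<in> arr C" "src C z = src C e" "tgt C z = tgt C g" "h \<cdot> z = q \<cdot> e"
    using weak_kernel[OF tri_rot[OF tri_rot[OF T]], of "q \<cdot> e"] pq e n t by auto
  \<comment> \<open>Both \<open>f\<close> and \<open>z \<cdot> p'\<close> have the same composite
    with \<open>h\<close>, so their difference comes from the target of \<open>x\<close>, which is
    approximable.\<close>
  define d where "d = minus_arr C f (z \<cdot> p')"
  have d: "d \<in> arr C" "src C d = ?W" "tgt C d = tgt C g" using f z p' by (auto simp: d_def)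
  have "h \<cdot> (z \<cdot> p') = q \<cdot> (e \<cdot> p')" using z(1-3) p'(1-3) t pq(1-6) e by (simp add: cmp_reassoc[OF z(4)])
  also have "\<dots> = h \<cdot> f" unfolding p'(4) by (rule pq(7))
  finally have "h \<cdot> d = zero_arr C ?W (tgt C h)"
    unfolding d_def using f z(1-3) p'(1-3) t by (simp add: cmp_minus)
  then obtain y where y: "y \<in> arr C" "src C y = ?W" "tgt C y = tgt C x" "g \<cdot> y = d"
    using weak_kernel[OF tri_rot[OF T], of d] d t by auto
  obtain a b where ab: "a \<in> arr C" "b \<in> arr C" "src C a = ?W" "tgt C a \<in> T0" "src C b = tgt C a"
    "tgt C b = tgt C x" "b \<cdot> a = y"
    using approximableE[OF Y, of y] y f by auto
  have "(g \<cdot> b) \<cdot> a = d" using ab(1-6) t y(4) by (simp add: ab(7))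
  moreover have "plus_arr C d (z \<cdot> p') = f" unfolding d_def using f z p' by (intro minus_plus) auto
  ultimately have fe: "plus_arr C ((g \<cdot> b) \<cdot> a) (z \<cdot> p') = f" by simp
  show "\<exists>a b. a \<in> arr C \<and> b \<in> arr C \<and> src C a = src C f \<and> tgt C a \<in> T0 \<and> src C b = tgt C a \<and>
        tgt C b = tgt C g \<and> b \<cdot> a = f"
    using factor_sum[of a "g \<cdot> b" p' z] ab t z p' E(2) unfolding fe by auto
qed

end

section \<open>Brown representability\<close>

lemma (in small_universe) small_Un:
  assumes "small \<kappa> A" "small \<kappa> B" shows "small \<kappa> (A \<union> B)"
proof -
  have "small \<kappa> (\<Union>b\<in>(UNIV :: bool set). if b then A else B)"
    by (rule small_UN) (use assms small_countable[of "UNIV :: bool set"] in auto)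
  then show ?thesis by (simp add: UNIV_bool Un_commute)
qed

text \<open>Values are pointed sets with base point \<open>kz\<close>, and subtraction enters only
  through \<open>pb_minus\<close>. This is enough for representability, and it covers both Hom
  functors and characters without a common group structure on the values.\<close>

locale cohomological = triangulated_core C \<kappa> T0
  for C :: "('o, 'm, 'x) tri_data_scheme" (structure) and \<kappa> :: "'u rel" and T0 +
  fixes K :: "'o \<Rightarrow> 'k set" and pb :: "'m \<Rightarrow> 'k \<Rightarrow> 'k" and kz :: "'o \<Rightarrow> 'k"
  assumes pb_in: "\<lbrakk>f \<in> arr C; y \<in> K (tgt C f)\<rbrakk> \<Longrightarrow> pb f y \<in> K (src C f)"
    and pb_idn: "\<lbrakk>X \<in> obj C; y \<in> K X\<rbrakk> \<Longrightarrow> pb (idn C X) y = y"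
    and pb_cmp: "\<lbrakk>f \<in> arr C; g \<in> arr C; tgt C f = src C g; y \<in> K (tgt C g)\<rbrakk>
      \<Longrightarrow> pb (g \<cdot> f) y = pb f (pb g y)"
    and pb_zero: "\<lbrakk>X \<in> obj C; Y \<in> obj C; y \<in> K Y\<rbrakk> \<Longrightarrow> pb (zero_arr C X Y) y = kz X"
    and pb_minus: "\<lbrakk>f \<in> arr C; g \<in> arr C; src C f = src C g; tgt C f = tgt C g; y \<in> K (tgt C g);
        pb f y = pb g y\<rbrakk> \<Longrightarrow> pb (minus_arr C f g) y = kz (src C g)"
    and K_glue: "\<lbrakk>small \<kappa> (J :: 'u set); is_coproduct C J Xs Q \<iota>; \<And>j. j \<in> J \<Longrightarrow> xs j \<in> K (Xs j)\<rbrakk>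
      \<Longrightarrow> \<exists>z \<in> K Q. \<forall>j \<in> J. pb (\<iota> j) z = xs j"
    and K_separated: "\<lbrakk>small \<kappa> (J :: 'u set); is_coproduct C J Xs Q \<iota>; z \<in> K Q;
        \<And>j. j \<in> J \<Longrightarrow> pb (\<iota> j) z = kz (Xs j)\<rbrakk> \<Longrightarrow> z = kz Q"
    and K_exact: "\<lbrakk>(f, g, h) \<in> tri C; y \<in> K (tgt C f); pb f y = kz (src C f)\<rbrakk>
      \<Longrightarrow> \<exists>z \<in> K (tgt C g). pb g z = y"
    and K_small: "t \<in> T0 \<Longrightarrow> small \<kappa> (K t)"
begin

lemma K_glue_any:
  assumes A: "small \<kappa> A" and cop: "is_coproduct C A X Q \<iota>" and x: "\<And>a. a \<in> A \<Longrightarrow> x a \<in> K (X a)"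
  obtains z where "z \<in> K Q" "\<And>a. a \<in> A \<Longrightarrow> pb (\<iota> a) z = x a"
proof -
  obtain J :: "'u set" and e where J: "bij_betw e J A" "small \<kappa> J" using A by (rule small_copy)
  have cop': "is_coproduct C J (\<lambda>j. X (e j)) Q (\<lambda>j. \<iota> (e j))"
    by (rule coproduct_reindex[OF J(1) cop]) auto
  have "x (e j) \<in> K (X (e j))" if "j \<in> J" for j using x J(1) bij_betwE that by blast
  then obtain z where z: "z \<in> K Q" "\<forall>j \<in> J. pb (\<iota> (e j)) z = x (e j)"
    using K_glue[OF J(2) cop', of "\<lambda>j. x (e j)"] by blast
  have "pb (\<iota> a) z = x a" if "a \<in> A" for a
  proof -
    obtain j where "j \<in> J" "a = e j" using J(1) \<open>a \<in> A\<close> unfolding bij_betw_def by blast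
    then show ?thesis using z(2) by simp
  qed
  then show ?thesis using z(1) by (rule that[rotated])
qed

lemma K_separated_any:
  assumes A: "small \<kappa> A" and cop: "is_coproduct C A X Q \<iota>" and z: "z \<in> K Q"
    and e: "\<And>a. a \<in> A \<Longrightarrow> pb (\<iota> a) z = kz (X a)"
  shows "z = kz Q"
proof -
  obtain J :: "'u set" and e where J: "bij_betw e J A" "small \<kappa> J" using A by (rule small_copy)
  have cop': "is_coproduct C J (\<lambda>j. X (e j)) Q (\<lambda>j. \<iota> (e j))"
    by (rule coproduct_reindex[OF J(1) cop]) auto
  show ?thesis
    by (rule K_separated[OF J(2) cop' z]) (use e J(1) bij_betwE in blast)
qed

text \<open>On the core, pulling back \<open>u\<close> is then a bijection from
  \<open>Hom C t I\<close> to \<open>K t\<close>: a trivial kernel gives injectivity by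
  \<open>pb_minus\<close>. Testing on the core suffices because the core generates.\<close>

definition universal :: "'o \<Rightarrow> 'k \<Rightarrow> bool" where
  "universal I u \<longleftrightarrow> I \<in> obj C \<and> u \<in> K I \<and> (\<forall>t \<in> T0. \<forall>k \<in> K t. \<exists>f \<in> Hom C t I. pb f u = k) \<and>
     (\<forall>f. f \<in> arr C \<and> src C f \<in> T0 \<and> tgt C f = I \<and> pb f u = kz (src C f) \<longrightarrow> f = zero_arr C (src C f) I)"

lemma universalD:
  assumes "universal I u"
  shows "I \<in> obj C" "u \<in> K I"
    "f \<in> arr C \<Longrightarrow> src C f \<in> T0 \<Longrightarrow> tgt C f = I \<Longrightarrow> pb f u = kz (src C f) \<Longrightarrow> f = zero_arr C (src C f) I"
  using assms unfolding universal_def by blast+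

lemma universal_lift:
  assumes "universal I u" "t \<in> T0" "k \<in> K t"
  obtains f where "f \<in> arr C" "src C f = t" "tgt C f = I" "pb f u = k"
proof -
  have "\<exists>f \<in> Hom C t I. pb f u = k" using assms unfolding universal_def by blast
  then show ?thesis using that by auto
qed

text \<open>One stage realizes values and kills kernels at once. The clause on approximability
  travels along so that the same tower can later exhibit compact objects as retracts of core
  objects.\<close>

definition step :: "'o \<Rightarrow> 'k \<Rightarrow> 'o \<Rightarrow> 'k \<Rightarrow> 'm \<Rightarrow> bool" where
  "step Y y Y' y' j \<longleftrightarrow> Y' \<in> obj C \<and> y' \<in> K Y' \<and> j \<in> Hom C Y Y' \<and> pb j y' = y \<and>
     (\<forall>f. f \<in> arr C \<and> src C f \<in> T0 \<and> tgt C f = Y \<and> pb f y = kz (src C f) \<longrightarrow> j \<cdot> f = zero_arr C (src C f) Y') \<and>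
     (\<forall>t \<in> T0. \<forall>k \<in> K t. \<exists>f \<in> Hom C t Y'. pb f y' = k) \<and>
     (approximable Y \<longrightarrow> approximable Y')"

text \<open>Attaching a copy of \<open>t\<close> for each element of \<open>K t\<close> realizes all
  values; coning off all core arrows with trivial pullback then kills the kernel. Exactness extends
  the element to the cone.\<close>

lemma step_ex:
  assumes Y: "Y \<in> obj C" "y \<in> K Y"
  shows "\<exists>Y' y' j. step Y y Y' y' j"
proof -
  \<comment> \<open>\<open>None\<close> stands for \<open>Y\<close> itself,
    \<open>Some (t, k)\<close> for a copy of \<open>t\<close> that realizes the value
    \<open>k\<close>.\<close>
  define A where "A = insert None (Some ` Sigma T0 K)"
  have sA: "small \<kappa> A"
  proof -
    have "small \<kappa> (Some ` Sigma T0 K)" using core_small K_small by (intro small_image small_Sigma)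
    then show ?thesis
      using small_Un[OF small_countable[of "{None}"]] unfolding A_def by (metis countable_finite finite.emptyI finite.insertI insert_is_Un)
  qed
  define X where "X a = (case a of None \<Rightarrow> Y | Some tk \<Rightarrow> fst tk)" for a :: "('o \<times> 'k) option"
  define x where "x a = (case a of None \<Rightarrow> y | Some tk \<Rightarrow> snd tk)" for a :: "('o \<times> 'k) option"
  have Xo: "X a \<in> obj C" if "a \<in> A" for a
    using that Y(1) core_obj by (auto simp: A_def X_def)
  have xK: "x a \<in> K (X a)" if "a \<in> A" for a
    using that Y(2) by (auto simp: A_def X_def x_def)
  obtain Q \<iota> where cop: "is_coproduct C A X Q \<iota>"
    by (rule has_small_coproducts_any[OF inaccessible small_coproducts sA, of X]) (use Xo in auto)
  note c = coproductD[OF cop]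
  obtain u1 where u1: "u1 \<in> K Q" "\<And>a. a \<in> A \<Longrightarrow> pb (\<iota> a) u1 = x a"
    by (rule K_glue_any[OF sA cop, of x]) (use xK in auto)
  \<comment> \<open>The arrows to be killed, taken in the enlarged object \<open>Q\<close>: an arrow
    into \<open>Y\<close> with trivial pullback becomes one of them after composition with the
    coprojection of \<open>None\<close>.\<close>
  define B where "B = {f \<in> arr C. src C f \<in> T0 \<and> tgt C f = Q \<and> pb f u1 = kz (src C f)}"
  have sB: "small \<kappa> B"
  proof (rule small_subset)
    show "small \<kappa> (\<Union>t\<in>T0. Hom C t Q)"
      using core_small locally_small core_obj c(1) unfolding locally_small_def by (intro small_UN) auto
  qed (auto simp: B_def)
  obtain Q2 \<iota>2 where cop2: "is_coproduct C B (src C) Q2 \<iota>2"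
    by (rule has_small_coproducts_any[OF inaccessible small_coproducts sB, of "src C"]) (auto simp: B_def)
  note c2 = coproductD[OF cop2]
  obtain d where d: "d \<in> arr C" "src C d = Q2" "tgt C d = Q" "\<And>f. f \<in> B \<Longrightarrow> d \<cdot> \<iota>2 f = f"
    by (rule coproduct_ex[OF cop2 c(1), of "\<lambda>f. f"]) (auto simp: B_def)
  have "pb d u1 = kz Q2"
  proof (rule K_separated_any[OF sB cop2])
    show "pb d u1 \<in> K Q2" using pb_in[of d u1] d u1(1) by simp
    fix f assume f: "f \<in> B"
    have "pb (\<iota>2 f) (pb d u1) = pb (d \<cdot> \<iota>2 f) u1"
      using pb_cmp[of "\<iota>2 f" d u1] d c2 f u1(1) by simp
    then show "pb (\<iota>2 f) (pb d u1) = kz (src C f)" using d(4)[OF f] f by (simp add: B_def)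
  qed
  obtain g h where T: "(d, g, h) \<in> tri C" using tri_cone[OF d(1)] by blast
  note t = triD[OF T]
  obtain u2 where u2: "u2 \<in> K (tgt C g)" "pb g u2 = u1"
    using K_exact[OF T, of u1] u1(1) d \<open>pb d u1 = kz Q2\<close> by auto
  have N: "None \<in> A" by (simp add: A_def)
  have iN: "\<iota> None \<in> arr C" "src C (\<iota> None) = Y" "tgt C (\<iota> None) = Q"
    using c(3-5)[OF N] by (auto simp: X_def)
  have gd: "g \<cdot> d = zero_arr C Q2 (tgt C g)" using tri_gf[OF T] d by simp
  have "step Y y (tgt C g) u2 (g \<cdot> \<iota> None)"
    unfolding step_def
  proof (intro conjI allI impI ballI)
    show "tgt C g \<in> obj C" using t by auto
    show "u2 \<in> K (tgt C g)" by fact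
    show "g \<cdot> \<iota> None \<in> Hom C Y (tgt C g)" using iN t d by auto
    show "pb (g \<cdot> \<iota> None) u2 = y"
      using pb_cmp[of "\<iota> None" g u2] iN t d u2 u1(2)[OF N] by (simp add: x_def)
    show "approximable (tgt C g)" if aY: "approximable Y"
    proof (rule approximable_cone[OF T])
      have "approximable (X a)" if "a \<in> A" for a
        using that aY approximable_core by (auto simp: A_def X_def)
      then show "approximable (tgt C d)" using approximable_coproduct[OF sA cop] d by simp
      have "approximable (src C f)" if "f \<in> B" for f using that approximable_core by (auto simp: B_def)
      then show "approximable (src C d)" using approximable_coproduct[OF sB cop2] d by simp
    qed
    show "\<exists>f \<in> Hom C t' (tgt C g). pb f u2 = k" if tk: "t' \<in> T0" "k \<in> K t'" for t' k
    proof -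
      have a: "Some (t', k) \<in> A" using tk by (auto simp: A_def)
      have i: "\<iota> (Some (t', k)) \<in> arr C" "src C (\<iota> (Some (t', k))) = t'" "tgt C (\<iota> (Some (t', k))) = Q"
        using c(3-5)[OF a] by (auto simp: X_def)
      have "pb (g \<cdot> \<iota> (Some (t', k))) u2 = k"
        using pb_cmp[of "\<iota> (Some (t', k))" g u2] i t d u2 u1(2)[OF a] by (simp add: x_def)
      then show ?thesis using i t d by (intro bexI[of _ "g \<cdot> \<iota> (Some (t', k))"]) auto
    qed
    fix f assume f: "f \<in> arr C \<and> src C f \<in> T0 \<and> tgt C f = Y \<and> pb f y = kz (src C f)"
    have "pb (\<iota> None \<cdot> f) u1 = kz (src C f)"
      using pb_cmp[of f "\<iota> None" u1] f iN u1 N by (simp add: x_def)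
    then have fB: "\<iota> None \<cdot> f \<in> B" using f iN by (auto simp: B_def)
    have "(g \<cdot> \<iota> None) \<cdot> f = g \<cdot> (\<iota> None \<cdot> f)" using f iN t d by simp
    also have "\<dots> = g \<cdot> (d \<cdot> \<iota>2 (\<iota> None \<cdot> f))" using d(4)[OF fB] by simp
    also have "\<dots> = zero_arr C Q2 (tgt C g) \<cdot> \<iota>2 (\<iota> None \<cdot> f)"
      by (rule cmp_reassoc[OF gd]) (use c2(3,5)[OF fB] d t in auto)
    also have "\<dots> = zero_arr C (src C f) (tgt C g)" using c2(3-5)[OF fB] f iN t by simp
    finally show "(g \<cdot> \<iota> None) \<cdot> f = zero_arr C (src C f) (tgt C g)" .
  qed
  then show ?thesis by blast
qed

lemma stepD:
  assumes "step Y y Y' y' j"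
  shows "Y' \<in> obj C" "y' \<in> K Y'" "j \<in> arr C" "src C j = Y" "tgt C j = Y'" "pb j y' = y"
    "f \<in> arr C \<Longrightarrow> src C f \<in> T0 \<Longrightarrow> tgt C f = Y \<Longrightarrow> pb f y = kz (src C f) \<Longrightarrow> j \<cdot> f = zero_arr C (src C f) Y'"
    "t \<in> T0 \<Longrightarrow> k \<in> K t \<Longrightarrow> \<exists>f \<in> Hom C t Y'. pb f y' = k"
    "approximable Y \<Longrightarrow> approximable Y'"
  using assms unfolding step_def Hom_iff by blast+

lemma tower_sequence:
  assumes "Y0 \<in> obj C" "y0 \<in> K Y0"
  obtains X x j where "X (0 :: nat) = Y0" "x 0 = y0" "\<And>n. X n \<in> obj C" "\<And>n. x n \<in> K (X n)"
    "\<And>n. step (X n) (x n) (X (Suc n)) (x (Suc n)) (j n)"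
    "\<And>n. approximable Y0 \<Longrightarrow> approximable (X n)"
proof -
  let ?P = "\<lambda>n z. fst z \<in> obj C \<and> snd z \<in> K (fst z) \<and> (n = (0 :: nat) \<longrightarrow> z = (Y0, y0))"
  let ?Q = "\<lambda>n :: nat. \<lambda>z z'. \<exists>j. step (fst z) (snd z) (fst z') (snd z') j"
  have "\<exists>f. \<forall>n. ?P n (f n) \<and> ?Q n (f n) (f (Suc n))"
  proof (rule dependent_nat_choice)
    show "\<exists>z. ?P 0 z" using assms by (intro exI[of _ "(Y0, y0)"]) simp
    fix z n assume z: "?P n z"
    then obtain Y' y' j where "step (fst z) (snd z) Y' y' j" using step_ex by blast
    then show "\<exists>z'. ?P (Suc n) z' \<and> ?Q n z z'"
      using stepD(1,2) by (intro exI[of _ "(Y', y')"]) auto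
  qed
  then obtain F where F: "\<And>n. ?P n (F n)" "\<And>n. ?Q n (F n) (F (Suc n))" by blast
  from choice[of "\<lambda>n j. step (fst (F n)) (snd (F n)) (fst (F (Suc n))) (snd (F (Suc n))) j"] F(2)
  obtain j where j: "\<forall>n. step (fst (F n)) (snd (F n)) (fst (F (Suc n))) (snd (F (Suc n))) (j n)" by blast
  have F0: "F 0 = (Y0, y0)" using F(1)[of 0] by blast
  have "approximable (fst (F n))" if "approximable Y0" for n
    by (induction n) (use F0 that stepD(9)[OF j[rule_format]] in auto)
  then show ?thesis
    by (intro that[of "\<lambda>n. fst (F n)" "\<lambda>n. snd (F n)" j]) (use F0 F(1) j in auto)
qed

text \<open>\<open>I\<close> is the homotopy colimit of the stages. An arrow from a compact object
  to \<open>I\<close> comes from some stage, and one from the core with trivial pullback dies at the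
  next stage.\<close>

lemma tower:
  assumes Y0: "Y0 \<in> obj C" "y0 \<in> K Y0"
  obtains I u i where "universal I u" "i \<in> arr C" "src C i = Y0" "tgt C i = I" "pb i u = y0"
    "approximable Y0 \<Longrightarrow> approximable I"
proof -
  obtain X x j where X0: "X (0 :: nat) = Y0" "x 0 = y0" and Xo: "\<And>n. X n \<in> obj C" and xK: "\<And>n. x n \<in> K (X n)"
    and st: "\<And>n. step (X n) (x n) (X (Suc n)) (x (Suc n)) (j n)"
    and ap: "\<And>n. approximable Y0 \<Longrightarrow> approximable (X n)" by (rule tower_sequence[OF Y0]) blast
  note s = stepD[OF st]
  have sN: "small \<kappa> (UNIV :: nat set)" by (rule small_countable) simp
  obtain Q \<iota> where cop: "is_coproduct C UNIV X Q \<iota>"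
    by (rule has_small_coproducts_any[OF inaccessible small_coproducts sN, of X]) (use Xo in auto)
  note c = coproductD[OF cop, simplified]
  obtain sh where sh: "sh \<in> arr C" "src C sh = Q" "tgt C sh = Q" "\<And>n. sh \<cdot> \<iota> n = \<iota> (Suc n) \<cdot> j n"
    using coproduct_ex[OF cop c(1), of "\<lambda>n. \<iota> (Suc n) \<cdot> j n"] c s(3-5) by auto
  \<comment> \<open>The identity minus the shift map of the tower; its cone is the homotopy colimit.
    The glued element \<open>w\<close> extends to the cone because \<open>x (Suc n)\<close> pulls
    back to \<open>x n\<close>.\<close>
  define d where "d = minus_arr C (idn C Q) sh"
  have d: "d \<in> arr C" "src C d = Q" "tgt C d = Q" using sh(1-3) c(1) by (auto simp: d_def)
  have di: "d \<cdot> \<iota> n = minus_arr C (\<iota> n) (\<iota> (Suc n) \<cdot> j n)" for n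
    unfolding d_def using sh c by (simp add: cmp_minus)
  obtain w where w: "w \<in> K Q" "\<And>n. pb (\<iota> n) w = x n"
    by (rule K_glue_any[OF sN cop, of x]) (use xK in auto)
  have "pb d w = kz Q"
  proof (rule K_separated_any[OF sN cop])
    show "pb d w \<in> K Q" using pb_in[of d w] d w(1) by simp
    fix n
    have "pb (\<iota> (Suc n) \<cdot> j n) w = pb (\<iota> n) w"
      using pb_cmp[of "j n" "\<iota> (Suc n)" w] c s(3-5) w s(6) by simp
    then have "pb (minus_arr C (\<iota> n) (\<iota> (Suc n) \<cdot> j n)) w = kz (X n)"
      using pb_minus[of "\<iota> n" "\<iota> (Suc n) \<cdot> j n" w] c s(3-5) w(1) by simp
    then show "pb (\<iota> n) (pb d w) = kz (X n)"
      using pb_cmp[of "\<iota> n" d w] c d w(1) di by simp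
  qed
  obtain p h where T: "(d, p, h) \<in> tri C" using tri_cone[OF d(1)] by blast
  note t = triD[OF T]
  define I where "I = tgt C p"
  have p: "p \<in> arr C" "src C p = Q" "tgt C p = I" using t d by (auto simp: I_def)
  have h: "h \<in> arr C" "src C h = I" "tgt C h = \<Sigma>\<^sub>o Q" using t d by (auto simp: I_def)
  have Io: "I \<in> obj C" using p by auto
  obtain u where u: "u \<in> K I" "pb p u = w"
    using K_exact[OF T, of w] w(1) d \<open>pb d w = kz Q\<close> by (auto simp: I_def)
  define i where "i n = p \<cdot> \<iota> n" for n
  have i: "i n \<in> arr C" "src C (i n) = X n" "tgt C (i n) = I" for n using c p by (auto simp: i_def)
  have iu: "pb (i n) u = x n" for n
    unfolding i_def using pb_cmp[of "\<iota> n" p u] c p u w(2) by simp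
  have pd: "p \<cdot> d = zero_arr C Q I" using tri_gf[OF T] d p by simp
  have ij: "i (Suc n) \<cdot> j n = i n" for n
  proof -
    have "p \<cdot> (d \<cdot> \<iota> n) = zero_arr C (X n) I"
      using cmp_reassoc[OF pd, of "\<iota> n"] c d p Io by simp
    then have "minus_arr C (i n) (i (Suc n) \<cdot> j n) = zero_arr C (X n) I"
      unfolding di i_def using c p s(3-5) by (simp add: cmp_minus)
    then show ?thesis
      using minus_eq_zero_iff[of "i n" "i (Suc n) \<cdot> j n"] i s(3-5) by simp
  qed
  \<comment> \<open>This brings two summands that arise at different stages to a common one.\<close>
  have up: "\<exists>g'. g' \<in> arr C \<and> src C g' = src C g \<and> tgt C g' = X m \<and> i m \<cdot> g' = i n \<cdot> g"
    if nm: "n \<le> m" and g: "g \<in> arr C" "tgt C g = X n" for n m g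
    using nm
  proof (induction m rule: dec_induct)
    case base show ?case using g by blast
  next
    case (step m)
    then obtain g' where g': "g' \<in> arr C" "src C g' = src C g" "tgt C g' = X m" "i m \<cdot> g' = i n \<cdot> g" by blast
    have "i (Suc m) \<cdot> (j m \<cdot> g') = i m \<cdot> g'"
      by (rule cmp_reassoc[OF ij]) (use g' s(3-5) i in auto)
    then show ?case using g' s(3-5) by (intro exI[of _ "j m \<cdot> g'"]) auto
  qed
  obtain \<pi> where \<pi>: "\<And>n. \<pi> n \<in> arr C" "\<And>n. src C (\<pi> n) = Q" "\<And>n. tgt C (\<pi> n) = X n"
    "\<And>n. \<pi> n \<cdot> \<iota> n = idn C (X n)" "\<And>n m. m \<noteq> n \<Longrightarrow> \<pi> n \<cdot> \<iota> m = zero_arr C (X m) (X n)"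
    using coproduct_proj[OF cop] by (metis UNIV_I)
  have \<pi>d: "(\<pi> n \<cdot> d) \<cdot> \<iota> m = minus_arr C (\<pi> n \<cdot> \<iota> m) ((\<pi> n \<cdot> \<iota> (Suc m)) \<cdot> j m)" for n m
    using \<pi>(1-3) d c s(3-5) by (simp add: di cmp_minus)
  \<comment> \<open>This identity and the next give the components of \<open>d\<close> recursively,
    so that the components of an arrow killed by \<open>d\<close> vanish one after another.\<close>
  have \<pi>0: "\<pi> 0 \<cdot> d = \<pi> 0"
  proof (rule coproduct_uniq[OF cop])
    fix m
    show "(\<pi> 0 \<cdot> d) \<cdot> \<iota> m = \<pi> 0 \<cdot> \<iota> m"
      unfolding \<pi>d \<pi>(5)[of "Suc m" 0, simplified] using \<pi>(1-3) c s(3-5) Xo by simp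
  qed (use \<pi>(1-3) d in auto)
  have \<pi>S: "\<pi> (Suc n) \<cdot> d = minus_arr C (\<pi> (Suc n)) (j n \<cdot> \<pi> n)" for n
  proof (rule coproduct_uniq[OF cop])
    fix m
    have "(\<pi> (Suc n) \<cdot> \<iota> (Suc m)) \<cdot> j m = j n \<cdot> (\<pi> n \<cdot> \<iota> m)"
    proof (cases "m = n")
      case True then show ?thesis using \<pi>(4) s(3-5) by simp
    next
      case False then show ?thesis using \<pi>(5)[of "Suc m" "Suc n"] \<pi>(5)[of m n] s(3-5) Xo by simp
    qed
    then show "(\<pi> (Suc n) \<cdot> d) \<cdot> \<iota> m = minus_arr C (\<pi> (Suc n)) (j n \<cdot> \<pi> n) \<cdot> \<iota> m"
      unfolding \<pi>d using \<pi>(1-3) c s(3-5) by (simp add: cmp_minus)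
  qed (use \<pi>(1-3) d s(3-5) in auto)
  \<comment> \<open>Compactness of the source makes \<open>y\<close> a finite sum; only therefore do
    its vanishing components force \<open>y\<close> to be zero.\<close>
  have inj: "y = zero_arr C (src C y) Q"
    if y: "y \<in> arr C" "tgt C y = Q" "compact_object \<kappa> C (src C y)" "d \<cdot> y = zero_arr C (src C y) Q" for y
  proof (rule finsum_eq_zero[OF cop])
    show W: "src C y \<in> obj C" using y by auto
    show "y \<in> finsum C UNIV X Q \<iota> (src C y)"
      by (rule compact_finsum[OF inaccessible y(3) sN cop]) (use y in auto)
    fix n q assume q: "q \<in> Hom C Q (X n)" "q \<cdot> \<iota> n = idn C (X n)"
        "\<And>i. i \<in> UNIV \<Longrightarrow> i \<noteq> n \<Longrightarrow> q \<cdot> \<iota> i = zero_arr C (X i) (X n)"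
    have "q = \<pi> n"
    proof (rule coproduct_uniq[OF cop])
      fix m show "q \<cdot> \<iota> m = \<pi> n \<cdot> \<iota> m" using q(2,3) \<pi>(4,5) by (cases "m = n") auto
    qed (use q(1) \<pi>(1-3) in auto)
    moreover have "\<pi> n \<cdot> y = zero_arr C (src C y) (X n)"
    proof (induction n)
      case 0
      have "\<pi> 0 \<cdot> y = \<pi> 0 \<cdot> (d \<cdot> y)" using cmp_reassoc[OF \<pi>0, of y] y \<pi>(1-3) d by simp
      then show ?case using y(4) \<pi>(1-3) W by simp
    next
      case (Suc n)
      have "minus_arr C (\<pi> (Suc n)) (j n \<cdot> \<pi> n) \<cdot> y = \<pi> (Suc n) \<cdot> (d \<cdot> y)"
        using cmp_reassoc[OF \<pi>S, of y n] y(1,2) \<pi>(1-3) d by simp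
      also have "\<dots> = zero_arr C (src C y) (X (Suc n))" using y(4) \<pi>(1-3) W by simp
      finally show ?case using y(1,2) \<pi>(1-3) s(3-5) Suc W Xo by (simp add: cmp_minus)
    qed
    ultimately show "q \<cdot> y = zero_arr C (src C y) (X n)" by simp
  qed
  \<comment> \<open>The composite \<open>h \<cdot> f\<close> desuspends to an arrow killed by
    \<open>d\<close>, hence is zero by \<open>inj\<close>. So \<open>f\<close> lifts to the
    coproduct, where it is a finite sum, and the finitely many summands are moved to one
    stage.\<close>
  have factor: "\<exists>n g. g \<in> arr C \<and> src C g = src C f \<and> tgt C g = X n \<and> i n \<cdot> g = f"
    if f: "f \<in> arr C" "compact_object \<kappa> C (src C f)" "tgt C f = I" for f
  proof -
    define W where "W = src C f"
    have Wo: "W \<in> obj C" "compact_object \<kappa> C W" "src C f = W" using f by (auto simp: W_def)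
    obtain V \<theta> where V: "V \<in> obj C" "iso_arr C \<theta>" "src C \<theta> = \<Sigma>\<^sub>o V" "tgt C \<theta> = W"
      by (rule desuspension[OF Wo(1)])
    have "retract C (\<Sigma>\<^sub>o V) W" using iso_retract(1)[OF V(2)] V by simp
    then have Vc: "compact_object \<kappa> C V" using compact_unshift[OF compact_retract[OF Wo(2)] V(1)] by blast
    obtain y where y: "y \<in> arr C" "src C y = V" "tgt C y = Q" "\<Sigma>\<^sub>m y = h \<cdot> (f \<cdot> \<theta>)"
      by (rule shift_full[of "h \<cdot> (f \<cdot> \<theta>)" V Q]) (use f h V Wo c(1) in auto)
    have dh: "\<Sigma>\<^sub>m d \<cdot> h = zero_arr C I (\<Sigma>\<^sub>o Q)" using tri_shift_zero[OF T] d p by simp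
    have "\<Sigma>\<^sub>m (d \<cdot> y) = \<Sigma>\<^sub>m d \<cdot> (h \<cdot> (f \<cdot> \<theta>))" using y d by (simp add: shift_cmp)
    also have "\<dots> = zero_arr C I (\<Sigma>\<^sub>o Q) \<cdot> (f \<cdot> \<theta>)"
      by (rule cmp_reassoc[OF dh]) (use f V Wo h d in auto)
    also have "\<dots> = \<Sigma>\<^sub>m (zero_arr C V Q)" using f V Wo c(1) by simp
    finally have "d \<cdot> y = zero_arr C V Q" using y d V(1) c(1) by - (rule shift_faithful, auto)
    then have "y = zero_arr C V Q" using inj[of y] y Vc by simp
    then have "h \<cdot> (f \<cdot> \<theta>) = zero_arr C (\<Sigma>\<^sub>o V) (\<Sigma>\<^sub>o Q)" using y(4) V(1) c(1) by simp
    then have "(h \<cdot> f) \<cdot> \<theta> = zero_arr C W (\<Sigma>\<^sub>o Q) \<cdot> \<theta>" using f h V Wo c(1) by simp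
    then have hf: "h \<cdot> f = zero_arr C W (\<Sigma>\<^sub>o Q)"
      by (rule iso_epi[OF V(2), rotated -1]) (use f h V Wo c(1) in auto)
    obtain l where l: "l \<in> arr C" "src C l = W" "tgt C l = Q" "p \<cdot> l = f"
      using weak_kernel[OF tri_rot[OF T], of f] f Wo p h hf by auto
    have "l \<in> finsum C UNIV X Q \<iota> W"
      by (rule compact_finsum[OF inaccessible Wo(2) sN cop]) (use l in auto)
    then have "\<exists>n g. g \<in> arr C \<and> src C g = W \<and> tgt C g = X n \<and> i n \<cdot> g = p \<cdot> l"
    proof induction
      case finsum_zero
      show ?case
        by (rule exI[of _ 0], rule exI[of _ "zero_arr C W (X 0)"]) (use Wo Xo p i Io c(1) in auto)
    next
      case (finsum_insert m a l)
      have lH: "l \<in> arr C" "src C l = W" "tgt C l = Q" using finsum_Hom[OF finsum_insert(3) cop Wo(1)] by auto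
      have a: "a \<in> arr C" "src C a = W" "tgt C a = X m" using finsum_insert(2) by auto
      from finsum_insert.IH obtain n g where g: "g \<in> arr C" "src C g = W" "tgt C g = X n" "i n \<cdot> g = p \<cdot> l"
        by (elim exE conjE)
      obtain a' where a': "a' \<in> arr C" "src C a' = W" "tgt C a' = X (max m n)" "i (max m n) \<cdot> a' = i m \<cdot> a"
        using up[of m "max m n" a] a by auto
      obtain g' where g': "g' \<in> arr C" "src C g' = W" "tgt C g' = X (max m n)" "i (max m n) \<cdot> g' = i n \<cdot> g"
        using up[of n "max m n" g] g(1-3) by auto
      have "i (max m n) \<cdot> plus_arr C a' g' = plus_arr C (i m \<cdot> a) (p \<cdot> l)"
        using a' g' i g(4) by (simp add: cmp_plus_arr)
      also have "\<dots> = p \<cdot> plus_arr C (\<iota> m \<cdot> a) l"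
        unfolding i_def using p c a lH by (simp add: cmp_plus_arr)
      finally show ?case using a'(1-3) g'(1-3)
        by (intro exI[of _ "max m n"] exI[of _ "plus_arr C a' g'"]) auto
    qed
    then show ?thesis unfolding l(4) Wo(3) .
  qed
  have "universal I u"
    unfolding universal_def
  proof (intro conjI ballI allI impI)
    show "I \<in> obj C" "u \<in> K I" by fact+
    fix t k assume tk: "t \<in> T0" "k \<in> K t"
    \<comment> \<open>Stage 0 is the arbitrary starting object; values are realized from stage 1
      on.\<close>
    obtain f where f: "f \<in> Hom C t (X (Suc 0))" "pb f (x (Suc 0)) = k" using s(8)[OF tk, of 0] by blast
    have "pb (i (Suc 0) \<cdot> f) u = k" using pb_cmp[of f "i (Suc 0)" u] f i u(1) iu by auto
    then show "\<exists>f \<in> Hom C t I. pb f u = k"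
      using f i by (intro bexI[of _ "i (Suc 0) \<cdot> f"]) auto
  next
    fix f assume f: "f \<in> arr C \<and> src C f \<in> T0 \<and> tgt C f = I \<and> pb f u = kz (src C f)"
    then obtain n g where g: "g \<in> arr C" "src C g = src C f" "tgt C g = X n" "i n \<cdot> g = f"
      using factor[of f] core_compact by blast
    have "pb g (x n) = kz (src C g)" using pb_cmp[of g "i n" u] g i u(1) iu f by simp
    then have "j n \<cdot> g = zero_arr C (src C g) (X (Suc n))" using s(7)[of g n] g f by simp
    moreover have "src C f \<in> obj C" using f by auto
    ultimately have "i (Suc n) \<cdot> (j n \<cdot> g) = zero_arr C (src C g) I" using i g Xo by simp
    moreover have "i (Suc n) \<cdot> (j n \<cdot> g) = i n \<cdot> g"
      by (rule cmp_reassoc[OF ij]) (use g s(3-5) i in auto)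
    ultimately show "f = zero_arr C (src C f) I" using g by simp
  qed
  moreover have "approximable I" if a0: "approximable Y0"
  proof (rule approximableI[OF Io])
    fix f assume f: "f \<in> arr C" "compact_object \<kappa> C (src C f)" "tgt C f = I"
    obtain n g where g: "g \<in> arr C" "src C g = src C f" "tgt C g = X n" "i n \<cdot> g = f"
      using factor[OF f] by blast
    obtain a b where ab: "a \<in> arr C" "b \<in> arr C" "src C a = src C g" "tgt C a \<in> T0" "src C b = tgt C a"
      "tgt C b = X n" "b \<cdot> a = g"
      by (rule approximableE[OF ap[OF a0] g(1) _ g(3)]) (use f g in auto)
    have "(i n \<cdot> b) \<cdot> a = f" using ab(1-6) i by (simp add: ab(7) g(4))
    then show "\<exists>a b. a \<in> arr C \<and> b \<in> arr C \<and> src C a = src C f \<and> tgt C a \<in> T0 \<and> src C b = tgt C a \<and>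
        tgt C b = I \<and> b \<cdot> a = f"
      using ab(1-6) i g(2) by (intro exI[of _ a] exI[of _ "i n \<cdot> b"]) auto
  qed
  ultimately show ?thesis
    using i[of 0] iu[of 0] X0 by (intro that[of I u "i 0"]) auto
qed

text \<open>The cone of \<open>e\<close> receives only zero arrows from the core. The connecting map
  sends such an arrow to the suspension of an arrow into \<open>I\<close> with trivial pullback,
  hence to zero, so it lifts to \<open>I'\<close>. The lift has the same pullback as an arrow that
  factors through \<open>e\<close>, therefore equals it, and dies in the cone.\<close>

lemma universal_iso:
  assumes U: "universal I u" and U': "universal I' u'" and e: "e \<in> arr C" "src C e = I" "tgt C e = I'" "pb e u' = u"
  shows "iso_arr C e"
proof -
  obtain g h where T: "(e, g, h) \<in> tri C" using tri_cone[OF e(1)] by blast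
  note t = triD[OF T]
  note u = universalD[OF U] and u' = universalD[OF U']
  have "zero_object C (tgt C g)"
  proof (rule core_generates)
    show "tgt C g \<in> obj C" using t by auto
    fix l assume l: "l \<in> arr C" "src C l \<in> T0" "tgt C l = tgt C g"
    define W where "W = src C l"
    have W: "W \<in> T0" "W \<in> obj C" "src C l = W" using l core_obj by (auto simp: W_def)
    obtain V \<theta> where V: "V \<in> T0" "iso_arr C \<theta>" "src C \<theta> = \<Sigma>\<^sub>o V" "tgt C \<theta> = W"
      using core_unshift[OF W(1)] by blast
    have Vo: "V \<in> obj C" by (rule core_obj[OF V(1)])
    obtain y where y: "y \<in> arr C" "src C y = V" "tgt C y = I" "\<Sigma>\<^sub>m y = h \<cdot> (l \<cdot> \<theta>)"
      by (rule shift_full[of "h \<cdot> (l \<cdot> \<theta>)" V I]) (use l t e V Vo W u(1) in auto)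
    have eh: "\<Sigma>\<^sub>m e \<cdot> h = zero_arr C (tgt C g) (\<Sigma>\<^sub>o I')" using tri_shift_zero[OF T] e by simp
    have "\<Sigma>\<^sub>m (e \<cdot> y) = \<Sigma>\<^sub>m e \<cdot> (h \<cdot> (l \<cdot> \<theta>))" using y e by (simp add: shift_cmp)
    also have "\<dots> = zero_arr C (tgt C g) (\<Sigma>\<^sub>o I') \<cdot> (l \<cdot> \<theta>)"
      by (rule cmp_reassoc[OF eh]) (use l V W t e in auto)
    also have "\<dots> = \<Sigma>\<^sub>m (zero_arr C V I')" using l V Vo W u'(1) by simp
    finally have ey: "e \<cdot> y = zero_arr C V I'" using y e Vo u'(1) by - (rule shift_faithful, auto)
    have "pb y u = kz V"
      using pb_cmp[of y e u'] y e u'(2) ey pb_zero[OF Vo u'(1,2)] by simp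
    then have "y = zero_arr C V I" using u(3)[of y] y V by simp
    then have "h \<cdot> (l \<cdot> \<theta>) = zero_arr C (\<Sigma>\<^sub>o V) (\<Sigma>\<^sub>o I)" using y(4) Vo u(1) by simp
    then have "(h \<cdot> l) \<cdot> \<theta> = zero_arr C W (\<Sigma>\<^sub>o I) \<cdot> \<theta>" using l t e V W u(1) by simp
    then have "h \<cdot> l = zero_arr C W (\<Sigma>\<^sub>o I)"
      by (rule iso_epi[OF V(2), rotated -1]) (use l t e V W u(1) in auto)
    then obtain m where m: "m \<in> arr C" "src C m = W" "tgt C m = I'" "g \<cdot> m = l"
      using weak_kernel[OF tri_rot[OF T], of l] l t e W by auto
    have "pb m u' \<in> K W" using pb_in[of m u'] m u'(2) by simp
    then obtain m' where m': "m' \<in> arr C" "src C m' = W" "tgt C m' = I" "pb m' u = pb m u'"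
      using universal_lift[OF U W(1)] by blast
    have "pb (e \<cdot> m') u' = pb m u'" using pb_cmp[of m' e u'] m' e u'(2) by simp
    then have "pb (minus_arr C m (e \<cdot> m')) u' = kz W"
      using pb_minus[of m "e \<cdot> m'" u'] m m' e u'(2) by simp
    then have "minus_arr C m (e \<cdot> m') = zero_arr C W I'"
      using u'(3)[of "minus_arr C m (e \<cdot> m')"] m m' e W by simp
    then have "m = e \<cdot> m'" using minus_eq_zero_iff[of m "e \<cdot> m'"] m m' e by simp
    then have "l = g \<cdot> (e \<cdot> m')" using m(4) by simp
    also have "\<dots> = zero_arr C I (tgt C g) \<cdot> m'"
      by (rule cmp_reassoc) (use tri_gf[OF T] e t m' in auto)
    finally show "l = zero_arr C (src C l) (tgt C g)" using m' t W by simp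
  qed
  then show ?thesis by (rule iso_of_zero_cone[OF T])
qed

lemma universal_ex:
  assumes "Y0 \<in> obj C" "y0 \<in> K Y0"
  obtains I u where "universal I u" "approximable Y0 \<Longrightarrow> approximable I"
  using tower[OF assms] by blast

text \<open>The tower is started at the coproduct of \<open>I\<close> and \<open>X\<close> with the
  element glued from \<open>u\<close> and \<open>x\<close>. The part
  \<open>I \<rightarrow> I'\<close> is invertible by \<open>universal_iso\<close>, and its inverse
  brings the part of \<open>X\<close> back to \<open>I\<close>.\<close>

lemma universal_weakly_terminal:
  assumes U: "universal I u" and X: "X \<in> obj C" "x \<in> K X"
  obtains f where "f \<in> arr C" "src C f = X" "tgt C f = I" "pb f u = x"
proof -
  note u = universalD[OF U]
  define Y where "Y b = (if b then I else X)" for b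
  define y where "y b = (if b then u else x)" for b
  have sB: "small \<kappa> (UNIV :: bool set)" by (rule small_countable) simp
  obtain Q \<iota> where cop: "is_coproduct C UNIV Y Q \<iota>"
    by (rule has_small_coproducts_any[OF inaccessible small_coproducts sB, of Y]) (use X u in \<open>auto simp: Y_def\<close>)
  note c = coproductD[OF cop, simplified]
  obtain z where z: "z \<in> K Q" "\<And>b. pb (\<iota> b) z = y b"
    by (rule K_glue_any[OF sB cop, of y]) (use X u in \<open>auto simp: Y_def y_def\<close>)
  obtain I' u' i where U': "universal I' u'" and i: "i \<in> arr C" "src C i = Q" "tgt C i = I'" "pb i u' = z"
    by (rule tower[OF c(1) z(1)]) blast
  note u' = universalD[OF U']
  have iT: "\<iota> True \<in> arr C" "src C (\<iota> True) = I" "tgt C (\<iota> True) = Q"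
    and iF: "\<iota> False \<in> arr C" "src C (\<iota> False) = X" "tgt C (\<iota> False) = Q" using c by (auto simp: Y_def)
  define e where "e = i \<cdot> \<iota> True"
  have e: "e \<in> arr C" "src C e = I" "tgt C e = I'" using i iT by (auto simp: e_def)
  have eu: "pb e u' = u"
    unfolding e_def using pb_cmp[of "\<iota> True" i u'] i iT u'(2) z(2)[of True] by (simp add: y_def)
  have iso: "iso_arr C e" by (rule universal_iso[OF U U' e eu])
  have "pb (inv_arr C e) u = pb (e \<cdot> inv_arr C e) u'"
    using pb_cmp[of "inv_arr C e" e u'] iso e u'(2) eu by simp
  also have "\<dots> = u'" using iso e pb_idn[OF u'(1,2)] by simp
  finally have inv: "pb (inv_arr C e) u = u'" .
  let ?f = "inv_arr C e \<cdot> (i \<cdot> \<iota> False)"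
  have "pb ?f u = pb (i \<cdot> \<iota> False) u'"
    using pb_cmp[of "i \<cdot> \<iota> False" "inv_arr C e" u] iso e i iF u(2) inv by simp
  also have "\<dots> = x" using pb_cmp[of "\<iota> False" i u'] i iF u'(2) z(2)[of False] by (simp add: y_def)
  finally show ?thesis by (intro that[of ?f]) (use iso e i iF in auto)
qed

end

section \<open>Compact objects as retracts of core objects\<close>

context triangulated_core
begin

lemma representable_cohomological:
  assumes X: "X \<in> obj C"
  shows "cohomological C \<kappa> T0 (\<lambda>Y. Hom C Y X) (\<lambda>f y. y \<cdot> f) (\<lambda>Y. zero_arr C Y X)"
proof unfold_locales
  show "y \<cdot> f \<in> Hom C (src C f) X" if "f \<in> arr C" "y \<in> Hom C (tgt C f) X" for f y using that by auto
  show "y \<cdot> idn C Y = y" if "Y \<in> obj C" "y \<in> Hom C Y X" for Y y using that by auto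
  show "y \<cdot> g \<cdot> f = (y \<cdot> g) \<cdot> f" if "f \<in> arr C" "g \<in> arr C" "tgt C f = src C g" "y \<in> Hom C (tgt C g) X" for f g y
    using that by auto
  show "y \<cdot> zero_arr C Y Z = zero_arr C Y X" if "Y \<in> obj C" "Z \<in> obj C" "y \<in> Hom C Z X" for Y Z y
    using that by auto
  show "y \<cdot> minus_arr C f g = zero_arr C (src C g) X"
    if "f \<in> arr C" "g \<in> arr C" "src C f = src C g" "tgt C f = tgt C g" "y \<in> Hom C (tgt C g) X" "y \<cdot> f = y \<cdot> g" for f g y
    using that by (simp add: cmp_minus)
  show "\<exists>z \<in> Hom C Q X. \<forall>j \<in> J. z \<cdot> \<iota> j = x j"
    if "small \<kappa> J" and cop: "is_coproduct C J Y Q \<iota>" and x: "\<And>j. j \<in> J \<Longrightarrow> x j \<in> Hom C (Y j) X" for J :: "'u set" and Y Q \<iota> x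
  proof -
    obtain u where "u \<in> arr C" "src C u = Q" "tgt C u = X" "\<And>j. j \<in> J \<Longrightarrow> u \<cdot> \<iota> j = x j"
      using coproduct_ex[OF cop X x] by blast
    then show ?thesis by (intro bexI[of _ u]) auto
  qed
  show "z = zero_arr C Q X"
    if "small \<kappa> J" and cop: "is_coproduct C J Y Q \<iota>" and z: "z \<in> Hom C Q X"
      "\<And>j. j \<in> J \<Longrightarrow> z \<cdot> \<iota> j = zero_arr C (Y j) X" for J :: "'u set" and Y Q \<iota> z
    by (rule coproduct_uniq[OF cop]) (use z X coproductD[OF cop] in auto)
  show "\<exists>z \<in> Hom C (tgt C g) X. z \<cdot> g = y"
    if T: "(f, g, h) \<in> tri C" and y: "y \<in> Hom C (tgt C f) X" "y \<cdot> f = zero_arr C (src C f) X" for f g h y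
  proof -
    obtain w where "w \<in> arr C" "src C w = tgt C g" "tgt C w = tgt C y" "w \<cdot> g = y"
      by (rule weak_cokernel[OF T, of y]) (use y in auto)
    then show ?thesis using y by (intro bexI[of _ w]) auto
  qed
  show "small \<kappa> (Hom C t X)" if "t \<in> T0" for t
    using core_obj[OF that] X locally_small unfolding locally_small_def by blast
qed

text \<open>\<open>X\<close> represents its own Hom functor. The tower for this functor, started at
  a core object, ends at an approximable object isomorphic to \<open>X\<close>, and the isomorphism,
  having compact source, factors through the core.\<close>

lemma compact_retract_core:
  assumes "compact_object \<kappa> C X"
  obtains t where "t \<in> T0" "retract C X t"
proof -
  have X: "X \<in> obj C" by (rule compact_obj[OF assms])
  interpret K: cohomological C \<kappa> T0 "\<lambda>Y. Hom C Y X" "\<lambda>f y. y \<cdot> f" "\<lambda>Y. zero_arr C Y X"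
    by (rule representable_cohomological[OF X])
  obtain Z where Z: "Z \<in> T0" using core_zero by blast
  have Zo: "Z \<in> obj C" by (rule core_obj[OF Z])
  obtain I u where U: "K.universal I u" and A: "approximable I"
    by (rule K.universal_ex[of Z "zero_arr C Z X"]) (use Zo X approximable_core[OF Z] in auto)
  have u: "u \<in> arr C" "src C u = I" "tgt C u = X" using K.universalD(2)[OF U] by auto
  have "K.universal X (idn C X)"
    unfolding K.universal_def
  proof (intro conjI ballI allI impI)
    show "X \<in> obj C" "idn C X \<in> Hom C X X" using X by auto
    show "\<exists>f \<in> Hom C t X. idn C X \<cdot> f = k" if "k \<in> Hom C t X" for t k
      using that by (intro bexI[of _ k]) auto
    show "f = zero_arr C (src C f) X"
      if "f \<in> arr C \<and> src C f \<in> T0 \<and> tgt C f = X \<and> idn C X \<cdot> f = zero_arr C (src C f) X" for f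
      using that by auto
  qed
  then have iso: "iso_arr C u" by (rule K.universal_iso[OF U]) (use u in auto)
  obtain a b where ab: "a \<in> arr C" "b \<in> arr C" "src C a = X" "tgt C a \<in> T0" "src C b = tgt C a"
    "tgt C b = I" "b \<cdot> a = inv_arr C u"
    using approximableE[OF A, of "inv_arr C u"] iso u assms by auto
  have "(u \<cdot> b) \<cdot> a = idn C X" using ab(1-6) u iso by (simp add: ab(7))
  then have "retract C X (tgt C a)" using ab(1-6) u by (intro retractI[of a "u \<cdot> b"]) auto
  then show ?thesis using that ab(4) by blast
qed

end

section \<open>Characters of commutative monoids\<close>

text \<open>A copy of Q/Z inside the complex numbers, written multiplicatively.\<close>

definition roots_of_unity :: "complex set" where
  "roots_of_unity = {z. \<exists>n > 0. z ^ n = 1}"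

lemma roots_of_unity_simps [simp]:
  "1 \<in> roots_of_unity"
  "z \<in> roots_of_unity \<Longrightarrow> w \<in> roots_of_unity \<Longrightarrow> z * w \<in> roots_of_unity"
  "z \<in> roots_of_unity \<Longrightarrow> z ^ k \<in> roots_of_unity"
  "z \<in> roots_of_unity \<Longrightarrow> w \<in> roots_of_unity \<Longrightarrow> z / w \<in> roots_of_unity"
proof -
  show "1 \<in> roots_of_unity" unfolding roots_of_unity_def by (auto intro: exI[of _ 1])
  show "z ^ k \<in> roots_of_unity" if z: "z \<in> roots_of_unity"
  proof -
    obtain m where "m > 0" "z ^ m = 1" using z unfolding roots_of_unity_def by blast
    then have "(z ^ k) ^ m = 1" by (metis mult.commute power_mult power_one)
    then show ?thesis using \<open>m > 0\<close> unfolding roots_of_unity_def by blast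
  qed
  have *: "\<exists>m > 0. z ^ m = 1 \<and> w ^ m = 1" if zw: "z \<in> roots_of_unity" "w \<in> roots_of_unity"
  proof -
    obtain m n where "m > 0" "z ^ m = 1" "n > 0" "w ^ n = 1"
      using zw unfolding roots_of_unity_def by blast
    then have "z ^ (m * n) = 1 \<and> w ^ (m * n) = 1"
      by (metis mult.commute power_mult power_one)
    then show ?thesis using \<open>m > 0\<close> \<open>n > 0\<close> by (intro exI[of _ "m * n"]) auto
  qed
  show "z * w \<in> roots_of_unity" if zw: "z \<in> roots_of_unity" "w \<in> roots_of_unity"
  proof -
    obtain m where "m > 0" "z ^ m = 1" "w ^ m = 1" using *[OF zw] by blast
    then have "m > 0 \<and> (z * w) ^ m = 1" by (simp add: power_mult_distrib)
    then show ?thesis unfolding roots_of_unity_def by blast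
  qed
  show "z / w \<in> roots_of_unity" if zw: "z \<in> roots_of_unity" "w \<in> roots_of_unity"
  proof -
    obtain m where "m > 0" "z ^ m = 1" "w ^ m = 1" using *[OF zw] by blast
    then have "m > 0 \<and> (z / w) ^ m = 1" by (simp add: power_divide)
    then show ?thesis unfolding roots_of_unity_def by blast
  qed
qed

lemma roots_of_unity_nonzero [simp]: "z \<in> roots_of_unity \<Longrightarrow> z \<noteq> 0"
  by (auto simp: roots_of_unity_def zero_power)

lemma roots_of_unity_prod: "(\<And>a. a \<in> A \<Longrightarrow> f a \<in> roots_of_unity) \<Longrightarrow> prod f A \<in> roots_of_unity"
  by (induction A rule: infinite_finite_induct) auto

lemma roots_of_unity_divisible:
  assumes v: "v \<in> roots_of_unity" and k: "k > 0"
  obtains d where "d \<in> roots_of_unity" "d ^ k = v"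
proof -
  have "v = rcis (root k (cmod v)) (Arg v / k) ^ k"
    unfolding DeMoivre2 using k by (simp add: real_root_pow_pos2 rcis_cmod_Arg)
  then obtain w where w: "v = w ^ k" by blast
  obtain n where "n > 0" "v ^ n = 1" using v unfolding roots_of_unity_def by blast
  then have "w ^ (k * n) = 1" "k * n > 0" using w k by (auto simp: power_mult)
  then have "w \<in> roots_of_unity" unfolding roots_of_unity_def by blast
  then show ?thesis using w by (intro that[of w]) auto
qed

lemma countable_roots_of_unity: "countable roots_of_unity"
proof -
  have "roots_of_unity \<subseteq> (\<Union>n \<in> {0<..}. {z. z ^ n = 1})" by (auto simp: roots_of_unity_def)
  moreover have "countable (\<Union>n \<in> {0<..}. {z :: complex. z ^ n = 1})"
    by (rule countable_UN) (auto intro: countable_finite)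
  ultimately show ?thesis by (rule countable_subset)
qed

text \<open>Encoding by a set of pairs makes extension the same as inclusion, as Zorn's lemma wants.
  The last clause makes the values depend only on the classes in the group completion; this includes
  single-valuedness.\<close>

definition partial_character :: "('a, 'b) monoid_scheme \<Rightarrow> ('a \<times> complex) set \<Rightarrow> bool" where
  "partial_character M P \<longleftrightarrow> P \<subseteq> carrier M \<times> roots_of_unity \<and> (\<one>\<^bsub>M\<^esub>, 1) \<in> P \<and>
     (\<forall>m v n w. (m, v) \<in> P \<and> (n, w) \<in> P \<longrightarrow> (m \<otimes>\<^bsub>M\<^esub> n, v * w) \<in> P) \<and>
     (\<forall>m v n w e. (m, v) \<in> P \<and> (n, w) \<in> P \<and> e \<in> carrier M \<and> m \<otimes>\<^bsub>M\<^esub> e = n \<otimes>\<^bsub>M\<^esub> e \<longrightarrow> v = w)"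

context comm_monoid
begin

lemma partial_characterD:
  assumes "partial_character G P"
  shows "(m, v) \<in> P \<Longrightarrow> m \<in> carrier G" "(m, v) \<in> P \<Longrightarrow> v \<in> roots_of_unity" "(\<one>, 1) \<in> P"
    "(m, v) \<in> P \<Longrightarrow> (n, w) \<in> P \<Longrightarrow> (m \<otimes> n, v * w) \<in> P"
    "(m, v) \<in> P \<Longrightarrow> (n, w) \<in> P \<Longrightarrow> e \<in> carrier G \<Longrightarrow> m \<otimes> e = n \<otimes> e \<Longrightarrow> v = w"
  using assms unfolding partial_character_def by blast+

text \<open>New elements are products with a power of \<open>z\<close>. When two of them are
  compared, the smaller power is absorbed into the cancelled factor \<open>e\<close>, and
  \<open>H\<close> is exactly what remains.\<close>

lemma partial_character_extend:
  assumes P: "partial_character G P" and z: "z \<in> carrier G" and d: "d \<in> roots_of_unity"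
    and H: "\<And>k m v n w e. (m, v) \<in> P \<Longrightarrow> (n, w) \<in> P \<Longrightarrow> e \<in> carrier G \<Longrightarrow>
      m \<otimes> z [^] (k :: nat) \<otimes> e = n \<otimes> e \<Longrightarrow> v * d ^ k = w"
  obtains P' where "partial_character G P'" "P \<subseteq> P'" "(z, d) \<in> P'"
proof -
  note D = partial_characterD[OF P]
  define P' where "P' = {(m \<otimes> z [^] k, v * d ^ k) | m v (k :: nat). (m, v) \<in> P}"
  have sep: "v * d ^ k = w * d ^ l"
    if mn: "(m, v) \<in> P" "(n, w) \<in> P" "e \<in> carrier G" "m \<otimes> z [^] k \<otimes> e = n \<otimes> z [^] l \<otimes> e" "l \<le> k"
    for m v n w e and k l :: nat
  proof -
    have c: "m \<in> carrier G" "n \<in> carrier G" using D(1) mn by auto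
    have "z [^] k = z [^] (k - l) \<otimes> z [^] l" using z mn(5) by (simp add: nat_pow_mult)
    then have "m \<otimes> z [^] (k - l) \<otimes> (z [^] l \<otimes> e) = n \<otimes> (z [^] l \<otimes> e)"
      using mn(3,4) c z by (simp add: m_assoc)
    then have "v * d ^ (k - l) = w" using H[OF mn(1,2), of "z [^] l \<otimes> e" "k - l"] mn(3) z by simp
    then show ?thesis using mn(5) by (metis le_add_diff_inverse2 mult.assoc power_add)
  qed
  have "partial_character G P'"
    unfolding partial_character_def
  proof (intro conjI allI impI)
    show "P' \<subseteq> carrier G \<times> roots_of_unity" using D(1,2) z d by (auto simp: P'_def)
    show "(\<one>, 1) \<in> P'" unfolding P'_def using D(3) by (auto intro!: exI[of _ \<one>] exI[of _ 1] exI[of _ "0 :: nat"])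
    show "(m \<otimes> n, v * w) \<in> P'" if "(m, v) \<in> P' \<and> (n, w) \<in> P'" for m v n w
    proof -
      obtain m' v' k n' w' l where e: "(m', v') \<in> P" "m = m' \<otimes> z [^] (k :: nat)" "v = v' * d ^ k"
        "(n', w') \<in> P" "n = n' \<otimes> z [^] (l :: nat)" "w = w' * d ^ l"
        using \<open>(m, v) \<in> P' \<and> (n, w) \<in> P'\<close> unfolding P'_def by blast
      have "m \<otimes> n = (m' \<otimes> n') \<otimes> z [^] (k + l)"
        unfolding e using D(1)[OF e(1)] D(1)[OF e(4)] z by (simp add: nat_pow_mult[symmetric] m_ac)
      moreover have "v * w = (v' * w') * d ^ (k + l)" unfolding e by (simp add: power_add)
      ultimately show ?thesis unfolding P'_def using D(4)[OF e(1,4)] by blast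
    qed
    show "v = w" if mn: "(m, v) \<in> P' \<and> (n, w) \<in> P' \<and> e \<in> carrier G \<and> m \<otimes> e = n \<otimes> e" for m v n w e
    proof -
      obtain m' v' k n' w' l where e: "(m', v') \<in> P" "m = m' \<otimes> z [^] (k :: nat)" "v = v' * d ^ k"
        "(n', w') \<in> P" "n = n' \<otimes> z [^] (l :: nat)" "w = w' * d ^ l"
        using mn unfolding P'_def by blast
      have ec: "e \<in> carrier G" "m' \<otimes> z [^] k \<otimes> e = n' \<otimes> z [^] l \<otimes> e" using mn unfolding e(2,5) by auto
      show ?thesis
      proof (cases "l \<le> k")
        case True then show ?thesis unfolding e(3,6) by (rule sep[OF e(1,4) ec])
      next
        case False
        then have "k \<le> l" by simp
        then show ?thesis unfolding e(3,6) by (rule sep[OF e(4,1) ec(1) ec(2)[symmetric], symmetric])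
      qed
    qed
  qed
  moreover have "P \<subseteq> P'"
  proof (rule subrelI)
    fix m v assume "(m, v) \<in> P"
    then show "(m, v) \<in> P'" unfolding P'_def using D(1)
      by (auto intro!: exI[of _ m] exI[of _ v] exI[of _ "0 :: nat"])
  qed
  moreover have "(z, d) \<in> P'" unfolding P'_def using D(3) z
    by (auto intro!: exI[of _ \<one>] exI[of _ 1] exI[of _ "1 :: nat"])
  ultimately show ?thesis by (rule that)
qed

text \<open>The exponents at which a value is forced on a power of \<open>z\<close> are closed under
  differences, so all of them follow from the least positive one, and divisibility provides a root
  of the value forced there.\<close>

lemma partial_character_extend_exists:
  assumes P: "partial_character G P" and z: "z \<in> carrier G"
  obtains P' d where "partial_character G P'" "P \<subseteq> P'" "(z, d) \<in> P'"
proof -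
  note D = partial_characterD[OF P]
  \<comment> \<open>\<open>R k u\<close> says that the values on \<open>P\<close> force the value
    \<open>u\<close> at the power of \<open>z\<close> with exponent \<open>k\<close>.\<close>
  define R where "R k u \<longleftrightarrow> (\<exists>m v n w e. (m, v) \<in> P \<and> (n, w) \<in> P \<and> e \<in> carrier G \<and>
      m \<otimes> z [^] k \<otimes> e = n \<otimes> e \<and> u = w / v)" for k :: nat and u
  have R0: "u = 1" if R: "R 0 u" for u
  proof -
    obtain m v n w e where "(m, v) \<in> P" "(n, w) \<in> P" "e \<in> carrier G" "m \<otimes> z [^] (0::nat) \<otimes> e = n \<otimes> e" "u = w / v"
      using R unfolding R_def by blast
    then have "v = w" using D(5)[of m v n w e] D(1)[of m v] by simp
    then show ?thesis using \<open>u = w / v\<close> D(2)[OF \<open>(m, v) \<in> P\<close>] by simp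
  qed
  have RD: "u \<in> roots_of_unity" if "R k u" for k u
    using that D(2) unfolding R_def by auto
  have Rdiff: "R (k - l) (u / u')" if R: "R k u" "R l u'" "l \<le> k" for k l u u'
  proof -
    obtain m v n w e where 1: "(m, v) \<in> P" "(n, w) \<in> P" "e \<in> carrier G" "m \<otimes> z [^] k \<otimes> e = n \<otimes> e" "u = w / v"
      using R(1) unfolding R_def by blast
    obtain m' v' n' w' e' where 2: "(m', v') \<in> P" "(n', w') \<in> P" "e' \<in> carrier G"
      "m' \<otimes> z [^] l \<otimes> e' = n' \<otimes> e'" "u' = w' / v'"
      using R(2) unfolding R_def by blast
    have c: "m \<in> carrier G" "n \<in> carrier G" "m' \<in> carrier G" "n' \<in> carrier G" using D(1) 1 2 by auto
    have k: "z [^] k = z [^] (k - l) \<otimes> z [^] l" using z R(3) by (simp add: nat_pow_mult)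
    have "(m \<otimes> n') \<otimes> z [^] (k - l) \<otimes> (e \<otimes> e') = m \<otimes> z [^] (k - l) \<otimes> e \<otimes> (n' \<otimes> e')"
      using c 1(3) 2(3) z by (simp add: m_ac)
    also have "\<dots> = m \<otimes> (z [^] (k - l) \<otimes> z [^] l) \<otimes> e \<otimes> (m' \<otimes> e')"
      unfolding 2(4)[symmetric] using c 1(3) 2(3) z by (simp add: m_ac)
    also have "\<dots> = (n \<otimes> e) \<otimes> (m' \<otimes> e')" unfolding k[symmetric] 1(4) ..
    also have "\<dots> = (n \<otimes> m') \<otimes> (e \<otimes> e')" using c 1(3) 2(3) by (simp add: m_ac)
    finally have "(m \<otimes> n') \<otimes> z [^] (k - l) \<otimes> (e \<otimes> e') = (n \<otimes> m') \<otimes> (e \<otimes> e')" .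
    moreover have "u / u' = (w * v') / (v * w')" using 1(5) 2(5) by simp
    moreover have "e \<otimes> e' \<in> carrier G" using 1(3) 2(3) by simp
    ultimately show ?thesis unfolding R_def using D(4)[OF 1(1) 2(2)] D(4)[OF 1(2) 2(1)] by blast
  qed
  have "\<exists>d \<in> roots_of_unity. \<forall>k u. R k u \<longrightarrow> d ^ k = u"
  proof (cases "\<exists>k > 0. \<exists>u. R k u")
    case False
    \<comment> \<open>No positive power of \<open>z\<close> is constrained, so any value is
      consistent; 1 is chosen.\<close>
    have "1 ^ k = u" if "R k u" for k u
    proof -
      have "\<not> 0 < k"
      proof
        assume "0 < k"
        with that have "\<exists>k > 0. \<exists>u. R k u" by (intro exI conjI)
        with False show "False" by (rule notE)
      qed
      then have "k = 0" by simp
      then show ?thesis using R0[of u] that by simp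
    qed
    then show ?thesis by (intro bexI[of _ 1]) auto
  next
    case True
    define k0 where "k0 = (LEAST k. k > 0 \<and> (\<exists>u. R k u))"
    have k0: "k0 > 0" "\<exists>u. R k0 u" and least: "\<And>k u. k > 0 \<Longrightarrow> R k u \<Longrightarrow> k0 \<le> k"
      using LeastI_ex[of "\<lambda>k. k > 0 \<and> (\<exists>u. R k u)"] True Least_le[of "\<lambda>k. k > 0 \<and> (\<exists>u. R k u)"]
      unfolding k0_def by blast+
    obtain u0 where u0: "R k0 u0" using k0(2) by blast
    obtain d where d: "d \<in> roots_of_unity" "d ^ k0 = u0"
      by (rule roots_of_unity_divisible[OF RD[OF u0] k0(1)])
    have "d ^ k = u" if "R k u" for k u
      using that
    proof (induction k arbitrary: u rule: less_induct)
      case (less k)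
      show ?case
      proof (cases "k = 0")
        case True then show ?thesis using R0 less(2) by simp
      next
        case False
        then have kk: "k0 \<le> k" using least less(2) by blast
        have "d ^ (k - k0) = u / u0"
          by (rule less(1)) (use k0(1) False Rdiff[OF less(2) u0 kk] in auto)
        then have "d ^ (k - k0) * d ^ k0 = u" using d(2) RD[OF u0] by simp
        then show ?thesis using kk by (simp add: power_add[symmetric])
      qed
    qed
    then show ?thesis using d(1) by blast
  qed
  then obtain d where d: "d \<in> roots_of_unity" "\<forall>k u. R k u \<longrightarrow> d ^ k = u" by (elim bexE)
  show ?thesis
  proof (rule partial_character_extend[OF P z d(1)])
    show "v * d ^ k = w" if "(m, v) \<in> P" "(n, w) \<in> P" "e \<in> carrier G" "m \<otimes> z [^] k \<otimes> e = n \<otimes> e"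
      for k :: nat and m v n w e
    proof -
      have "R k (w / v)" unfolding R_def using that by blast
      then have "d ^ k = w / v" by (rule d(2)[rule_format])
      then show ?thesis using D(2)[OF \<open>(m, v) \<in> P\<close>] by simp
    qed
  qed (rule that)
qed

text \<open>Zorn's lemma applies because each clause of a partial character involves at most two
  pairs, which lie in one member of a chain. A maximal one is total by the one-step
  extension.\<close>

lemma partial_character_total:
  assumes P: "partial_character G P"
  obtains \<rho> where "\<And>m. m \<in> carrier G \<Longrightarrow> \<rho> m \<in> roots_of_unity" "\<rho> \<one> = 1"
    "\<And>m n. m \<in> carrier G \<Longrightarrow> n \<in> carrier G \<Longrightarrow> \<rho> (m \<otimes> n) = \<rho> m * \<rho> n"
    "\<And>m v. (m, v) \<in> P \<Longrightarrow> \<rho> m = v"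
proof -
  define A where "A = {P'. partial_character G P' \<and> P \<subseteq> P'}"
  have "\<exists>Q \<in> A. \<forall>X \<in> A. Q \<subseteq> X \<longrightarrow> X = Q"
  proof (rule subset_Zorn_nonempty)
    show "A \<noteq> {}" using P by (auto simp: A_def)
    fix c assume c: "c \<noteq> {}" "subset.chain A c"
    then have cA: "c \<subseteq> A" and ch: "\<And>X Y. X \<in> c \<Longrightarrow> Y \<in> c \<Longrightarrow> X \<subseteq> Y \<or> Y \<subseteq> X"
      by (auto simp: subset_chain_def)
    have pc: "partial_character G X" if "X \<in> c" for X using cA that by (auto simp: A_def)
    have two: "\<exists>X \<in> c. a \<in> X \<and> b \<in> X" if ab: "a \<in> \<Union>c" "b \<in> \<Union>c" for a b
    proof -
      obtain X Y where "X \<in> c" "a \<in> X" "Y \<in> c" "b \<in> Y" using ab by blast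
      then show ?thesis using ch[of X Y] by blast
    qed
    have "partial_character G (\<Union>c)"
      unfolding partial_character_def
    proof (intro conjI allI impI)
      show "\<Union>c \<subseteq> carrier G \<times> roots_of_unity"
        using pc unfolding partial_character_def by blast
      obtain X where "X \<in> c" using c(1) by blast
      then show "(\<one>, 1) \<in> \<Union>c" using partial_characterD(3)[OF pc] by blast
      show "(m \<otimes> n, v * w) \<in> \<Union>c" if mn: "(m, v) \<in> \<Union>c \<and> (n, w) \<in> \<Union>c" for m v n w
      proof -
        obtain X where "X \<in> c" "(m, v) \<in> X" "(n, w) \<in> X" using two[of "(m, v)" "(n, w)"] mn by blast
        then show ?thesis using partial_characterD(4)[OF pc] by blast
      qed
      show "v = w" if mn: "(m, v) \<in> \<Union>c \<and> (n, w) \<in> \<Union>c \<and> e \<in> carrier G \<and> m \<otimes> e = n \<otimes> e" for m v n w e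
      proof -
        obtain X where "X \<in> c" "(m, v) \<in> X" "(n, w) \<in> X" using two[of "(m, v)" "(n, w)"] mn by blast
        then show ?thesis using partial_characterD(5)[OF pc] mn by blast
      qed
    qed
    moreover have "P \<subseteq> \<Union>c" using c(1) cA by (auto simp: A_def)
    ultimately show "\<Union>c \<in> A" by (simp add: A_def)
  qed
  then obtain Q where Q: "partial_character G Q" "P \<subseteq> Q" and max: "\<forall>X \<in> A. Q \<subseteq> X \<longrightarrow> X = Q"
    unfolding A_def by blast
  note D = partial_characterD[OF Q(1)]
  have tot: "\<exists>v. (m, v) \<in> Q" if m: "m \<in> carrier G" for m
  proof -
    obtain X d where X: "partial_character G X" "Q \<subseteq> X" "(m, d) \<in> X"
      by (rule partial_character_extend_exists[OF Q(1) m])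
    then have "X \<in> A" using Q(2) by (auto simp: A_def)
    then have "X = Q" using max X(2) by blast
    then show ?thesis using X(3) by blast
  qed
  define \<rho> where "\<rho> m = (THE v. (m, v) \<in> Q)" for m
  have \<rho>: "\<rho> m = v" if "(m, v) \<in> Q" for m v
    unfolding \<rho>_def
  proof (rule the_equality[where P = "\<lambda>v. (m, v) \<in> Q", OF that])
    fix w assume "(m, w) \<in> Q"
    then show "w = v" using D(5)[OF _ that, of m w \<one>] D(1) by simp
  qed
  have \<rho>Q: "(m, \<rho> m) \<in> Q" if "m \<in> carrier G" for m using tot[OF that] \<rho> by metis
  show ?thesis
  proof (rule that[of \<rho>])
    show "\<rho> m \<in> roots_of_unity" if "m \<in> carrier G" for m using D(2) \<rho>Q[OF that] by blast
    show "\<rho> \<one> = 1" using \<rho>[OF D(3)] .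
    show "\<rho> (m \<otimes> n) = \<rho> m * \<rho> n" if "m \<in> carrier G" "n \<in> carrier G" for m n
      using \<rho>[OF D(4)[OF \<rho>Q[OF that(1)] \<rho>Q[OF that(2)]]] .
    show "\<rho> m = v" if "(m, v) \<in> P" for m v using \<rho> Q(2) that by blast
  qed
qed

text \<open>The hypothesis on \<open>z\<close> says that it is not trivial in the group completion.
  Its order there, finite or not, admits a root of unity other than 1 as the value at
  \<open>z\<close>.\<close>

lemma character_separates:
  assumes z: "z \<in> carrier G" and nz: "\<And>e. e \<in> carrier G \<Longrightarrow> z \<otimes> e \<noteq> e"
  obtains P d where "partial_character G P" "(z, d) \<in> P" "d \<noteq> 1"
proof -
  define R where "R k \<longleftrightarrow> (\<exists>e \<in> carrier G. z [^] k \<otimes> e = e)" for k :: nat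
  have Rdiff: "R (k - l)" if R: "R k" "R l" "l \<le> k" for k l
  proof -
    obtain e e' where e: "e \<in> carrier G" "z [^] k \<otimes> e = e" "e' \<in> carrier G" "z [^] l \<otimes> e' = e'"
      using R unfolding R_def by blast
    have k: "z [^] k = z [^] (k - l) \<otimes> z [^] l" using z R(3) by (simp add: nat_pow_mult)
    have "z [^] (k - l) \<otimes> (e \<otimes> e') = z [^] (k - l) \<otimes> (e \<otimes> (z [^] l \<otimes> e'))" unfolding e(4) ..
    also have "\<dots> = (z [^] k \<otimes> e) \<otimes> e'" unfolding k using e(1,3) z by (simp add: m_ac)
    finally have "z [^] (k - l) \<otimes> (e \<otimes> e') = e \<otimes> e'" unfolding e(2) .
    then show ?thesis unfolding R_def using e by blast
  qed
  have R1: "\<not> R 1" using nz z unfolding R_def by simp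
  have "\<exists>d \<in> roots_of_unity. d \<noteq> 1 \<and> (\<forall>k. R k \<longrightarrow> d ^ k = 1)"
  proof (cases "\<exists>k > 0. R k")
    case False
    \<comment> \<open>Here \<open>z\<close> has infinite order in the group completion and any value
      is consistent; \<open>- 1\<close> is a root of unity different from 1.\<close>
    have "(- 1 :: complex) ^ 2 = 1" by simp
    then have "(- 1 :: complex) \<in> roots_of_unity" unfolding roots_of_unity_def using zero_less_numeral by blast
    moreover have "(- 1 :: complex) ^ k = 1" if "R k" for k
    proof -
      have "\<not> 0 < k"
      proof
        assume "0 < k"
        with that have "\<exists>k > 0. R k" by (intro exI conjI)
        with False show "False" by (rule notE)
      qed
      then have "k = 0" by simp
      then show ?thesis by simp
    qed
    ultimately show ?thesis by (intro bexI[of _ "- 1"]) auto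
  next
    case True
    define k0 where "k0 = (LEAST k. k > 0 \<and> R k)"
    have k0: "k0 > 0" "R k0" and least: "\<And>k. k > 0 \<Longrightarrow> R k \<Longrightarrow> k0 \<le> k"
      using LeastI_ex[of "\<lambda>k. k > 0 \<and> R k"] True Least_le[of "\<lambda>k. k > 0 \<and> R k"]
      unfolding k0_def by blast+
    \<comment> \<open>Exponent 1 is excluded by the hypothesis on \<open>z\<close>, so the equation
      \<open>z ^ k0 = 1\<close> has a complex solution other than 1.\<close>
    have k1: "k0 > 1" using k0 R1 by (metis One_nat_def Suc_lessI)
    have "card {z :: complex. z ^ k0 = 1} = k0" using k1 by (intro card_roots_unity_eq) auto
    then have "{z :: complex. z ^ k0 = 1} \<noteq> {1}" using k1 by auto
    then obtain d :: complex where d: "d ^ k0 = 1" "d \<noteq> 1" by (auto simp: set_eq_iff)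
    have "d ^ k = 1" if "R k" for k
      using that
    proof (induction k rule: less_induct)
      case (less k)
      show ?case
      proof (cases "k = 0")
        case False
        then have kk: "k0 \<le> k" using least less(2) by blast
        have "d ^ (k - k0) = 1"
          by (rule less(1)) (use k0(1) False Rdiff[OF less(2) k0(2) kk] in auto)
        then have "d ^ (k - k0) * d ^ k0 = 1" using d(1) by simp
        then show ?thesis using kk by (simp add: power_add[symmetric])
      qed simp
    qed
    moreover have "d \<in> roots_of_unity" unfolding roots_of_unity_def using d(1) k0(1) by blast
    ultimately show ?thesis using d(2) by blast
  qed
  then obtain d where d: "d \<in> roots_of_unity" "d \<noteq> 1" "\<forall>k. R k \<longrightarrow> d ^ k = 1"
    by (elim bexE conjE)
  have P: "partial_character G {(\<one>, 1)}" by (auto simp: partial_character_def)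
  show ?thesis
  proof (rule partial_character_extend[OF P z d(1)])
    show "v * d ^ k = w" if "(m, v) \<in> {(\<one>, 1)}" "(n, w) \<in> {(\<one>, 1)}" "e \<in> carrier G" "m \<otimes> z [^] k \<otimes> e = n \<otimes> e"
      for k :: nat and m v n w e
    proof -
      have "R k" unfolding R_def using that z by (intro bexI[of _ e]) auto
      then show ?thesis using d(3) that by auto
    qed
  qed (use that d(2) in blast)
qed

end

text \<open>Sorted lists with respect to one linear order restrict to sorted lists, which gives the
  coherence under inclusion.\<close>

lemma enumeration_exists:
  obtains enum :: "(nat \<times> 's) set \<Rightarrow> (nat \<times> 's) list" where
    "\<And>J. finite J \<Longrightarrow> set (enum J) = J"
    "\<And>J J'. finite J' \<Longrightarrow> J \<subseteq> J' \<Longrightarrow> enum J = filter (\<lambda>i. i \<in> J) (enum J')"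
    "\<And>J s. finite J \<Longrightarrow> \<exists>n. (n, s) \<notin> J \<and> enum (insert (n, s) J) = enum J @ [(n, s)]"
proof -
  obtain r :: "'s rel" where r: "well_order_on UNIV r" using well_order_on[of UNIV] by (elim exE)
  then have r': "refl r" "trans r" "antisym r" "total_on UNIV r"
    by (auto simp: well_order_on_def linear_order_on_def partial_order_on_def preorder_on_def)
  \<comment> \<open>The number is compared first, so a copy of any \<open>s\<close> with a large
    enough number comes after all of a given finite set.\<close>
  define le where "le p q \<longleftrightarrow> fst p < fst q \<or> (fst p = fst q \<and> (snd p, snd q) \<in> r)" for p q :: "nat \<times> 's"
  interpret lo: linorder le "\<lambda>p q. le p q \<and> \<not> le q p"
  proof
    show "le p p" for p using r'(1) by (auto simp: le_def refl_on_def)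
    show "le p u" if "le p q" "le q u" for p q u using that r'(2) by (auto simp: le_def dest: transD)
    show "p = q" if "le p q" "le q p" for p q
      using that r'(3) by (auto simp: le_def prod_eq_iff dest: antisymD)
    show "le p q \<or> le q p" for p q
      using r'(1,4) by (auto simp: le_def total_on_def refl_on_def) (metis nat_neq_iff)
  qed simp
  let ?e = "lo.sorted_list_of_set"
  show ?thesis
  proof (rule that[of ?e])
    show "set (?e J) = J" if "finite J" for J using that by simp
    show "?e J = filter (\<lambda>i. i \<in> J) (?e J')" if "finite J'" "J \<subseteq> J'" for J J'
    proof (rule lo.sorted_distinct_set_unique)
      have "finite J" using that finite_subset by blast
      then show "set (?e J) = set (filter (\<lambda>i. i \<in> J) (?e J'))" using that by auto
    qed (auto intro: sorted_wrt_filter)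
    show "\<exists>n. (n, s) \<notin> J \<and> ?e (insert (n, s) J) = ?e J @ [(n, s)]" if J: "finite J" for J s
    proof -
      obtain n where n: "\<And>p. p \<in> J \<Longrightarrow> fst p < n"
      proof -
        have "\<forall>p \<in> J. fst p < Suc (Max (fst ` J))" using J by (auto simp: less_Suc_eq_le)
        then show ?thesis using that by blast
      qed
      have nJ: "(n, s) \<notin> J" using n by fastforce
      have e: "sorted_wrt le (?e K) \<and> distinct (?e K) \<and> set (?e K) = K" if "finite K" for K
        using that by simp
      have e1: "sorted_wrt le (?e (insert (n, s) J)) \<and> distinct (?e (insert (n, s) J)) \<and>
          set (?e (insert (n, s) J)) = insert (n, s) J"
        by (rule e) (use J in simp)
      have e2: "sorted_wrt le (?e J @ [(n, s)])"
        using e[OF J] n by (auto simp: sorted_wrt_append le_def)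
      have e3: "distinct (?e J @ [(n, s)])" "set (?e J @ [(n, s)]) = insert (n, s) J"
        using e[OF J] nJ by auto
      have "?e (insert (n, s) J) = ?e J @ [(n, s)]"
        using lo.sorted_distinct_set_unique e1 e2 e3 by blast
      then show ?thesis using nJ by blast
    qed
  qed
qed

section \<open>An object that is injective for a family of coaugmentations\<close>

context additive_category
begin

lemma plus_right_cancel:
  assumes "f \<in> arr C" "g \<in> arr C" "h \<in> arr C" "src C f = src C h" "tgt C f = tgt C h"
    "src C g = src C h" "tgt C g = tgt C h" "plus_arr C f h = plus_arr C g h"
  shows "f = g"
proof -
  interpret comm_group "Hom_group C (src C h) (tgt C h)" using assms by (intro Hom_comm_group) auto
  show ?thesis using right_cancel[of h f g] assms by (auto simp: Hom_group_def)
qed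

end

text \<open>The pairs \<open>(n, s)\<close> are countably many copies of the index \<open>s\<close>. Lists of pairs act by composing the
  \<open>\<Phi>\<close>, the last pair innermost, and the coherence of \<open>enum\<close> provides transition maps along inclusions
  of finite sets. By \<open>enum_fresh\<close> a copy of \<open>s\<close> can be added innermost, so that the iterate at the larger
  set is the iterate at \<open>L\<close> applied to \<open>\<Phi>o s X\<close>.\<close>

locale coaugmented_family = triangulated_core C \<kappa> T0
  for C :: "('o, 'm, 'x) tri_data_scheme" (structure) and \<kappa> :: "'u rel" and T0 +
  fixes c :: 'o and Sx :: "'s set" and \<Phi>o :: "'s \<Rightarrow> 'o \<Rightarrow> 'o" and \<Phi>m :: "'s \<Rightarrow> 'm \<Rightarrow> 'm"
    and \<tau> :: "'s \<Rightarrow> 'o \<Rightarrow> 'm" and enum :: "(nat \<times> 's) set \<Rightarrow> (nat \<times> 's) list"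
  assumes c_compact: "compact_object \<kappa> C c"
    and Sx_small: "small \<kappa> Sx"
    and \<Phi>o_obj [simp]: "X \<in> obj C \<Longrightarrow> \<Phi>o s X \<in> obj C"
    and \<Phi>m_arr [simp]: "f \<in> arr C \<Longrightarrow> \<Phi>m s f \<in> arr C"
    and \<Phi>m_src [simp]: "f \<in> arr C \<Longrightarrow> src C (\<Phi>m s f) = \<Phi>o s (src C f)"
    and \<Phi>m_tgt [simp]: "f \<in> arr C \<Longrightarrow> tgt C (\<Phi>m s f) = \<Phi>o s (tgt C f)"
    and \<Phi>m_idn [simp]: "X \<in> obj C \<Longrightarrow> \<Phi>m s (idn C X) = idn C (\<Phi>o s X)"
    and \<Phi>m_cmp: "\<lbrakk>f \<in> arr C; g \<in> arr C; tgt C f = src C g\<rbrakk> \<Longrightarrow> \<Phi>m s (g \<cdot> f) = \<Phi>m s g \<cdot> \<Phi>m s f"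
    and \<Phi>m_plus: "\<lbrakk>f \<in> arr C; g \<in> arr C; src C f = src C g; tgt C f = tgt C g\<rbrakk>
      \<Longrightarrow> \<Phi>m s (plus_arr C f g) = plus_arr C (\<Phi>m s f) (\<Phi>m s g)"
    and \<Phi>_coproduct: "\<lbrakk>small \<kappa> (J :: 'u set); is_coproduct C J Xs Q \<iota>\<rbrakk>
      \<Longrightarrow> is_coproduct C J (\<lambda>j. \<Phi>o s (Xs j)) (\<Phi>o s Q) (\<lambda>j. \<Phi>m s (\<iota> j))"
    and \<Phi>_exact: "(f, g, h) \<in> tri C \<Longrightarrow> \<exists>h'. (\<Phi>m s f, \<Phi>m s g, h') \<in> tri C"
    and \<tau>_arr [simp]: "X \<in> obj C \<Longrightarrow> \<tau> s X \<in> arr C"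
    and \<tau>_src [simp]: "X \<in> obj C \<Longrightarrow> src C (\<tau> s X) = X"
    and \<tau>_tgt [simp]: "X \<in> obj C \<Longrightarrow> tgt C (\<tau> s X) = \<Phi>o s X"
    and \<tau>_natural: "f \<in> arr C \<Longrightarrow> \<Phi>m s f \<cdot> \<tau> s (src C f) = \<tau> s (tgt C f) \<cdot> f"
    and enum_set: "finite L \<Longrightarrow> set (enum L) = L"
    and enum_filter: "finite L' \<Longrightarrow> L \<subseteq> L' \<Longrightarrow> enum L = filter (\<lambda>i. i \<in> L) (enum L')"
    and enum_fresh: "finite L \<Longrightarrow> \<exists>n. (n, s) \<notin> L \<and> enum (insert (n, s) L) = enum L @ [(n, s)]"
begin

primrec ao :: "(nat \<times> 's) list \<Rightarrow> 'o \<Rightarrow> 'o" where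
  "ao [] X = X"
| "ao (y # l) X = \<Phi>o (snd y) (ao l X)"

primrec am :: "(nat \<times> 's) list \<Rightarrow> 'm \<Rightarrow> 'm" where
  "am [] f = f"
| "am (y # l) f = \<Phi>m (snd y) (am l f)"

text \<open>The transition from the iterate over the sublist of \<open>l\<close> with entries in
  \<open>J\<close> to the iterate over all of \<open>l\<close>: entries in \<open>J\<close> are
  kept, the others are inserted by \<open>\<tau>\<close>.\<close>

primrec tr :: "(nat \<times> 's) set \<Rightarrow> (nat \<times> 's) list \<Rightarrow> 'o \<Rightarrow> 'm" where
  "tr J [] X = idn C X"
| "tr J (y # l) X = (if y \<in> J then \<Phi>m (snd y) (tr J l X) else \<tau> (snd y) (ao l X) \<cdot> tr J l X)"

lemma ao_obj [simp]: "X \<in> obj C \<Longrightarrow> ao l X \<in> obj C"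
  by (induction l) auto

lemma am_simps [simp]:
  assumes "f \<in> arr C"
  shows "am l f \<in> arr C" "src C (am l f) = ao l (src C f)" "tgt C (am l f) = ao l (tgt C f)"
  using assms by (induction l) auto

lemma am_idn [simp]: "X \<in> obj C \<Longrightarrow> am l (idn C X) = idn C (ao l X)"
  by (induction l) auto

lemma am_cmp: "\<lbrakk>f \<in> arr C; g \<in> arr C; tgt C f = src C g\<rbrakk> \<Longrightarrow> am l (g \<cdot> f) = am l g \<cdot> am l f"
  by (induction l) (auto simp: \<Phi>m_cmp)

lemma am_plus: "\<lbrakk>f \<in> arr C; g \<in> arr C; src C f = src C g; tgt C f = tgt C g\<rbrakk>
    \<Longrightarrow> am l (plus_arr C f g) = plus_arr C (am l f) (am l g)"
  by (induction l) (auto simp: \<Phi>m_plus)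

lemma am_coproduct: "\<lbrakk>small \<kappa> (J :: 'u set); is_coproduct C J X Q \<iota>\<rbrakk>
    \<Longrightarrow> is_coproduct C J (\<lambda>j. ao l (X j)) (ao l Q) (\<lambda>j. am l (\<iota> j))"
  by (induction l) (auto simp: \<Phi>_coproduct)

lemma am_exact: "(f, g, h) \<in> tri C \<Longrightarrow> \<exists>h'. (am l f, am l g, h') \<in> tri C"
  by (induction l) (auto dest: \<Phi>_exact)

lemma am_zero: "X \<in> obj C \<Longrightarrow> Y \<in> obj C \<Longrightarrow> am l (zero_arr C X Y) = zero_arr C (ao l X) (ao l Y)"
  using am_plus[of "zero_arr C X Y" "zero_arr C X Y" l]
    plus_left_cancel[of "am l (zero_arr C X Y)" "am l (zero_arr C X Y)"] by auto

lemma am_minus: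
  assumes "f \<in> arr C" "g \<in> arr C" "src C f = src C g" "tgt C f = tgt C g"
  shows "am l (minus_arr C f g) = minus_arr C (am l f) (am l g)"
proof -
  have "plus_arr C (am l (minus_arr C f g)) (am l g) = am l f"
    using am_plus[of "minus_arr C f g" g l] assms minus_plus[OF assms] by simp
  also have "\<dots> = plus_arr C (minus_arr C (am l f) (am l g)) (am l g)"
    using minus_plus[of "am l f" "am l g"] assms by simp
  finally show ?thesis by (rule plus_right_cancel[rotated -1]) (use assms in auto)
qed

lemma tr_simps [simp]:
  assumes "X \<in> obj C"
  shows "tr J l X \<in> arr C" "src C (tr J l X) = ao (filter (\<lambda>i. i \<in> J) l) X" "tgt C (tr J l X) = ao l X"
  using assms by (induction l) auto

lemma tr_idn: "X \<in> obj C \<Longrightarrow> set l \<subseteq> J \<Longrightarrow> tr J l X = idn C (ao l X)"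
  by (induction l) auto

lemma tr_natural:
  assumes "f \<in> arr C"
  shows "am l f \<cdot> tr J l (src C f) = tr J l (tgt C f) \<cdot> am (filter (\<lambda>i. i \<in> J) l) f"
proof (induction l)
  case Nil then show ?case using assms by simp
next
  case (Cons y l)
  show ?case
  proof (cases "y \<in> J")
    case True
    have "\<Phi>m (snd y) (am l f) \<cdot> \<Phi>m (snd y) (tr J l (src C f)) =
        \<Phi>m (snd y) (tr J l (tgt C f) \<cdot> am (filter (\<lambda>i. i \<in> J) l) f)"
      using assms Cons by (simp add: \<Phi>m_cmp[symmetric])
    then show ?thesis using assms True by (simp add: \<Phi>m_cmp)
  next
    case False
    have "\<Phi>m (snd y) (am l f) \<cdot> (\<tau> (snd y) (ao l (src C f)) \<cdot> tr J l (src C f)) =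
        (\<tau> (snd y) (ao l (tgt C f)) \<cdot> am l f) \<cdot> tr J l (src C f)"
      using assms \<tau>_natural[of "am l f" "snd y"] by (intro cmp_reassoc) auto
    also have "\<dots> = \<tau> (snd y) (ao l (tgt C f)) \<cdot> (tr J l (tgt C f) \<cdot> am (filter (\<lambda>i. i \<in> J) l) f)"
      using assms Cons by simp
    finally show ?thesis using assms False by simp
  qed
qed

text \<open>The transitions compose strictly because both follow the order of one list. At an entry
  in \<open>J\<close> but not in \<open>J'\<close>, naturality moves \<open>\<tau>\<close> past the
  later transition.\<close>

lemma tr_tr:
  assumes X: "X \<in> obj C" and JJ: "J' \<subseteq> J"
  shows "tr J l X \<cdot> tr J' (filter (\<lambda>i. i \<in> J) l) X = tr J' l X"
proof (induction l)
  case Nil then show ?case using X by simp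
next
  case (Cons y l)
  have f: "filter (\<lambda>i. i \<in> J') (filter (\<lambda>i. i \<in> J) l) = filter (\<lambda>i. i \<in> J') l"
    using JJ by (auto intro!: filter_cong)
  let ?a = "tr J l X" and ?b = "tr J' (filter (\<lambda>i. i \<in> J) l) X"
  have ab: "?a \<in> arr C" "?b \<in> arr C" "tgt C ?b = src C ?a" using X by auto
  consider "y \<in> J'" | "y \<in> J" "y \<notin> J'" | "y \<notin> J" by blast
  then show ?case
  proof cases
    case 1
    then have "y \<in> J" using JJ by blast
    then show ?thesis using 1 ab Cons \<Phi>m_cmp[of ?b ?a "snd y"] by simp
  next
    case 2
    have "\<Phi>m (snd y) ?a \<cdot> (\<tau> (snd y) (ao (filter (\<lambda>i. i \<in> J) l) X) \<cdot> ?b) = (\<tau> (snd y) (ao l X) \<cdot> ?a) \<cdot> ?b"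
      using \<tau>_natural[of ?a "snd y"] X by (intro cmp_reassoc) auto
    also have "\<dots> = \<tau> (snd y) (ao l X) \<cdot> tr J' l X" using ab X Cons by simp
    finally show ?thesis using 2 by simp
  next
    case 3
    then have "y \<notin> J'" using JJ by blast
    then show ?thesis using 3 ab Cons X by simp
  qed
qed

lemma ao_snoc: "ao (l @ [i]) X = ao l (\<Phi>o (snd i) X)"
  by (induction l) auto

text \<open>The last entry of a list is innermost, so adding it applies the iterate to
  \<open>\<tau>\<close> itself. This ties transitions to a fresh copy with the coaugmentation of the
  argument \<open>X\<close>.\<close>

lemma tr_snoc:
  assumes "X \<in> obj C" "set l \<subseteq> J" "i \<notin> J"
  shows "tr J (l @ [i]) X = am l (\<tau> (snd i) X)"
  using assms by (induction l) auto

declare tr_simps [simp del]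

section \<open>Germs over finite index sets and their characters\<close>

definition Fin :: "(nat \<times> 's) set \<Rightarrow> bool" where
  "Fin J \<longleftrightarrow> finite J \<and> J \<subseteq> UNIV \<times> Sx"

abbreviation AO :: "(nat \<times> 's) set \<Rightarrow> 'o \<Rightarrow> 'o" where "AO J \<equiv> ao (enum J)"
abbreviation AM :: "(nat \<times> 's) set \<Rightarrow> 'm \<Rightarrow> 'm" where "AM J \<equiv> am (enum J)"
abbreviation TR :: "(nat \<times> 's) set \<Rightarrow> (nat \<times> 's) set \<Rightarrow> 'o \<Rightarrow> 'm" where "TR J J' \<equiv> tr J (enum J')"

lemma Fin_simps [simp]:
  "Fin {}" "Fin J \<Longrightarrow> Fin J' \<Longrightarrow> Fin (J \<union> J')" "Fin J \<Longrightarrow> s \<in> Sx \<Longrightarrow> Fin (insert (n, s) J)"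
  by (auto simp: Fin_def)

lemma enum_empty [simp]: "enum {} = []"
  using enum_set[of "{}"] by simp

lemma TR_simps [simp]:
  assumes "X \<in> obj C" "Fin J'" "J \<subseteq> J'"
  shows "TR J J' X \<in> arr C" "src C (TR J J' X) = AO J X" "tgt C (TR J J' X) = AO J' X"
  using assms enum_filter[of J' J] by (auto simp: Fin_def tr_simps)

lemma TR_idn [simp]: "X \<in> obj C \<Longrightarrow> Fin J \<Longrightarrow> TR J J X = idn C (AO J X)"
  using tr_idn[of X "enum J" J] enum_set[of J] by (auto simp: Fin_def)

lemma TR_TR: "\<lbrakk>X \<in> obj C; Fin J''; J \<subseteq> J'; J' \<subseteq> J''\<rbrakk> \<Longrightarrow> TR J' J'' X \<cdot> TR J J' X = TR J J'' X"
  using tr_tr[of X J J' "enum J''"] enum_filter[of J'' J'] by (auto simp: Fin_def)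

lemma TR_natural:
  "\<lbrakk>f \<in> arr C; Fin J'; J \<subseteq> J'\<rbrakk> \<Longrightarrow> AM J' f \<cdot> TR J J' (src C f) = TR J J' (tgt C f) \<cdot> AM J f"
  using tr_natural[of f "enum J'" J] enum_filter[of J' J] by (auto simp: Fin_def)

text \<open>Representatives of the colimit of the groups \<open>Hom(c, AO J X)\<close> over \<open>J\<close>. Instead of identifying them
  along the transition maps, the characters below are required to be invariant.\<close>

definition germs :: "'o \<Rightarrow> ((nat \<times> 's) set \<times> 'm) set" where
  "germs X = {(J, x). Fin J \<and> x \<in> Hom C c (AO J X)}"

lemma germs_iff [simp]:
  "(J, x) \<in> germs X \<longleftrightarrow> Fin J \<and> x \<in> arr C \<and> src C x = c \<and> tgt C x = AO J X"
  by (auto simp: germs_def)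

lemma c_obj [simp]: "c \<in> obj C"
  using c_compact by (rule compact_obj)

text \<open>Only a monoid, since adding germs enlarges the index set. Its group completion is the
  colimit of the groups \<open>Hom(c, AO J X)\<close>: adding the zero germ at a larger index set
  performs the transition to it.\<close>

definition germ_monoid :: "'o \<Rightarrow> ((nat \<times> 's) set \<times> 'm) monoid" where
  "germ_monoid X = \<lparr>carrier = germs X,
     monoid.mult = (\<lambda>d e. (fst d \<union> fst e, plus_arr C (TR (fst d) (fst d \<union> fst e) X \<cdot> snd d)
        (TR (fst e) (fst d \<union> fst e) X \<cdot> snd e))),
     monoid.one = ({}, zero_arr C c X)\<rparr>"

lemma germ_mult: "(J, x) \<otimes>\<^bsub>germ_monoid X\<^esub> (J', y) =
    (J \<union> J', plus_arr C (TR J (J \<union> J') X \<cdot> x) (TR J' (J \<union> J') X \<cdot> y))"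
  by (simp add: germ_monoid_def)

lemma germ_carrier [simp]: "carrier (germ_monoid X) = germs X"
  by (simp add: germ_monoid_def)

lemma germ_comm_monoid:
  assumes X: "X \<in> obj C" shows "comm_monoid (germ_monoid X)"
proof (rule comm_monoidI)
  let ?M = "germ_monoid X"
  have one: "\<one>\<^bsub>?M\<^esub> = ({}, zero_arr C c X)" by (simp add: germ_monoid_def)
  show "\<one>\<^bsub>?M\<^esub> \<in> carrier ?M" unfolding one using X by simp
  fix d e f assume "d \<in> carrier ?M" "e \<in> carrier ?M" "f \<in> carrier ?M"
  then obtain J x J' y J'' z where d: "d = (J, x)" "Fin J" "x \<in> arr C" "src C x = c" "tgt C x = AO J X"
    and e: "e = (J', y)" "Fin J'" "y \<in> arr C" "src C y = c" "tgt C y = AO J' X"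
    and f: "f = (J'', z)" "Fin J''" "z \<in> arr C" "src C z = c" "tgt C z = AO J'' X"
    by (cases d, cases e, cases f) auto
  show "d \<otimes>\<^bsub>?M\<^esub> e \<in> carrier ?M" unfolding d(1) e(1) germ_mult using d e X by simp
  show "\<one>\<^bsub>?M\<^esub> \<otimes>\<^bsub>?M\<^esub> d = d" unfolding one d(1) germ_mult using d X by simp
  show "d \<otimes>\<^bsub>?M\<^esub> e = e \<otimes>\<^bsub>?M\<^esub> d"
    unfolding d(1) e(1) germ_mult Un_commute[of J' J]
    using plus_comm[of "TR J (J \<union> J') X \<cdot> x" "TR J' (J \<union> J') X \<cdot> y"] d e X by simp
  show "d \<otimes>\<^bsub>?M\<^esub> e \<otimes>\<^bsub>?M\<^esub> f = d \<otimes>\<^bsub>?M\<^esub> (e \<otimes>\<^bsub>?M\<^esub> f)"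
  proof -
    let ?N = "J \<union> (J' \<union> J'')"
    have N: "Fin ?N" "J \<union> J' \<subseteq> ?N" "J' \<union> J'' \<subseteq> ?N" using d e f by auto
    have 1: "TR (J \<union> J') ?N X \<cdot> (TR J (J \<union> J') X \<cdot> x) = TR J ?N X \<cdot> x"
      by (rule cmp_reassoc[OF TR_TR]) (use d e X N in auto)
    have 2: "TR (J \<union> J') ?N X \<cdot> (TR J' (J \<union> J') X \<cdot> y) = TR J' ?N X \<cdot> y"
      by (rule cmp_reassoc[OF TR_TR]) (use d e X N in auto)
    have 3: "TR (J' \<union> J'') ?N X \<cdot> (TR J' (J' \<union> J'') X \<cdot> y) = TR J' ?N X \<cdot> y"
      by (rule cmp_reassoc[OF TR_TR]) (use f e X N in auto)
    have 4: "TR (J' \<union> J'') ?N X \<cdot> (TR J'' (J' \<union> J'') X \<cdot> z) = TR J'' ?N X \<cdot> z"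
      by (rule cmp_reassoc[OF TR_TR]) (use f e X N in auto)
    have 5: "TR (J \<union> J') ?N X \<cdot> plus_arr C (TR J (J \<union> J') X \<cdot> x) (TR J' (J \<union> J') X \<cdot> y) =
        plus_arr C (TR J ?N X \<cdot> x) (TR J' ?N X \<cdot> y)"
      using d e X N 1 2 by (subst cmp_plus_arr) auto
    have 6: "TR (J' \<union> J'') ?N X \<cdot> plus_arr C (TR J' (J' \<union> J'') X \<cdot> y) (TR J'' (J' \<union> J'') X \<cdot> z) =
        plus_arr C (TR J' ?N X \<cdot> y) (TR J'' ?N X \<cdot> z)"
      using f e X N 3 4 by (subst cmp_plus_arr) auto
    have "plus_arr C (plus_arr C (TR J ?N X \<cdot> x) (TR J' ?N X \<cdot> y)) (TR J'' ?N X \<cdot> z) =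
        plus_arr C (TR J ?N X \<cdot> x) (plus_arr C (TR J' ?N X \<cdot> y) (TR J'' ?N X \<cdot> z))"
      by (rule plus_assoc) (use d e f X N in \<open>auto simp: le_supI1 le_supI2\<close>)
    then show ?thesis unfolding d(1) e(1) f(1) germ_mult Un_assoc 5 6 by simp
  qed
qed

text \<open>Invariance under transitions makes these the characters of the colimit; extensionality
  reduces equality of characters to equality on germs.\<close>

definition chars :: "'o \<Rightarrow> ((nat \<times> 's) set \<times> 'm \<Rightarrow> complex) set" where
  "chars X = {\<rho> \<in> germs X \<rightarrow>\<^sub>E roots_of_unity.
     (\<forall>J x y. (J, x) \<in> germs X \<and> (J, y) \<in> germs X \<longrightarrow> \<rho> (J, plus_arr C x y) = \<rho> (J, x) * \<rho> (J, y)) \<and>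
     (\<forall>J J' x. (J, x) \<in> germs X \<and> Fin J' \<and> J \<subseteq> J' \<longrightarrow> \<rho> (J', TR J J' X \<cdot> x) = \<rho> (J, x))}"

lemma charsD:
  assumes "\<rho> \<in> chars X"
  shows "(J, x) \<in> germs X \<Longrightarrow> \<rho> (J, x) \<in> roots_of_unity"
    "(J, x) \<in> germs X \<Longrightarrow> (J, y) \<in> germs X \<Longrightarrow> \<rho> (J, plus_arr C x y) = \<rho> (J, x) * \<rho> (J, y)"
    "(J, x) \<in> germs X \<Longrightarrow> Fin J' \<Longrightarrow> J \<subseteq> J' \<Longrightarrow> \<rho> (J', TR J J' X \<cdot> x) = \<rho> (J, x)"
    "\<rho> \<in> extensional (germs X)"
proof -
  have 1: "\<rho> \<in> germs X \<rightarrow>\<^sub>E roots_of_unity"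
    and 2: "\<forall>J x y. (J, x) \<in> germs X \<and> (J, y) \<in> germs X \<longrightarrow> \<rho> (J, plus_arr C x y) = \<rho> (J, x) * \<rho> (J, y)"
    and 3: "\<forall>J J' x. (J, x) \<in> germs X \<and> Fin J' \<and> J \<subseteq> J' \<longrightarrow> \<rho> (J', TR J J' X \<cdot> x) = \<rho> (J, x)"
    using assms unfolding chars_def by simp_all
  show "(J, x) \<in> germs X \<Longrightarrow> \<rho> (J, x) \<in> roots_of_unity" using 1 by (rule PiE_mem)
  show "(J, x) \<in> germs X \<Longrightarrow> (J, y) \<in> germs X \<Longrightarrow> \<rho> (J, plus_arr C x y) = \<rho> (J, x) * \<rho> (J, y)"
    using 2 by blast
  show "(J, x) \<in> germs X \<Longrightarrow> Fin J' \<Longrightarrow> J \<subseteq> J' \<Longrightarrow> \<rho> (J', TR J J' X \<cdot> x) = \<rho> (J, x)"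
    using 3 by blast
  show "\<rho> \<in> extensional (germs X)" using 1 by (simp add: PiE_def)
qed

lemma charsI:
  assumes "\<And>J x. (J, x) \<in> germs X \<Longrightarrow> \<rho> (J, x) \<in> roots_of_unity"
    "\<And>J x y. (J, x) \<in> germs X \<Longrightarrow> (J, y) \<in> germs X \<Longrightarrow> \<rho> (J, plus_arr C x y) = \<rho> (J, x) * \<rho> (J, y)"
    "\<And>J J' x. (J, x) \<in> germs X \<Longrightarrow> Fin J' \<Longrightarrow> J \<subseteq> J' \<Longrightarrow> \<rho> (J', TR J J' X \<cdot> x) = \<rho> (J, x)"
    and X: "X \<in> obj C"
  shows "restrict \<rho> (germs X) \<in> chars X"
  unfolding chars_def
proof (intro CollectI conjI allI impI)
  show "restrict \<rho> (germs X) \<in> germs X \<rightarrow>\<^sub>E roots_of_unity" using assms(1) by (auto simp del: germs_iff)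
  show "restrict \<rho> (germs X) (J, plus_arr C x y) = restrict \<rho> (germs X) (J, x) * restrict \<rho> (germs X) (J, y)"
    if "(J, x) \<in> germs X \<and> (J, y) \<in> germs X" for J x y
  proof -
    have "(J, plus_arr C x y) \<in> germs X" using that by simp
    then show ?thesis using that assms(2)[of J x y] by (simp only: restrict_apply' simp_thms)
  qed
  show "restrict \<rho> (germs X) (J', TR J J' X \<cdot> x) = restrict \<rho> (germs X) (J, x)"
    if "(J, x) \<in> germs X \<and> Fin J' \<and> J \<subseteq> J'" for J J' x
  proof -
    have "(J', TR J J' X \<cdot> x) \<in> germs X" using that X by simp
    then show ?thesis using that assms(3)[of J x J'] by (simp only: restrict_apply' simp_thms)
  qed
qed

lemma chars_eqI:
  assumes "\<rho> \<in> chars X" "\<rho>' \<in> chars X" "\<And>J x. (J, x) \<in> germs X \<Longrightarrow> \<rho> (J, x) = \<rho>' (J, x)"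
  shows "\<rho> = \<rho>'"
proof (rule extensionalityI[OF charsD(4)[OF assms(1)] charsD(4)[OF assms(2)]])
  fix e assume "e \<in> germs X"
  then show "\<rho> e = \<rho>' e" using assms(3) by (cases e) blast
qed

lemma chars_zero:
  assumes "\<rho> \<in> chars X" "X \<in> obj C" "Fin J"
  shows "\<rho> (J, zero_arr C c (AO J X)) = 1"
proof -
  let ?z = "zero_arr C c (AO J X)"
  have g: "(J, ?z) \<in> germs X" using assms(2,3) by simp
  have "\<rho> (J, ?z) = \<rho> (J, ?z) * \<rho> (J, ?z)" using charsD(2)[OF assms(1) g g] assms(2) by simp
  then show ?thesis using roots_of_unity_nonzero[OF charsD(1)[OF assms(1) g]] by simp
qed

lemma chars_minus:
  assumes "\<rho> \<in> chars X" "(J, x) \<in> germs X" "(J, y) \<in> germs X"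
  shows "\<rho> (J, minus_arr C x y) * \<rho> (J, y) = \<rho> (J, x)"
proof -
  have "(J, minus_arr C x y) \<in> germs X" using assms by simp
  from charsD(2)[OF assms(1) this assms(3)] show ?thesis using minus_plus[of x y] assms(2,3) by simp
qed

text \<open>Invariance under transitions follows from multiplicativity: the zero germ at
  \<open>J'\<close> is idempotent, hence has value 1, and adding it moves a germ to
  \<open>J'\<close>.\<close>

lemma chars_hom:
  assumes X: "X \<in> obj C" and r: "\<And>d. d \<in> germs X \<Longrightarrow> \<rho> d \<in> roots_of_unity"
    and m: "\<And>d e. d \<in> germs X \<Longrightarrow> e \<in> germs X \<Longrightarrow> \<rho> (d \<otimes>\<^bsub>germ_monoid X\<^esub> e) = \<rho> d * \<rho> e"
  shows "restrict \<rho> (germs X) \<in> chars X"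
proof (rule charsI[OF _ _ _ X])
  show "\<rho> (J, x) \<in> roots_of_unity" if "(J, x) \<in> germs X" for J x by (rule r[OF that])
  show "\<rho> (J, plus_arr C x y) = \<rho> (J, x) * \<rho> (J, y)" if g: "(J, x) \<in> germs X" "(J, y) \<in> germs X" for J x y
    using m[OF g] g X by (simp add: germ_mult)
  show "\<rho> (J', TR J J' X \<cdot> x) = \<rho> (J, x)" if g: "(J, x) \<in> germs X" "Fin J'" "J \<subseteq> J'" for J J' x
  proof -
    let ?z = "(J', zero_arr C c (AO J' X))"
    have z: "?z \<in> germs X" using g X by simp
    have "?z \<otimes>\<^bsub>germ_monoid X\<^esub> ?z = ?z" using g X by (simp add: germ_mult)
    then have "\<rho> ?z = \<rho> ?z * \<rho> ?z" using m[OF z z] by simp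
    then have "\<rho> ?z = 1" using roots_of_unity_nonzero[OF r[OF z]] by simp
    moreover have "(J, x) \<otimes>\<^bsub>germ_monoid X\<^esub> ?z = (J', TR J J' X \<cdot> x)"
      using g X by (simp add: germ_mult Un_absorb1)
    ultimately show ?thesis using m[OF g(1) z] by simp
  qed
qed

definition pullback :: "'m \<Rightarrow> ((nat \<times> 's) set \<times> 'm \<Rightarrow> complex) \<Rightarrow> (nat \<times> 's) set \<times> 'm \<Rightarrow> complex" where
  "pullback f \<rho> = restrict (\<lambda>d. \<rho> (fst d, AM (fst d) f \<cdot> snd d)) (germs (src C f))"

definition trivial :: "'o \<Rightarrow> (nat \<times> 's) set \<times> 'm \<Rightarrow> complex" where
  "trivial X = restrict (\<lambda>_. 1) (germs X)"

lemma pullback_apply: "(J, x) \<in> germs (src C f) \<Longrightarrow> pullback f \<rho> (J, x) = \<rho> (J, AM J f \<cdot> x)"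
  by (simp add: pullback_def del: germs_iff)

lemma trivial_apply: "(J, x) \<in> germs X \<Longrightarrow> trivial X (J, x) = 1"
  by (simp add: trivial_def del: germs_iff)

lemma trivial_chars: "X \<in> obj C \<Longrightarrow> trivial X \<in> chars X"
  unfolding trivial_def by (rule charsI) auto

lemma AM_germ: "f \<in> arr C \<Longrightarrow> (J, x) \<in> germs (src C f) \<Longrightarrow> (J, AM J f \<cdot> x) \<in> germs (tgt C f)"
  by simp

lemma pullback_chars:
  assumes f: "f \<in> arr C" and r: "\<rho> \<in> chars (tgt C f)"
  shows "pullback f \<rho> \<in> chars (src C f)"
  unfolding pullback_def
proof (rule charsI)
  note D = charsD[OF r]
  show "\<rho> (fst (J, x), AM (fst (J, x)) f \<cdot> snd (J, x)) \<in> roots_of_unity" if "(J, x) \<in> germs (src C f)" for J x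
    using D(1)[OF AM_germ[OF f that]] by simp
  show "\<rho> (fst (J, plus_arr C x y), AM (fst (J, plus_arr C x y)) f \<cdot> snd (J, plus_arr C x y)) =
      \<rho> (fst (J, x), AM (fst (J, x)) f \<cdot> snd (J, x)) * \<rho> (fst (J, y), AM (fst (J, y)) f \<cdot> snd (J, y))"
    if g: "(J, x) \<in> germs (src C f)" "(J, y) \<in> germs (src C f)" for J x y
    using D(2)[OF AM_germ[OF f g(1)] AM_germ[OF f g(2)]] g f by (simp add: cmp_plus_arr)
  show "\<rho> (fst (J', TR J J' (src C f) \<cdot> x), AM (fst (J', TR J J' (src C f) \<cdot> x)) f \<cdot> snd (J', TR J J' (src C f) \<cdot> x)) =
      \<rho> (fst (J, x), AM (fst (J, x)) f \<cdot> snd (J, x))"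
    if g: "(J, x) \<in> germs (src C f)" "Fin J'" "J \<subseteq> J'" for J J' x
  proof -
    have "AM J' f \<cdot> (TR J J' (src C f) \<cdot> x) = (TR J J' (tgt C f) \<cdot> AM J f) \<cdot> x"
      by (rule cmp_reassoc[OF TR_natural]) (use f g in auto)
    also have "\<dots> = TR J J' (tgt C f) \<cdot> (AM J f \<cdot> x)" using f g by simp
    finally show ?thesis using D(3)[OF AM_germ[OF f g(1)] g(2,3)] by simp
  qed
qed (use f in auto)

text \<open>By \<open>H\<close> the character is well defined on the image of \<open>\<phi>\<close>,
  and divisibility extends it from there. For the second map of a triangle this is exactness; for a
  coaugmentation it yields the retraction.\<close>

lemma chars_extend:
  assumes \<phi>: "\<phi> \<in> arr C" and y: "y \<in> chars (src C \<phi>)"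
    and H: "\<And>M x. (M, x) \<in> germs (src C \<phi>) \<Longrightarrow> AM M \<phi> \<cdot> x = zero_arr C c (AO M (tgt C \<phi>)) \<Longrightarrow> y (M, x) = 1"
  shows "\<exists>z \<in> chars (tgt C \<phi>). pullback \<phi> z = y"
proof -
  let ?Y = "src C \<phi>" and ?Z = "tgt C \<phi>"
  have o: "?Y \<in> obj C" "?Z \<in> obj C" using \<phi> by auto
  note D = charsD[OF y]
  interpret M: comm_monoid "germ_monoid ?Z" by (rule germ_comm_monoid[OF o(2)])
  \<comment> \<open>The partial character on the image of \<open>\<phi>\<close>, given by the values
    of \<open>y\<close> on preimages.\<close>
  define P where "P = {((J, AM J \<phi> \<cdot> x), y (J, x)) | J x. (J, x) \<in> germs ?Y}"
  have nat: "TR J J' ?Z \<cdot> (AM J \<phi> \<cdot> x) = AM J' \<phi> \<cdot> (TR J J' ?Y \<cdot> x)"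
    if "(J, x) \<in> germs ?Y" "Fin J'" "J \<subseteq> J'" for J J' x
    using cmp_reassoc[OF TR_natural, of \<phi> J' J x] that \<phi> by simp
  have tg: "(J', TR J J' ?Y \<cdot> x) \<in> germs ?Y" if "(J, x) \<in> germs ?Y" "Fin J'" "J \<subseteq> J'" for J J' x
    using that o by simp
  have "partial_character (germ_monoid ?Z) P"
    unfolding partial_character_def
  proof (intro conjI allI impI)
    show "P \<subseteq> carrier (germ_monoid ?Z) \<times> roots_of_unity"
      using D(1) AM_germ[OF \<phi>] by (auto simp: P_def simp del: germs_iff)
    have "({}, zero_arr C c ?Y) \<in> germs ?Y" using o by simp
    then have "(({}, AM {} \<phi> \<cdot> zero_arr C c ?Y), y ({}, zero_arr C c ?Y)) \<in> P" unfolding P_def by blast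
    moreover have "y ({}, zero_arr C c ?Y) = 1" using chars_zero[OF y o(1), of "{}"] by simp
    moreover have "({}, AM {} \<phi> \<cdot> zero_arr C c ?Y) = \<one>\<^bsub>germ_monoid ?Z\<^esub>"
      using \<phi> by (simp add: germ_monoid_def)
    ultimately show "(\<one>\<^bsub>germ_monoid ?Z\<^esub>, 1) \<in> P" by (simp only:)
    show "(m \<otimes>\<^bsub>germ_monoid ?Z\<^esub> n, v * w) \<in> P" if mn: "(m, v) \<in> P \<and> (n, w) \<in> P" for m v n w
    proof -
      obtain J x J' x' where e: "(J, x) \<in> germs ?Y" "m = (J, AM J \<phi> \<cdot> x)" "v = y (J, x)"
        "(J', x') \<in> germs ?Y" "n = (J', AM J' \<phi> \<cdot> x')" "w = y (J', x')"
        using mn unfolding P_def by blast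
      have U: "Fin (J \<union> J')" using e by simp
      let ?x = "plus_arr C (TR J (J \<union> J') ?Y \<cdot> x) (TR J' (J \<union> J') ?Y \<cdot> x')"
      have g1: "(J \<union> J', TR J (J \<union> J') ?Y \<cdot> x) \<in> germs ?Y" by (rule tg[OF e(1) U]) blast
      have g2: "(J \<union> J', TR J' (J \<union> J') ?Y \<cdot> x') \<in> germs ?Y" by (rule tg[OF e(4) U]) blast
      have g3: "(J \<union> J', ?x) \<in> germs ?Y" using g1 g2 by simp
      have "AM (J \<union> J') \<phi> \<cdot> ?x = plus_arr C (AM (J \<union> J') \<phi> \<cdot> (TR J (J \<union> J') ?Y \<cdot> x)) (AM (J \<union> J') \<phi> \<cdot> (TR J' (J \<union> J') ?Y \<cdot> x'))"
        by (rule cmp_plus_arr(1)) (use g1 g2 \<phi> in auto)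
      also have "\<dots> = plus_arr C (TR J (J \<union> J') ?Z \<cdot> (AM J \<phi> \<cdot> x)) (TR J' (J \<union> J') ?Z \<cdot> (AM J' \<phi> \<cdot> x'))"
        unfolding nat[OF e(1) U Un_upper1] nat[OF e(4) U Un_upper2] ..
      finally have "m \<otimes>\<^bsub>germ_monoid ?Z\<^esub> n = (J \<union> J', AM (J \<union> J') \<phi> \<cdot> ?x)"
        unfolding e(2,5) germ_mult by simp
      moreover have "v * w = y (J \<union> J', ?x)"
        unfolding D(2)[OF g1 g2] D(3)[OF e(1) U Un_upper1] D(3)[OF e(4) U Un_upper2] e(3,6) ..
      ultimately show ?thesis unfolding P_def using g3 by blast
    qed
    show "v = w" if mn: "(m, v) \<in> P \<and> (n, w) \<in> P \<and> e \<in> carrier (germ_monoid ?Z) \<and>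
        m \<otimes>\<^bsub>germ_monoid ?Z\<^esub> e = n \<otimes>\<^bsub>germ_monoid ?Z\<^esub> e" for m v n w e
    proof -
      obtain J x J' x' where e: "(J, x) \<in> germs ?Y" "m = (J, AM J \<phi> \<cdot> x)" "v = y (J, x)"
        "(J', x') \<in> germs ?Y" "n = (J', AM J' \<phi> \<cdot> x')" "w = y (J', x')"
        using mn unfolding P_def by blast
      obtain L l where L: "e = (L, l)" "(L, l) \<in> germs ?Z" using mn by (cases e) auto
      define N where "N = J \<union> L"
      have "m \<otimes>\<^bsub>germ_monoid ?Z\<^esub> e = n \<otimes>\<^bsub>germ_monoid ?Z\<^esub> e" using mn by blast
      then have N': "J' \<union> L = N" and eq: "plus_arr C (TR J N ?Z \<cdot> (AM J \<phi> \<cdot> x)) (TR L N ?Z \<cdot> l) =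
          plus_arr C (TR J' N ?Z \<cdot> (AM J' \<phi> \<cdot> x')) (TR L N ?Z \<cdot> l)"
        unfolding e(2,5) L(1) germ_mult N_def by auto
      have N: "Fin N" "J \<subseteq> N" "J' \<subseteq> N" "L \<subseteq> N" using e(1) L(2) N' by (auto simp: N_def)
      \<comment> \<open>The summand \<open>e\<close> is cancelled in the Hom group at the common
        stage \<open>N\<close>. The difference of the two preimages is then killed by
        \<open>\<phi>\<close> at that stage, where \<open>H\<close> applies.\<close>
      have "TR J N ?Z \<cdot> (AM J \<phi> \<cdot> x) = TR J' N ?Z \<cdot> (AM J' \<phi> \<cdot> x')"
        by (rule plus_right_cancel[OF _ _ _ _ _ _ _ eq]) (use e(1,4) L(2) N o \<phi> in auto)
      then have E: "AM N \<phi> \<cdot> (TR J N ?Y \<cdot> x) = AM N \<phi> \<cdot> (TR J' N ?Y \<cdot> x')"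
        unfolding nat[OF e(1) N(1,2)] nat[OF e(4) N(1,3)] .
      let ?x = "TR J N ?Y \<cdot> x" and ?x' = "TR J' N ?Y \<cdot> x'"
      have g: "(N, ?x) \<in> germs ?Y" "(N, ?x') \<in> germs ?Y" using tg[OF e(1) N(1,2)] tg[OF e(4) N(1,3)] .
      have "AM N \<phi> \<cdot> minus_arr C ?x ?x' = minus_arr C (AM N \<phi> \<cdot> ?x) (AM N \<phi> \<cdot> ?x')"
        by (rule cmp_minus(1)) (use g \<phi> in auto)
      also have "\<dots> = zero_arr C c (AO N ?Z)"
        unfolding E using g(2) \<phi> by (subst minus_self) auto
      finally have z: "AM N \<phi> \<cdot> minus_arr C ?x ?x' = zero_arr C c (AO N ?Z)" .
      have "(N, minus_arr C ?x ?x') \<in> germs ?Y" using g by simp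
      then have "y (N, minus_arr C ?x ?x') = 1" using z by (rule H)
      then have "y (N, ?x) = y (N, ?x')" using chars_minus[OF y g] by simp
      then show "v = w" unfolding D(3)[OF e(1) N(1,2)] D(3)[OF e(4) N(1,3)] e(3,6) .
    qed
  qed
  then obtain \<rho> where \<rho>: "\<And>m. m \<in> carrier (germ_monoid ?Z) \<Longrightarrow> \<rho> m \<in> roots_of_unity"
    "\<And>m n. m \<in> carrier (germ_monoid ?Z) \<Longrightarrow> n \<in> carrier (germ_monoid ?Z) \<Longrightarrow>
      \<rho> (m \<otimes>\<^bsub>germ_monoid ?Z\<^esub> n) = \<rho> m * \<rho> n" "\<And>m v. (m, v) \<in> P \<Longrightarrow> \<rho> m = v"
    by (rule M.partial_character_total) (rule that)
  let ?z = "restrict \<rho> (germs ?Z)"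
  have z: "?z \<in> chars ?Z" by (rule chars_hom[OF o(2)]) (use \<rho>(1,2) in \<open>simp_all del: germs_iff\<close>)
  have "pullback \<phi> ?z = y"
  proof (rule chars_eqI[OF pullback_chars[OF \<phi> z] y])
    fix J x assume g: "(J, x) \<in> germs ?Y"
    have "((J, AM J \<phi> \<cdot> x), y (J, x)) \<in> P" unfolding P_def using g by blast
    then have "\<rho> (J, AM J \<phi> \<cdot> x) = y (J, x)" by (rule \<rho>(3))
    then show "pullback \<phi> ?z (J, x) = y (J, x)"
      using pullback_apply[OF g] AM_germ[OF \<phi> g] by (simp del: germs_iff)
  qed
  then show ?thesis using z by blast
qed

lemma germ_finsum:
  assumes J: "small \<kappa> (J :: 'u set)" and cop: "is_coproduct C J X Q \<iota>" and g: "(L, x) \<in> germs Q"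
  shows "x \<in> finsum C J (\<lambda>j. AO L (X j)) (AO L Q) (\<lambda>j. AM L (\<iota> j)) c"
  by (rule compact_finsum_univ[OF c_compact J am_coproduct[OF J cop]]) (use g in simp)

text \<open>A germ of the coproduct is a finite sum because \<open>c\<close> is compact and the
  iterates preserve coproducts. So the product of the values of \<open>y j\<close> on its
  projections has only finitely many factors different from 1.\<close>

lemma chars_glue:
  assumes J: "small \<kappa> (J :: 'u set)" and cop: "is_coproduct C J X Q \<iota>" and y: "\<And>j. j \<in> J \<Longrightarrow> y j \<in> chars (X j)"
  shows "\<exists>z \<in> chars Q. \<forall>j \<in> J. pullback (\<iota> j) z = y j"
proof -
  note k = coproductD[OF cop]
  obtain \<pi> where \<pi>: "\<And>j. j \<in> J \<Longrightarrow> \<pi> j \<in> arr C" "\<And>j. j \<in> J \<Longrightarrow> src C (\<pi> j) = Q"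
    "\<And>j. j \<in> J \<Longrightarrow> tgt C (\<pi> j) = X j" "\<And>j. j \<in> J \<Longrightarrow> \<pi> j \<cdot> \<iota> j = idn C (X j)"
    "\<And>j k. j \<in> J \<Longrightarrow> k \<in> J \<Longrightarrow> k \<noteq> j \<Longrightarrow> \<pi> j \<cdot> \<iota> k = zero_arr C (X k) (X j)"
    by (rule coproduct_proj[OF cop]) blast
  have \<pi>m: "AM L (\<pi> j) \<cdot> AM L (\<iota> j) = idn C (AO L (X j))" if "j \<in> J" for j L
    using am_cmp[of "\<iota> j" "\<pi> j" "enum L"] \<pi> k that by simp
  have \<pi>m0: "AM L (\<pi> j) \<cdot> AM L (\<iota> i) = zero_arr C (AO L (X i)) (AO L (X j))" if "j \<in> J" "i \<in> J" "i \<noteq> j" for j i L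
    using am_cmp[of "\<iota> i" "\<pi> j" "enum L"] \<pi>(1-3) \<pi>(5)[OF that] k that am_zero by simp
  define w where "w j d = y j (fst d, AM (fst d) (\<pi> j) \<cdot> snd d)" for j d
  have pg: "(L, AM L (\<pi> j) \<cdot> x) \<in> germs (X j)" if "(L, x) \<in> germs Q" "j \<in> J" for L x j
    using that \<pi>(1-3) by simp
  have wz: "w j (L, x) = 1" if "(L, x) \<in> germs Q" "j \<in> J" "AM L (\<pi> j) \<cdot> x = zero_arr C c (AO L (X j))" for L x j
    using chars_zero[OF y[OF that(2)] k(2)[OF that(2)], of L] that by (simp add: w_def)
  have fin: "finite {j \<in> J. AM L (\<pi> j) \<cdot> x \<noteq> zero_arr C c (AO L (X j))}" if g: "(L, x) \<in> germs Q" for L x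
    using germ_finsum[OF J cop g]
  proof induction
    case finsum_zero
    have e: "{j \<in> J. AM L (\<pi> j) \<cdot> zero_arr C c (AO L Q) \<noteq> zero_arr C c (AO L (X j))} = {}"
      using \<pi>(1-3) by auto
    show ?case unfolding e by (rule finite.emptyI)
  next
    case (finsum_insert i a f)
    note i = finsum_insert(1)
    have a: "a \<in> arr C" "src C a = c" "tgt C a = AO L (X i)" using finsum_insert(2) by auto
    have fH: "f \<in> arr C" "src C f = c" "tgt C f = AO L Q"
      using finsum_Hom[OF finsum_insert(3) am_coproduct[OF J cop] c_obj] by auto
    have "AM L (\<pi> j) \<cdot> plus_arr C (AM L (\<iota> i) \<cdot> a) f = zero_arr C c (AO L (X j))"
      if j: "j \<in> J" "j \<noteq> i" "AM L (\<pi> j) \<cdot> f = zero_arr C c (AO L (X j))" for j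
      using a fH \<pi>(1-3) k i j
      by (simp add: cmp_plus_arr cmp_reassoc[OF \<pi>m0[OF j(1) i j(2)[symmetric]]])
    then have "{j \<in> J. AM L (\<pi> j) \<cdot> plus_arr C (AM L (\<iota> i) \<cdot> a) f \<noteq> zero_arr C c (AO L (X j))} \<subseteq>
        insert i {j \<in> J. AM L (\<pi> j) \<cdot> f \<noteq> zero_arr C c (AO L (X j))}" by blast
    then show ?case by (rule finite_subset) (use finsum_insert.IH in simp)
  qed
  have finw: "finite {j \<in> J. w j (L, x) \<noteq> 1}" if g: "(L, x) \<in> germs Q" for L x
    by (rule finite_subset[OF _ fin[OF g]]) (use wz[OF g] in blast)
  define \<rho> where "\<rho> d = (\<Prod>j \<in> {j \<in> J. w j d \<noteq> 1}. w j d)" for d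
  \<comment> \<open>The finite support varies with the germ; over a common larger finite set the
    products for two germs can be multiplied.\<close>
  have \<rho>F: "\<rho> d = (\<Prod>j \<in> F. w j d)" if "finite F" "F \<subseteq> J" "{j \<in> J. w j d \<noteq> 1} \<subseteq> F" for F d
    unfolding \<rho>_def using that by (intro prod.mono_neutral_left) auto
  have wr: "w j (L, x) \<in> roots_of_unity" if "(L, x) \<in> germs Q" "j \<in> J" for L x j
    using charsD(1)[OF y[OF that(2)] pg[OF that]] by (simp add: w_def)
  have z: "restrict \<rho> (germs Q) \<in> chars Q"
  proof (rule charsI)
    show "Q \<in> obj C" by (rule k(1))
    show "\<rho> (L, x) \<in> roots_of_unity" if g: "(L, x) \<in> germs Q" for L x
      unfolding \<rho>_def by (rule roots_of_unity_prod) (use wr[OF g] in blast)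
    show "\<rho> (L, plus_arr C x x') = \<rho> (L, x) * \<rho> (L, x')"
      if g: "(L, x) \<in> germs Q" "(L, x') \<in> germs Q" for L x x'
    proof -
      have w: "w j (L, plus_arr C x x') = w j (L, x) * w j (L, x')" if j: "j \<in> J" for j
        using charsD(2)[OF y[OF j] pg[OF g(1) j] pg[OF g(2) j]] g \<pi>(1-3)[OF j]
        by (simp add: w_def cmp_plus_arr)
      let ?F = "{j \<in> J. w j (L, x) \<noteq> 1} \<union> {j \<in> J. w j (L, x') \<noteq> 1}"
      have F: "finite ?F" "?F \<subseteq> J" using finw g by auto
      have "{j \<in> J. w j (L, plus_arr C x x') \<noteq> 1} \<subseteq> ?F" using w by auto
      then have "\<rho> (L, plus_arr C x x') = (\<Prod>j \<in> ?F. w j (L, x) * w j (L, x'))"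
        using \<rho>F[OF F] w by (auto intro!: prod.cong)
      also have "\<dots> = \<rho> (L, x) * \<rho> (L, x')"
        unfolding prod.distrib using \<rho>F[OF F, of "(L, x)"] \<rho>F[OF F, of "(L, x')"] by auto
      finally show ?thesis .
    qed
    show "\<rho> (L', TR L L' Q \<cdot> x) = \<rho> (L, x)" if g: "(L, x) \<in> germs Q" "Fin L'" "L \<subseteq> L'" for L L' x
    proof -
      have w: "w j (L', TR L L' Q \<cdot> x) = w j (L, x)" if j: "j \<in> J" for j
      proof -
        have "AM L' (\<pi> j) \<cdot> (TR L L' Q \<cdot> x) = (TR L L' (X j) \<cdot> AM L (\<pi> j)) \<cdot> x"
          by (rule cmp_reassoc) (use TR_natural[OF \<pi>(1)[OF j] g(2,3)] g \<pi>(1-3)[OF j] k(1) in auto)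
        also have "\<dots> = TR L L' (X j) \<cdot> (AM L (\<pi> j) \<cdot> x)" using g \<pi>(1-3)[OF j] k(2)[OF j] by simp
        finally show ?thesis using charsD(3)[OF y[OF j] pg[OF g(1) j] g(2,3)] by (simp add: w_def)
      qed
      then have "{j \<in> J. w j (L', TR L L' Q \<cdot> x) \<noteq> 1} = {j \<in> J. w j (L, x) \<noteq> 1}" by auto
      then show ?thesis unfolding \<rho>_def using w by (auto intro!: prod.cong)
    qed
  qed
  have "pullback (\<iota> i) (restrict \<rho> (germs Q)) = y i" if i: "i \<in> J" for i
  proof (rule chars_eqI)
    have i': "\<iota> i \<in> arr C" "src C (\<iota> i) = X i" "tgt C (\<iota> i) = Q" using k i by auto
    show "pullback (\<iota> i) (restrict \<rho> (germs Q)) \<in> chars (X i)"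
      using pullback_chars[OF i'(1)] i' z by simp
    show "y i \<in> chars (X i)" by (rule y[OF i])
    fix L x assume g: "(L, x) \<in> germs (X i)"
    have g': "(L, AM L (\<iota> i) \<cdot> x) \<in> germs Q" using AM_germ[OF i'(1)] g i' by simp
    have x: "x \<in> arr C" "src C x = c" "tgt C x = AO L (X i)" using g by auto
    have w1: "w j (L, AM L (\<iota> i) \<cdot> x) = (if j = i then y i (L, x) else 1)" if j: "j \<in> J" for j
    proof (cases "j = i")
      case True
      then show ?thesis using cmp_reassoc[OF \<pi>m[OF i, of L], of x] x \<pi>(1-3)[OF i] i' by (simp add: w_def)
    next
      case False
      have "AM L (\<pi> j) \<cdot> (AM L (\<iota> i) \<cdot> x) = zero_arr C c (AO L (X j))"
        using cmp_reassoc[OF \<pi>m0[OF j i False[symmetric], of L], of x] x \<pi>(1-3)[OF j] i' k(2)[OF j] by simp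
      then show ?thesis using wz[OF g' j] False by simp
    qed
    have "\<rho> (L, AM L (\<iota> i) \<cdot> x) = (\<Prod>j \<in> {i}. w j (L, AM L (\<iota> i) \<cdot> x))"
      by (rule \<rho>F) (use i w1 in \<open>auto split: if_splits\<close>)
    then show "pullback (\<iota> i) (restrict \<rho> (germs Q)) (L, x) = y i (L, x)"
      using w1[OF i] g' pullback_apply[of L x "\<iota> i"] g i' by (simp del: germs_iff)
  qed
  then show ?thesis using z by blast
qed

text \<open>Germs of the coproduct are finite sums of germs of the summands, so a character is
  determined by its restrictions to the summands.\<close>

lemma chars_separated:
  assumes J: "small \<kappa> (J :: 'u set)" and cop: "is_coproduct C J X Q \<iota>" and z: "z \<in> chars Q"
    and t: "\<And>j. j \<in> J \<Longrightarrow> pullback (\<iota> j) z = trivial (X j)"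
  shows "z = trivial Q"
proof (rule chars_eqI[OF z trivial_chars])
  note k = coproductD[OF cop]
  show "Q \<in> obj C" by (rule k)
  fix L x assume g: "(L, x) \<in> germs Q"
  have L: "Fin L" using g by simp
  have "z (L, x) = 1"
    using germ_finsum[OF J cop g]
  proof induction
    case finsum_zero
    show ?case by (rule chars_zero[OF z k(1) L])
  next
    case (finsum_insert j a f)
    note j = finsum_insert(1)
    have a: "(L, a) \<in> germs (X j)" using finsum_insert(2) L by auto
    have f: "(L, f) \<in> germs Q"
      using finsum_Hom[OF finsum_insert(3) am_coproduct[OF J cop] c_obj] L by auto
    have ja: "(L, AM L (\<iota> j) \<cdot> a) \<in> germs Q" using AM_germ[of "\<iota> j" L a] a k j by simp
    have "z (L, AM L (\<iota> j) \<cdot> a) = pullback (\<iota> j) z (L, a)"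
      using pullback_apply[of L a "\<iota> j" z] a k j by simp
    also have "\<dots> = 1" unfolding t[OF j] by (rule trivial_apply[OF a])
    finally show ?case using charsD(2)[OF z ja f] finsum_insert.IH by simp
  qed
  then show "z (L, x) = trivial Q (L, x)" using trivial_apply[OF g] by simp
qed

lemma chars_small:
  assumes t: "t \<in> T0" shows "small \<kappa> (chars t)"
proof (rule small_subset)
  have "small \<kappa> (Pow (UNIV \<times> Sx :: (nat \<times> 's) set))"
    by (intro small_Pow small_Sigma Sx_small small_countable[of "UNIV :: nat set"]) auto
  then have "small \<kappa> {J. Fin J}" by (rule small_subset) (auto simp: Fin_def)
  moreover have "small \<kappa> (Hom C c (AO J t))" for J
    using locally_small core_obj[OF t] unfolding locally_small_def by simp
  ultimately have "small \<kappa> (SIGMA J : {J. Fin J}. Hom C c (AO J t))" by (rule small_Sigma)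
  then have "small \<kappa> (germs t)" by (rule small_subset) auto
  then show "small \<kappa> (germs t \<rightarrow>\<^sub>E roots_of_unity)"
    by (rule small_extensional_funcset[OF _ small_countable[OF countable_roots_of_unity]])
qed (auto simp: chars_def)

lemma chars_cohomological: "cohomological C \<kappa> T0 chars pullback trivial"
proof unfold_locales
  show "pullback f y \<in> chars (src C f)" if "f \<in> arr C" "y \<in> chars (tgt C f)" for f y
    using that by (rule pullback_chars)
  show "pullback (idn C X) y = y" if X: "X \<in> obj C" "y \<in> chars X" for X y
  proof (rule chars_eqI[of _ X])
    show "pullback (idn C X) y \<in> chars X" using pullback_chars[of "idn C X" y] X by simp
    fix J x assume "(J, x) \<in> germs X"
    then show "pullback (idn C X) y (J, x) = y (J, x)" using pullback_apply[of J x "idn C X" y] X by simp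
  qed fact
  show "pullback (g \<cdot> f) y = pullback f (pullback g y)"
    if fg: "f \<in> arr C" "g \<in> arr C" "tgt C f = src C g" "y \<in> chars (tgt C g)" for f g y
  proof (rule chars_eqI[of _ "src C f"])
    show "pullback (g \<cdot> f) y \<in> chars (src C f)" using pullback_chars[of "g \<cdot> f" y] fg by simp
    show "pullback f (pullback g y) \<in> chars (src C f)"
      using pullback_chars[OF fg(1), of "pullback g y"] pullback_chars[OF fg(2,4)] fg(3) by simp
    fix J x assume g: "(J, x) \<in> germs (src C f)"
    have "(J, AM J f \<cdot> x) \<in> germs (src C g)" using AM_germ[OF fg(1) g] fg(3) by simp
    then show "pullback (g \<cdot> f) y (J, x) = pullback f (pullback g y) (J, x)"
      using pullback_apply[of J x "g \<cdot> f" y] pullback_apply[OF g] pullback_apply[of J "AM J f \<cdot> x" g y] g fg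
      by (simp add: am_cmp)
  qed
  show "pullback (zero_arr C X Y) y = trivial X" if XY: "X \<in> obj C" "Y \<in> obj C" "y \<in> chars Y" for X Y y
  proof (rule chars_eqI[of _ X])
    show "pullback (zero_arr C X Y) y \<in> chars X" using pullback_chars[of "zero_arr C X Y" y] XY by simp
    show "trivial X \<in> chars X" by (rule trivial_chars[OF XY(1)])
    fix J x assume g: "(J, x) \<in> germs X"
    then show "pullback (zero_arr C X Y) y (J, x) = trivial X (J, x)"
      using pullback_apply[of J x "zero_arr C X Y" y] trivial_apply[OF g] XY chars_zero[OF XY(3,2), of J]
      by (simp add: am_zero)
  qed
  show "pullback (minus_arr C f g) y = trivial (src C g)"
    if fg: "f \<in> arr C" "g \<in> arr C" "src C f = src C g" "tgt C f = tgt C g" "y \<in> chars (tgt C g)"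
      "pullback f y = pullback g y" for f g y
  proof (rule chars_eqI[of _ "src C g"])
    show "pullback (minus_arr C f g) y \<in> chars (src C g)" using pullback_chars[of "minus_arr C f g" y] fg by simp
    show "trivial (src C g) \<in> chars (src C g)" by (rule trivial_chars) (use fg in auto)
    fix J x assume gx: "(J, x) \<in> germs (src C g)"
    have f1: "(J, AM J f \<cdot> x) \<in> germs (tgt C g)" using AM_germ[OF fg(1), of J x] gx fg by simp
    have g1: "(J, AM J g \<cdot> x) \<in> germs (tgt C g)" by (rule AM_germ[OF fg(2) gx])
    have "y (J, AM J f \<cdot> x) = y (J, AM J g \<cdot> x)"
      using pullback_apply[of J x f y] pullback_apply[OF gx, of y] gx fg by simp
    then have "y (J, minus_arr C (AM J f \<cdot> x) (AM J g \<cdot> x)) = 1"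
      using chars_minus[OF fg(5) f1 g1] roots_of_unity_nonzero[OF charsD(1)[OF fg(5) g1]] by simp
    moreover have "AM J (minus_arr C f g) \<cdot> x = minus_arr C (AM J f \<cdot> x) (AM J g \<cdot> x)"
      using gx fg by (simp add: am_minus cmp_minus)
    ultimately show "pullback (minus_arr C f g) y (J, x) = trivial (src C g) (J, x)"
      using pullback_apply[of J x "minus_arr C f g" y] trivial_apply[OF gx] gx fg by simp
  qed
  show "\<exists>z \<in> chars Q. \<forall>j \<in> J. pullback (\<iota> j) z = xs j"
    if "small \<kappa> J" "is_coproduct C J Xs Q \<iota>" "\<And>j. j \<in> J \<Longrightarrow> xs j \<in> chars (Xs j)" for J :: "'u set" and Xs Q \<iota> xs
    using that by (rule chars_glue)
  show "z = trivial Q" if "small \<kappa> J" "is_coproduct C J Xs Q \<iota>" "z \<in> chars Q"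
      "\<And>j. j \<in> J \<Longrightarrow> pullback (\<iota> j) z = trivial (Xs j)" for J :: "'u set" and Xs Q \<iota> z
    using that by (rule chars_separated)
  show "\<exists>z \<in> chars (tgt C g). pullback g z = y"
    if T: "(f, g, h) \<in> tri C" and y: "y \<in> chars (tgt C f)" "pullback f y = trivial (src C f)" for f g h y
  proof (rule chars_extend)
    note t = triD[OF T]
    show "g \<in> arr C" "y \<in> chars (src C g)" using t y by auto
    fix M x assume g: "(M, x) \<in> germs (src C g)" and z: "AM M g \<cdot> x = zero_arr C c (AO M (tgt C g))"
    \<comment> \<open>The iterate at stage \<open>M\<close> is exact, so a germ killed by
      \<open>g\<close> lifts along \<open>f\<close> at the same stage, and there \<open>y\<close> is
      trivial by assumption.\<close>
    obtain h' where T': "(AM M f, AM M g, h') \<in> tri C" using am_exact[OF T] by blast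
    obtain w where w: "w \<in> arr C" "src C w = c" "tgt C w = AO M (src C f)" "AM M f \<cdot> w = x"
      using weak_kernel[OF T', of x] g z t by auto
    have "(M, w) \<in> germs (src C f)" using w g by simp
    then show "y (M, x) = 1" using pullback_apply[of M w f y] y(2) trivial_apply w(4) by metis
  qed
  show "small \<kappa> (chars t)" if "t \<in> T0" for t using that by (rule chars_small)
qed

text \<open>The assumption says that the germ of the identity of \<open>c\<close> survives every
  transition, which expresses that its class in the colimit is nonzero.\<close>

theorem split_coaugmentations:
  assumes nz: "\<And>J. Fin J \<Longrightarrow> TR {} J c \<noteq> zero_arr C c (AO J c)"
  obtains I where "I \<in> obj C" "\<not> zero_object C I"
    "\<And>s. s \<in> Sx \<Longrightarrow> \<exists>r. r \<in> arr C \<and> src C r = \<Phi>o s I \<and> tgt C r = I \<and> r \<cdot> \<tau> s I = idn C I"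
proof -
  interpret K: cohomological C \<kappa> T0 chars pullback trivial by (rule chars_cohomological)
  obtain Z where Z: "Z \<in> T0" using core_zero by blast
  obtain I u where U: "K.universal I u"
    by (rule K.universal_ex[OF core_obj[OF Z] trivial_chars[OF core_obj[OF Z]]]) blast
  note u = K.universalD[OF U]
  have "\<not> zero_object C I"
  proof
    assume I0: "zero_object C I"
    interpret M: comm_monoid "germ_monoid c" by (rule germ_comm_monoid) simp
    let ?z = "({}, idn C c)"
    have zc: "?z \<in> carrier (germ_monoid c)" by simp
    have "?z \<otimes>\<^bsub>germ_monoid c\<^esub> e \<noteq> e" if ec: "e \<in> carrier (germ_monoid c)" for e
    proof
      assume eq: "?z \<otimes>\<^bsub>germ_monoid c\<^esub> e = e"
      obtain L w where e: "e = (L, w)" "(L, w) \<in> germs c" using ec by (cases e) auto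
      have "plus_arr C (TR {} L c) w = w" using eq e by (simp add: germ_mult)
      also have "\<dots> = plus_arr C (zero_arr C c (AO L c)) w" using e by simp
      finally have "TR {} L c = zero_arr C c (AO L c)"
        by (rule plus_right_cancel[rotated -1]) (use e in auto)
      then show False using nz[of L] e by simp
    qed
    then obtain P d where P: "partial_character (germ_monoid c) P" "(?z, d) \<in> P" "d \<noteq> 1"
      by (rule M.character_separates[OF zc]) blast
    obtain \<rho> where \<rho>: "\<And>m. m \<in> carrier (germ_monoid c) \<Longrightarrow> \<rho> m \<in> roots_of_unity"
      "\<And>m n. m \<in> carrier (germ_monoid c) \<Longrightarrow> n \<in> carrier (germ_monoid c) \<Longrightarrow>
        \<rho> (m \<otimes>\<^bsub>germ_monoid c\<^esub> n) = \<rho> m * \<rho> n" "\<And>m v. (m, v) \<in> P \<Longrightarrow> \<rho> m = v"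
      by (rule M.partial_character_total[OF P(1)]) (rule that)
    have r: "restrict \<rho> (germs c) \<in> chars c"
      by (rule chars_hom[OF c_obj]) (use \<rho>(1,2) in \<open>simp_all del: germs_iff\<close>)
    obtain f where f: "f \<in> arr C" "src C f = c" "tgt C f = I" "pullback f u = restrict \<rho> (germs c)"
      by (rule K.universal_weakly_terminal[OF U c_obj r])
    have "f = zero_arr C c I" using zero_objectD(3)[OF I0 f(1)] f by simp
    then have "restrict \<rho> (germs c) = trivial c" using f(4) K.pb_zero[OF c_obj u(1,2)] by simp
    then have "\<rho> ?z = trivial c ?z" using zc by (metis germ_carrier restrict_apply')
    then show False using \<rho>(3)[OF P(2)] P(3) trivial_apply[of "{}" "idn C c" c] by simp
  qed
  moreover have "\<exists>r. r \<in> arr C \<and> src C r = \<Phi>o s I \<and> tgt C r = I \<and> r \<cdot> \<tau> s I = idn C I" if s: "s \<in> Sx" for s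
  proof -
    have I: "I \<in> obj C" by (rule u)
    have "\<exists>z \<in> chars (tgt C (\<tau> s I)). pullback (\<tau> s I) z = u"
    proof (rule chars_extend)
      show "\<tau> s I \<in> arr C" "u \<in> chars (src C (\<tau> s I))" using I u by auto
      fix M x assume g: "(M, x) \<in> germs (src C (\<tau> s I))" and z: "AM M (\<tau> s I) \<cdot> x = zero_arr C c (AO M (tgt C (\<tau> s I)))"
      have M: "Fin M" "finite M" using g by (auto simp: Fin_def)
      have g': "(M, x) \<in> germs I" using g I by simp
      \<comment> \<open>Applying \<open>\<tau>\<close> innermost is the transition to a fresh copy
        of \<open>s\<close>, and \<open>u\<close> is invariant under transitions; hence
        \<open>u\<close> is trivial on a germ killed by \<open>\<tau>\<close>.\<close>
      obtain n where n: "(n, s) \<notin> M" "enum (insert (n, s) M) = enum M @ [(n, s)]"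
        using enum_fresh[OF M(2)] by blast
      let ?N = "insert (n, s) M"
      have "TR M ?N I = AM M (\<tau> s I)"
        unfolding n(2) using tr_snoc[OF I, of "enum M" M "(n, s)"] n(1) enum_set[OF M(2)] by simp
      then have "TR M ?N I \<cdot> x = zero_arr C c (AO ?N I)"
        using z I by (simp add: n(2) ao_snoc)
      moreover have "u (?N, TR M ?N I \<cdot> x) = u (M, x)"
        by (rule charsD(3)[OF u(2) g']) (use M s in auto)
      ultimately show "u (M, x) = 1" using chars_zero[OF u(2) I, of ?N] M s by simp
    qed
    then obtain z where z: "z \<in> chars (\<Phi>o s I)" "pullback (\<tau> s I) z = u" using I by auto
    obtain f where f: "f \<in> arr C" "src C f = \<Phi>o s I" "tgt C f = I" "pullback f u = z"
      by (rule K.universal_weakly_terminal[OF U _ z(1)]) (use I in auto)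
    \<comment> \<open>The arrow \<open>f\<close> exists by weak terminality; its composite with
      \<open>\<tau>\<close> fixes \<open>u\<close>, hence is invertible, and the inverse corrects
      \<open>f\<close> to a retraction.\<close>
    have "pullback (f \<cdot> \<tau> s I) u = u" using K.pb_cmp[of "\<tau> s I" f u] f I z u(2) by simp
    then have iso: "iso_arr C (f \<cdot> \<tau> s I)"
      by (intro K.universal_iso[OF U U]) (use f I in auto)
    have "(inv_arr C (f \<cdot> \<tau> s I) \<cdot> f) \<cdot> \<tau> s I = inv_arr C (f \<cdot> \<tau> s I) \<cdot> (f \<cdot> \<tau> s I)"
      using f I iso by (intro cmp_assoc_arr) auto
    also have "\<dots> = idn C I" using inv_arr_simps(5)[OF iso] f I by simp
    finally show ?thesis
      using f I iso by (intro exI[of _ "inv_arr C (f \<cdot> \<tau> s I) \<cdot> f"]) auto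
  qed
  ultimately show ?thesis using u(1) by (intro that[of I]) auto
qed

end

section \<open>Monoidal coherence\<close>

context category
begin

lemma coproduct_transport:
  assumes cop: "is_coproduct C J X Q \<iota>" and \<theta>: "iso_arr C \<theta>" "src C \<theta> = Q" "tgt C \<theta> = Q'"
    and \<xi>: "\<And>j. j \<in> J \<Longrightarrow> iso_arr C (\<xi> j)" "\<And>j. j \<in> J \<Longrightarrow> src C (\<xi> j) = X j" "\<And>j. j \<in> J \<Longrightarrow> tgt C (\<xi> j) = X' j"
    and i: "\<And>j. j \<in> J \<Longrightarrow> \<iota>' j \<in> Hom C (X' j) Q'" "\<And>j. j \<in> J \<Longrightarrow> \<iota>' j \<cdot> \<xi> j = \<theta> \<cdot> \<iota> j"
  shows "is_coproduct C J X' Q' \<iota>'"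
proof (rule is_coproductI)
  note c = coproductD[OF cop]
  have th: "\<theta> \<in> arr C" using \<theta> by simp
  have x: "\<xi> j \<in> arr C" if "j \<in> J" for j using \<xi>(1)[OF that] by simp
  have i': "\<iota>' j \<in> arr C" "src C (\<iota>' j) = X' j" "tgt C (\<iota>' j) = Q'" if "j \<in> J" for j
    using i(1)[OF that] by auto
  show "Q' \<in> obj C" using tgt_obj[OF th] \<theta> by simp
  show "X' j \<in> obj C" if "j \<in> J" for j using tgt_obj[OF x[OF that]] \<xi>(3)[OF that] by simp
  show "\<iota>' j \<in> Hom C (X' j) Q'" if "j \<in> J" for j by (rule i(1)[OF that])
  show "\<exists>u \<in> Hom C Q' Y. \<forall>j \<in> J. u \<cdot> \<iota>' j = f j"
    if Y: "Y \<in> obj C" and f: "\<And>j. j \<in> J \<Longrightarrow> f j \<in> Hom C (X' j) Y" for Y f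
  proof -
    have f': "f j \<in> arr C" "src C (f j) = X' j" "tgt C (f j) = Y" if "j \<in> J" for j using f[OF that] by auto
    obtain u where u: "u \<in> arr C" "src C u = Q" "tgt C u = Y" "\<And>j. j \<in> J \<Longrightarrow> u \<cdot> \<iota> j = f j \<cdot> \<xi> j"
      by (rule coproduct_ex[OF cop Y, of "\<lambda>j. f j \<cdot> \<xi> j"]) (use f' x \<xi> in auto)
    have "(u \<cdot> inv_arr C \<theta>) \<cdot> \<iota>' j = f j" if j: "j \<in> J" for j
    proof (rule iso_epi[OF \<xi>(1)[OF j]])
      have "((u \<cdot> inv_arr C \<theta>) \<cdot> \<iota>' j) \<cdot> \<xi> j = u \<cdot> (inv_arr C \<theta> \<cdot> (\<iota>' j \<cdot> \<xi> j))"
        using u(1-3) \<theta> i' x \<xi> j by simp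
      also have "\<dots> = u \<cdot> \<iota> j" unfolding i(2)[OF j] using \<theta> c j by simp
      finally show "((u \<cdot> inv_arr C \<theta>) \<cdot> \<iota>' j) \<cdot> \<xi> j = f j \<cdot> \<xi> j" using u(4)[OF j] by simp
    qed (use u(1-3) \<theta> i' f' \<xi> j in auto)
    then show ?thesis by (intro bexI[of _ "u \<cdot> inv_arr C \<theta>"]) (use u(1-3) \<theta> in auto)
  qed
  show "u = v" if uv: "u \<in> arr C" "v \<in> arr C" "src C u = Q'" "src C v = Q'" "tgt C u = tgt C v"
    "\<And>j. j \<in> J \<Longrightarrow> u \<cdot> \<iota>' j = v \<cdot> \<iota>' j" for u v
  proof (rule iso_epi[OF \<theta>(1)])
    show "u \<cdot> \<theta> = v \<cdot> \<theta>"
    proof (rule coproduct_uniq[OF cop])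
      fix j assume j: "j \<in> J"
      have *: "(z \<cdot> \<theta>) \<cdot> \<iota> j = (z \<cdot> \<iota>' j) \<cdot> \<xi> j" if "z \<in> arr C" "src C z = Q'" for z
        using that \<theta> th c j i' x \<xi>(2,3) i(2)[OF j] by simp
      show "(u \<cdot> \<theta>) \<cdot> \<iota> j = (v \<cdot> \<theta>) \<cdot> \<iota> j" unfolding *[OF uv(1,3)] *[OF uv(2,4)] uv(6)[OF j] ..
    qed (use uv(1-5) \<theta> th in auto)
  qed (use uv(1-5) \<theta> in auto)
qed

end

definition coaug :: "('o, 'm, 'x) tt_data_scheme \<Rightarrow> 'm \<Rightarrow> 'o \<Rightarrow> 'm" where
  "coaug C s X = (s \<odot>\<^sub>m\<^bsub>C\<^esub> idn C X) \<cdot>\<^bsub>C\<^esub> inv_arr C (lunit C X)"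

context symmetric_monoidal_category
begin

declare unit_obj [simp] tensor_obj [simp]

lemma tensor_simps [simp]:
  assumes "f \<in> arr C" "g \<in> arr C"
  shows "f \<odot>\<^sub>m g \<in> arr C" "src C (f \<odot>\<^sub>m g) = src C f \<odot> src C g" "tgt C (f \<odot>\<^sub>m g) = tgt C f \<odot> tgt C g"
  using tensor_Hom[of f "src C f" "tgt C f" g "src C g" "tgt C g"] assms by auto

declare tensor_idn [simp]

lemma interchange [simp]:
  "\<lbrakk>f \<in> arr C; f' \<in> arr C; g \<in> arr C; g' \<in> arr C; tgt C f = src C f'; tgt C g = src C g'\<rbrakk>
    \<Longrightarrow> (f' \<odot>\<^sub>m g') \<cdot> (f \<odot>\<^sub>m g) = (f' \<cdot> f) \<odot>\<^sub>m (g' \<cdot> g)"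
  using tensor_cmp[of f "src C f" "src C f'" f' "tgt C f'" g "src C g" "src C g'" g' "tgt C g'"] by simp

lemma interchange_assoc [simp]:
  assumes "f \<in> arr C" "f' \<in> arr C" "g \<in> arr C" "g' \<in> arr C" "tgt C f = src C f'" "tgt C g = src C g'"
    "h \<in> arr C" "tgt C h = src C f \<odot> src C g"
  shows "(f' \<odot>\<^sub>m g') \<cdot> ((f \<odot>\<^sub>m g) \<cdot> h) = ((f' \<cdot> f) \<odot>\<^sub>m (g' \<cdot> g)) \<cdot> h"
  by (rule cmp_reassoc[OF interchange]) (use assms in auto)

lemma assoc_simps [simp]:
  assumes "X \<in> obj C" "Y \<in> obj C" "Z \<in> obj C"
  shows "iso_arr C (assoc C X Y Z)" "assoc C X Y Z \<in> arr C" "src C (assoc C X Y Z) = (X \<odot> Y) \<odot> Z"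
    "tgt C (assoc C X Y Z) = X \<odot> (Y \<odot> Z)"
  using assoc_iso[OF assms] by (auto simp: isos_iff)

lemma lunit_simps [simp]:
  assumes "X \<in> obj C"
  shows "iso_arr C (lunit C X)" "lunit C X \<in> arr C" "src C (lunit C X) = unit C \<odot> X" "tgt C (lunit C X) = X"
  using lunit_iso[OF assms] by (auto simp: isos_iff)

lemma runit_simps [simp]:
  assumes "X \<in> obj C"
  shows "iso_arr C (runit C X)" "runit C X \<in> arr C" "src C (runit C X) = X \<odot> unit C" "tgt C (runit C X) = X"
  using runit_iso[OF assms] by (auto simp: isos_iff)

lemma swap_simps [simp]:
  assumes "X \<in> obj C" "Y \<in> obj C"
  shows "swap C X Y \<in> arr C" "src C (swap C X Y) = X \<odot> Y" "tgt C (swap C X Y) = Y \<odot> X"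
  using swap_Hom[OF assms] by auto

lemma swap_iso [simp]: "X \<in> obj C \<Longrightarrow> Y \<in> obj C \<Longrightarrow> iso_arr C (swap C X Y)"
  by (rule iso_arrI[of _ "swap C Y X"]) (auto simp: swap_swap)

lemma tensor_iso [simp]:
  assumes "iso_arr C f" "iso_arr C g" shows "iso_arr C (f \<odot>\<^sub>m g)"
  by (rule iso_arrI[of _ "inv_arr C f \<odot>\<^sub>m inv_arr C g"]) (use assms in auto)

lemma assoc_nat:
  "\<lbrakk>f \<in> arr C; g \<in> arr C; h \<in> arr C\<rbrakk> \<Longrightarrow> (f \<odot>\<^sub>m (g \<odot>\<^sub>m h)) \<cdot> assoc C (src C f) (src C g) (src C h) =
    assoc C (tgt C f) (tgt C g) (tgt C h) \<cdot> ((f \<odot>\<^sub>m g) \<odot>\<^sub>m h)"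
  by (rule assoc_natural) auto

lemma lunit_nat: "f \<in> arr C \<Longrightarrow> f \<cdot> lunit C (src C f) = lunit C (tgt C f) \<cdot> (idn C (unit C) \<odot>\<^sub>m f)"
  by (rule lunit_natural) auto

lemma runit_nat: "f \<in> arr C \<Longrightarrow> f \<cdot> runit C (src C f) = runit C (tgt C f) \<cdot> (f \<odot>\<^sub>m idn C (unit C))"
  by (rule runit_natural) auto

lemma swap_nat: "\<lbrakk>f \<in> arr C; g \<in> arr C\<rbrakk>
    \<Longrightarrow> (g \<odot>\<^sub>m f) \<cdot> swap C (src C f) (src C g) = swap C (tgt C f) (tgt C g) \<cdot> (f \<odot>\<^sub>m g)"
  by (rule swap_natural) auto

lemma left_unit_cancel:
  assumes "f \<in> arr C" "g \<in> arr C" "src C f = src C g" "tgt C f = tgt C g"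
    "idn C (unit C) \<odot>\<^sub>m f = idn C (unit C) \<odot>\<^sub>m g"
  shows "f = g"
proof (rule iso_epi[of "lunit C (src C g)"])
  show "f \<cdot> lunit C (src C g) = g \<cdot> lunit C (src C g)"
    using lunit_nat[OF assms(1)] lunit_nat[OF assms(2)] assms(3-5) by simp
qed (use assms in auto)

lemma right_unit_cancel:
  assumes "f \<in> arr C" "g \<in> arr C" "src C f = src C g" "tgt C f = tgt C g"
    "f \<odot>\<^sub>m idn C (unit C) = g \<odot>\<^sub>m idn C (unit C)"
  shows "f = g"
proof (rule iso_epi[of "runit C (src C g)"])
  show "f \<cdot> runit C (src C g) = g \<cdot> runit C (src C g)"
    using runit_nat[OF assms(1)] runit_nat[OF assms(2)] assms(3-5) by simp
qed (use assms in auto)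

text \<open>The next three lemmas are Kelly's: the axioms for units follow from the pentagon and the triangle.\<close>

lemma lunit_tensor:
  assumes X: "X \<in> obj C" and Y: "Y \<in> obj C"
  shows "lunit C (X \<odot> Y) \<cdot> assoc C (unit C) X Y = lunit C X \<odot>\<^sub>m idn C Y"
proof -
  let ?U = "unit C"
  \<comment> \<open>Both sides are tensored with the unit on the left and composed with the
    isomorphism \<open>?w\<close>, which places them in the pentagon on unit, unit,
    \<open>X\<close>, \<open>Y\<close>; both then become \<open>?e\<close>.\<close>
  let ?w = "assoc C ?U (?U \<odot> X) Y \<cdot> (assoc C ?U ?U X \<odot>\<^sub>m idn C Y)"
  let ?e = "assoc C ?U X Y \<cdot> ((runit C ?U \<odot>\<^sub>m idn C X) \<odot>\<^sub>m idn C Y)"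
  have w: "iso_arr C ?w" "?w \<in> arr C" "src C ?w = ((?U \<odot> ?U) \<odot> X) \<odot> Y" "tgt C ?w = ?U \<odot> ((?U \<odot> X) \<odot> Y)"
    using X Y by auto
  have "(idn C ?U \<odot>\<^sub>m lunit C (X \<odot> Y)) \<cdot> ((idn C ?U \<odot>\<^sub>m assoc C ?U X Y) \<cdot> ?w) =
      (idn C ?U \<odot>\<^sub>m lunit C (X \<odot> Y)) \<cdot> (assoc C ?U ?U (X \<odot> Y) \<cdot> assoc C (?U \<odot> ?U) X Y)"
    using pentagon[of ?U ?U X Y] X Y by simp
  also have "\<dots> = (runit C ?U \<odot>\<^sub>m idn C (X \<odot> Y)) \<cdot> assoc C (?U \<odot> ?U) X Y"
    by (rule cmp_reassoc[OF unit_triangle]) (use X Y in auto)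
  also have "\<dots> = ?e"
    using assoc_nat[of "runit C ?U" "idn C X" "idn C Y"] X Y by simp
  finally have 1: "(idn C ?U \<odot>\<^sub>m (lunit C (X \<odot> Y) \<cdot> assoc C ?U X Y)) \<cdot> ?w = ?e"
    using X Y by simp
  have n: "(idn C ?U \<odot>\<^sub>m (lunit C X \<odot>\<^sub>m idn C Y)) \<cdot> assoc C ?U (?U \<odot> X) Y =
      assoc C ?U X Y \<cdot> ((idn C ?U \<odot>\<^sub>m lunit C X) \<odot>\<^sub>m idn C Y)"
    using assoc_nat[of "idn C ?U" "lunit C X" "idn C Y"] X Y by simp
  have "(idn C ?U \<odot>\<^sub>m (lunit C X \<odot>\<^sub>m idn C Y)) \<cdot> ?w =
      (assoc C ?U X Y \<cdot> ((idn C ?U \<odot>\<^sub>m lunit C X) \<odot>\<^sub>m idn C Y)) \<cdot> (assoc C ?U ?U X \<odot>\<^sub>m idn C Y)"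
    by (rule cmp_reassoc[OF n]) (use X Y in auto)
  also have "\<dots> = ?e" using X Y by (simp add: unit_triangle)
  finally have 2: "(idn C ?U \<odot>\<^sub>m (lunit C X \<odot>\<^sub>m idn C Y)) \<cdot> ?w = ?e" .
  have "idn C ?U \<odot>\<^sub>m (lunit C (X \<odot> Y) \<cdot> assoc C ?U X Y) = idn C ?U \<odot>\<^sub>m (lunit C X \<odot>\<^sub>m idn C Y)"
    by (rule iso_epi[OF w(1)]) (use 1 2 w X Y in auto)
  then show ?thesis by (rule left_unit_cancel[rotated -1]) (use X Y in auto)
qed

lemma runit_tensor:
  assumes X: "X \<in> obj C" and Y: "Y \<in> obj C"
  shows "(idn C X \<odot>\<^sub>m runit C Y) \<cdot> assoc C X Y (unit C) = runit C (X \<odot> Y)"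
proof -
  let ?U = "unit C"
  let ?a = "assoc C X Y ?U"
  have n1: "(idn C X \<odot>\<^sub>m (idn C Y \<odot>\<^sub>m lunit C ?U)) \<cdot> assoc C X Y (?U \<odot> ?U) = ?a \<cdot> (idn C (X \<odot> Y) \<odot>\<^sub>m lunit C ?U)"
    using assoc_nat[of "idn C X" "idn C Y" "lunit C ?U"] X Y by simp
  have n2: "(idn C X \<odot>\<^sub>m (runit C Y \<odot>\<^sub>m idn C ?U)) \<cdot> assoc C X (Y \<odot> ?U) ?U = ?a \<cdot> ((idn C X \<odot>\<^sub>m runit C Y) \<odot>\<^sub>m idn C ?U)"
    using assoc_nat[of "idn C X" "runit C Y" "idn C ?U"] X Y by simp
  have "?a \<cdot> (runit C (X \<odot> Y) \<odot>\<^sub>m idn C ?U) =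
      (?a \<cdot> (idn C (X \<odot> Y) \<odot>\<^sub>m lunit C ?U)) \<cdot> assoc C (X \<odot> Y) ?U ?U"
    using X Y by (simp add: unit_triangle)
  also have "\<dots> = (idn C X \<odot>\<^sub>m (idn C Y \<odot>\<^sub>m lunit C ?U)) \<cdot> (assoc C X Y (?U \<odot> ?U) \<cdot> assoc C (X \<odot> Y) ?U ?U)"
    by (rule cmp_reassoc[OF n1, symmetric]) (use X Y in auto)
  also have "\<dots> = (idn C X \<odot>\<^sub>m (idn C Y \<odot>\<^sub>m lunit C ?U)) \<cdot>
      ((idn C X \<odot>\<^sub>m assoc C Y ?U ?U) \<cdot> (assoc C X (Y \<odot> ?U) ?U \<cdot> (?a \<odot>\<^sub>m idn C ?U)))"
    using pentagon[of X Y ?U ?U] X Y by simp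
  also have "\<dots> = (idn C X \<odot>\<^sub>m (runit C Y \<odot>\<^sub>m idn C ?U)) \<cdot> (assoc C X (Y \<odot> ?U) ?U \<cdot> (?a \<odot>\<^sub>m idn C ?U))"
    using X Y by (simp add: unit_triangle)
  also have "\<dots> = (?a \<cdot> ((idn C X \<odot>\<^sub>m runit C Y) \<odot>\<^sub>m idn C ?U)) \<cdot> (?a \<odot>\<^sub>m idn C ?U)"
    by (rule cmp_reassoc[OF n2]) (use X Y in auto)
  also have "\<dots> = ?a \<cdot> (((idn C X \<odot>\<^sub>m runit C Y) \<cdot> ?a) \<odot>\<^sub>m idn C ?U)"
    using X Y by simp
  finally have "runit C (X \<odot> Y) \<odot>\<^sub>m idn C ?U = ((idn C X \<odot>\<^sub>m runit C Y) \<cdot> ?a) \<odot>\<^sub>m idn C ?U"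
    by (rule iso_mono[rotated -1]) (use X Y in auto)
  then show ?thesis using right_unit_cancel[of "runit C (X \<odot> Y)" "(idn C X \<odot>\<^sub>m runit C Y) \<cdot> ?a"] X Y by simp
qed

lemma lunit_unit: "lunit C (unit C) = runit C (unit C)"
proof (rule right_unit_cancel)
  let ?U = "unit C"
  \<comment> \<open>Naturality of the left unitor at itself. Cancelling one copy identifies
    \<open>lunit C (?U \<odot> ?U)\<close> with the whiskered unitor, to which
    \<open>lunit_tensor\<close> and the triangle apply.\<close>
  have "lunit C ?U \<cdot> lunit C (?U \<odot> ?U) = lunit C ?U \<cdot> (idn C ?U \<odot>\<^sub>m lunit C ?U)"
    using lunit_nat[of "lunit C ?U"] by simp
  then have "lunit C (?U \<odot> ?U) = idn C ?U \<odot>\<^sub>m lunit C ?U"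
    by (rule iso_mono[rotated -1]) auto
  then have "lunit C ?U \<odot>\<^sub>m idn C ?U = (idn C ?U \<odot>\<^sub>m lunit C ?U) \<cdot> assoc C ?U ?U ?U"
    using lunit_tensor[of ?U ?U] by simp
  then show "lunit C ?U \<odot>\<^sub>m idn C ?U = runit C ?U \<odot>\<^sub>m idn C ?U" by (simp add: unit_triangle)
qed auto

lemma unit_dualizable: "dualizable C (unit C)"
proof -
  let ?U = "unit C" and ?l = "lunit C (unit C)"
  have t: "(idn C ?U \<odot>\<^sub>m ?l) \<cdot> assoc C ?U ?U ?U = ?l \<odot>\<^sub>m idn C ?U"
    using unit_triangle[of ?U ?U] by (simp add: lunit_unit)
  have 1: "runit C ?U \<cdot> (idn C ?U \<odot>\<^sub>m ?l) \<cdot> assoc C ?U ?U ?U \<cdot> (inv_arr C ?l \<odot>\<^sub>m idn C ?U) = lunit C ?U"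
    using cmp_reassoc[OF t, of "inv_arr C ?l \<odot>\<^sub>m idn C ?U"] by (simp add: lunit_unit)
  have "(?l \<odot>\<^sub>m idn C ?U) \<cdot> (inv_arr C (assoc C ?U ?U ?U) \<cdot> (idn C ?U \<odot>\<^sub>m inv_arr C ?l)) = idn C (?U \<odot> ?U)"
    unfolding t[symmetric] by simp
  then have 2: "lunit C ?U \<cdot> (?l \<odot>\<^sub>m idn C ?U) \<cdot> inv_arr C (assoc C ?U ?U ?U) \<cdot> (idn C ?U \<odot>\<^sub>m inv_arr C ?l) = runit C ?U"
    by (simp add: lunit_unit)
  show ?thesis unfolding dualizable_def
    using 1 2 by (intro conjI bexI[of _ ?U] bexI[of _ ?l] bexI[of _ "inv_arr C ?l"]) auto
qed

lemma tensor_retract: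
  assumes "retract C X Y" "retract C X' Y'" shows "retract C (X \<odot> X') (Y \<odot> Y')"
proof -
  obtain i r where 1: "i \<in> arr C" "r \<in> arr C" "src C i = X" "tgt C i = Y" "src C r = Y" "tgt C r = X"
    "r \<cdot> i = idn C X" "X \<in> obj C" "Y \<in> obj C" by (rule retractE[OF assms(1)])
  obtain j s where 2: "j \<in> arr C" "s \<in> arr C" "src C j = X'" "tgt C j = Y'" "src C s = Y'" "tgt C s = X'"
    "s \<cdot> j = idn C X'" "X' \<in> obj C" "Y' \<in> obj C" by (rule retractE[OF assms(2)])
  show ?thesis by (rule retractI[of "i \<odot>\<^sub>m j" "r \<odot>\<^sub>m s"]) (use 1 2 in auto)
qed

lemma tensor_comm_retract: "X \<in> obj C \<Longrightarrow> Y \<in> obj C \<Longrightarrow> retract C (X \<odot> Y) (Y \<odot> X)"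
  using iso_retract(1)[of "swap C X Y"] by simp

lemma tensor_assoc_retract:
  assumes "X \<in> obj C" "Y \<in> obj C" "Z \<in> obj C"
  shows "retract C ((X \<odot> Y) \<odot> Z) (X \<odot> (Y \<odot> Z))" "retract C (X \<odot> (Y \<odot> Z)) ((X \<odot> Y) \<odot> Z)"
  using iso_retract[of "assoc C X Y Z"] assms by auto

lemma unit_retract: "X \<in> obj C \<Longrightarrow> retract C X (unit C \<odot> X)" "X \<in> obj C \<Longrightarrow> retract C X (X \<odot> unit C)"
  using iso_retract(2)[of "lunit C X"] iso_retract(2)[of "runit C X"] by auto

lemma coaug_simps [simp]:
  assumes "s \<in> arr C" "src C s = unit C" "X \<in> obj C"
  shows "coaug C s X \<in> arr C" "src C (coaug C s X) = X" "tgt C (coaug C s X) = tgt C s \<odot> X"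
  using assms by (auto simp: coaug_def)

lemma coaug_natural:
  assumes s: "s \<in> arr C" "src C s = unit C" and f: "f \<in> arr C"
  shows "(idn C (tgt C s) \<odot>\<^sub>m f) \<cdot> coaug C s (src C f) = coaug C s (tgt C f) \<cdot> f"
proof (rule iso_epi[of "lunit C (src C f)"])
  have "coaug C s (tgt C f) \<cdot> (f \<cdot> lunit C (src C f)) = s \<odot>\<^sub>m f"
    unfolding lunit_nat[OF f] coaug_def using s f by simp
  then show "((idn C (tgt C s) \<odot>\<^sub>m f) \<cdot> coaug C s (src C f)) \<cdot> lunit C (src C f) =
      (coaug C s (tgt C f) \<cdot> f) \<cdot> lunit C (src C f)"
    using s f by (simp add: coaug_def)
qed (use s f in auto)

lemma coaug_tensor:
  assumes s: "s \<in> arr C" "src C s = unit C" and X: "X \<in> obj C" "Y \<in> obj C"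
  shows "assoc C (tgt C s) X Y \<cdot> (coaug C s X \<odot>\<^sub>m idn C Y) = coaug C s (X \<odot> Y)"
proof (rule iso_epi[of "lunit C X \<odot>\<^sub>m idn C Y"])
  have n: "assoc C (tgt C s) X Y \<cdot> ((s \<odot>\<^sub>m idn C X) \<odot>\<^sub>m idn C Y) = (s \<odot>\<^sub>m idn C (X \<odot> Y)) \<cdot> assoc C (unit C) X Y"
    using assoc_nat[of s "idn C X" "idn C Y"] s X by simp
  have "(assoc C (tgt C s) X Y \<cdot> (coaug C s X \<odot>\<^sub>m idn C Y)) \<cdot> (lunit C X \<odot>\<^sub>m idn C Y) =
      assoc C (tgt C s) X Y \<cdot> ((s \<odot>\<^sub>m idn C X) \<odot>\<^sub>m idn C Y)"
    using s X by (simp add: coaug_def)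
  also have "\<dots> = (s \<odot>\<^sub>m idn C (X \<odot> Y)) \<cdot> assoc C (unit C) X Y" by (rule n)
  also have "\<dots> = coaug C s (X \<odot> Y) \<cdot> (lunit C (X \<odot> Y) \<cdot> assoc C (unit C) X Y)"
    unfolding coaug_def using s X by simp
  also have "\<dots> = coaug C s (X \<odot> Y) \<cdot> (lunit C X \<odot>\<^sub>m idn C Y)"
    unfolding lunit_tensor[OF X] ..
  finally show "(assoc C (tgt C s) X Y \<cdot> (coaug C s X \<odot>\<^sub>m idn C Y)) \<cdot> (lunit C X \<odot>\<^sub>m idn C Y) =
      coaug C s (X \<odot> Y) \<cdot> (lunit C X \<odot>\<^sub>m idn C Y)" .
qed (use s X in auto)

text \<open>Inserting \<open>s\<close> in front of \<open>X\<close> or of \<open>Y\<close> amounts,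
  up to the symmetry, to inserting it in front of the whole product. This transfers both splitting
  and vanishing of a coaugmentation from one factor to the other.\<close>

lemma coaug_exchange:
  assumes s: "s \<in> arr C" "src C s = unit C" and X: "X \<in> obj C" "Y \<in> obj C"
  obtains u v where "iso_arr C u" "iso_arr C v" "src C u = (tgt C s \<odot> Y) \<odot> X" "tgt C u = (tgt C s \<odot> X) \<odot> Y"
    "src C v = X \<odot> Y" "tgt C v = Y \<odot> X" "coaug C s X \<odot>\<^sub>m idn C Y = u \<cdot> (coaug C s Y \<odot>\<^sub>m idn C X) \<cdot> v"
proof -
  let ?A = "tgt C s"
  have A: "?A \<in> obj C" using s by auto
  let ?u = "inv_arr C (assoc C ?A X Y) \<cdot> (idn C ?A \<odot>\<^sub>m swap C Y X) \<cdot> assoc C ?A Y X"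
  have n: "(idn C ?A \<odot>\<^sub>m swap C Y X) \<cdot> coaug C s (Y \<odot> X) = coaug C s (X \<odot> Y) \<cdot> swap C Y X"
    using coaug_natural[OF s, of "swap C Y X"] X by simp
  have "?u \<cdot> (coaug C s Y \<odot>\<^sub>m idn C X) \<cdot> swap C X Y =
      inv_arr C (assoc C ?A X Y) \<cdot> ((idn C ?A \<odot>\<^sub>m swap C Y X) \<cdot> (coaug C s (Y \<odot> X) \<cdot> swap C X Y))"
    using s X A by (simp add: cmp_reassoc[OF coaug_tensor])
  also have "(idn C ?A \<odot>\<^sub>m swap C Y X) \<cdot> (coaug C s (Y \<odot> X) \<cdot> swap C X Y) =
      (coaug C s (X \<odot> Y) \<cdot> swap C Y X) \<cdot> swap C X Y"
    by (rule cmp_reassoc[OF n]) (use s X A in auto)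
  also have "\<dots> = coaug C s (X \<odot> Y)" using s X by (simp add: swap_swap)
  also have "inv_arr C (assoc C ?A X Y) \<cdot> coaug C s (X \<odot> Y) = coaug C s X \<odot>\<^sub>m idn C Y"
    unfolding coaug_tensor[OF s X, symmetric] using s X A by simp
  finally have e: "coaug C s X \<odot>\<^sub>m idn C Y = ?u \<cdot> (coaug C s Y \<odot>\<^sub>m idn C X) \<cdot> swap C X Y" ..
  show ?thesis by (rule that[of ?u "swap C X Y"]) (use s X A e in auto)
qed

lemma coaug_split_tensor:
  assumes s: "s \<in> arr C" "src C s = unit C" and X: "X \<in> obj C" "Y \<in> obj C"
    and r: "r \<in> arr C" "src C r = tgt C s \<odot> Y" "tgt C r = Y" "r \<cdot> coaug C s Y = idn C Y"
  obtains q where "q \<in> arr C" "src C q = (tgt C s \<odot> X) \<odot> Y" "tgt C q = X \<odot> Y"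
    "q \<cdot> (coaug C s X \<odot>\<^sub>m idn C Y) = idn C (X \<odot> Y)"
proof -
  obtain u v where uv: "iso_arr C u" "iso_arr C v" "src C u = (tgt C s \<odot> Y) \<odot> X" "tgt C u = (tgt C s \<odot> X) \<odot> Y"
    "src C v = X \<odot> Y" "tgt C v = Y \<odot> X" "coaug C s X \<odot>\<^sub>m idn C Y = u \<cdot> (coaug C s Y \<odot>\<^sub>m idn C X) \<cdot> v"
    by (rule coaug_exchange[OF s X])
  let ?q = "inv_arr C v \<cdot> (r \<odot>\<^sub>m idn C X) \<cdot> inv_arr C u"
  have "?q \<cdot> (coaug C s X \<odot>\<^sub>m idn C Y) = idn C (X \<odot> Y)"
    unfolding uv(7) using uv(1-6) s X r(1-3) by (simp add: r(4))
  then show ?thesis by (intro that[of ?q]) (use uv(1-6) s X r in auto)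
qed

end

section \<open>Tensor triangulated categories\<close>

context symmetric_monoidal_category
begin

lemma dualizableE:
  assumes "dualizable C Y"
  obtains D ev coev where "Y \<in> obj C" "D \<in> obj C" "ev \<in> arr C" "src C ev = D \<odot> Y" "tgt C ev = unit C"
    "coev \<in> arr C" "src C coev = unit C" "tgt C coev = Y \<odot> D"
    "runit C Y \<cdot> (idn C Y \<odot>\<^sub>m ev) \<cdot> assoc C Y D Y \<cdot> (coev \<odot>\<^sub>m idn C Y) = lunit C Y"
    "lunit C D \<cdot> (ev \<odot>\<^sub>m idn C D) \<cdot> inv_arr C (assoc C D Y D) \<cdot> (idn C D \<odot>\<^sub>m coev) = runit C D"
proof -
  have Y: "Y \<in> obj C" using assms by (simp add: dualizable_def)
  obtain D where D: "D \<in> obj C" "\<exists>ev \<in> Hom C (D \<odot> Y) (unit C). \<exists>coev \<in> Hom C (unit C) (Y \<odot> D).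
    runit C Y \<cdot> (idn C Y \<odot>\<^sub>m ev) \<cdot> assoc C Y D Y \<cdot> (coev \<odot>\<^sub>m idn C Y) = lunit C Y \<and>
    lunit C D \<cdot> (ev \<odot>\<^sub>m idn C D) \<cdot> inv_arr C (assoc C D Y D) \<cdot> (idn C D \<odot>\<^sub>m coev) = runit C D"
    using assms unfolding dualizable_def by (elim conjE) (erule bexE, rule that)
  from D(2) obtain ev coev where E: "ev \<in> Hom C (D \<odot> Y) (unit C)" "coev \<in> Hom C (unit C) (Y \<odot> D)"
    "runit C Y \<cdot> (idn C Y \<odot>\<^sub>m ev) \<cdot> assoc C Y D Y \<cdot> (coev \<odot>\<^sub>m idn C Y) = lunit C Y"
    "lunit C D \<cdot> (ev \<odot>\<^sub>m idn C D) \<cdot> inv_arr C (assoc C D Y D) \<cdot> (idn C D \<odot>\<^sub>m coev) = runit C D"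
    by (elim bexE conjE) (rule that)
  show ?thesis by (rule that[OF Y D(1) _ _ _ _ _ _ E(3,4)]) (use E(1,2) in \<open>auto simp: Hom_def\<close>)
qed

text \<open>A triangle identity of the adjunction between tensoring with \<open>Y\<close> and
  tensoring with its dual \<open>D\<close>: the unit of the adjunction at \<open>X\<close>, tensored
  with \<open>Y\<close>, followed by the counit at \<open>X \<odot> Y\<close>.\<close>

lemma zigzag_tensor:
  assumes X: "X \<in> obj C" and Y: "Y \<in> obj C" and D: "D \<in> obj C"
    and ev: "ev \<in> arr C" "src C ev = D \<odot> Y" "tgt C ev = unit C"
    and coev: "coev \<in> arr C" "src C coev = unit C" "tgt C coev = Y \<odot> D"
    and eq: "runit C Y \<cdot> (idn C Y \<odot>\<^sub>m ev) \<cdot> assoc C Y D Y \<cdot> (coev \<odot>\<^sub>m idn C Y) = lunit C Y"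
  shows "runit C (X \<odot> Y) \<cdot> (idn C (X \<odot> Y) \<odot>\<^sub>m ev) \<cdot> assoc C (X \<odot> Y) D Y \<cdot>
    ((inv_arr C (assoc C X Y D) \<cdot> (idn C X \<odot>\<^sub>m coev) \<cdot> inv_arr C (runit C X)) \<odot>\<^sub>m idn C Y) = idn C (X \<odot> Y)"
proof -
  let ?U = "unit C"
  let ?e = "inv_arr C (assoc C X Y D) \<cdot> (idn C X \<odot>\<^sub>m coev) \<cdot> inv_arr C (runit C X)"
  have e: "?e \<in> arr C" "src C ?e = X" "tgt C ?e = (X \<odot> Y) \<odot> D" using X Y D coev by auto
  have n1: "assoc C X Y ?U \<cdot> (idn C (X \<odot> Y) \<odot>\<^sub>m ev) = (idn C X \<odot>\<^sub>m (idn C Y \<odot>\<^sub>m ev)) \<cdot> assoc C X Y (D \<odot> Y)"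
    using assoc_nat[of "idn C X" "idn C Y" ev] X Y ev by simp
  have n2: "assoc C X (Y \<odot> D) Y \<cdot> ((idn C X \<odot>\<^sub>m coev) \<odot>\<^sub>m idn C Y) = (idn C X \<odot>\<^sub>m (coev \<odot>\<^sub>m idn C Y)) \<cdot> assoc C X ?U Y"
    using assoc_nat[of "idn C X" coev "idn C Y"] X Y coev by simp
  have p: "assoc C X Y (D \<odot> Y) \<cdot> assoc C (X \<odot> Y) D Y =
      (idn C X \<odot>\<^sub>m assoc C Y D Y) \<cdot> assoc C X (Y \<odot> D) Y \<cdot> (assoc C X Y D \<odot>\<^sub>m idn C Y)"
    by (rule pentagon) fact+
  have "runit C (X \<odot> Y) \<cdot> (idn C (X \<odot> Y) \<odot>\<^sub>m ev) \<cdot> assoc C (X \<odot> Y) D Y \<cdot> (?e \<odot>\<^sub>m idn C Y) =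
      (idn C X \<odot>\<^sub>m runit C Y) \<cdot> ((assoc C X Y ?U \<cdot> (idn C (X \<odot> Y) \<odot>\<^sub>m ev)) \<cdot> (assoc C (X \<odot> Y) D Y \<cdot> (?e \<odot>\<^sub>m idn C Y)))"
    unfolding runit_tensor[OF X Y, symmetric] using X Y D ev e by simp
  also have "\<dots> = (idn C X \<odot>\<^sub>m runit C Y) \<cdot> ((idn C X \<odot>\<^sub>m (idn C Y \<odot>\<^sub>m ev)) \<cdot>
      ((assoc C X Y (D \<odot> Y) \<cdot> assoc C (X \<odot> Y) D Y) \<cdot> (?e \<odot>\<^sub>m idn C Y)))"
    unfolding n1 using X Y D ev e by simp
  also have "\<dots> = (idn C X \<odot>\<^sub>m (runit C Y \<cdot> (idn C Y \<odot>\<^sub>m ev) \<cdot> assoc C Y D Y)) \<cdot>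
      (assoc C X (Y \<odot> D) Y \<cdot> (((idn C X \<odot>\<^sub>m coev) \<odot>\<^sub>m idn C Y) \<cdot> (inv_arr C (runit C X) \<odot>\<^sub>m idn C Y)))"
    unfolding p using X Y D ev coev by simp
  also have "assoc C X (Y \<odot> D) Y \<cdot> (((idn C X \<odot>\<^sub>m coev) \<odot>\<^sub>m idn C Y) \<cdot> (inv_arr C (runit C X) \<odot>\<^sub>m idn C Y)) =
      ((idn C X \<odot>\<^sub>m (coev \<odot>\<^sub>m idn C Y)) \<cdot> assoc C X ?U Y) \<cdot> (inv_arr C (runit C X) \<odot>\<^sub>m idn C Y)"
    by (rule cmp_reassoc[OF n2]) (use X Y D coev in auto)
  also have "(idn C X \<odot>\<^sub>m (runit C Y \<cdot> (idn C Y \<odot>\<^sub>m ev) \<cdot> assoc C Y D Y)) \<cdot>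
      (((idn C X \<odot>\<^sub>m (coev \<odot>\<^sub>m idn C Y)) \<cdot> assoc C X ?U Y) \<cdot> (inv_arr C (runit C X) \<odot>\<^sub>m idn C Y)) =
      (idn C X \<odot>\<^sub>m lunit C Y) \<cdot> (assoc C X ?U Y \<cdot> (inv_arr C (runit C X) \<odot>\<^sub>m idn C Y))"
    using X Y D ev coev eq by simp
  also have "\<dots> = (runit C X \<odot>\<^sub>m idn C Y) \<cdot> (inv_arr C (runit C X) \<odot>\<^sub>m idn C Y)"
    by (rule cmp_reassoc[OF unit_triangle]) (use X Y in auto)
  also have "\<dots> = idn C (X \<odot> Y)" using X Y by simp
  finally show ?thesis .
qed

text \<open>A zigzag identity, read as a retraction of the coaugmentation by \<open>coev\<close> at
  \<open>Y\<close>.\<close>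

lemma coaug_coev:
  assumes Y: "Y \<in> obj C" "D \<in> obj C"
    and ev: "ev \<in> arr C" "src C ev = D \<odot> Y" "tgt C ev = unit C"
    and coev: "coev \<in> arr C" "src C coev = unit C" "tgt C coev = Y \<odot> D"
    and eq: "runit C Y \<cdot> (idn C Y \<odot>\<^sub>m ev) \<cdot> assoc C Y D Y \<cdot> (coev \<odot>\<^sub>m idn C Y) = lunit C Y"
  shows "(runit C Y \<cdot> (idn C Y \<odot>\<^sub>m ev) \<cdot> assoc C Y D Y) \<cdot> coaug C coev Y = idn C Y"
proof -
  have "(runit C Y \<cdot> (idn C Y \<odot>\<^sub>m ev) \<cdot> assoc C Y D Y) \<cdot> coaug C coev Y =
      (runit C Y \<cdot> (idn C Y \<odot>\<^sub>m ev) \<cdot> assoc C Y D Y \<cdot> (coev \<odot>\<^sub>m idn C Y)) \<cdot> inv_arr C (lunit C Y)"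
    using Y ev coev by (simp add: coaug_def)
  then show ?thesis unfolding eq using Y by simp
qed

end

section \<open>Internal homs and endomorphism objects\<close>

context closed_symmetric_monoidal_category
begin

declare ihom_obj [simp]

lemma ihom_ev_simps [simp]:
  assumes "X \<in> obj C" "Y \<in> obj C"
  shows "ihom_ev C X Y \<in> arr C" "src C (ihom_ev C X Y) = ihom C X Y \<odot> X" "tgt C (ihom_ev C X Y) = Y"
  using ihom_ev_Hom[OF assms] by auto

lemma transpose:
  assumes "X \<in> obj C" "Z \<in> obj C" "f \<in> arr C" "src C f = Z \<odot> X" "tgt C f = Y"
  obtains g where "g \<in> arr C" "src C g = Z" "tgt C g = ihom C X Y" "ihom_ev C X Y \<cdot> (g \<odot>\<^sub>m idn C X) = f"
proof -
  have "Y \<in> obj C" using assms by auto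
  then have "\<exists>!g. g \<in> Hom C Z (ihom C X Y) \<and> ihom_ev C X Y \<cdot> (g \<odot>\<^sub>m idn C X) = f"
    using ihom_ev_universal[of X Y Z f] assms by simp
  then show ?thesis using that by auto
qed

lemma transpose_unique:
  assumes "X \<in> obj C" "Y \<in> obj C" "g \<in> arr C" "g' \<in> arr C" "src C g = src C g'"
    "tgt C g = ihom C X Y" "tgt C g' = ihom C X Y"
    "ihom_ev C X Y \<cdot> (g \<odot>\<^sub>m idn C X) = ihom_ev C X Y \<cdot> (g' \<odot>\<^sub>m idn C X)"
  shows "g = g'"
proof -
  have Z: "src C g' \<in> obj C" using assms by auto
  have "ihom_ev C X Y \<cdot> (g' \<odot>\<^sub>m idn C X) \<in> Hom C (src C g' \<odot> X) Y" using assms by simp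
  from ihom_ev_universal[OF assms(1,2) Z this] show ?thesis using assms by auto
qed

text \<open>Tensoring with \<open>W\<close> is left adjoint to the internal hom: a cocone is
  transposed, extended over the coproduct and transposed back.\<close>

lemma tensor_coproduct:
  assumes cop: "is_coproduct C J X Q \<iota>" and W: "W \<in> obj C"
  shows "is_coproduct C J (\<lambda>j. X j \<odot> W) (Q \<odot> W) (\<lambda>j. \<iota> j \<odot>\<^sub>m idn C W)"
proof (rule is_coproductI)
  note c = coproductD[OF cop]
  show "Q \<odot> W \<in> obj C" "\<And>j. j \<in> J \<Longrightarrow> X j \<odot> W \<in> obj C"
    "\<And>j. j \<in> J \<Longrightarrow> \<iota> j \<odot>\<^sub>m idn C W \<in> Hom C (X j \<odot> W) (Q \<odot> W)" using c W by auto
  show "\<exists>u \<in> Hom C (Q \<odot> W) Y. \<forall>j \<in> J. u \<cdot> (\<iota> j \<odot>\<^sub>m idn C W) = f j"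
    if Y: "Y \<in> obj C" and f: "\<And>j. j \<in> J \<Longrightarrow> f j \<in> Hom C (X j \<odot> W) Y" for Y f
  proof -
    have "\<forall>j \<in> J. \<exists>g. g \<in> Hom C (X j) (ihom C W Y) \<and> ihom_ev C W Y \<cdot> (g \<odot>\<^sub>m idn C W) = f j"
    proof
      fix j assume j: "j \<in> J"
      obtain g where "g \<in> arr C" "src C g = X j" "tgt C g = ihom C W Y" "ihom_ev C W Y \<cdot> (g \<odot>\<^sub>m idn C W) = f j"
        by (rule transpose[OF W c(2)[OF j], of "f j" Y]) (use f[OF j] in auto)
      then show "\<exists>g. g \<in> Hom C (X j) (ihom C W Y) \<and> ihom_ev C W Y \<cdot> (g \<odot>\<^sub>m idn C W) = f j" by auto
    qed
    from bchoice[OF this] obtain g where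
      g: "\<forall>j \<in> J. g j \<in> Hom C (X j) (ihom C W Y) \<and> ihom_ev C W Y \<cdot> (g j \<odot>\<^sub>m idn C W) = f j" by (rule exE)
    obtain u where u: "u \<in> arr C" "src C u = Q" "tgt C u = ihom C W Y" "\<And>j. j \<in> J \<Longrightarrow> u \<cdot> \<iota> j = g j"
      by (rule coproduct_ex[OF cop ihom_obj[OF W Y], of g]) (use g in auto)
    have "(ihom_ev C W Y \<cdot> (u \<odot>\<^sub>m idn C W)) \<cdot> (\<iota> j \<odot>\<^sub>m idn C W) = f j" if j: "j \<in> J" for j
      using u g c j W Y by simp
    then show ?thesis by (intro bexI[of _ "ihom_ev C W Y \<cdot> (u \<odot>\<^sub>m idn C W)"]) (use u W Y in auto)
  qed
  show "u = v" if uv: "u \<in> arr C" "v \<in> arr C" "src C u = Q \<odot> W" "src C v = Q \<odot> W" "tgt C u = tgt C v"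
    "\<And>j. j \<in> J \<Longrightarrow> u \<cdot> (\<iota> j \<odot>\<^sub>m idn C W) = v \<cdot> (\<iota> j \<odot>\<^sub>m idn C W)" for u v
  proof -
    define Y where "Y = tgt C v"
    have Y: "Y \<in> obj C" "tgt C u = Y" "tgt C v = Y" using uv(2,5) by (auto simp: Y_def)
    obtain u' where u': "u' \<in> arr C" "src C u' = Q" "tgt C u' = ihom C W Y" "ihom_ev C W Y \<cdot> (u' \<odot>\<^sub>m idn C W) = u"
      by (rule transpose[OF W c(1) uv(1,3) Y(2)])
    obtain v' where v': "v' \<in> arr C" "src C v' = Q" "tgt C v' = ihom C W Y" "ihom_ev C W Y \<cdot> (v' \<odot>\<^sub>m idn C W) = v"
      by (rule transpose[OF W c(1) uv(2,4) Y(3)])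
    have "u' = v'"
    proof (rule coproduct_uniq[OF cop])
      fix j assume j: "j \<in> J"
      have *: "ihom_ev C W Y \<cdot> ((z' \<cdot> \<iota> j) \<odot>\<^sub>m idn C W) = z \<cdot> (\<iota> j \<odot>\<^sub>m idn C W)"
        if "z' \<in> arr C" "src C z' = Q" "tgt C z' = ihom C W Y" "ihom_ev C W Y \<cdot> (z' \<odot>\<^sub>m idn C W) = z" for z z'
        unfolding that(4)[symmetric] using that(1-3) c j W Y by simp
      show "u' \<cdot> \<iota> j = v' \<cdot> \<iota> j"
        by (rule transpose_unique[OF W Y(1)]) (use *[OF u'] *[OF v'] uv(6)[OF j] u'(1-3) v'(1-3) c j in auto)
    qed (use u'(1-3) v'(1-3) in auto)
    then show "u = v" using u'(4) v'(4) by simp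
  qed
qed

lemma tensor_coproduct_left:
  assumes cop: "is_coproduct C J X Q \<iota>" and W: "W \<in> obj C"
  shows "is_coproduct C J (\<lambda>j. W \<odot> X j) (W \<odot> Q) (\<lambda>j. idn C W \<odot>\<^sub>m \<iota> j)"
proof (rule coproduct_transport[OF tensor_coproduct[OF cop W], of "swap C Q W" _ "\<lambda>j. swap C (X j) W"])
  note c = coproductD[OF cop]
  show "(idn C W \<odot>\<^sub>m \<iota> j) \<cdot> swap C (X j) W = swap C Q W \<cdot> (\<iota> j \<odot>\<^sub>m idn C W)" if "j \<in> J" for j
    using swap_nat[of "\<iota> j" "idn C W"] c that W by simp
qed (use coproductD[OF cop] W in auto)

text \<open>Arrows into \<open>R\<close> are determined by their action on \<open>I\<close>. Thus
  the right unit law of composition makes \<open>R\<close> a weak ring, and a retraction at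
  \<open>I\<close> acts on the values of endomorphisms to give one at \<open>R\<close>.\<close>

lemma endomorphism_ring:
  assumes I: "I \<in> obj C"
  obtains R \<eta> where "weak_ring C R \<eta>" "ihom_ev C I I \<cdot> (\<eta> \<odot>\<^sub>m idn C I) = lunit C I" "R = ihom C I I"
    "\<And>s r. s \<in> arr C \<Longrightarrow> src C s = unit C \<Longrightarrow> r \<in> arr C \<Longrightarrow> src C r = tgt C s \<odot> I \<Longrightarrow> tgt C r = I \<Longrightarrow>
      r \<cdot> coaug C s I = idn C I \<Longrightarrow> \<exists>q. q \<in> arr C \<and> src C q = tgt C s \<odot> R \<and> tgt C q = R \<and> q \<cdot> coaug C s R = idn C R"
proof -
  define R where "R = ihom C I I"
  define ev where "ev = ihom_ev C I I"
  have R: "R \<in> obj C" using I by (simp add: R_def)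
  have ev: "ev \<in> arr C" "src C ev = R \<odot> I" "tgt C ev = I" using I by (auto simp: ev_def R_def)
  have uniq: "g = g'" if "g \<in> arr C" "g' \<in> arr C" "src C g = src C g'" "tgt C g = R" "tgt C g' = R"
    "ev \<cdot> (g \<odot>\<^sub>m idn C I) = ev \<cdot> (g' \<odot>\<^sub>m idn C I)" for g g'
    by (rule transpose_unique[OF I I]) (use that in \<open>auto simp: R_def ev_def\<close>)
  obtain \<eta> where \<eta>: "\<eta> \<in> arr C" "src C \<eta> = unit C" "tgt C \<eta> = R" "ev \<cdot> (\<eta> \<odot>\<^sub>m idn C I) = lunit C I"
    unfolding R_def ev_def by (rule transpose[OF I, of "unit C" "lunit C I" I]) (use I in auto)
  \<comment> \<open>Composition of endomorphisms, as the transpose of evaluating twice.\<close>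
  obtain m where m: "m \<in> arr C" "src C m = R \<odot> R" "tgt C m = R"
      "ev \<cdot> (m \<odot>\<^sub>m idn C I) = ev \<cdot> (idn C R \<odot>\<^sub>m ev) \<cdot> assoc C R R I"
    unfolding R_def ev_def
    by (rule transpose[OF I, of "ihom C I I \<odot> ihom C I I" "ihom_ev C I I \<cdot> (idn C (ihom C I I) \<odot>\<^sub>m ihom_ev C I I) \<cdot>
          assoc C (ihom C I I) (ihom C I I) I" I]) (use I in auto)
  let ?i = "(idn C R \<odot>\<^sub>m \<eta>) \<cdot> inv_arr C (runit C R)"
  have i: "?i \<in> arr C" "src C ?i = R" "tgt C ?i = R \<odot> R" using R \<eta> by auto
  have "m \<cdot> ?i = idn C R"
  proof (rule uniq)
    have n: "assoc C R R I \<cdot> ((idn C R \<odot>\<^sub>m \<eta>) \<odot>\<^sub>m idn C I) = (idn C R \<odot>\<^sub>m (\<eta> \<odot>\<^sub>m idn C I)) \<cdot> assoc C R (unit C) I"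
      using assoc_nat[of "idn C R" \<eta> "idn C I"] R I \<eta> by simp
    have "ev \<cdot> ((m \<cdot> ?i) \<odot>\<^sub>m idn C I) = (ev \<cdot> (m \<odot>\<^sub>m idn C I)) \<cdot> (?i \<odot>\<^sub>m idn C I)"
      using ev m(1-3) i I by simp
    also have "\<dots> = ev \<cdot> ((idn C R \<odot>\<^sub>m ev) \<cdot> (assoc C R R I \<cdot> (((idn C R \<odot>\<^sub>m \<eta>) \<odot>\<^sub>m idn C I) \<cdot> (inv_arr C (runit C R) \<odot>\<^sub>m idn C I))))"
      unfolding m(4) using ev R I \<eta>(1-3) by simp
    also have "assoc C R R I \<cdot> (((idn C R \<odot>\<^sub>m \<eta>) \<odot>\<^sub>m idn C I) \<cdot> (inv_arr C (runit C R) \<odot>\<^sub>m idn C I)) =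
        ((idn C R \<odot>\<^sub>m (\<eta> \<odot>\<^sub>m idn C I)) \<cdot> assoc C R (unit C) I) \<cdot> (inv_arr C (runit C R) \<odot>\<^sub>m idn C I)"
      by (rule cmp_reassoc[OF n]) (use R I \<eta> in auto)
    also have "ev \<cdot> ((idn C R \<odot>\<^sub>m ev) \<cdot> (((idn C R \<odot>\<^sub>m (\<eta> \<odot>\<^sub>m idn C I)) \<cdot> assoc C R (unit C) I) \<cdot> (inv_arr C (runit C R) \<odot>\<^sub>m idn C I))) =
        ev \<cdot> ((idn C R \<odot>\<^sub>m lunit C I) \<cdot> (assoc C R (unit C) I \<cdot> (inv_arr C (runit C R) \<odot>\<^sub>m idn C I)))"
      using ev R I \<eta> by simp
    also have "(idn C R \<odot>\<^sub>m lunit C I) \<cdot> (assoc C R (unit C) I \<cdot> (inv_arr C (runit C R) \<odot>\<^sub>m idn C I)) =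
        (runit C R \<odot>\<^sub>m idn C I) \<cdot> (inv_arr C (runit C R) \<odot>\<^sub>m idn C I)"
      by (rule cmp_reassoc[OF unit_triangle]) (use R I in auto)
    finally show "ev \<cdot> ((m \<cdot> ?i) \<odot>\<^sub>m idn C I) = ev \<cdot> (idn C R \<odot>\<^sub>m idn C I)" using R I ev by simp
  qed (use m i R in auto)
  then have "weak_ring C R \<eta>"
    unfolding weak_ring_def split_mono_def using R \<eta>(1-3) i m(1-3) by (auto intro!: bexI[of _ m])
  moreover have "\<exists>q. q \<in> arr C \<and> src C q = tgt C s \<odot> R \<and> tgt C q = R \<and> q \<cdot> coaug C s R = idn C R"
    if s: "s \<in> arr C" "src C s = unit C" and r: "r \<in> arr C" "src C r = tgt C s \<odot> I" "tgt C r = I" "r \<cdot> coaug C s I = idn C I"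
    for s r
  proof -
    let ?A = "tgt C s"
    have A: "?A \<in> obj C" using s by auto
    \<comment> \<open>The transpose of evaluating in the second factor and then applying
      \<open>r\<close>.\<close>
    obtain q where q: "q \<in> arr C" "src C q = ?A \<odot> R" "tgt C q = R"
        "ev \<cdot> (q \<odot>\<^sub>m idn C I) = r \<cdot> (idn C ?A \<odot>\<^sub>m ev) \<cdot> assoc C ?A R I"
      unfolding R_def ev_def
      by (rule transpose[OF I, of "?A \<odot> ihom C I I" "r \<cdot> (idn C ?A \<odot>\<^sub>m ihom_ev C I I) \<cdot> assoc C ?A (ihom C I I) I" I])
        (use I A r in auto)
    have "q \<cdot> coaug C s R = idn C R"
    proof (rule uniq)
      have "ev \<cdot> ((q \<cdot> coaug C s R) \<odot>\<^sub>m idn C I) = (ev \<cdot> (q \<odot>\<^sub>m idn C I)) \<cdot> (coaug C s R \<odot>\<^sub>m idn C I)"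
        using ev q(1-3) s R I by simp
      also have "\<dots> = r \<cdot> ((idn C ?A \<odot>\<^sub>m ev) \<cdot> (assoc C ?A R I \<cdot> (coaug C s R \<odot>\<^sub>m idn C I)))"
        unfolding q(4) using ev r(1-3) s R I A by simp
      also have "\<dots> = r \<cdot> (coaug C s I \<cdot> ev)"
        unfolding coaug_tensor[OF s R I] using coaug_natural[OF s ev(1)] ev by simp
      also have "\<dots> = idn C I \<cdot> ev"
        by (rule cmp_reassoc[OF r(4)]) (use ev r(1-3) s I in auto)
      finally show "ev \<cdot> ((q \<cdot> coaug C s R) \<odot>\<^sub>m idn C I) = ev \<cdot> (idn C R \<odot>\<^sub>m idn C I)" using R I ev by simp
    qed (use q s R in auto)
    then show ?thesis using q(1-3) by blast
  qed
  ultimately show ?thesis using \<eta>(4) by (intro that[of R \<eta>]) (auto simp: R_def ev_def)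
qed

end

section \<open>Coaugmentations and duality in a tensor triangulated category\<close>

context tt_category
begin

lemma tensor_plus_left:
  "\<lbrakk>f \<in> arr C; f' \<in> arr C; g \<in> arr C; src C f = src C f'; tgt C f = tgt C f'\<rbrakk>
    \<Longrightarrow> plus_arr C f f' \<odot>\<^sub>m g = plus_arr C (f \<odot>\<^sub>m g) (f' \<odot>\<^sub>m g)"
  by (rule tensor_plus[of f "src C f'" "tgt C f'" f' g "src C g" "tgt C g"]) auto

lemma tensor_swap:
  assumes "f \<in> arr C" "g \<in> arr C"
  shows "g \<odot>\<^sub>m f = swap C (tgt C f) (tgt C g) \<cdot> ((f \<odot>\<^sub>m g) \<cdot> swap C (src C g) (src C f))"
proof -
  have "swap C (tgt C f) (tgt C g) \<cdot> ((f \<odot>\<^sub>m g) \<cdot> swap C (src C g) (src C f)) =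
      ((g \<odot>\<^sub>m f) \<cdot> swap C (src C f) (src C g)) \<cdot> swap C (src C g) (src C f)"
    by (rule cmp_reassoc[OF swap_nat[symmetric]]) (use assms in auto)
  then show ?thesis using assms by (simp add: swap_swap)
qed

lemma tensor_plus_right:
  assumes "f \<in> arr C" "f' \<in> arr C" "g \<in> arr C" "src C f = src C f'" "tgt C f = tgt C f'"
  shows "g \<odot>\<^sub>m plus_arr C f f' = plus_arr C (g \<odot>\<^sub>m f) (g \<odot>\<^sub>m f')"
  using assms by (simp add: tensor_swap[of _ g] tensor_plus_left cmp_plus_arr)

lemma tensor_zero [simp]:
  assumes "X \<in> obj C" "Y \<in> obj C" "g \<in> arr C"
  shows "zero_arr C X Y \<odot>\<^sub>m g = zero_arr C (X \<odot> src C g) (Y \<odot> tgt C g)"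
    and "g \<odot>\<^sub>m zero_arr C X Y = zero_arr C (src C g \<odot> X) (tgt C g \<odot> Y)"
proof -
  show z: "zero_arr C X Y \<odot>\<^sub>m g = zero_arr C (X \<odot> src C g) (Y \<odot> tgt C g)"
    using tensor_plus_left[of "zero_arr C X Y" "zero_arr C X Y" g]
      plus_left_cancel[of "zero_arr C X Y \<odot>\<^sub>m g" "zero_arr C X Y \<odot>\<^sub>m g"] assms by auto
  show "g \<odot>\<^sub>m zero_arr C X Y = zero_arr C (src C g \<odot> X) (tgt C g \<odot> Y)"
    using assms by (simp add: tensor_swap[of _ g] z)
qed

lemma zero_tensor:
  assumes "zero_object C X" "Y \<in> obj C" shows "zero_object C (X \<odot> Y)" "zero_object C (Y \<odot> X)"
proof -
  have X: "X \<in> obj C" "idn C X = zero_arr C X X" using assms by (auto simp: zero_object_iff)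
  have "idn C (X \<odot> Y) = zero_arr C X X \<odot>\<^sub>m idn C Y" "idn C (Y \<odot> X) = idn C Y \<odot>\<^sub>m zero_arr C X X"
    unfolding X(2)[symmetric] using X(1) assms(2) by simp_all
  then show "zero_object C (X \<odot> Y)" "zero_object C (Y \<odot> X)" using X(1) assms(2) by (auto simp: zero_object_iff)
qed

lemma tensor_tri_left:
  assumes T: "(f, g, h) \<in> tri C" and A: "A \<in> obj C"
  shows "\<exists>h'. (idn C A \<odot>\<^sub>m f, idn C A \<odot>\<^sub>m g, h') \<in> tri C"
proof -
  note t = triD[OF T]
  let ?k = "shift_tensor C (src C f) A \<cdot> (h \<odot>\<^sub>m idn C A)"
  have T': "(f \<odot>\<^sub>m idn C A, g \<odot>\<^sub>m idn C A, ?k) \<in> tri C" by (rule tensor_exact[OF T A])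
  note t' = triD[OF T']
  let ?u = "swap C (src C f) A" and ?v = "swap C (tgt C f) A" and ?w = "swap C (tgt C g) A"
  have "(idn C A \<odot>\<^sub>m f, idn C A \<odot>\<^sub>m g, \<Sigma>\<^sub>m ?u \<cdot> (?k \<cdot> inv_arr C ?w)) \<in> tri C"
  proof (rule tri_iso_arr[OF T', of ?u ?v ?w])
    show "?v \<cdot> (f \<odot>\<^sub>m idn C A) = (idn C A \<odot>\<^sub>m f) \<cdot> ?u" using swap_nat[of f "idn C A"] t A by simp
    show "?w \<cdot> (g \<odot>\<^sub>m idn C A) = (idn C A \<odot>\<^sub>m g) \<cdot> ?v" using swap_nat[of g "idn C A"] t A by simp
    have k: "?k \<in> arr C" "src C ?k = tgt C g \<odot> A" "tgt C ?k = \<Sigma>\<^sub>o (src C f \<odot> A)" using t' t A by auto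
    show "\<Sigma>\<^sub>m ?u \<cdot> ?k = (\<Sigma>\<^sub>m ?u \<cdot> (?k \<cdot> inv_arr C ?w)) \<cdot> ?w"
      using k t(1-4) A by (simp del: cmp_simps add: cmp_simps)
  qed (use t t' A in auto)
  then show ?thesis by blast
qed

text \<open>By the second zigzag identity the unitor of \<open>D\<close> factors through
  \<open>ev\<close> tensored with \<open>D\<close>, and \<open>s\<close> kills
  \<open>ev\<close>.\<close>

lemma coaug_dual_zero:
  assumes Y: "Y \<in> obj C" "D \<in> obj C"
    and ev: "ev \<in> arr C" "src C ev = D \<odot> Y" "tgt C ev = unit C"
    and coev: "coev \<in> arr C" "src C coev = unit C" "tgt C coev = Y \<odot> D"
    and eq: "lunit C D \<cdot> (ev \<odot>\<^sub>m idn C D) \<cdot> inv_arr C (assoc C D Y D) \<cdot> (idn C D \<odot>\<^sub>m coev) = runit C D"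
    and s: "s \<in> arr C" "src C s = unit C" "s \<cdot> ev = zero_arr C (D \<odot> Y) (tgt C s)"
  shows "coaug C s D = zero_arr C D (tgt C s \<odot> D)"
proof (rule iso_epi[of "runit C D"])
  let ?k = "inv_arr C (assoc C D Y D) \<cdot> (idn C D \<odot>\<^sub>m coev)"
  have A: "tgt C s \<in> obj C" using s by auto
  have k: "?k \<in> arr C" "src C ?k = D \<odot> unit C" "tgt C ?k = (D \<odot> Y) \<odot> D" using Y coev by auto
  have "coaug C s D \<cdot> runit C D = (s \<odot>\<^sub>m idn C D) \<cdot> ((ev \<odot>\<^sub>m idn C D) \<cdot> ?k)"
    unfolding eq[symmetric] coaug_def using Y ev coev s(1,2) by simp
  also have "\<dots> = ((s \<cdot> ev) \<odot>\<^sub>m idn C D) \<cdot> ?k" using Y ev s(1,2) k by simp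
  also have "\<dots> = zero_arr C D (tgt C s \<odot> D) \<cdot> runit C D"
    unfolding s(3) using Y k A by simp
  finally show "coaug C s D \<cdot> runit C D = zero_arr C D (tgt C s \<odot> D) \<cdot> runit C D" .
qed (use Y s in auto)

text \<open>By \<open>coaug_exchange\<close> the coaugmentation of \<open>X\<close> tensored with
  \<open>D\<close> vanishes, because that of \<open>D\<close> does. Being also split it forces
  \<open>X \<odot> D\<close> to be zero, and \<open>b\<close> is a retract of a product containing
  \<open>D\<close>.\<close>

lemma split_coaug_annihilates:
  assumes b: "dualizable C b" "D \<in> obj C" "retract C b ((b \<odot> D) \<odot> b)"
    and s: "s \<in> arr C" "src C s = unit C" "coaug C s D = zero_arr C D (tgt C s \<odot> D)"
    and X: "X \<in> obj C" and r: "r \<in> arr C" "src C r = tgt C s \<odot> X" "tgt C r = X" "r \<cdot> coaug C s X = idn C X"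
  shows "zero_object C (X \<odot> b)"
proof -
  have bo: "b \<in> obj C" using b(1) by (simp add: dualizable_def)
  obtain u v where uv: "iso_arr C u" "iso_arr C v" "src C u = (tgt C s \<odot> D) \<odot> X" "tgt C u = (tgt C s \<odot> X) \<odot> D"
    "src C v = X \<odot> D" "tgt C v = D \<odot> X" "coaug C s X \<odot>\<^sub>m idn C D = u \<cdot> (coaug C s D \<odot>\<^sub>m idn C X) \<cdot> v"
    by (rule coaug_exchange[OF s(1,2) X b(2)])
  have A: "tgt C s \<in> obj C" using s by auto
  have z: "coaug C s X \<odot>\<^sub>m idn C D = zero_arr C (X \<odot> D) ((tgt C s \<odot> X) \<odot> D)"
    unfolding uv(7) s(3) using uv(1-6) X b(2) A by simp
  have "idn C (X \<odot> D) = (r \<odot>\<^sub>m idn C D) \<cdot> (coaug C s X \<odot>\<^sub>m idn C D)"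
    using r s(1,2) X b(2) by simp
  also have "\<dots> = zero_arr C (X \<odot> D) (X \<odot> D)" unfolding z using r(1-3) X b(2) A by simp
  finally have XD: "zero_object C (X \<odot> D)" using X b(2) by (simp add: zero_object_iff)
  have "retract C (X \<odot> b) (X \<odot> ((b \<odot> D) \<odot> b))" by (rule tensor_retract[OF retract_refl[OF X] b(3)])
  also have "retract C (X \<odot> ((b \<odot> D) \<odot> b)) (X \<odot> ((D \<odot> b) \<odot> b))"
    by (intro tensor_retract retract_refl tensor_comm_retract) (use X bo b(2) in auto)
  also have "retract C (X \<odot> ((D \<odot> b) \<odot> b)) (X \<odot> (D \<odot> (b \<odot> b)))"
    by (intro tensor_retract retract_refl tensor_assoc_retract) (use X bo b(2) in auto)
  also have "retract C (X \<odot> (D \<odot> (b \<odot> b))) ((X \<odot> D) \<odot> (b \<odot> b))"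
    by (intro tensor_assoc_retract) (use X bo b(2) in auto)
  finally show ?thesis by (rule zero_objectI_retract) (use zero_tensor(1)[OF XD] bo in simp)
qed

text \<open>If \<open>R\<close> were zero, then so would be \<open>\<eta>\<close> and its transpose,
  the left unitor of \<open>I\<close>, which is invertible.\<close>

lemma nonzero_endomorphism_ring:
  assumes I: "I \<in> obj C" "\<not> zero_object C I" and \<eta>: "weak_ring C R \<eta>"
    "ihom_ev C I I \<cdot> (\<eta> \<odot>\<^sub>m idn C I) = lunit C I" "R = ihom C I I"
  shows "\<not> zero_object C R"
proof
  assume R: "zero_object C R"
  have e: "\<eta> \<in> arr C" "src C \<eta> = unit C" "tgt C \<eta> = R" using \<eta>(1) by (auto simp: weak_ring_def)
  then have "\<eta> = zero_arr C (unit C) R" using zero_objectD(3)[OF R e(1)] by simp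
  then have "lunit C I = zero_arr C (unit C \<odot> I) I"
    using \<eta>(2) I(1) zero_objectD(1)[OF R] \<eta>(3) by simp
  then have "lunit C I \<cdot> inv_arr C (lunit C I) = zero_arr C (unit C \<odot> I) I \<cdot> inv_arr C (lunit C I)" by simp
  then have "idn C I = zero_arr C I I" using I(1) by simp
  then show False using I by (simp add: zero_object_iff)
qed

end

section \<open>Tensor products and duals of compact objects\<close>

locale rigid_tt_category = tt_category C + big_triangulated_category C \<kappa>
  for C :: "('o, 'm, 'x) tt_data_scheme" (structure) and \<kappa> :: "'u rel" +
  assumes rigid: "compact_object \<kappa> C X \<longleftrightarrow> dualizable C X"
begin

text \<open>Compactness passes to \<open>W\<close> from \<open>c\<close> when arrows out of
  \<open>W\<close> correspond to arrows out of \<open>c\<close> into another coproduct. Only the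
  behaviour of the transposition \<open>B\<close> on finite sums enters, so no adjunction has to be
  set up.\<close>

lemma compactI_adjoint:
  assumes W: "W \<in> obj C" and c: "compact_object \<kappa> C c"
    and H: "\<And>(J :: 'u set) X Q \<iota> f. is_coproduct C J X Q \<iota> \<Longrightarrow> f \<in> Hom C W Q \<Longrightarrow>
      \<exists>X' Q' \<iota>' g B. is_coproduct C J X' Q' \<iota>' \<and> g \<in> Hom C c Q' \<and> B g = f \<and>
        B (zero_arr C c Q') = zero_arr C W Q \<and>
        (\<forall>j a h. j \<in> J \<and> a \<in> Hom C c (X' j) \<and> h \<in> Hom C c Q' \<longrightarrow>
          (\<exists>a' \<in> Hom C W (X j). B (plus_arr C (\<iota>' j \<cdot> a) h) = plus_arr C (\<iota> j \<cdot> a') (B h)))"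
  shows "compact_object \<kappa> C W"
proof (rule compactI[OF W])
  fix J :: "'u set" and X Q \<iota> f
  assume J: "small \<kappa> J" and cop: "is_coproduct C J X Q \<iota>" and f: "f \<in> Hom C W Q"
  from H[OF cop f] obtain X' Q' \<iota>' g B where G: "is_coproduct C J X' Q' \<iota>'" "g \<in> Hom C c Q'" "B g = f"
    "B (zero_arr C c Q') = zero_arr C W Q"
    and B: "\<forall>j a h. j \<in> J \<and> a \<in> Hom C c (X' j) \<and> h \<in> Hom C c Q' \<longrightarrow>
          (\<exists>a' \<in> Hom C W (X j). B (plus_arr C (\<iota>' j \<cdot> a) h) = plus_arr C (\<iota> j \<cdot> a') (B h))"
    by (elim exE conjE)
  have "g \<in> finsum C J X' Q' \<iota>' c" by (rule compact_finsum_univ[OF c J G(1,2)])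
  then have "B g \<in> finsum C J X Q \<iota> W"
  proof induction
    case finsum_zero
    show ?case unfolding G(4) by (rule finsum.finsum_zero)
  next
    case (finsum_insert j a h)
    have "h \<in> Hom C c Q'" using finsum_Hom[OF finsum_insert(3) G(1) compact_obj[OF c]] by simp
    then obtain a' where "a' \<in> Hom C W (X j)" "B (plus_arr C (\<iota>' j \<cdot> a) h) = plus_arr C (\<iota> j \<cdot> a') (B h)"
      using B finsum_insert(1,2) by blast
    then show ?case using finsum.finsum_insert[OF finsum_insert(1) _ finsum_insert.IH] by simp
  qed
  then show "f \<in> finsum C J X Q \<iota> W" unfolding G(3) .
qed

lemma compact_unit: "compact_object \<kappa> C (unit C)"
  unfolding rigid by (rule unit_dualizable)

text \<open>An arrow from \<open>X \<odot> Y\<close> to \<open>Q\<close> corresponds to one from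
  \<open>X\<close> to \<open>Q \<odot> D\<close> with \<open>D\<close> the dual of \<open>Y\<close>,
  and tensoring with \<open>D\<close> preserves coproducts.\<close>

lemma compact_tensor:
  assumes X: "compact_object \<kappa> C X" and Y: "compact_object \<kappa> C Y"
  shows "compact_object \<kappa> C (X \<odot> Y)"
proof (rule compactI_adjoint[OF _ X])
  have Xo: "X \<in> obj C" by (rule compact_obj[OF X])
  obtain D ev coev where Yo: "Y \<in> obj C" and D: "D \<in> obj C"
    and ev: "ev \<in> arr C" "src C ev = D \<odot> Y" "tgt C ev = unit C"
    and coev: "coev \<in> arr C" "src C coev = unit C" "tgt C coev = Y \<odot> D"
    and eq: "runit C Y \<cdot> (idn C Y \<odot>\<^sub>m ev) \<cdot> assoc C Y D Y \<cdot> (coev \<odot>\<^sub>m idn C Y) = lunit C Y"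
    using dualizableE[OF Y[unfolded rigid]] by metis
  show "X \<odot> Y \<in> obj C" using Xo Yo by simp
  fix J :: "'u set" and Z Q \<iota> f
  assume cop: "is_coproduct C J Z Q \<iota>" and f: "f \<in> Hom C (X \<odot> Y) Q"
  note c = coproductD[OF cop]
  \<comment> \<open>Transposition from arrows \<open>X \<rightarrow> Q \<odot> D\<close> back to
    arrows \<open>X \<odot> Y \<rightarrow> Q\<close>; its naturality in \<open>Q\<close> carries
    the coprojections along.\<close>
  define B where "B Q k = runit C Q \<cdot> (idn C Q \<odot>\<^sub>m ev) \<cdot> assoc C Q D Y \<cdot> (k \<odot>\<^sub>m idn C Y)" for Q k
  let ?e = "inv_arr C (assoc C X Y D) \<cdot> (idn C X \<odot>\<^sub>m coev) \<cdot> inv_arr C (runit C X)"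
  have e: "?e \<in> arr C" "src C ?e = X" "tgt C ?e = (X \<odot> Y) \<odot> D" using Xo Yo D coev by auto
  have nat: "B (tgt C p) ((p \<odot>\<^sub>m idn C D) \<cdot> k) = p \<cdot> B (src C p) k"
    if p: "p \<in> arr C" and k: "k \<in> arr C" "tgt C k = src C p \<odot> D" for p k
  proof -
    let ?P = "src C p" and ?Q = "tgt C p"
    have n1: "assoc C ?Q D Y \<cdot> ((p \<odot>\<^sub>m idn C D) \<odot>\<^sub>m idn C Y) = (p \<odot>\<^sub>m idn C (D \<odot> Y)) \<cdot> assoc C ?P D Y"
      using assoc_nat[of p "idn C D" "idn C Y"] p D Yo by simp
    have "B ?Q ((p \<odot>\<^sub>m idn C D) \<cdot> k) =
        runit C ?Q \<cdot> ((idn C ?Q \<odot>\<^sub>m ev) \<cdot> (assoc C ?Q D Y \<cdot> (((p \<odot>\<^sub>m idn C D) \<odot>\<^sub>m idn C Y) \<cdot> (k \<odot>\<^sub>m idn C Y))))"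
      unfolding B_def using p k D Yo by simp
    also have "assoc C ?Q D Y \<cdot> (((p \<odot>\<^sub>m idn C D) \<odot>\<^sub>m idn C Y) \<cdot> (k \<odot>\<^sub>m idn C Y)) =
        ((p \<odot>\<^sub>m idn C (D \<odot> Y)) \<cdot> assoc C ?P D Y) \<cdot> (k \<odot>\<^sub>m idn C Y)"
      by (rule cmp_reassoc[OF n1]) (use p k D Yo in auto)
    also have "runit C ?Q \<cdot> ((idn C ?Q \<odot>\<^sub>m ev) \<cdot> (((p \<odot>\<^sub>m idn C (D \<odot> Y)) \<cdot> assoc C ?P D Y) \<cdot> (k \<odot>\<^sub>m idn C Y))) =
        runit C ?Q \<cdot> ((p \<odot>\<^sub>m idn C (unit C)) \<cdot> ((idn C ?P \<odot>\<^sub>m ev) \<cdot> (assoc C ?P D Y \<cdot> (k \<odot>\<^sub>m idn C Y))))"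
      using p k D Yo ev by simp
    also have "\<dots> = (p \<cdot> runit C ?P) \<cdot> ((idn C ?P \<odot>\<^sub>m ev) \<cdot> (assoc C ?P D Y \<cdot> (k \<odot>\<^sub>m idn C Y)))"
      by (rule cmp_reassoc[OF runit_nat[symmetric]]) (use p k D Yo ev in auto)
    finally show ?thesis unfolding B_def using p k D Yo ev by simp
  qed
  have Bt: "B P k \<in> arr C" "src C (B P k) = X \<odot> Y" "tgt C (B P k) = P"
    if "P \<in> obj C" "k \<in> arr C" "src C k = X" "tgt C k = P \<odot> D" for P k
    unfolding B_def using that D Yo ev by auto
  show "\<exists>X' Q' \<iota>' g B. is_coproduct C J X' Q' \<iota>' \<and> g \<in> Hom C X Q' \<and> B g = f \<and>
        B (zero_arr C X Q') = zero_arr C (X \<odot> Y) Q \<and>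
        (\<forall>j a h. j \<in> J \<and> a \<in> Hom C X (X' j) \<and> h \<in> Hom C X Q' \<longrightarrow>
          (\<exists>a' \<in> Hom C (X \<odot> Y) (Z j). B (plus_arr C (\<iota>' j \<cdot> a) h) = plus_arr C (\<iota> j \<cdot> a') (B h)))"
  proof (intro exI conjI allI impI)
    show "is_coproduct C J (\<lambda>j. Z j \<odot> D) (Q \<odot> D) (\<lambda>j. \<iota> j \<odot>\<^sub>m idn C D)" by (rule tensor_coproduct[OF cop D])
    show "(f \<odot>\<^sub>m idn C D) \<cdot> ?e \<in> Hom C X (Q \<odot> D)" using f e D by simp
    have "B Q ((f \<odot>\<^sub>m idn C D) \<cdot> ?e) = f \<cdot> B (X \<odot> Y) ?e" using nat[of f ?e] f e by simp
    also have "B (X \<odot> Y) ?e = idn C (X \<odot> Y)" unfolding B_def by (rule zigzag_tensor) fact+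
    finally show "B Q ((f \<odot>\<^sub>m idn C D) \<cdot> ?e) = f" using f by simp
    show "B Q (zero_arr C X (Q \<odot> D)) = zero_arr C (X \<odot> Y) Q"
      unfolding B_def using Xo Yo D ev c(1) by simp
    fix j a h assume jah: "j \<in> J \<and> a \<in> Hom C X (Z j \<odot> D) \<and> h \<in> Hom C X (Q \<odot> D)"
    then have j: "j \<in> J" and a: "a \<in> arr C" "src C a = X" "tgt C a = Z j \<odot> D"
      and h: "h \<in> arr C" "src C h = X" "tgt C h = Q \<odot> D" by auto
    have "B Q (plus_arr C ((\<iota> j \<odot>\<^sub>m idn C D) \<cdot> a) h) = plus_arr C (B Q ((\<iota> j \<odot>\<^sub>m idn C D) \<cdot> a)) (B Q h)"
      unfolding B_def using a h c j D Yo ev by (simp add: tensor_plus_left cmp_plus_arr)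
    also have "B Q ((\<iota> j \<odot>\<^sub>m idn C D) \<cdot> a) = \<iota> j \<cdot> B (Z j) a" using nat[of "\<iota> j" a] a c j by simp
    finally show "\<exists>a' \<in> Hom C (X \<odot> Y) (Z j). B Q (plus_arr C ((\<iota> j \<odot>\<^sub>m idn C D) \<cdot> a) h) = plus_arr C (\<iota> j \<cdot> a') (B Q h)"
      using Bt[OF c(2)[OF j] a] by (intro bexI[of _ "B (Z j) a"]) auto
  qed
qed

text \<open>Arrows \<open>D \<rightarrow> Q\<close> correspond to arrows from the unit to
  \<open>Y \<odot> Q\<close>, and the unit is compact.\<close>

lemma compact_dual:
  assumes Y: "Y \<in> obj C" "D \<in> obj C"
    and ev: "ev \<in> arr C" "src C ev = D \<odot> Y" "tgt C ev = unit C"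
    and coev: "coev \<in> arr C" "src C coev = unit C" "tgt C coev = Y \<odot> D"
    and eq: "lunit C D \<cdot> (ev \<odot>\<^sub>m idn C D) \<cdot> inv_arr C (assoc C D Y D) \<cdot> (idn C D \<odot>\<^sub>m coev) = runit C D"
  shows "compact_object \<kappa> C D"
proof (rule compactI_adjoint[OF Y(2) compact_unit])
  fix J :: "'u set" and Z Q \<iota> f
  assume cop: "is_coproduct C J Z Q \<iota>" and f: "f \<in> Hom C D Q"
  note c = coproductD[OF cop]
  define B where "B Q k = lunit C Q \<cdot> (ev \<odot>\<^sub>m idn C Q) \<cdot> inv_arr C (assoc C D Y Q) \<cdot> (idn C D \<odot>\<^sub>m k) \<cdot> inv_arr C (runit C D)"
    for Q k
  have nat: "B (tgt C p) ((idn C Y \<odot>\<^sub>m p) \<cdot> k) = p \<cdot> B (src C p) k"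
    if p: "p \<in> arr C" and k: "k \<in> arr C" "src C k = unit C" "tgt C k = Y \<odot> src C p" for p k
  proof -
    let ?P = "src C p" and ?Q = "tgt C p"
    let ?r = "(idn C D \<odot>\<^sub>m k) \<cdot> inv_arr C (runit C D)"
    have r: "?r \<in> arr C" "tgt C ?r = D \<odot> (Y \<odot> ?P)" using Y k by auto
    have "(idn C (D \<odot> Y) \<odot>\<^sub>m p) = inv_arr C (assoc C D Y ?Q) \<cdot> ((idn C D \<odot>\<^sub>m (idn C Y \<odot>\<^sub>m p)) \<cdot> assoc C D Y ?P)"
      using assoc_nat[of "idn C D" "idn C Y" p] p Y by simp
    then have n1: "inv_arr C (assoc C D Y ?Q) \<cdot> ((idn C D \<odot>\<^sub>m (idn C Y \<odot>\<^sub>m p)) \<cdot> ?r) =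
        (idn C (D \<odot> Y) \<odot>\<^sub>m p) \<cdot> (inv_arr C (assoc C D Y ?P) \<cdot> ?r)"
      using p Y r by simp
    have "B ?Q ((idn C Y \<odot>\<^sub>m p) \<cdot> k) = lunit C ?Q \<cdot> ((ev \<odot>\<^sub>m idn C ?Q) \<cdot> (inv_arr C (assoc C D Y ?Q) \<cdot>
        ((idn C D \<odot>\<^sub>m (idn C Y \<odot>\<^sub>m p)) \<cdot> ?r)))"
      unfolding B_def using p k Y by simp
    also have "\<dots> = lunit C ?Q \<cdot> ((idn C (unit C) \<odot>\<^sub>m p) \<cdot> ((ev \<odot>\<^sub>m idn C ?P) \<cdot> (inv_arr C (assoc C D Y ?P) \<cdot> ?r)))"
      unfolding n1 using p r Y ev by simp
    also have "\<dots> = (p \<cdot> lunit C ?P) \<cdot> ((ev \<odot>\<^sub>m idn C ?P) \<cdot> (inv_arr C (assoc C D Y ?P) \<cdot> ?r))"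
      by (rule cmp_reassoc[OF lunit_nat[symmetric]]) (use p r Y ev in auto)
    finally show ?thesis unfolding B_def using p r k Y ev by simp
  qed
  have Bt: "B P k \<in> arr C" "src C (B P k) = D" "tgt C (B P k) = P"
    if "P \<in> obj C" "k \<in> arr C" "src C k = unit C" "tgt C k = Y \<odot> P" for P k
    unfolding B_def using that Y ev by auto
  show "\<exists>X' Q' \<iota>' g B. is_coproduct C J X' Q' \<iota>' \<and> g \<in> Hom C (unit C) Q' \<and> B g = f \<and>
        B (zero_arr C (unit C) Q') = zero_arr C D Q \<and>
        (\<forall>j a h. j \<in> J \<and> a \<in> Hom C (unit C) (X' j) \<and> h \<in> Hom C (unit C) Q' \<longrightarrow>
          (\<exists>a' \<in> Hom C D (Z j). B (plus_arr C (\<iota>' j \<cdot> a) h) = plus_arr C (\<iota> j \<cdot> a') (B h)))"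
  proof (intro exI conjI allI impI)
    show "is_coproduct C J (\<lambda>j. Y \<odot> Z j) (Y \<odot> Q) (\<lambda>j. idn C Y \<odot>\<^sub>m \<iota> j)" by (rule tensor_coproduct_left[OF cop Y(1)])
    show "(idn C Y \<odot>\<^sub>m f) \<cdot> coev \<in> Hom C (unit C) (Y \<odot> Q)" using f coev Y by simp
    have "B Q ((idn C Y \<odot>\<^sub>m f) \<cdot> coev) = f \<cdot> B D coev" using nat[of f coev] f coev by simp
    also have "B D coev = (lunit C D \<cdot> (ev \<odot>\<^sub>m idn C D) \<cdot> inv_arr C (assoc C D Y D) \<cdot> (idn C D \<odot>\<^sub>m coev)) \<cdot> inv_arr C (runit C D)"
      unfolding B_def using Y ev coev by simp
    also have "\<dots> = idn C D" unfolding eq using Y by simp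
    finally show "B Q ((idn C Y \<odot>\<^sub>m f) \<cdot> coev) = f" using f by simp
    show "B Q (zero_arr C (unit C) (Y \<odot> Q)) = zero_arr C D Q"
      unfolding B_def using Y ev c(1) by simp
    fix j a h assume jah: "j \<in> J \<and> a \<in> Hom C (unit C) (Y \<odot> Z j) \<and> h \<in> Hom C (unit C) (Y \<odot> Q)"
    then have j: "j \<in> J" and a: "a \<in> arr C" "src C a = unit C" "tgt C a = Y \<odot> Z j"
      and h: "h \<in> arr C" "src C h = unit C" "tgt C h = Y \<odot> Q" by auto
    have "B Q (plus_arr C ((idn C Y \<odot>\<^sub>m \<iota> j) \<cdot> a) h) = plus_arr C (B Q ((idn C Y \<odot>\<^sub>m \<iota> j) \<cdot> a)) (B Q h)"
      unfolding B_def using a h c j Y ev by (simp add: tensor_plus_right cmp_plus_arr)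
    also have "B Q ((idn C Y \<odot>\<^sub>m \<iota> j) \<cdot> a) = \<iota> j \<cdot> B (Z j) a" using nat[of "\<iota> j" a] a c j by simp
    finally show "\<exists>a' \<in> Hom C D (Z j). B Q (plus_arr C ((idn C Y \<odot>\<^sub>m \<iota> j) \<cdot> a) h) = plus_arr C (\<iota> j \<cdot> a') (B Q h)"
      using Bt[OF c(2)[OF j] a] by (intro bexI[of _ "B (Z j) a"]) auto
  qed
qed

end

section \<open>From coaugmentations to a weak ring\<close>

locale rigid_core = rigid_tt_category C \<kappa> + triangulated_core C \<kappa> T0
  for C :: "('o, 'm, 'x) tt_data_scheme" (structure) and \<kappa> :: "'u rel" and T0
begin

text \<open>The predicate \<open>N\<close> is an invariant that keeps iterated coaugmentations of
  \<open>c\<close> away from zero: it holds for zero arrows, fails for the identity, and its failure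
  persists under each further coaugmentation.\<close>

lemma weak_ring_splitting_coaugmentations:
  fixes Sx :: "'s set" and sm :: "'s \<Rightarrow> 'm" and c :: 'o
  assumes Sx: "small \<kappa> Sx" and sm: "\<And>i. sm i \<in> arr C" "\<And>i. src C (sm i) = unit C"
    and c: "compact_object \<kappa> C c"
    and N: "\<And>g. g = zero_arr C c (tgt C g) \<Longrightarrow> g \<in> arr C \<Longrightarrow> N g" "\<not> N (idn C c)"
      "\<And>g i. g \<in> arr C \<Longrightarrow> src C g = c \<Longrightarrow> compact_object \<kappa> C (tgt C g) \<Longrightarrow> \<not> N g \<Longrightarrow> i \<in> Sx \<Longrightarrow>
        compact_object \<kappa> C (tgt C (sm i)) \<and> \<not> N (coaug C (sm i) (tgt C g) \<cdot> g)"
  obtains R \<eta> where "weak_ring C R \<eta>" "\<not> zero_object C R"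
    "\<And>i. i \<in> Sx \<Longrightarrow> \<exists>q. q \<in> arr C \<and> src C q = tgt C (sm i) \<odot> R \<and> tgt C q = R \<and> q \<cdot> coaug C (sm i) R = idn C R"
proof -
  obtain enum :: "(nat \<times> 's) set \<Rightarrow> (nat \<times> 's) list" where enum:
    "\<And>J. finite J \<Longrightarrow> set (enum J) = J"
    "\<And>J J'. finite J' \<Longrightarrow> J \<subseteq> J' \<Longrightarrow> enum J = filter (\<lambda>i. i \<in> J) (enum J')"
    "\<And>J s. finite J \<Longrightarrow> \<exists>n. (n, s) \<notin> J \<and> enum (insert (n, s) J) = enum J @ [(n, s)]"
    by (rule enumeration_exists) blast
  have A: "tgt C (sm i) \<in> obj C" for i using sm by auto
  interpret F: coaugmented_family C \<kappa> T0 c Sx "\<lambda>i X. tgt C (sm i) \<odot> X" "\<lambda>i f. idn C (tgt C (sm i)) \<odot>\<^sub>m f"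
    "\<lambda>i. coaug C (sm i)" enum
  proof unfold_locales
    show "compact_object \<kappa> C c" "small \<kappa> Sx" by fact+
    show "is_coproduct C J (\<lambda>j. tgt C (sm i) \<odot> Xs j) (tgt C (sm i) \<odot> Q) (\<lambda>j. idn C (tgt C (sm i)) \<odot>\<^sub>m \<iota> j)"
      if "is_coproduct C J Xs Q \<iota>" for J :: "'u set" and Xs Q \<iota> i
      using tensor_coproduct_left[OF that A] .
    show "\<exists>h'. (idn C (tgt C (sm i)) \<odot>\<^sub>m f, idn C (tgt C (sm i)) \<odot>\<^sub>m g, h') \<in> tri C" if "(f, g, h) \<in> tri C" for f g h i
      using tensor_tri_left[OF that A] .
    show "(idn C (tgt C (sm i)) \<odot>\<^sub>m f) \<cdot> coaug C (sm i) (src C f) = coaug C (sm i) (tgt C f) \<cdot> f" if "f \<in> arr C" for f i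
      by (rule coaug_natural[OF sm that])
    show "set (enum L) = L" if "finite L" for L using enum(1)[OF that] .
    show "enum L = filter (\<lambda>i. i \<in> L) (enum L')" if "finite L'" "L \<subseteq> L'" for L L' using enum(2)[OF that] .
    show "\<exists>n. (n, s) \<notin> L \<and> enum (insert (n, s) L) = enum L @ [(n, s)]" if "finite L" for L s using enum(3)[OF that] .
  qed (use A sm in \<open>auto simp: tensor_plus_right\<close>)
  \<comment> \<open>From the empty index set the transition is the composite of all the
    coaugmentations in the list, so the persistence of non-\<open>N\<close> can be applied one entry
    at a time.\<close>
  have tr: "F.tr {} l c \<in> arr C \<and> src C (F.tr {} l c) = c \<and> tgt C (F.tr {} l c) = F.ao l c \<and>
      compact_object \<kappa> C (F.ao l c) \<and> \<not> N (F.tr {} l c)" if "set l \<subseteq> UNIV \<times> Sx" for l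
    using that
  proof (induction l)
    case Nil
    then show ?case using c N(2) compact_obj[OF c] by simp
  next
    case (Cons y l)
    then have IH: "F.tr {} l c \<in> arr C" "src C (F.tr {} l c) = c" "tgt C (F.tr {} l c) = F.ao l c"
      "compact_object \<kappa> C (F.ao l c)" "\<not> N (F.tr {} l c)" and y: "snd y \<in> Sx" by auto
    have n: "compact_object \<kappa> C (tgt C (sm (snd y))) \<and> \<not> N (coaug C (sm (snd y)) (tgt C (F.tr {} l c)) \<cdot> F.tr {} l c)"
      by (rule N(3)) (use IH y in auto)
    then show ?case
      using IH sm compact_tensor[OF _ IH(4), of "tgt C (sm (snd y))"] compact_obj[OF IH(4)] by simp
  qed
  have nz: "F.TR {} J c \<noteq> zero_arr C c (F.AO J c)" if J: "F.Fin J" for J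
  proof
    assume z: "F.TR {} J c = zero_arr C c (F.AO J c)"
    have l: "set (enum J) \<subseteq> UNIV \<times> Sx" using J enum(1)[of J] by (auto simp: F.Fin_def)
    have "N (F.TR {} J c)" by (rule N(1)) (use tr[OF l] z in auto)
    then show False using tr[OF l] by blast
  qed
  obtain I where I: "I \<in> obj C" "\<not> zero_object C I"
    "\<And>s. s \<in> Sx \<Longrightarrow> \<exists>r. r \<in> arr C \<and> src C r = tgt C (sm s) \<odot> I \<and> tgt C r = I \<and> r \<cdot> coaug C (sm s) I = idn C I"
    by (rule F.split_coaugmentations, rule nz, assumption) (rule that)
  obtain R \<eta> where R: "weak_ring C R \<eta>" "ihom_ev C I I \<cdot> (\<eta> \<odot>\<^sub>m idn C I) = lunit C I" "R = ihom C I I"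
    "\<And>s r. s \<in> arr C \<Longrightarrow> src C s = unit C \<Longrightarrow> r \<in> arr C \<Longrightarrow> src C r = tgt C s \<odot> I \<Longrightarrow> tgt C r = I \<Longrightarrow>
      r \<cdot> coaug C s I = idn C I \<Longrightarrow> \<exists>q. q \<in> arr C \<and> src C q = tgt C s \<odot> R \<and> tgt C q = R \<and> q \<cdot> coaug C s R = idn C R"
    by (rule endomorphism_ring[OF I(1)]) (rule that)
  show ?thesis
  proof (rule that[OF R(1) nonzero_endomorphism_ring[OF I(1,2) R(1-3)]])
    fix i assume "i \<in> Sx"
    then obtain r where "r \<in> arr C" "src C r = tgt C (sm i) \<odot> I" "tgt C r = I" "r \<cdot> coaug C (sm i) I = idn C I"
      using I(3) by blast
    then show "\<exists>q. q \<in> arr C \<and> src C q = tgt C (sm i) \<odot> R \<and> tgt C q = R \<and> q \<cdot> coaug C (sm i) R = idn C R"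
      by (rule R(4)[OF sm])
  qed
qed

end

section \<open>Thick ideals of compact objects\<close>

lemma compact_part_simps [simp]:
  "obj (compact_part \<kappa> C) = {X. compact_object \<kappa> C X}"
  "arr (compact_part \<kappa> C) = {f \<in> arr C. compact_object \<kappa> C (src C f) \<and> compact_object \<kappa> C (tgt C f)}"
  "src (compact_part \<kappa> C) = src C" "tgt (compact_part \<kappa> C) = tgt C"
  "idn (compact_part \<kappa> C) = idn C" "cmp (compact_part \<kappa> C) = cmp C"
  "plus_arr (compact_part \<kappa> C) = plus_arr C" "zero_arr (compact_part \<kappa> C) = zero_arr C"
  "shift (compact_part \<kappa> C) = shift C" "tensor_obj (compact_part \<kappa> C) = tensor_obj C"
  "(f, g, h) \<in> tri (compact_part \<kappa> C) \<longleftrightarrow> (f, g, h) \<in> tri C \<and> compact_object \<kappa> C (src C f) \<and>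
     compact_object \<kappa> C (tgt C f) \<and> compact_object \<kappa> C (tgt C g)"
  by (auto simp: compact_part_def)

text \<open>The condition on \<open>P\<close> makes sense for objects that need not be compact: the zero objects form
  such a class.\<close>

definition thick_class :: "'u rel \<Rightarrow> ('o, 'm, 'x) tt_data_scheme \<Rightarrow> 'o set \<Rightarrow> bool" where
  "thick_class \<kappa> C P \<longleftrightarrow> P \<subseteq> obj C \<and> (\<forall>Z. zero_object C Z \<longrightarrow> Z \<in> P) \<and>
     (\<forall>X \<in> obj C. fobj (shift C) X \<in> P \<longleftrightarrow> X \<in> P) \<and>
     (\<forall>f g h. (f, g, h) \<in> tri C \<and> src C f \<in> P \<and> tgt C f \<in> P \<longrightarrow> tgt C g \<in> P) \<and>
     (\<forall>X Y. retract C X Y \<and> Y \<in> P \<longrightarrow> X \<in> P) \<and>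
     (\<forall>X Y. compact_object \<kappa> C X \<and> Y \<in> P \<longrightarrow> tensor_obj C X Y \<in> P)"

context rigid_tt_category
begin

abbreviation compact :: "'o \<Rightarrow> bool" where
  "compact X \<equiv> compact_object \<kappa> C X"

abbreviation ideal :: "'o set \<Rightarrow> bool" where
  "ideal P \<equiv> thick_tensor_ideal (compact_part \<kappa> C) P"

lemma zero_object_compact_part: "zero_object (compact_part \<kappa> C) Z \<longleftrightarrow> zero_object C Z"
proof
  assume Z: "zero_object (compact_part \<kappa> C) Z"
  then have c: "compact Z" by (simp add: zero_object_def)
  then have o: "Z \<in> obj C" by (rule compact_obj)
  have "\<exists>!f. f \<in> Hom (compact_part \<kappa> C) Z Z" using Z c unfolding zero_object_def by auto
  moreover have "idn C Z \<in> Hom (compact_part \<kappa> C) Z Z" "zero_arr C Z Z \<in> Hom (compact_part \<kappa> C) Z Z"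
    using o c by auto
  ultimately have "idn C Z = zero_arr C Z Z" by blast
  then show "zero_object C Z" using o by (simp add: zero_object_iff)
next
  assume Z: "zero_object C Z"
  show "zero_object (compact_part \<kappa> C) Z" unfolding zero_object_def
  proof (intro conjI ballI)
    show cZ: "Z \<in> obj (compact_part \<kappa> C)" using compact_zero[OF Z] by simp
    fix X assume "X \<in> obj (compact_part \<kappa> C)"
    then have X: "compact X" "X \<in> obj C" using compact_obj by auto
    show "\<exists>!f. f \<in> Hom (compact_part \<kappa> C) X Z"
    proof (rule ex1I)
      show "zero_arr C X Z \<in> Hom (compact_part \<kappa> C) X Z" using X cZ zero_objectD(1)[OF Z] by simp
      show "f = zero_arr C X Z" if "f \<in> Hom (compact_part \<kappa> C) X Z" for f
        using that zero_objectD(3)[OF Z, of f] by auto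
    qed
    show "\<exists>!f. f \<in> Hom (compact_part \<kappa> C) Z X"
    proof (rule ex1I)
      show "zero_arr C Z X \<in> Hom (compact_part \<kappa> C) Z X" using X cZ zero_objectD(1)[OF Z] by simp
      show "f = zero_arr C Z X" if "f \<in> Hom (compact_part \<kappa> C) Z X" for f
        using that zero_objectD(2)[OF Z, of f] by auto
    qed
  qed
qed

text \<open>The biproduct clause amounts to closure under retracts, because a retract has a
  complement, which is again compact. The shift clause extends to all objects since an object with
  compact suspension is compact.\<close>

lemma ideal_iff: "ideal P \<longleftrightarrow> thick_class \<kappa> C P \<and> (\<forall>X \<in> P. compact X)"
proof
  assume P: "ideal P"
  note D = P[unfolded thick_tensor_ideal_def]
  note D1 = D[THEN conjunct1] and D2 = D[THEN conjunct2, THEN conjunct1] and D3 = D[THEN conjunct2, THEN conjunct2, THEN conjunct1]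
    and D4 = D[THEN conjunct2, THEN conjunct2, THEN conjunct2, THEN conjunct1]
    and D5 = D[THEN conjunct2, THEN conjunct2, THEN conjunct2, THEN conjunct2, THEN conjunct1]
    and D6 = D[THEN conjunct2, THEN conjunct2, THEN conjunct2, THEN conjunct2, THEN conjunct2]
  have c: "compact X" if "X \<in> P" for X using subsetD[OF D1 that] by simp
  have cone: "tgt C g \<in> P" if "(f, g, h) \<in> tri C" "src C f \<in> P" "tgt C f \<in> P" for f g h
  proof -
    note t = triD[OF that(1)]
    have cc: "compact (src C f)" "compact (tgt C f)" using c that by auto
    then have "compact (tgt C g)" by (rule compact_cone[OF that(1)])
    then have "(f, g, h) \<in> tri (compact_part \<kappa> C)" "f \<in> Hom (compact_part \<kappa> C) (src C f) (tgt C f)"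
      "g \<in> Hom (compact_part \<kappa> C) (tgt C f) (tgt C g)" using t that(1) cc by auto
    then show ?thesis using D4[rule_format, of f g h "src C f" "tgt C f" "tgt C g"] that(2,3) by blast
  qed
  have retr: "X \<in> P" if XY: "retract C X Y" "Y \<in> P" for X Y
  proof -
    obtain i r where 1: "i \<in> arr C" "r \<in> arr C" "src C i = X" "tgt C i = Y" "src C r = Y" "tgt C r = X"
      "r \<cdot> i = idn C X" "X \<in> obj C" "Y \<in> obj C" by (rule retractE[OF XY(1)])
    obtain Z j q where B: "is_biproduct C X Z Y i j r q" by (rule retract_biproduct[OF 1(1-7)])
    have Y: "compact Y" by (rule c[OF XY(2)])
    have X: "compact X" by (rule compact_retract[OF Y XY(1)])
    have Z: "retract C Z Y" by (rule retractI[of j q]) (use B in \<open>auto simp: is_biproduct_def\<close>)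
    have Z: "compact Z" by (rule compact_retract[OF Y Z])
    have "is_biproduct (compact_part \<kappa> C) X Z Y i j r q" using B X Y Z by (auto simp: is_biproduct_def)
    then show ?thesis using D5[rule_format, of X Z Y i j r q] X Z XY(2) by simp
  qed
  have sh: "\<Sigma>\<^sub>o X \<in> P \<longleftrightarrow> X \<in> P" if "X \<in> obj C" for X
  proof (cases "compact X")
    case True
    then show ?thesis using D3[rule_format, of X] by simp
  next
    case False
    then show ?thesis using compact_unshift[OF _ that] c by blast
  qed
  show "thick_class \<kappa> C P \<and> (\<forall>X \<in> P. compact X)" unfolding thick_class_def
  proof (intro conjI allI ballI impI)
    show "P \<subseteq> obj C" using c compact_obj by blast
    show "Z \<in> P" if "zero_object C Z" for Z using D2 that unfolding zero_object_compact_part by blast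
    show "X \<odot> Y \<in> P" if "compact X \<and> Y \<in> P" for X Y using D6[rule_format, of X Y] that by simp
    show "tgt C g \<in> P" if "(f, g, h) \<in> tri C \<and> src C f \<in> P \<and> tgt C f \<in> P" for f g h
      using that by (elim conjE) (rule cone)
  qed (use sh c in \<open>auto intro: retr\<close>)
next
  assume P: "thick_class \<kappa> C P \<and> (\<forall>X \<in> P. compact X)"
  show "ideal P" unfolding thick_tensor_ideal_def
  proof (intro conjI allI ballI impI)
    show "P \<subseteq> obj (compact_part \<kappa> C)" using P by auto
    show "Z \<in> P" if "zero_object (compact_part \<kappa> C) Z" for Z
      using that P unfolding zero_object_compact_part thick_class_def by blast
    show "fobj (shift (compact_part \<kappa> C)) X \<in> P \<longleftrightarrow> X \<in> P" if "X \<in> obj (compact_part \<kappa> C)" for X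
      using that P compact_obj[of \<kappa> X] unfolding thick_class_def by simp
    show "Z \<in> P" if "(f, g, h) \<in> tri (compact_part \<kappa> C) \<and> f \<in> Hom (compact_part \<kappa> C) X Y \<and>
      g \<in> Hom (compact_part \<kappa> C) Y Z \<and> X \<in> P \<and> Y \<in> P" for X Y Z f g h
    proof -
      have "(f, g, h) \<in> tri C" "src C f \<in> P" "tgt C f \<in> P" "tgt C g = Z" using that by auto
      then show ?thesis using P unfolding thick_class_def by blast
    qed
    show "X \<in> P" if "is_biproduct (compact_part \<kappa> C) X Y B i j p q \<and> B \<in> P" for X Y B i j p q
    proof -
      have "retract C X B" by (rule retractI[of i p]) (use that in \<open>auto simp: is_biproduct_def\<close>)
      then show ?thesis using P that unfolding thick_class_def by blast
    qed
    show "tensor_obj (compact_part \<kappa> C) X Y \<in> P" if "X \<in> obj (compact_part \<kappa> C)" "Y \<in> P" for X Y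
      using that P unfolding thick_class_def by simp
  qed
qed

context
  fixes P assumes P: "thick_class \<kappa> C P"
begin

lemma thick_obj: "X \<in> P \<Longrightarrow> X \<in> obj C"
  using P unfolding thick_class_def by blast

lemma thick_zero: "zero_object C Z \<Longrightarrow> Z \<in> P"
  using P unfolding thick_class_def by blast

lemma thick_shift: "X \<in> obj C \<Longrightarrow> \<Sigma>\<^sub>o X \<in> P \<longleftrightarrow> X \<in> P"
  using P unfolding thick_class_def by blast

lemma thick_cone: "(f, g, h) \<in> tri C \<Longrightarrow> src C f \<in> P \<Longrightarrow> tgt C f \<in> P \<Longrightarrow> tgt C g \<in> P"
  using P unfolding thick_class_def by blast

lemma thick_retract: "retract C X Y \<Longrightarrow> Y \<in> P \<Longrightarrow> X \<in> P"
  using P unfolding thick_class_def by blast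

lemma thick_tensor: "compact X \<Longrightarrow> Y \<in> P \<Longrightarrow> X \<odot> Y \<in> P"
  using P unfolding thick_class_def by blast

lemma thick_tensor_right:
  assumes "compact X" "Y \<in> P" shows "Y \<odot> X \<in> P"
  using thick_retract[OF tensor_comm_retract thick_tensor[OF assms]] thick_obj[OF assms(2)] compact_obj[OF assms(1)]
  by blast

lemma thick_middle:
  assumes T: "(f, g, h) \<in> tri C" and "src C f \<in> P" "tgt C g \<in> P"
  shows "tgt C f \<in> P"
proof -
  note t = triD[OF T]
  have "(h, neg_arr C (\<Sigma>\<^sub>m f), neg_arr C (\<Sigma>\<^sub>m g)) \<in> tri C" by (rule tri_rot[OF tri_rot[OF T]])
  from thick_cone[OF this] have "\<Sigma>\<^sub>o (tgt C f) \<in> P" using t assms thick_shift[of "src C f"] by simp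
  then show ?thesis using t thick_shift[of "tgt C f"] by simp
qed

text \<open>By the octahedral axiom the cone of a composite is an extension of the two
  cones.\<close>

lemma thick_cone_cmp:
  assumes f: "(f, f\<^sub>1, f\<^sub>2) \<in> tri C" "tgt C f\<^sub>1 \<in> P" and g: "(g, g\<^sub>1, g\<^sub>2) \<in> tri C" "tgt C g\<^sub>1 \<in> P"
    and e: "tgt C f = src C g" and k: "(g \<cdot> f, k\<^sub>1, k\<^sub>2) \<in> tri C"
  shows "tgt C k\<^sub>1 \<in> P"
proof -
  note t = triD[OF f(1)] triD[OF g(1)] triD[OF k]
  have "\<exists>u \<in> Hom C (tgt C f\<^sub>1) (tgt C k\<^sub>1). \<exists>v \<in> Hom C (tgt C k\<^sub>1) (tgt C g\<^sub>1). (u, v, \<Sigma>\<^sub>m f\<^sub>1 \<cdot> g\<^sub>2) \<in> tri C \<and>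
      u \<cdot> f\<^sub>1 = k\<^sub>1 \<cdot> g \<and> v \<cdot> k\<^sub>1 = g\<^sub>1 \<and> k\<^sub>2 \<cdot> u = f\<^sub>2 \<and> g\<^sub>2 \<cdot> v = \<Sigma>\<^sub>m f \<cdot> k\<^sub>2"
    by (rule tri_octahedron[of f "src C f" "tgt C f" g "tgt C g", OF _ _ f(1) _ g(1) _ k]) (use t e in auto)
  then obtain u v where "u \<in> Hom C (tgt C f\<^sub>1) (tgt C k\<^sub>1)" "v \<in> Hom C (tgt C k\<^sub>1) (tgt C g\<^sub>1)"
    and T: "(u, v, \<Sigma>\<^sub>m f\<^sub>1 \<cdot> g\<^sub>2) \<in> tri C" by blast
  then show ?thesis using thick_middle[OF T] f(2) g(2) by simp
qed

text \<open>Serves twice: with \<open>P\<close> the class of zero objects it gives annihilators of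
  objects that may fail to be compact, and with \<open>P\<close> an ideal it drives the maximality
  argument for primes.\<close>

lemma ideal_colon:
  assumes y: "y \<in> obj C" shows "ideal {x. compact x \<and> x \<odot> y \<in> P}" (is "ideal ?N")
  unfolding ideal_iff thick_class_def
proof (intro conjI allI ballI impI)
  show "?N \<subseteq> obj C" using compact_obj by blast
  show "Z \<in> ?N" if "zero_object C Z" for Z
    using zero_tensor(1)[OF that y] compact_zero[OF that] thick_zero by blast
  show "\<Sigma>\<^sub>o X \<in> ?N \<longleftrightarrow> X \<in> ?N" if X: "X \<in> obj C" for X
  proof -
    have i: "iso_arr C (shift_tensor C X y)" "src C (shift_tensor C X y) = \<Sigma>\<^sub>o X \<odot> y"
      "tgt C (shift_tensor C X y) = \<Sigma>\<^sub>o (X \<odot> y)" using shift_tensor_iso[OF X y] by (auto simp: isos_iff)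
    have "\<Sigma>\<^sub>o X \<odot> y \<in> P \<longleftrightarrow> \<Sigma>\<^sub>o (X \<odot> y) \<in> P"
      using iso_retract[OF i(1)] thick_retract unfolding i(2,3) by blast
    also have "\<dots> \<longleftrightarrow> X \<odot> y \<in> P" using X y by (intro thick_shift) simp
    finally show ?thesis using compact_shift[of \<kappa> X] compact_unshift[of \<kappa> X] X by blast
  qed
  show "tgt C g \<in> ?N" if "(f, g, h) \<in> tri C \<and> src C f \<in> ?N \<and> tgt C f \<in> ?N" for f g h
  proof -
    have T: "(f, g, h) \<in> tri C" and c: "compact (src C f)" "compact (tgt C f)"
      and N: "src C f \<odot> y \<in> P" "tgt C f \<odot> y \<in> P" using that by auto
    note t = triD[OF T]
    have "compact (tgt C g)" by (rule compact_cone[OF T c])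
    moreover have "tgt C g \<odot> y \<in> P" using thick_cone[OF tensor_exact[OF T y]] t y N by simp
    ultimately show ?thesis by simp
  qed
  show "X \<in> ?N" if "retract C X Y \<and> Y \<in> ?N" for X Y
    using that compact_retract thick_retract tensor_retract[OF _ retract_refl[OF y]] by blast
  show "X \<odot> Y \<in> ?N" if "compact X \<and> Y \<in> ?N" for X Y
  proof -
    have c: "compact X" "compact Y" and N: "X \<odot> (Y \<odot> y) \<in> P" using that thick_tensor by auto
    have "retract C ((X \<odot> Y) \<odot> y) (X \<odot> (Y \<odot> y))" using compact_obj[OF c(1)] compact_obj[OF c(2)] y by (rule tensor_assoc_retract)
    then show ?thesis using thick_retract N compact_tensor[OF c] by blast
  qed
  show "compact X" if "X \<in> ?N" for X using that by simp
qed

end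

lemma thick_class_zero: "thick_class \<kappa> C {Z. zero_object C Z}"
  unfolding thick_class_def
proof (intro conjI allI ballI impI)
  show "{Z. zero_object C Z} \<subseteq> obj C" using zero_objectD(1) by blast
  show "\<Sigma>\<^sub>o X \<in> {Z. zero_object C Z} \<longleftrightarrow> X \<in> {Z. zero_object C Z}" if X: "X \<in> obj C" for X
  proof
    assume "X \<in> {Z. zero_object C Z}"
    then have "idn C X = zero_arr C X X" by (simp add: zero_object_iff)
    then have "\<Sigma>\<^sub>m (idn C X) = \<Sigma>\<^sub>m (zero_arr C X X)" by simp
    then show "\<Sigma>\<^sub>o X \<in> {Z. zero_object C Z}" using X by (simp add: zero_object_iff)
  next
    assume "\<Sigma>\<^sub>o X \<in> {Z. zero_object C Z}"
    then have "\<Sigma>\<^sub>m (idn C X) = \<Sigma>\<^sub>m (zero_arr C X X)" using X by (simp add: zero_object_iff)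
    then have "idn C X = zero_arr C X X" by - (rule shift_faithful, use X in auto)
    then show "X \<in> {Z. zero_object C Z}" using X by (simp add: zero_object_iff)
  qed
  show "tgt C g \<in> {Z. zero_object C Z}"
    if "(f, g, h) \<in> tri C \<and> src C f \<in> {Z. zero_object C Z} \<and> tgt C f \<in> {Z. zero_object C Z}" for f g h
  proof -
    have T: "(f, g, h) \<in> tri C" and z: "zero_object C (src C f)" "zero_object C (tgt C f)" using that by auto
    note t = triD[OF T]
    have g: "g = zero_arr C (tgt C f) (tgt C g)" using zero_objectD(2)[OF z(2) t(2,4)] .
    have o: "tgt C f \<in> obj C" "tgt C g \<in> obj C" "src C f \<in> obj C" using t by auto
    have "idn C (src C f) = zero_arr C (src C f) (src C f)" using z(1) by (simp add: zero_object_iff)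
    then have "\<Sigma>\<^sub>m (idn C (src C f)) = \<Sigma>\<^sub>m (zero_arr C (src C f) (src C f))" by simp
    then have s: "zero_object C (\<Sigma>\<^sub>o (src C f))" using o by (simp add: zero_object_iff)
    have h: "h \<cdot> idn C (tgt C g) = zero_arr C (tgt C g) (\<Sigma>\<^sub>o (src C f))" using zero_objectD(3)[OF s t(3,6)] t by simp
    obtain m where m: "m \<in> arr C" "src C m = tgt C g" "tgt C m = tgt C f" "g \<cdot> m = idn C (tgt C g)"
      by (rule weak_kernel[OF tri_rot[OF T], of "idn C (tgt C g)"]) (use t o h in auto)
    have "g \<cdot> m = zero_arr C (tgt C g) (tgt C g)" by (subst g) (use m(1-3) o in simp)
    then show ?thesis using m(4) o by (simp add: zero_object_iff)
  qed
  show "X \<in> {Z. zero_object C Z}" if "retract C X Y \<and> Y \<in> {Z. zero_object C Z}" for X Y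
    using that zero_objectI_retract by blast
  show "X \<odot> Y \<in> {Z. zero_object C Z}" if "compact X \<and> Y \<in> {Z. zero_object C Z}" for X Y
    using that zero_tensor(2) compact_obj by blast
qed auto

lemma ideal_compact: "ideal P \<Longrightarrow> X \<in> P \<Longrightarrow> compact X"
  by (simp add: ideal_iff)

lemma ideal_thick: "ideal P \<Longrightarrow> thick_class \<kappa> C P"
  by (simp add: ideal_iff)

lemma ideal_annihilator:
  assumes "y \<in> obj C" shows "ideal {x. compact x \<and> zero_object C (x \<odot> y)}"
  using ideal_colon[OF thick_class_zero assms] by simp

lemma ideal_Inter:
  assumes "\<And>A. A \<in> \<A> \<Longrightarrow> ideal A" shows "ideal {x. compact x \<and> (\<forall>A \<in> \<A>. x \<in> A)}"
  unfolding ideal_iff thick_class_def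
proof (intro conjI allI ballI impI)
  note T = ideal_thick[OF assms]
  let ?N = "{x. compact x \<and> (\<forall>A \<in> \<A>. x \<in> A)}"
  show "?N \<subseteq> obj C" using compact_obj by blast
  show "Z \<in> ?N" if "zero_object C Z" for Z using that compact_zero thick_zero[OF T] by blast
  show "\<Sigma>\<^sub>o X \<in> ?N \<longleftrightarrow> X \<in> ?N" if "X \<in> obj C" for X
    using that thick_shift[OF T that] compact_shift[of \<kappa> X] compact_unshift[of \<kappa> X] by blast
  show "tgt C g \<in> ?N" if "(f, g, h) \<in> tri C \<and> src C f \<in> ?N \<and> tgt C f \<in> ?N" for f g h
  proof -
    have t: "(f, g, h) \<in> tri C" and c: "compact (src C f)" "compact (tgt C f)" using that by auto
    show ?thesis using compact_cone[OF t c] thick_cone[OF T t] that by simp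
  qed
  show "X \<in> ?N" if "retract C X Y \<and> Y \<in> ?N" for X Y
    using that thick_retract[OF T, of _ X Y] compact_retract[of \<kappa> Y X] by simp
  show "X \<odot> Y \<in> ?N" if "compact X \<and> Y \<in> ?N" for X Y
    using that thick_tensor[OF T, of _ X Y] compact_tensor[of X Y] by simp
  show "compact X" if "X \<in> ?N" for X using that by simp
qed

lemma ideal_Union_chain:
  assumes A: "\<And>A. A \<in> \<A> \<Longrightarrow> ideal A" and chain: "\<And>A B. A \<in> \<A> \<Longrightarrow> B \<in> \<A> \<Longrightarrow> A \<subseteq> B \<or> B \<subseteq> A" and ne: "\<A> \<noteq> {}"
  shows "ideal (\<Union>\<A>)"
  unfolding ideal_iff thick_class_def
proof (intro conjI allI ballI impI)
  note T = ideal_thick[OF A]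
  show "\<Union>\<A> \<subseteq> obj C" using thick_obj[OF T] by blast
  show "Z \<in> \<Union>\<A>" if "zero_object C Z" for Z using that thick_zero[OF T] ne by blast
  show "\<Sigma>\<^sub>o X \<in> \<Union>\<A> \<longleftrightarrow> X \<in> \<Union>\<A>" if "X \<in> obj C" for X using thick_shift[OF T that] by blast
  show "tgt C g \<in> \<Union>\<A>" if fgh: "(f, g, h) \<in> tri C \<and> src C f \<in> \<Union>\<A> \<and> tgt C f \<in> \<Union>\<A>" for f g h
  proof -
    obtain A B where "A \<in> \<A>" "B \<in> \<A>" "src C f \<in> A" "tgt C f \<in> B" using fgh by blast
    then obtain A' where "A' \<in> \<A>" "src C f \<in> A'" "tgt C f \<in> A'" using chain by blast
    then show ?thesis using thick_cone[OF T, of A' f g h] fgh by blast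
  qed
  show "X \<in> \<Union>\<A>" if "retract C X Y \<and> Y \<in> \<Union>\<A>" for X Y using that thick_retract[OF T, of _ X Y] by blast
  show "X \<odot> Y \<in> \<Union>\<A>" if "compact X \<and> Y \<in> \<Union>\<A>" for X Y using that thick_tensor[OF T, of _ X Y] by blast
  show "compact X" if "X \<in> \<Union>\<A>" for X using that ideal_compact[OF A] by blast
qed

section \<open>Prime ideals\<close>

lemma prime_idealsD:
  assumes "P \<in> prime_ideals (compact_part \<kappa> C)"
  shows "ideal P" "unit C \<notin> P" "compact X \<Longrightarrow> compact Y \<Longrightarrow> X \<odot> Y \<in> P \<Longrightarrow> X \<in> P \<or> Y \<in> P"
proof -
  show P: "ideal P" using assms by (simp add: prime_ideals_def)
  show "compact X \<Longrightarrow> compact Y \<Longrightarrow> X \<odot> Y \<in> P \<Longrightarrow> X \<in> P \<or> Y \<in> P"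
    using assms by (simp add: prime_ideals_def)
  obtain X where X: "compact X" "X \<notin> P" using assms by (auto simp: prime_ideals_def)
  show "unit C \<notin> P"
  proof
    assume "unit C \<in> P"
    then have "X \<odot> unit C \<in> P" by (rule thick_tensor[OF ideal_thick[OF P] X(1)])
    then show False
      using thick_retract[OF ideal_thick[OF P] unit_retract(2)] compact_obj[OF X(1)] X(2) by blast
  qed
qed

lemma prime_idealsI:
  assumes "ideal P" "unit C \<notin> P" "\<And>X Y. compact X \<Longrightarrow> compact Y \<Longrightarrow> X \<odot> Y \<in> P \<Longrightarrow> X \<in> P \<or> Y \<in> P"
  shows "P \<in> prime_ideals (compact_part \<kappa> C)"
  using assms compact_unit by (auto simp: prime_ideals_def dest: ideal_compact)

text \<open>As for commutative rings, an ideal maximal among those that contain \<open>P\<close> and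
  miss the multiplicative set \<open>M\<close> is prime.\<close>

lemma prime_ideal_exists:
  assumes P: "ideal P" and M: "m0 \<in> M" "\<And>m. m \<in> M \<Longrightarrow> compact m" "\<And>m n. m \<in> M \<Longrightarrow> n \<in> M \<Longrightarrow> m \<odot> n \<in> M"
    and d: "P \<inter> M = {}"
  obtains Q where "Q \<in> prime_ideals (compact_part \<kappa> C)" "P \<subseteq> Q" "Q \<inter> M = {}"
proof -
  let ?A = "{A. ideal A \<and> P \<subseteq> A \<and> A \<inter> M = {}}"
  have "\<exists>Q \<in> ?A. \<forall>X \<in> ?A. Q \<subseteq> X \<longrightarrow> X = Q"
  proof (rule subset_Zorn_nonempty)
    show "?A \<noteq> {}" using P d by blast
    fix \<A> assume c: "\<A> \<noteq> {}" "subset.chain ?A \<A>"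
    then have 1: "\<And>A. A \<in> \<A> \<Longrightarrow> ideal A \<and> P \<subseteq> A \<and> A \<inter> M = {}"
      and 2: "\<And>A B. A \<in> \<A> \<Longrightarrow> B \<in> \<A> \<Longrightarrow> A \<subseteq> B \<or> B \<subseteq> A" unfolding subset_chain_def by blast+
    have "ideal (\<Union>\<A>)" by (rule ideal_Union_chain[OF _ 2 c(1)]) (use 1 in blast)
    then show "\<Union>\<A> \<in> ?A" using 1 c(1) by blast
  qed
  then obtain Q where Q': "Q \<in> ?A" "\<forall>X \<in> ?A. Q \<subseteq> X \<longrightarrow> X = Q" by (rule bexE)
  from Q'(1) have Q: "ideal Q" "P \<subseteq> Q" "Q \<inter> M = {}" by simp_all
  note T = ideal_thick[OF Q(1)]
  \<comment> \<open>The colon ideal of \<open>y\<close> contains \<open>Q\<close> and also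
    \<open>x\<close>, so by maximality it meets \<open>M\<close>.\<close>
  have colon: "\<exists>m \<in> M. m \<odot> y \<in> Q" if y: "compact y" "compact x" "x \<odot> y \<in> Q" "x \<notin> Q" for x y
  proof (rule ccontr)
    assume n: "\<not> ?thesis"
    have yo: "y \<in> obj C" by (rule compact_obj[OF y(1)])
    let ?N = "{x. compact x \<and> x \<odot> y \<in> Q}"
    have N: "ideal ?N" by (rule ideal_colon[OF T yo])
    have s: "Q \<subseteq> ?N" using thick_tensor_right[OF T y(1)] ideal_compact[OF Q(1)] by blast
    have "?N \<inter> M = {}" using n by blast
    then have "?N \<in> ?A" using N s Q(2) by simp
    then have "?N = Q" using Q'(2) s by blast
    moreover have "x \<in> ?N" using y by simp
    ultimately show False using y(4) by simp
  qed
  have "Q \<in> prime_ideals (compact_part \<kappa> C)"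
  proof (rule prime_idealsI[OF Q(1)])
    show "unit C \<notin> Q"
    proof
      assume "unit C \<in> Q"
      then have "m0 \<odot> unit C \<in> Q" by (rule thick_tensor[OF T M(2)[OF M(1)]])
      then have "m0 \<in> Q" using thick_retract[OF T unit_retract(2)] compact_obj[OF M(2)[OF M(1)]] by blast
      then show False using Q(3) M(1) by blast
    qed
    fix x y assume xy: "compact x" "compact y" "x \<odot> y \<in> Q"
    show "x \<in> Q \<or> y \<in> Q"
    proof (rule ccontr)
      assume n: "\<not> ?thesis"
      obtain m where m: "m \<in> M" "m \<odot> y \<in> Q" using colon[OF xy(2,1,3)] n by blast
      have mc: "compact m" by (rule M(2)[OF m(1)])
      \<comment> \<open>A second use of \<open>colon\<close>, now with \<open>m\<close> as right
        factor, puts a product of two elements of \<open>M\<close> into \<open>Q\<close>.\<close>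
      have "y \<odot> m \<in> Q"
        by (rule thick_retract[OF T tensor_comm_retract m(2)]) (use compact_obj xy(2) mc in blast)+
      then obtain m' where "m' \<in> M" "m' \<odot> m \<in> Q" using colon[OF mc xy(2)] n by blast
      then show False using M(3)[OF _ m(1)] Q(3) by blast
    qed
  qed
  then show ?thesis using that Q(2,3) by blast
qed

text \<open>If \<open>d\<close> is the fibre of \<open>k\<close>, then \<open>S y d = 0\<close>, so \<open>y d\<close> lifts to the fibre of \<open>S\<close>; if \<open>d'\<close> is
  the fibre of the lift, then \<open>y d d' = 0\<close>, so \<open>y\<close> factors through the cone of \<open>d d'\<close>.\<close>

lemma factor_through_thick:
  assumes P: "thick_class \<kappa> C P" and S: "(e, S, h) \<in> tri C" "src C e \<in> P"
    and y: "y \<in> arr C" "tgt C y = src C S"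
    and kl: "k \<in> arr C" "l \<in> arr C" "tgt C k = src C l" "tgt C k \<in> P" "l \<cdot> k = S \<cdot> y"
  obtains k' l' where "k' \<in> arr C" "l' \<in> arr C" "tgt C k' = src C l'" "tgt C k' \<in> P" "l' \<cdot> k' = y"
proof -
  note t = triD[OF S(1)]
  have "src C (l \<cdot> k) = src C (S \<cdot> y)" "tgt C (l \<cdot> k) = tgt C (S \<cdot> y)" unfolding kl(5) by simp_all
  then have st: "src C k = src C y" "tgt C l = tgt C S" using kl(1-3) y t by auto
  obtain d k2 where D: "(d, k, k2) \<in> tri C" by (rule fibre[OF kl(1)])
  note td = triD[OF D]
  have "S \<cdot> (y \<cdot> d) = (S \<cdot> y) \<cdot> d" using t y td st by simp
  also have "\<dots> = l \<cdot> (k \<cdot> d)" unfolding kl(5)[symmetric] using kl(1-3) td by simp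
  also have "\<dots> = zero_arr C (src C d) (tgt C S)" unfolding tri_gf[OF D] using kl(1-3) td st by simp
  finally have z0: "S \<cdot> (y \<cdot> d) = zero_arr C (src C d) (tgt C S)" .
  obtain f where f: "f \<in> arr C" "src C f = src C d" "tgt C f = src C e" "e \<cdot> f = y \<cdot> d"
    by (rule weak_kernel[OF S(1), of "y \<cdot> d"]) (use t y td st z0 in auto)
  obtain d' f2 where D': "(d', f, f2) \<in> tri C" by (rule fibre[OF f(1)])
  note td' = triD[OF D']
  obtain w w2 where W: "(d \<cdot> d', w, w2) \<in> tri C" using tri_cone[of "d \<cdot> d'"] td td' f by auto
  note tw = triD[OF W]
  have WP: "tgt C w \<in> P"
    by (rule thick_cone_cmp[OF P D' _ D _ _ W]) (use td td' f S(2) kl(4) in auto)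
  have "y \<cdot> (d \<cdot> d') = e \<cdot> (f \<cdot> d')" using y td td' f(1-3) st t
    by (simp add: cmp_reassoc[OF f(4)[symmetric]])
  also have "\<dots> = zero_arr C (src C d') (tgt C y)" unfolding tri_gf[OF D'] using f td' t y by simp
  finally have z: "y \<cdot> (d \<cdot> d') = zero_arr C (src C d') (tgt C y)" .
  obtain v where "v \<in> arr C" "src C v = tgt C w" "tgt C v = tgt C y" "v \<cdot> w = y"
    by (rule weak_cokernel[OF W y(1)]) (use y td td' f st z in auto)
  then show ?thesis using that[of w v] tw WP by simp
qed

end

context rigid_core
begin

text \<open>If \<open>a\<close> is a retract of \<open>t\<close> with complement \<open>c\<close>, then the cone of the idempotent of \<open>t\<close> with
  image \<open>c\<close> is the sum of \<open>a\<close> and its suspension.\<close>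

lemma core_representative:
  assumes a: "compact a"
  obtains a' where "a' \<in> T0" "\<And>P. ideal P \<Longrightarrow> a' \<in> P \<longleftrightarrow> a \<in> P"
proof -
  obtain t where t: "t \<in> T0" "retract C a t" by (rule compact_retract_core[OF a])
  obtain i r where 1: "i \<in> arr C" "r \<in> arr C" "src C i = a" "tgt C i = t" "src C r = t" "tgt C r = a"
    "r \<cdot> i = idn C a" "a \<in> obj C" "t \<in> obj C" by (rule retractE[OF t(2)])
  obtain c j q h where B: "is_biproduct C a c t i j r q" and T: "(i, q, h) \<in> tri C"
    by (rule retract_triangle[OF 1(1-7)])
  have b: "j \<in> arr C" "q \<in> arr C" "src C j = c" "tgt C j = t" "src C q = t" "tgt C q = c"
    "q \<cdot> j = idn C c" "q \<cdot> i = zero_arr C a c" "r \<cdot> j = zero_arr C c a"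
    "plus_arr C (i \<cdot> r) (j \<cdot> q) = idn C t" using B by (auto simp: is_biproduct_def)
  have co: "c \<in> obj C" using b by auto
  obtain z i' r' h' where B': "is_biproduct C c z t j i' q r'" and T': "(j, r', h') \<in> tri C"
    by (rule retract_triangle[OF b(1-7)])
  have b': "i' \<in> arr C" "r' \<in> arr C" "src C i' = z" "tgt C i' = t" "src C r' = t" "tgt C r' = z"
    "r' \<cdot> i' = idn C z" "r' \<cdot> j = zero_arr C c z" using B' by (auto simp: is_biproduct_def)
  have zo: "z \<in> obj C" using b' by auto
  have e: "j \<cdot> q \<in> arr C" "src C (j \<cdot> q) \<in> T0" "tgt C (j \<cdot> q) \<in> T0" using b(1-6) t by auto
  obtain g k where W: "(j \<cdot> q, g, k) \<in> tri C" "tgt C g \<in> T0" using core_cone[OF e] by blast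
  note tw = triD[OF W(1)]
  \<comment> \<open>Like \<open>a\<close>, the object \<open>z\<close> is a complement of
    \<open>c\<close> in \<open>t\<close>; expanding the identity of \<open>t\<close> between the
    inclusion and projection of \<open>z\<close> exhibits it as a retract of
    \<open>a\<close>.\<close>
  have "r' \<cdot> (i \<cdot> (r \<cdot> i')) = (r' \<cdot> plus_arr C (i \<cdot> r) (j \<cdot> q)) \<cdot> i'"
    using 1 b(1-6) b'(1-6) by (simp add: cmp_plus_arr cmp_reassoc[OF b'(8)] zo co)
  also have "\<dots> = idn C z" unfolding b(10) using b' 1(9) by simp
  finally have z: "retract C z a"
    using 1 b' by (intro retractI[of "r \<cdot> i'" "r' \<cdot> i"]) auto
  have "r \<cdot> (j \<cdot> q) = zero_arr C t a" using 1 b co by (simp add: cmp_reassoc[OF b(9)])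
  then obtain w where w: "w \<in> arr C" "src C w = tgt C g" "tgt C w = a" "w \<cdot> g = r"
    by - (rule weak_cokernel[OF W(1) 1(2)], use 1 b in auto)
  have "w \<cdot> (g \<cdot> i) = idn C a" using w(1-3) tw 1 b by (simp add: cmp_reassoc[OF w(4)])
  then have ag: "retract C a (tgt C g)" using w tw 1 b by (intro retractI[of "g \<cdot> i" w]) auto
  show ?thesis
  proof (rule that[OF W(2)])
    fix P assume P: "ideal P"
    note th = ideal_thick[OF P]
    show "tgt C g \<in> P \<longleftrightarrow> a \<in> P"
    proof
      assume "tgt C g \<in> P" then show "a \<in> P" by (rule thick_retract[OF th ag])
    next
      assume a: "a \<in> P"
      show "tgt C g \<in> P"
      proof (rule thick_cone_cmp[OF th tri_rot[OF T] _ T' _ _ W(1)])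
        show "tgt C h \<in> P" using triD[OF T] a 1 thick_shift[OF th] by simp
        show "tgt C r' \<in> P" using thick_retract[OF th z a] b' by simp
        show "tgt C q = src C j" using b by simp
      qed
    qed
  qed
qed

end

section \<open>A weak ring at a prime\<close>

text \<open>Factoring through an object of \<open>P\<close> means vanishing in the Verdier quotient by \<open>P\<close>; the tensor factor
  outside \<open>P\<close> is there because tensoring with \<open>a \<notin> P\<close> need not be faithful on the quotient.\<close>

definition negligible :: "'u rel \<Rightarrow> ('o, 'm, 'x) tt_data_scheme \<Rightarrow> 'o set \<Rightarrow> 'm \<Rightarrow> bool" where
  "negligible \<kappa> C P g \<longleftrightarrow> (\<exists>x k l. compact_object \<kappa> C x \<and> x \<notin> P \<and> k \<in> arr C \<and> l \<in> arr C \<and>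
     tgt C k = src C l \<and> tgt C k \<in> P \<and> l \<cdot>\<^bsub>C\<^esub> k = g \<odot>\<^sub>m\<^bsub>C\<^esub> idn C x)"

lemma negligibleE:
  assumes "negligible \<kappa> C P g"
  obtains x k l where "compact_object \<kappa> C x" "x \<notin> P" "k \<in> arr C" "l \<in> arr C" "tgt C k = src C l"
    "tgt C k \<in> P" "l \<cdot>\<^bsub>C\<^esub> k = g \<odot>\<^sub>m\<^bsub>C\<^esub> idn C x"
  using assms unfolding negligible_def by (elim exE conjE) (rule that)

context rigid_tt_category
begin

context
  fixes P assumes P: "P \<in> prime_ideals (compact_part \<kappa> C)"
begin

lemmas prime_thick = ideal_thick[OF prime_idealsD(1)[OF P]]

lemma negligible_zero:
  assumes g: "g \<in> arr C" "g = zero_arr C c (tgt C g)" and c: "c \<in> obj C"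
  shows "negligible \<kappa> C P g"
proof -
  obtain Z where Z: "zero_object C Z" using ex_zero_object by blast
  note Zo = zero_objectD(1)[OF Z]
  have t: "tgt C g \<in> obj C" using g(1) by simp
  have "g \<odot>\<^sub>m idn C (unit C) = zero_arr C c (tgt C g) \<odot>\<^sub>m idn C (unit C)"
    by (rule arg_cong[OF g(2), of "\<lambda>g. g \<odot>\<^sub>m idn C (unit C)"])
  also have "\<dots> = zero_arr C Z (tgt C g \<odot> unit C) \<cdot> zero_arr C (c \<odot> unit C) Z" using t c Zo by simp
  finally have e: "zero_arr C Z (tgt C g \<odot> unit C) \<cdot> zero_arr C (c \<odot> unit C) Z = g \<odot>\<^sub>m idn C (unit C)" ..
  show ?thesis unfolding negligible_def
    by (rule exI[of _ "unit C"], rule exI[of _ "zero_arr C (c \<odot> unit C) Z"],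
        rule exI[of _ "zero_arr C Z (tgt C g \<odot> unit C)"])
      (use compact_unit prime_idealsD(2)[OF P] e t c Zo thick_zero[OF prime_thick Z] in simp)
qed

text \<open>A factorization of the identity of \<open>unit C \<odot> x\<close> through an object of
  \<open>P\<close> would make \<open>x\<close> a retract of that object.\<close>

lemma idn_unit_not_negligible: "\<not> negligible \<kappa> C P (idn C (unit C))"
proof
  assume "negligible \<kappa> C P (idn C (unit C))"
  then obtain x k l where x: "compact x" "x \<notin> P" and kl: "k \<in> arr C" "l \<in> arr C" "tgt C k = src C l"
    "tgt C k \<in> P" "l \<cdot> k = idn C (unit C) \<odot>\<^sub>m idn C x" by (rule negligibleE)
  have xo: "x \<in> obj C" by (rule compact_obj[OF x(1)])
  have e: "l \<cdot> k = idn C (unit C \<odot> x)" using kl(5) xo by simp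
  have "src C (l \<cdot> k) = unit C \<odot> x" "tgt C (l \<cdot> k) = unit C \<odot> x" unfolding e using xo by auto
  then have "src C k = unit C \<odot> x" "tgt C l = unit C \<odot> x" using kl(1-3) by auto
  then have "retract C (unit C \<odot> x) (tgt C k)" using kl(1-3) e by (intro retractI[of k l]) auto
  then have "unit C \<odot> x \<in> P" using thick_retract[OF prime_thick] kl(4) by blast
  then show False using thick_retract[OF prime_thick unit_retract(1)[OF xo]] x(2) by blast
qed

text \<open>After tensoring with \<open>a\<close> the coaugmentation splits and can be cancelled.
  The auxiliary factor grows from \<open>x\<close> to \<open>x \<odot> a\<close>, which stays
  outside \<open>P\<close> by primeness.\<close>

lemma negligible_coaug_split:
  assumes a: "compact a" "a \<notin> P" and s: "s \<in> arr C" "src C s = unit C"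
    and r: "r \<in> arr C" "src C r = tgt C s \<odot> a" "tgt C r = a" "r \<cdot> coaug C s a = idn C a"
    and g: "g \<in> arr C" and n: "negligible \<kappa> C P (coaug C s (tgt C g) \<cdot> g)"
  shows "negligible \<kappa> C P g"
proof -
  obtain x k l where x: "compact x" "x \<notin> P" and kl: "k \<in> arr C" "l \<in> arr C" "tgt C k = src C l"
    "tgt C k \<in> P" "l \<cdot> k = (coaug C s (tgt C g) \<cdot> g) \<odot>\<^sub>m idn C x" by (rule negligibleE[OF n])
  let ?Z = "tgt C g" and ?X = "src C g" and ?B = "tgt C s"
  have o: "x \<in> obj C" "a \<in> obj C" "?Z \<in> obj C" "?X \<in> obj C" "?B \<in> obj C"
    using compact_obj[OF x(1)] compact_obj[OF a(1)] g s by auto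
  have Zx: "?Z \<odot> x \<in> obj C" using o by simp
  have "src C (l \<cdot> k) = ?X \<odot> x" "tgt C (l \<cdot> k) = (?B \<odot> ?Z) \<odot> x" unfolding kl(5) using g s o by auto
  then have t: "src C k = ?X \<odot> x" "tgt C l = (?B \<odot> ?Z) \<odot> x" using kl(1-3) by auto
  obtain q where q: "q \<in> arr C" "src C q = (?B \<odot> (?Z \<odot> x)) \<odot> a" "tgt C q = (?Z \<odot> x) \<odot> a"
    "q \<cdot> (coaug C s (?Z \<odot> x) \<odot>\<^sub>m idn C a) = idn C ((?Z \<odot> x) \<odot> a)"
    by (rule coaug_split_tensor[OF s Zx o(2) r])
  have "assoc C ?B ?Z x \<cdot> (l \<cdot> k) = assoc C ?B ?Z x \<cdot> ((coaug C s ?Z \<odot>\<^sub>m idn C x) \<cdot> (g \<odot>\<^sub>m idn C x))"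
    unfolding kl(5) using g s o by simp
  also have "\<dots> = coaug C s (?Z \<odot> x) \<cdot> (g \<odot>\<^sub>m idn C x)"
    by (rule cmp_reassoc[OF coaug_tensor[OF s o(3,1)]]) (use g s o in auto)
  finally have e: "assoc C ?B ?Z x \<cdot> (l \<cdot> k) = coaug C s (?Z \<odot> x) \<cdot> (g \<odot>\<^sub>m idn C x)" .
  let ?k = "(k \<odot>\<^sub>m idn C a) \<cdot> inv_arr C (assoc C ?X x a)"
  let ?l = "assoc C ?Z x a \<cdot> (q \<cdot> ((assoc C ?B ?Z x \<cdot> l) \<odot>\<^sub>m idn C a))"
  have k: "?k \<in> arr C" "tgt C ?k = tgt C k \<odot> a" using kl(1) t o by auto
  have l: "?l \<in> arr C" "src C ?l = tgt C k \<odot> a" using kl(1-3) t o q by auto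
  have "?l \<cdot> ?k = assoc C ?Z x a \<cdot> (q \<cdot> (((assoc C ?B ?Z x \<cdot> (l \<cdot> k)) \<odot>\<^sub>m idn C a) \<cdot> inv_arr C (assoc C ?X x a)))"
    using kl(1-3) t o q(1-3) by simp
  also have "\<dots> = assoc C ?Z x a \<cdot> (q \<cdot> ((coaug C s (?Z \<odot> x) \<odot>\<^sub>m idn C a) \<cdot>
      (((g \<odot>\<^sub>m idn C x) \<odot>\<^sub>m idn C a) \<cdot> inv_arr C (assoc C ?X x a))))"
    unfolding e using g s o by simp
  also have "q \<cdot> ((coaug C s (?Z \<odot> x) \<odot>\<^sub>m idn C a) \<cdot> (((g \<odot>\<^sub>m idn C x) \<odot>\<^sub>m idn C a) \<cdot> inv_arr C (assoc C ?X x a))) =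
      idn C ((?Z \<odot> x) \<odot> a) \<cdot> (((g \<odot>\<^sub>m idn C x) \<odot>\<^sub>m idn C a) \<cdot> inv_arr C (assoc C ?X x a))"
    by (rule cmp_reassoc[OF q(4)]) (use g s o q in auto)
  also have "\<dots> = ((g \<odot>\<^sub>m idn C x) \<odot>\<^sub>m idn C a) \<cdot> inv_arr C (assoc C ?X x a)" using g o by simp
  also have "assoc C ?Z x a \<cdot> (((g \<odot>\<^sub>m idn C x) \<odot>\<^sub>m idn C a) \<cdot> inv_arr C (assoc C ?X x a)) =
      ((g \<odot>\<^sub>m (idn C x \<odot>\<^sub>m idn C a)) \<cdot> assoc C ?X x a) \<cdot> inv_arr C (assoc C ?X x a)"
    by (rule cmp_reassoc) (use assoc_nat[of g "idn C x" "idn C a"] g o in auto)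
  also have "\<dots> = g \<odot>\<^sub>m idn C (x \<odot> a)" using g o by simp
  finally have lk: "?l \<cdot> ?k = g \<odot>\<^sub>m idn C (x \<odot> a)" .
  have "x \<odot> a \<notin> P" using prime_idealsD(3)[OF P x(1) a(1)] x(2) a(2) by blast
  moreover have "tgt C k \<odot> a \<in> P" by (rule thick_tensor_right[OF prime_thick a(1) kl(4)])
  ultimately show ?thesis unfolding negligible_def
    using compact_tensor[OF x(1) a(1)] k l lk by (intro exI[of _ "x \<odot> a"] exI[of _ ?k] exI[of _ ?l]) simp
qed

text \<open>Here the coaugmentation, tensored with \<open>x\<close>, has its fibre in
  \<open>P\<close>, so it is invertible modulo \<open>P\<close>; \<open>factor_through_thick\<close>
  cancels it and the factor \<open>x\<close> is kept.\<close>

lemma negligible_coaug_fibre: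
  assumes T: "(e, s, h) \<in> tri C" "src C e \<in> P" and s: "src C s = unit C"
    and g: "g \<in> arr C" "compact (tgt C g)" and n: "negligible \<kappa> C P (coaug C s (tgt C g) \<cdot> g)"
  shows "negligible \<kappa> C P g"
proof -
  obtain x k l where x: "compact x" "x \<notin> P" and kl: "k \<in> arr C" "l \<in> arr C" "tgt C k = src C l"
    "tgt C k \<in> P" "l \<cdot> k = (coaug C s (tgt C g) \<cdot> g) \<odot>\<^sub>m idn C x" by (rule negligibleE[OF n])
  note t = triD[OF T(1)]
  let ?Z = "tgt C g"
  have o: "x \<in> obj C" "?Z \<in> obj C" using compact_obj[OF x(1)] g by auto
  let ?S = "(s \<odot>\<^sub>m idn C ?Z) \<odot>\<^sub>m idn C x"
  let ?y = "(inv_arr C (lunit C ?Z) \<odot>\<^sub>m idn C x) \<cdot> (g \<odot>\<^sub>m idn C x)"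
  have S: "((e \<odot>\<^sub>m idn C ?Z) \<odot>\<^sub>m idn C x, ?S, shift_tensor C (src C (e \<odot>\<^sub>m idn C ?Z)) x \<cdot>
      ((shift_tensor C (src C e) ?Z \<cdot> (h \<odot>\<^sub>m idn C ?Z)) \<odot>\<^sub>m idn C x)) \<in> tri C"
    by (rule tensor_exact[OF tensor_exact[OF T(1) o(2)] o(1)])
  have eP: "src C ((e \<odot>\<^sub>m idn C ?Z) \<odot>\<^sub>m idn C x) \<in> P"
    using thick_tensor_right[OF prime_thick x(1) thick_tensor_right[OF prime_thick g(2) T(2)]] t o by simp
  have y: "?y \<in> arr C" "tgt C ?y = src C ?S" using g o t s by auto
  have lk: "l \<cdot> k = ?S \<cdot> ?y" unfolding kl(5) coaug_def using g o t s by simp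
  obtain k' l' where k': "k' \<in> arr C" "l' \<in> arr C" "tgt C k' = src C l'" "tgt C k' \<in> P" "l' \<cdot> k' = ?y"
    by (rule factor_through_thick[OF prime_thick S eP y kl(1-4) lk])
  have "src C (l' \<cdot> k') = src C g \<odot> x" "tgt C (l' \<cdot> k') = (unit C \<odot> ?Z) \<odot> x" unfolding k'(5) using g o by auto
  then have tk: "src C k' = src C g \<odot> x" "tgt C l' = (unit C \<odot> ?Z) \<odot> x" using k'(1-3) by auto
  let ?l = "(lunit C ?Z \<odot>\<^sub>m idn C x) \<cdot> l'"
  have "?l \<cdot> k' = (lunit C ?Z \<odot>\<^sub>m idn C x) \<cdot> (l' \<cdot> k')" using k'(1-3) tk o by simp
  also have "\<dots> = g \<odot>\<^sub>m idn C x" unfolding k'(5) using g o by simp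
  finally show ?thesis unfolding negligible_def
    using x k'(1-4) tk o by (intro exI[of _ x] exI[of _ k'] exI[of _ ?l]) simp
qed

end

text \<open>One duality yields both kinds of coaugmentation: the coevaluation, split at
  \<open>b\<close>, and the map \<open>s\<close> to the cone of the evaluation, which vanishes at
  the dual \<open>D\<close>.\<close>

lemma dual_maps:
  assumes b: "compact b"
  obtains D coev r e s h where "compact D" "coev \<in> arr C" "src C coev = unit C" "tgt C coev = b \<odot> D"
    "r \<in> arr C" "src C r = (b \<odot> D) \<odot> b" "tgt C r = b" "r \<cdot> coaug C coev b = idn C b"
    "(e, s, h) \<in> tri C" "src C e = D \<odot> b" "src C s = unit C" "compact (tgt C s)"
    "coaug C s D = zero_arr C D (tgt C s \<odot> D)"
proof -
  obtain D ev coev where b': "b \<in> obj C" "D \<in> obj C"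
    and ev: "ev \<in> arr C" "src C ev = D \<odot> b" "tgt C ev = unit C"
    and coev: "coev \<in> arr C" "src C coev = unit C" "tgt C coev = b \<odot> D"
    and 1: "runit C b \<cdot> (idn C b \<odot>\<^sub>m ev) \<cdot> assoc C b D b \<cdot> (coev \<odot>\<^sub>m idn C b) = lunit C b"
    and 2: "lunit C D \<cdot> (ev \<odot>\<^sub>m idn C D) \<cdot> inv_arr C (assoc C D b D) \<cdot> (idn C D \<odot>\<^sub>m coev) = runit C D"
    by (rule dualizableE[OF b[unfolded rigid]])
  obtain s h where T: "(ev, s, h) \<in> tri C" using tri_cone[OF ev(1)] by blast
  note t = triD[OF T]
  have D: "compact D" by (rule compact_dual[OF b' ev coev 2])
  have "compact (src C ev)" "compact (tgt C ev)" using compact_tensor[OF D b] compact_unit ev by simp_all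
  then have B: "compact (tgt C s)" by (rule compact_cone[OF T])
  have z: "coaug C s D = zero_arr C D (tgt C s \<odot> D)"
    by (rule coaug_dual_zero[OF b' ev coev 2]) (use t ev tri_gf[OF T] in auto)
  show ?thesis
    by (rule that[OF D coev _ _ _ coaug_coev[OF b' ev coev 1] T ev(2) _ B z]) (use b' ev t in auto)
qed

end

context rigid_core
begin

lemma weak_ring_at_prime:
  assumes P: "P \<in> prime_ideals (compact_part \<kappa> C)"
  obtains R \<eta> where "weak_ring C R \<eta>" "\<not> zero_object C R" "\<And>b. b \<in> P \<Longrightarrow> zero_object C (R \<odot> b)"
    "\<And>a. a \<in> T0 \<Longrightarrow> a \<notin> P \<Longrightarrow> \<exists>D \<in> obj C. retract C R ((a \<odot> D) \<odot> R)"
proof -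
  \<comment> \<open>\<open>splits\<close> and \<open>kills\<close> hold the data to be extracted
    later for \<open>b\<close> outside and inside \<open>P\<close>, so that a single choice function
    \<open>sm\<close> serves both kinds.\<close>
  define splits where "splits b s \<longleftrightarrow> (\<exists>D r. D \<in> obj C \<and> tgt C s = b \<odot> D \<and> r \<in> arr C \<and> src C r = tgt C s \<odot> b \<and>
    tgt C r = b \<and> r \<cdot> coaug C s b = idn C b)" for b s
  define kills where "kills b s \<longleftrightarrow> (\<exists>D e h. D \<in> obj C \<and> retract C b ((b \<odot> D) \<odot> b) \<and> (e, s, h) \<in> tri C \<and>
    src C e \<in> P \<and> coaug C s D = zero_arr C D (tgt C s \<odot> D))" for b s
  have "\<exists>s. s \<in> arr C \<and> src C s = unit C \<and> compact (tgt C s) \<and> (b \<in> T0 \<longrightarrow> (b \<notin> P \<longrightarrow> splits b s) \<and> (b \<in> P \<longrightarrow> kills b s))"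
    for b
  proof (cases "b \<in> T0")
    case True
    have b: "compact b" by (rule core_compact[OF True])
    obtain D coev r e s h where D: "compact D" and coev: "coev \<in> arr C" "src C coev = unit C" "tgt C coev = b \<odot> D"
      and r: "r \<in> arr C" "src C r = (b \<odot> D) \<odot> b" "tgt C r = b" "r \<cdot> coaug C coev b = idn C b"
      and T: "(e, s, h) \<in> tri C" "src C e = D \<odot> b" and s: "src C s = unit C" "compact (tgt C s)"
        "coaug C s D = zero_arr C D (tgt C s \<odot> D)" by (rule dual_maps[OF b])
    show ?thesis
    proof (cases "b \<in> P")
      case True
      have "D \<odot> b \<in> P" by (rule thick_tensor[OF ideal_thick[OF prime_idealsD(1)[OF P]] D True])
      moreover have "retract C b ((b \<odot> D) \<odot> b)"
        by (rule retractI[of "coaug C coev b" r]) (use coev r compact_obj[OF b] in auto)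
      ultimately have "kills b s" unfolding kills_def using compact_obj[OF D] T s
        by (intro exI[of _ D] exI[of _ e] exI[of _ h]) simp
      then show ?thesis using True s triD[OF T(1)] by (intro exI[of _ s]) simp
    next
      case False
      have "splits b coev" unfolding splits_def using compact_obj[OF D] coev r
        by (intro exI[of _ D] exI[of _ r]) simp
      then show ?thesis using False coev compact_tensor[OF b D] by (intro exI[of _ coev]) simp
    qed
  next
    case False
    \<comment> \<open>\<open>sm\<close> has to be an arrow out of the unit for every index; outside
      the core the identity is the default.\<close>
    then show ?thesis using compact_unit by (intro exI[of _ "idn C (unit C)"]) simp
  qed
  then obtain sm where sm: "\<And>b. sm b \<in> arr C" "\<And>b. src C (sm b) = unit C" "\<And>b. compact (tgt C (sm b))"
    and sp: "\<And>b. b \<in> T0 \<Longrightarrow> b \<notin> P \<Longrightarrow> splits b (sm b)" and ki: "\<And>b. b \<in> T0 \<Longrightarrow> b \<in> P \<Longrightarrow> kills b (sm b)"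
    by metis
  have uo: "unit C \<in> obj C" by simp
  obtain R \<eta> where R: "weak_ring C R \<eta>" "\<not> zero_object C R"
    "\<And>i. i \<in> T0 \<Longrightarrow> \<exists>q. q \<in> arr C \<and> src C q = tgt C (sm i) \<odot> R \<and> tgt C q = R \<and> q \<cdot> coaug C (sm i) R = idn C R"
  proof (rule weak_ring_splitting_coaugmentations[OF core_small sm(1,2) compact_unit, of "negligible \<kappa> C P"])
    show "negligible \<kappa> C P g" if "g = zero_arr C (unit C) (tgt C g)" "g \<in> arr C" for g
      by (rule negligible_zero[OF P that(2,1) uo])
    show "\<not> negligible \<kappa> C P (idn C (unit C))" by (rule idn_unit_not_negligible[OF P])
    show "compact (tgt C (sm i)) \<and> \<not> negligible \<kappa> C P (coaug C (sm i) (tgt C g) \<cdot> g)"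
      if g: "g \<in> arr C" "src C g = unit C" "compact (tgt C g)" "\<not> negligible \<kappa> C P g" and i: "i \<in> T0" for g i
    proof (intro conjI notI)
      show "compact (tgt C (sm i))" by (rule sm(3))
      assume n: "negligible \<kappa> C P (coaug C (sm i) (tgt C g) \<cdot> g)"
      show False
      proof (cases "i \<in> P")
        case True
        obtain D e h where "(e, sm i, h) \<in> tri C" "src C e \<in> P" using ki[OF i True] unfolding kills_def by blast
        from negligible_coaug_fibre[OF P this sm(2) g(1,3) n] show False using g(4) by blast
      next
        case False
        obtain D r where "r \<in> arr C" "src C r = tgt C (sm i) \<odot> i" "tgt C r = i" "r \<cdot> coaug C (sm i) i = idn C i"
          using sp[OF i False] unfolding splits_def by blast
        from negligible_coaug_split[OF P core_compact[OF i] False sm(1,2) this g(1) n] show False using g(4) by blast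
      qed
    qed
  qed (rule that)
  have Ro: "R \<in> obj C" using R(1) by (simp add: weak_ring_def)
  show ?thesis
  proof (rule that[OF R(1,2)])
    fix b assume b: "b \<in> P"
    have bc: "compact b" by (rule ideal_compact[OF prime_idealsD(1)[OF P] b])
    obtain b' where b': "b' \<in> T0" "\<And>A. ideal A \<Longrightarrow> b' \<in> A \<longleftrightarrow> b \<in> A" using core_representative[OF bc] by metis
    have bP: "b' \<in> P" using b'(2)[OF prime_idealsD(1)[OF P]] b by blast
    obtain D e h where D: "D \<in> obj C" "retract C b' ((b' \<odot> D) \<odot> b')" "coaug C (sm b') D = zero_arr C D (tgt C (sm b') \<odot> D)"
      using ki[OF b'(1) bP] unfolding kills_def by blast
    obtain q where q: "q \<in> arr C" "src C q = tgt C (sm b') \<odot> R" "tgt C q = R" "q \<cdot> coaug C (sm b') R = idn C R"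
      using R(3)[OF b'(1)] by blast
    have c': "compact b'" by (rule core_compact[OF b'(1)])
    have "zero_object C (R \<odot> b')"
      by (rule split_coaug_annihilates[OF c'[unfolded rigid] D(1,2) sm(1,2) D(3) Ro q])
    then have "zero_object C (b' \<odot> R)"
      by (rule zero_objectI_retract[OF tensor_comm_retract[OF compact_obj[OF c'] Ro]])
    \<comment> \<open>The annihilator of \<open>R\<close> is an ideal, so membership passes from the
      core representative \<open>b'\<close> to \<open>b\<close>.\<close>
    then have "b \<in> {x. compact x \<and> zero_object C (x \<odot> R)}"
      using b'(2)[OF ideal_annihilator[OF Ro]] c' by simp
    then show "zero_object C (R \<odot> b)"
      using zero_objectI_retract[OF tensor_comm_retract[OF Ro compact_obj[OF bc]]] by simp
  next
    fix a assume a: "a \<in> T0" "a \<notin> P"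
    obtain D where D: "D \<in> obj C" "tgt C (sm a) = a \<odot> D" using sp[OF a] unfolding splits_def by blast
    obtain q where "q \<in> arr C" "src C q = tgt C (sm a) \<odot> R" "tgt C q = R" "q \<cdot> coaug C (sm a) R = idn C R"
      using R(3)[OF a(1)] by blast
    then have "retract C R ((a \<odot> D) \<odot> R)"
      by (intro retractI[of "coaug C (sm a) R" q]) (use sm D Ro in auto)
    then show "\<exists>D \<in> obj C. retract C R ((a \<odot> D) \<odot> R)" using D(1) by blast
  qed
qed

end

section \<open>Geometric functors\<close>

text \<open>Both zigzag identities of an image have this shape, so the rearrangement is done once
  for abstract arrows: \<open>m\<close> are monoidal comparisons, \<open>f\<close> images of arrows,
  \<open>a\<close> arrows formed in the target category. The comparisons slide past one arrow at a
  time.\<close>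

lemma (in category) zigzag_transport:
  assumes e: "m1 \<cdot> a1 = f1 \<cdot> m2" "m2 \<cdot> (a2 \<cdot> a3) = f2 \<cdot> (m3 \<cdot> a4)" "a4 \<cdot> a5 = a6 \<cdot> a7" "m3 \<cdot> a6 = f3 \<cdot> m4"
    and a: "m1 \<in> arr C" "m2 \<in> arr C" "m3 \<in> arr C" "m4 \<in> arr C" "a1 \<in> arr C" "a2 \<in> arr C" "a3 \<in> arr C" "a4 \<in> arr C"
      "a5 \<in> arr C" "a6 \<in> arr C" "a7 \<in> arr C" "f0 \<in> arr C" "f1 \<in> arr C" "f2 \<in> arr C" "f3 \<in> arr C"
    and t: "tgt C a5 = src C a3" "tgt C a5 = src C a4" "tgt C a3 = src C a2" "tgt C a2 = src C a1" "tgt C a2 = src C m2"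
      "tgt C a1 = src C m1" "tgt C m2 = src C f1" "tgt C m1 = src C f0" "tgt C f1 = src C f0" "tgt C a4 = src C m3"
      "tgt C m3 = src C f2" "tgt C f2 = src C f1" "tgt C a7 = src C a6" "tgt C a6 = src C m3" "tgt C a7 = src C m4"
      "tgt C m4 = src C f3" "tgt C f3 = src C f2"
  shows "f0 \<cdot> (m1 \<cdot> (a1 \<cdot> (a2 \<cdot> (a3 \<cdot> a5)))) = (f0 \<cdot> (f1 \<cdot> (f2 \<cdot> f3))) \<cdot> (m4 \<cdot> a7)"
proof -
  have 1: "m1 \<cdot> (a1 \<cdot> (a2 \<cdot> (a3 \<cdot> a5))) = (f1 \<cdot> m2) \<cdot> (a2 \<cdot> (a3 \<cdot> a5))" by (rule cmp_reassoc[OF e(1)]) (use a t in auto)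
  have 2: "m2 \<cdot> ((a2 \<cdot> a3) \<cdot> a5) = (f2 \<cdot> (m3 \<cdot> a4)) \<cdot> a5" by (rule cmp_reassoc[OF e(2)]) (use a t in auto)
  have 3: "m3 \<cdot> (a6 \<cdot> a7) = (f3 \<cdot> m4) \<cdot> a7" by (rule cmp_reassoc[OF e(4)]) (use a t in auto)
  have "m1 \<cdot> (a1 \<cdot> (a2 \<cdot> (a3 \<cdot> a5))) = f1 \<cdot> (m2 \<cdot> ((a2 \<cdot> a3) \<cdot> a5))" unfolding 1 using a t by simp
  also have "\<dots> = f1 \<cdot> (f2 \<cdot> (m3 \<cdot> (a4 \<cdot> a5)))" unfolding 2 using a t by simp
  also have "\<dots> = f1 \<cdot> (f2 \<cdot> ((f3 \<cdot> m4) \<cdot> a7))" unfolding e(3) 3 ..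
  finally show ?thesis using a t by simp
qed

section \<open>Strong monoidal functors preserve duals\<close>

locale strong_monoidal = C: symmetric_monoidal_category C + D: symmetric_monoidal_category D
  for C :: "('o, 'm, 'x) tt_data_scheme" and D :: "('p, 'n, 'y) tt_data_scheme" +
  fixes F :: "('o, 'm, 'p, 'n) fctr" and \<epsilon> :: 'n and \<mu> :: "'o \<Rightarrow> 'o \<Rightarrow> 'n"
  assumes F: "is_functor C D F"
    and eps: "iso_arr D \<epsilon>" "src D \<epsilon> = unit D" "tgt D \<epsilon> = fobj F (unit C)"
    and mu: "X \<in> obj C \<Longrightarrow> Y \<in> obj C \<Longrightarrow> \<mu> X Y \<in> isos D (fobj F X \<odot>\<^bsub>D\<^esub> fobj F Y) (fobj F (X \<odot>\<^bsub>C\<^esub> Y))"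
    and mu_natural: "f \<in> arr C \<Longrightarrow> g \<in> arr C \<Longrightarrow>
      farr F (f \<odot>\<^sub>m\<^bsub>C\<^esub> g) \<cdot>\<^bsub>D\<^esub> \<mu> (src C f) (src C g) = \<mu> (tgt C f) (tgt C g) \<cdot>\<^bsub>D\<^esub> (farr F f \<odot>\<^sub>m\<^bsub>D\<^esub> farr F g)"
    and mu_assoc: "X \<in> obj C \<Longrightarrow> Y \<in> obj C \<Longrightarrow> Z \<in> obj C \<Longrightarrow>
      farr F (assoc C X Y Z) \<cdot>\<^bsub>D\<^esub> \<mu> (X \<odot>\<^bsub>C\<^esub> Y) Z \<cdot>\<^bsub>D\<^esub> (\<mu> X Y \<odot>\<^sub>m\<^bsub>D\<^esub> idn D (fobj F Z)) =
      \<mu> X (Y \<odot>\<^bsub>C\<^esub> Z) \<cdot>\<^bsub>D\<^esub> (idn D (fobj F X) \<odot>\<^sub>m\<^bsub>D\<^esub> \<mu> Y Z) \<cdot>\<^bsub>D\<^esub> assoc D (fobj F X) (fobj F Y) (fobj F Z)"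
    and mu_lunit: "X \<in> obj C \<Longrightarrow>
      farr F (lunit C X) \<cdot>\<^bsub>D\<^esub> \<mu> (unit C) X \<cdot>\<^bsub>D\<^esub> (\<epsilon> \<odot>\<^sub>m\<^bsub>D\<^esub> idn D (fobj F X)) = lunit D (fobj F X)"
    and mu_runit: "X \<in> obj C \<Longrightarrow>
      farr F (runit C X) \<cdot>\<^bsub>D\<^esub> \<mu> X (unit C) \<cdot>\<^bsub>D\<^esub> (idn D (fobj F X) \<odot>\<^sub>m\<^bsub>D\<^esub> \<epsilon>) = runit D (fobj F X)"
begin

lemma F_simps [simp]:
  "X \<in> obj C \<Longrightarrow> fobj F X \<in> obj D"
  "f \<in> arr C \<Longrightarrow> farr F f \<in> arr D"
  "f \<in> arr C \<Longrightarrow> src D (farr F f) = fobj F (src C f)"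
  "f \<in> arr C \<Longrightarrow> tgt D (farr F f) = fobj F (tgt C f)"
  "X \<in> obj C \<Longrightarrow> farr F (idn C X) = idn D (fobj F X)"
  using functor_obj[OF F] functor_arr[OF F C.category_axioms] functor_idn[OF F] by auto

lemmas F_cmp = functor_cmp[OF F C.category_axioms]

lemma mu_simps [simp]:
  assumes "X \<in> obj C" "Y \<in> obj C"
  shows "iso_arr D (\<mu> X Y)" "src D (\<mu> X Y) = fobj F X \<odot>\<^bsub>D\<^esub> fobj F Y" "tgt D (\<mu> X Y) = fobj F (X \<odot>\<^bsub>C\<^esub> Y)"
  using mu[OF assms] by (auto simp: D.isos_iff)

declare eps [simp]

lemma mu_retract:
  assumes "X \<in> obj C" "Y \<in> obj C"
  shows "retract D (fobj F X \<odot>\<^bsub>D\<^esub> fobj F Y) (fobj F (X \<odot>\<^bsub>C\<^esub> Y))" "retract D (fobj F (X \<odot>\<^bsub>C\<^esub> Y)) (fobj F X \<odot>\<^bsub>D\<^esub> fobj F Y)"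
  using D.iso_retract[of "\<mu> X Y"] assms by auto

lemma image_dualizable:
  assumes "dualizable C X" shows "dualizable D (fobj F X)"
proof -
  obtain Y ev coev where o: "X \<in> obj C" "Y \<in> obj C"
    and ev: "ev \<in> arr C" "src C ev = Y \<odot>\<^bsub>C\<^esub> X" "tgt C ev = unit C"
    and coev: "coev \<in> arr C" "src C coev = unit C" "tgt C coev = X \<odot>\<^bsub>C\<^esub> Y"
    and 1: "runit C X \<cdot>\<^bsub>C\<^esub> (idn C X \<odot>\<^sub>m\<^bsub>C\<^esub> ev) \<cdot>\<^bsub>C\<^esub> assoc C X Y X \<cdot>\<^bsub>C\<^esub> (coev \<odot>\<^sub>m\<^bsub>C\<^esub> idn C X) = lunit C X"
    and 2: "lunit C Y \<cdot>\<^bsub>C\<^esub> (ev \<odot>\<^sub>m\<^bsub>C\<^esub> idn C Y) \<cdot>\<^bsub>C\<^esub> inv_arr C (assoc C Y X Y) \<cdot>\<^bsub>C\<^esub> (idn C Y \<odot>\<^sub>m\<^bsub>C\<^esub> coev) = runit C Y"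
    by (rule C.dualizableE[OF assms])
  \<comment> \<open>Evaluation and coevaluation of the image are those of \<open>X\<close>
    conjugated by the comparison isomorphisms.\<close>
  define ev' where "ev' = inv_arr D \<epsilon> \<cdot>\<^bsub>D\<^esub> (farr F ev \<cdot>\<^bsub>D\<^esub> \<mu> Y X)"
  define coev' where "coev' = inv_arr D (\<mu> X Y) \<cdot>\<^bsub>D\<^esub> (farr F coev \<cdot>\<^bsub>D\<^esub> \<epsilon>)"
  have ev': "ev' \<in> arr D" "src D ev' = fobj F Y \<odot>\<^bsub>D\<^esub> fobj F X" "tgt D ev' = unit D"
    "\<epsilon> \<cdot>\<^bsub>D\<^esub> ev' = farr F ev \<cdot>\<^bsub>D\<^esub> \<mu> Y X"
    using o ev by (auto simp: ev'_def)
  have coev': "coev' \<in> arr D" "src D coev' = unit D" "tgt D coev' = fobj F X \<odot>\<^bsub>D\<^esub> fobj F Y"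
    "\<mu> X Y \<cdot>\<^bsub>D\<^esub> coev' = farr F coev \<cdot>\<^bsub>D\<^esub> \<epsilon>"
    using o coev by (auto simp: coev'_def)
  let ?X = "fobj F X" and ?Y = "fobj F Y"
  have O: "?X \<in> obj D" "?Y \<in> obj D" using o by auto
  have "runit D ?X \<cdot>\<^bsub>D\<^esub> (idn D ?X \<odot>\<^sub>m\<^bsub>D\<^esub> ev') \<cdot>\<^bsub>D\<^esub> assoc D ?X ?Y ?X \<cdot>\<^bsub>D\<^esub> (coev' \<odot>\<^sub>m\<^bsub>D\<^esub> idn D ?X) =
      farr F (runit C X) \<cdot>\<^bsub>D\<^esub> (\<mu> X (unit C) \<cdot>\<^bsub>D\<^esub> ((idn D ?X \<odot>\<^sub>m\<^bsub>D\<^esub> farr F ev) \<cdot>\<^bsub>D\<^esub> ((idn D ?X \<odot>\<^sub>m\<^bsub>D\<^esub> \<mu> Y X) \<cdot>\<^bsub>D\<^esub>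
        (assoc D ?X ?Y ?X \<cdot>\<^bsub>D\<^esub> (coev' \<odot>\<^sub>m\<^bsub>D\<^esub> idn D ?X)))))"
    unfolding mu_runit[OF o(1), symmetric] using o O ev ev' coev' by simp
  also have "\<dots> = (farr F (runit C X) \<cdot>\<^bsub>D\<^esub> (farr F (idn C X \<odot>\<^sub>m\<^bsub>C\<^esub> ev) \<cdot>\<^bsub>D\<^esub> (farr F (assoc C X Y X) \<cdot>\<^bsub>D\<^esub>
      farr F (coev \<odot>\<^sub>m\<^bsub>C\<^esub> idn C X)))) \<cdot>\<^bsub>D\<^esub> (\<mu> (unit C) X \<cdot>\<^bsub>D\<^esub> (\<epsilon> \<odot>\<^sub>m\<^bsub>D\<^esub> idn D ?X))"
  proof (rule D.zigzag_transport)
    show "\<mu> X (unit C) \<cdot>\<^bsub>D\<^esub> (idn D ?X \<odot>\<^sub>m\<^bsub>D\<^esub> farr F ev) = farr F (idn C X \<odot>\<^sub>m\<^bsub>C\<^esub> ev) \<cdot>\<^bsub>D\<^esub> \<mu> X (Y \<odot>\<^bsub>C\<^esub> X)"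
      using mu_natural[of "idn C X" ev] o ev by simp
    show "\<mu> X (Y \<odot>\<^bsub>C\<^esub> X) \<cdot>\<^bsub>D\<^esub> ((idn D ?X \<odot>\<^sub>m\<^bsub>D\<^esub> \<mu> Y X) \<cdot>\<^bsub>D\<^esub> assoc D ?X ?Y ?X) =
        farr F (assoc C X Y X) \<cdot>\<^bsub>D\<^esub> (\<mu> (X \<odot>\<^bsub>C\<^esub> Y) X \<cdot>\<^bsub>D\<^esub> (\<mu> X Y \<odot>\<^sub>m\<^bsub>D\<^esub> idn D ?X))"
      using mu_assoc[of X Y X] o by simp
    show "(\<mu> X Y \<odot>\<^sub>m\<^bsub>D\<^esub> idn D ?X) \<cdot>\<^bsub>D\<^esub> (coev' \<odot>\<^sub>m\<^bsub>D\<^esub> idn D ?X) = (farr F coev \<odot>\<^sub>m\<^bsub>D\<^esub> idn D ?X) \<cdot>\<^bsub>D\<^esub> (\<epsilon> \<odot>\<^sub>m\<^bsub>D\<^esub> idn D ?X)"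
      using o coev coev' by simp
    show "\<mu> (X \<odot>\<^bsub>C\<^esub> Y) X \<cdot>\<^bsub>D\<^esub> (farr F coev \<odot>\<^sub>m\<^bsub>D\<^esub> idn D ?X) = farr F (coev \<odot>\<^sub>m\<^bsub>C\<^esub> idn C X) \<cdot>\<^bsub>D\<^esub> \<mu> (unit C) X"
      using mu_natural[of coev "idn C X"] o coev by simp
  qed (use o O ev coev ev' coev' in auto)
  also have "farr F (runit C X) \<cdot>\<^bsub>D\<^esub> (farr F (idn C X \<odot>\<^sub>m\<^bsub>C\<^esub> ev) \<cdot>\<^bsub>D\<^esub> (farr F (assoc C X Y X) \<cdot>\<^bsub>D\<^esub>
      farr F (coev \<odot>\<^sub>m\<^bsub>C\<^esub> idn C X))) = farr F (lunit C X)"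
    unfolding 1[symmetric] using o ev coev by (simp add: F_cmp)
  also have "farr F (lunit C X) \<cdot>\<^bsub>D\<^esub> (\<mu> (unit C) X \<cdot>\<^bsub>D\<^esub> (\<epsilon> \<odot>\<^sub>m\<^bsub>D\<^esub> idn D ?X)) = lunit D ?X" by (rule mu_lunit[OF o(1)])
  finally have 3: "runit D ?X \<cdot>\<^bsub>D\<^esub> (idn D ?X \<odot>\<^sub>m\<^bsub>D\<^esub> ev') \<cdot>\<^bsub>D\<^esub> assoc D ?X ?Y ?X \<cdot>\<^bsub>D\<^esub> (coev' \<odot>\<^sub>m\<^bsub>D\<^esub> idn D ?X) = lunit D ?X" .
  \<comment> \<open>Compatibility with the inverse associator, which the second zigzag identity
    involves; it follows from \<open>mu_assoc\<close> by cancelling associators on both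
    sides.\<close>
  have a: "\<mu> (Y \<odot>\<^bsub>C\<^esub> X) Y \<cdot>\<^bsub>D\<^esub> ((\<mu> Y X \<odot>\<^sub>m\<^bsub>D\<^esub> idn D ?Y) \<cdot>\<^bsub>D\<^esub> inv_arr D (assoc D ?Y ?X ?Y)) =
      farr F (inv_arr C (assoc C Y X Y)) \<cdot>\<^bsub>D\<^esub> (\<mu> Y (X \<odot>\<^bsub>C\<^esub> Y) \<cdot>\<^bsub>D\<^esub> (idn D ?Y \<odot>\<^sub>m\<^bsub>D\<^esub> \<mu> X Y))" (is "?l = ?i \<cdot>\<^bsub>D\<^esub> ?r")
  proof -
    have i: "?i \<cdot>\<^bsub>D\<^esub> farr F (assoc C Y X Y) = idn D (fobj F ((Y \<odot>\<^bsub>C\<^esub> X) \<odot>\<^bsub>C\<^esub> Y))"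
      using o by (simp flip: F_cmp)
    have l: "?l \<in> arr D" "tgt D ?l = fobj F ((Y \<odot>\<^bsub>C\<^esub> X) \<odot>\<^bsub>C\<^esub> Y)" using o O by auto
    have "farr F (assoc C Y X Y) \<cdot>\<^bsub>D\<^esub> ?l = (farr F (assoc C Y X Y) \<cdot>\<^bsub>D\<^esub> \<mu> (Y \<odot>\<^bsub>C\<^esub> X) Y \<cdot>\<^bsub>D\<^esub> (\<mu> Y X \<odot>\<^sub>m\<^bsub>D\<^esub> idn D ?Y)) \<cdot>\<^bsub>D\<^esub>
        inv_arr D (assoc D ?Y ?X ?Y)" using o O by simp
    also have "\<dots> = ?r" unfolding mu_assoc[OF o(2,1,2)] using o O by simp
    finally have "?i \<cdot>\<^bsub>D\<^esub> ?r = ?i \<cdot>\<^bsub>D\<^esub> (farr F (assoc C Y X Y) \<cdot>\<^bsub>D\<^esub> ?l)" by simp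
    also have "\<dots> = idn D (fobj F ((Y \<odot>\<^bsub>C\<^esub> X) \<odot>\<^bsub>C\<^esub> Y)) \<cdot>\<^bsub>D\<^esub> ?l" by (rule D.cmp_reassoc[OF i]) (use o O l in auto)
    also have "\<dots> = ?l" using l by simp
    finally show ?thesis ..
  qed
  have "lunit D ?Y \<cdot>\<^bsub>D\<^esub> (ev' \<odot>\<^sub>m\<^bsub>D\<^esub> idn D ?Y) \<cdot>\<^bsub>D\<^esub> inv_arr D (assoc D ?Y ?X ?Y) \<cdot>\<^bsub>D\<^esub> (idn D ?Y \<odot>\<^sub>m\<^bsub>D\<^esub> coev') =
      farr F (lunit C Y) \<cdot>\<^bsub>D\<^esub> (\<mu> (unit C) Y \<cdot>\<^bsub>D\<^esub> ((farr F ev \<odot>\<^sub>m\<^bsub>D\<^esub> idn D ?Y) \<cdot>\<^bsub>D\<^esub> ((\<mu> Y X \<odot>\<^sub>m\<^bsub>D\<^esub> idn D ?Y) \<cdot>\<^bsub>D\<^esub>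
        (inv_arr D (assoc D ?Y ?X ?Y) \<cdot>\<^bsub>D\<^esub> (idn D ?Y \<odot>\<^sub>m\<^bsub>D\<^esub> coev')))))"
    unfolding mu_lunit[OF o(2), symmetric] using o O ev ev' coev' by simp
  also have "\<dots> = (farr F (lunit C Y) \<cdot>\<^bsub>D\<^esub> (farr F (ev \<odot>\<^sub>m\<^bsub>C\<^esub> idn C Y) \<cdot>\<^bsub>D\<^esub> (farr F (inv_arr C (assoc C Y X Y)) \<cdot>\<^bsub>D\<^esub>
      farr F (idn C Y \<odot>\<^sub>m\<^bsub>C\<^esub> coev)))) \<cdot>\<^bsub>D\<^esub> (\<mu> Y (unit C) \<cdot>\<^bsub>D\<^esub> (idn D ?Y \<odot>\<^sub>m\<^bsub>D\<^esub> \<epsilon>))"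
  proof (rule D.zigzag_transport[OF _ a])
    show "\<mu> (unit C) Y \<cdot>\<^bsub>D\<^esub> (farr F ev \<odot>\<^sub>m\<^bsub>D\<^esub> idn D ?Y) = farr F (ev \<odot>\<^sub>m\<^bsub>C\<^esub> idn C Y) \<cdot>\<^bsub>D\<^esub> \<mu> (Y \<odot>\<^bsub>C\<^esub> X) Y"
      using mu_natural[of ev "idn C Y"] o ev by simp
    show "(idn D ?Y \<odot>\<^sub>m\<^bsub>D\<^esub> \<mu> X Y) \<cdot>\<^bsub>D\<^esub> (idn D ?Y \<odot>\<^sub>m\<^bsub>D\<^esub> coev') = (idn D ?Y \<odot>\<^sub>m\<^bsub>D\<^esub> farr F coev) \<cdot>\<^bsub>D\<^esub> (idn D ?Y \<odot>\<^sub>m\<^bsub>D\<^esub> \<epsilon>)"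
      using o coev coev' by simp
    show "\<mu> Y (X \<odot>\<^bsub>C\<^esub> Y) \<cdot>\<^bsub>D\<^esub> (idn D ?Y \<odot>\<^sub>m\<^bsub>D\<^esub> farr F coev) = farr F (idn C Y \<odot>\<^sub>m\<^bsub>C\<^esub> coev) \<cdot>\<^bsub>D\<^esub> \<mu> Y (unit C)"
      using mu_natural[of "idn C Y" coev] o coev by simp
  qed (use o O ev coev ev' coev' in auto)
  also have "farr F (lunit C Y) \<cdot>\<^bsub>D\<^esub> (farr F (ev \<odot>\<^sub>m\<^bsub>C\<^esub> idn C Y) \<cdot>\<^bsub>D\<^esub> (farr F (inv_arr C (assoc C Y X Y)) \<cdot>\<^bsub>D\<^esub>
      farr F (idn C Y \<odot>\<^sub>m\<^bsub>C\<^esub> coev))) = farr F (runit C Y)"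
    unfolding 2[symmetric] using o ev coev by (simp add: F_cmp)
  also have "farr F (runit C Y) \<cdot>\<^bsub>D\<^esub> (\<mu> Y (unit C) \<cdot>\<^bsub>D\<^esub> (idn D ?Y \<odot>\<^sub>m\<^bsub>D\<^esub> \<epsilon>)) = runit D ?Y" by (rule mu_runit[OF o(2)])
  finally have 4: "lunit D ?Y \<cdot>\<^bsub>D\<^esub> (ev' \<odot>\<^sub>m\<^bsub>D\<^esub> idn D ?Y) \<cdot>\<^bsub>D\<^esub> inv_arr D (assoc D ?Y ?X ?Y) \<cdot>\<^bsub>D\<^esub> (idn D ?Y \<odot>\<^sub>m\<^bsub>D\<^esub> coev') = runit D ?Y" .
  show ?thesis unfolding dualizable_def
    by (intro conjI bexI[of _ ?Y] bexI[of _ ev'] bexI[of _ coev']) (use 3 4 O ev' coev' in auto)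
qed

end

lemma strong_monoidalE:
  assumes S: "strong_symmetric_monoidal_functor C D F" and C: "symmetric_monoidal_category C" and D: "symmetric_monoidal_category D"
  obtains \<epsilon> \<mu> where "strong_monoidal C D F \<epsilon> \<mu>"
proof -
  interpret C: symmetric_monoidal_category C by fact
  interpret D: symmetric_monoidal_category D by fact
  obtain \<epsilon> \<mu> where F: "is_functor C D F" and eps: "\<epsilon> \<in> isos D (unit D) (fobj F (unit C))"
    and mu: "\<forall>X \<in> obj C. \<forall>Y \<in> obj C. \<mu> X Y \<in> isos D (fobj F X \<odot>\<^bsub>D\<^esub> fobj F Y) (fobj F (X \<odot>\<^bsub>C\<^esub> Y))"
    and nat: "\<forall>X \<in> obj C. \<forall>X' \<in> obj C. \<forall>Y \<in> obj C. \<forall>Y' \<in> obj C. \<forall>f \<in> Hom C X X'. \<forall>g \<in> Hom C Y Y'.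
      farr F (f \<odot>\<^sub>m\<^bsub>C\<^esub> g) \<cdot>\<^bsub>D\<^esub> \<mu> X Y = \<mu> X' Y' \<cdot>\<^bsub>D\<^esub> (farr F f \<odot>\<^sub>m\<^bsub>D\<^esub> farr F g)"
    and as: "\<forall>X \<in> obj C. \<forall>Y \<in> obj C. \<forall>Z \<in> obj C.
      farr F (assoc C X Y Z) \<cdot>\<^bsub>D\<^esub> \<mu> (X \<odot>\<^bsub>C\<^esub> Y) Z \<cdot>\<^bsub>D\<^esub> (\<mu> X Y \<odot>\<^sub>m\<^bsub>D\<^esub> idn D (fobj F Z)) =
      \<mu> X (Y \<odot>\<^bsub>C\<^esub> Z) \<cdot>\<^bsub>D\<^esub> (idn D (fobj F X) \<odot>\<^sub>m\<^bsub>D\<^esub> \<mu> Y Z) \<cdot>\<^bsub>D\<^esub> assoc D (fobj F X) (fobj F Y) (fobj F Z)"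
    and un: "\<forall>X \<in> obj C.
      farr F (lunit C X) \<cdot>\<^bsub>D\<^esub> \<mu> (unit C) X \<cdot>\<^bsub>D\<^esub> (\<epsilon> \<odot>\<^sub>m\<^bsub>D\<^esub> idn D (fobj F X)) = lunit D (fobj F X) \<and>
      farr F (runit C X) \<cdot>\<^bsub>D\<^esub> \<mu> X (unit C) \<cdot>\<^bsub>D\<^esub> (idn D (fobj F X) \<odot>\<^sub>m\<^bsub>D\<^esub> \<epsilon>) = runit D (fobj F X)"
    using S unfolding strong_symmetric_monoidal_functor_def by (elim conjE exE) (rule that)
  have "strong_monoidal C D F \<epsilon> \<mu>"
  proof unfold_locales
    show "is_functor C D F" by fact
    show "iso_arr D \<epsilon>" "src D \<epsilon> = unit D" "tgt D \<epsilon> = fobj F (unit C)" using eps by (auto simp: D.isos_iff)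
    show "\<mu> X Y \<in> isos D (fobj F X \<odot>\<^bsub>D\<^esub> fobj F Y) (fobj F (X \<odot>\<^bsub>C\<^esub> Y))" if "X \<in> obj C" "Y \<in> obj C" for X Y
      using mu that by blast
    show "farr F (f \<odot>\<^sub>m\<^bsub>C\<^esub> g) \<cdot>\<^bsub>D\<^esub> \<mu> (src C f) (src C g) = \<mu> (tgt C f) (tgt C g) \<cdot>\<^bsub>D\<^esub> (farr F f \<odot>\<^sub>m\<^bsub>D\<^esub> farr F g)"
      if "f \<in> arr C" "g \<in> arr C" for f g
      by (rule nat[rule_format]) (use that in auto)
    show "farr F (assoc C X Y Z) \<cdot>\<^bsub>D\<^esub> \<mu> (X \<odot>\<^bsub>C\<^esub> Y) Z \<cdot>\<^bsub>D\<^esub> (\<mu> X Y \<odot>\<^sub>m\<^bsub>D\<^esub> idn D (fobj F Z)) =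
      \<mu> X (Y \<odot>\<^bsub>C\<^esub> Z) \<cdot>\<^bsub>D\<^esub> (idn D (fobj F X) \<odot>\<^sub>m\<^bsub>D\<^esub> \<mu> Y Z) \<cdot>\<^bsub>D\<^esub> assoc D (fobj F X) (fobj F Y) (fobj F Z)"
      if "X \<in> obj C" "Y \<in> obj C" "Z \<in> obj C" for X Y Z by (rule as[rule_format]) fact+
    show "farr F (lunit C X) \<cdot>\<^bsub>D\<^esub> \<mu> (unit C) X \<cdot>\<^bsub>D\<^esub> (\<epsilon> \<odot>\<^sub>m\<^bsub>D\<^esub> idn D (fobj F X)) = lunit D (fobj F X)"
      "farr F (runit C X) \<cdot>\<^bsub>D\<^esub> \<mu> X (unit C) \<cdot>\<^bsub>D\<^esub> (idn D (fobj F X) \<odot>\<^sub>m\<^bsub>D\<^esub> \<epsilon>) = runit D (fobj F X)"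
      if "X \<in> obj C" for X using un[rule_format, OF that] by blast+
  qed
  then show ?thesis by (rule that)
qed

section \<open>Geometric functors, ideals and spectra\<close>

locale geometric = C: rigid_tt_category C \<kappa> + D: rigid_tt_category D \<kappa> + strong_monoidal C D F \<epsilon> \<mu>
  for C :: "('o, 'm, 'x) tt_data_scheme" and D :: "('p, 'n, 'y) tt_data_scheme" and \<kappa> :: "'u rel"
    and F :: "('o, 'm, 'p, 'n) fctr" and \<epsilon> \<mu> +
  assumes exact: "exact_functor C D F"
begin

lemma image_zero:
  assumes "zero_object C Z" shows "zero_object D (fobj F Z)"
proof -
  have a: "additive_functor C D F" using exact by (simp add: exact_functor_def)
  have Z: "Z \<in> obj C" "idn C Z = zero_arr C Z Z" using assms by (auto simp: C.zero_object_iff)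
  have "idn D (fobj F Z) = farr F (zero_arr C Z Z)" unfolding Z(2)[symmetric] using Z(1) by simp
  also have "\<dots> = zero_arr D (fobj F Z) (fobj F Z)"
    by (rule additive_functor_zero[OF a C.additive_category_axioms D.additive_category_axioms Z(1) Z(1)])
  finally show ?thesis using Z(1) by (simp add: D.zero_object_iff)
qed

lemma image_shift:
  assumes "X \<in> obj C"
  shows "retract D (fobj F (\<Sigma>\<^sub>o\<^bsub>C\<^esub> X)) (\<Sigma>\<^sub>o\<^bsub>D\<^esub> (fobj F X))" "retract D (\<Sigma>\<^sub>o\<^bsub>D\<^esub> (fobj F X)) (fobj F (\<Sigma>\<^sub>o\<^bsub>C\<^esub> X))"
proof -
  obtain \<phi> where "\<forall>X \<in> obj C. \<phi> X \<in> isos D (fobj F (\<Sigma>\<^sub>o\<^bsub>C\<^esub> X)) (\<Sigma>\<^sub>o\<^bsub>D\<^esub> (fobj F X))"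
    using exact unfolding exact_functor_def by (elim conjE exE) (rule that)
  then have "iso_arr D (\<phi> X) \<and> src D (\<phi> X) = fobj F (\<Sigma>\<^sub>o\<^bsub>C\<^esub> X) \<and> tgt D (\<phi> X) = \<Sigma>\<^sub>o\<^bsub>D\<^esub> (fobj F X)"
    using assms D.isos_iff by blast
  then show "retract D (fobj F (\<Sigma>\<^sub>o\<^bsub>C\<^esub> X)) (\<Sigma>\<^sub>o\<^bsub>D\<^esub> (fobj F X))" "retract D (\<Sigma>\<^sub>o\<^bsub>D\<^esub> (fobj F X)) (fobj F (\<Sigma>\<^sub>o\<^bsub>C\<^esub> X))"
    using D.iso_retract[of "\<phi> X"] by simp_all
qed

lemma image_tri:
  assumes "(f, g, h) \<in> tri C" shows "\<exists>h'. (farr F f, farr F g, h') \<in> tri D"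
proof -
  obtain \<phi> where "\<forall>f g h. (f, g, h) \<in> tri C \<longrightarrow> (farr F f, farr F g, \<phi> (src C f) \<cdot>\<^bsub>D\<^esub> farr F h) \<in> tri D"
    using exact unfolding exact_functor_def by (elim conjE exE) (rule that)
  then show ?thesis using assms by blast
qed

text \<open>Compact means dualizable on both sides, and dualizability is preserved by the monoidal
  structure alone.\<close>

lemma image_compact: "C.compact X \<Longrightarrow> D.compact (fobj F X)"
  unfolding C.rigid D.rigid by (rule image_dualizable)

text \<open>Besides giving the ideal part of the map on spectra, this transfers membership of an
  image from an object to its core representative in \<open>image_vanishes\<close>.\<close>

lemma ideal_preimage:
  assumes N: "thick_class \<kappa> D N" shows "C.ideal {x. C.compact x \<and> fobj F x \<in> N}" (is "C.ideal ?N")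
  unfolding C.ideal_iff thick_class_def
proof (intro conjI allI ballI impI)
  show "?N \<subseteq> obj C" using C.compact_obj by blast
  show "Z \<in> ?N" if "zero_object C Z" for Z
    using C.compact_zero[OF that] D.thick_zero[OF N image_zero[OF that]] by simp
  show "\<Sigma>\<^sub>o\<^bsub>C\<^esub> X \<in> ?N \<longleftrightarrow> X \<in> ?N" if X: "X \<in> obj C" for X
  proof -
    have "fobj F (\<Sigma>\<^sub>o\<^bsub>C\<^esub> X) \<in> N \<longleftrightarrow> \<Sigma>\<^sub>o\<^bsub>D\<^esub> (fobj F X) \<in> N"
      using D.thick_retract[OF N image_shift(1)[OF X]] D.thick_retract[OF N image_shift(2)[OF X]] by blast
    also have "\<dots> \<longleftrightarrow> fobj F X \<in> N" using X by (intro D.thick_shift[OF N]) simp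
    finally show ?thesis using C.compact_shift[of \<kappa> X] C.compact_unshift[of \<kappa> X] X by blast
  qed
  show "tgt C g \<in> ?N" if "(f, g, h) \<in> tri C \<and> src C f \<in> ?N \<and> tgt C f \<in> ?N" for f g h
  proof -
    have T: "(f, g, h) \<in> tri C" and c: "C.compact (src C f)" "C.compact (tgt C f)"
      and n: "fobj F (src C f) \<in> N" "fobj F (tgt C f) \<in> N" using that by auto
    obtain h' where T': "(farr F f, farr F g, h') \<in> tri D" using image_tri[OF T] by blast
    show ?thesis using C.compact_cone[OF T c] D.thick_cone[OF N T'] n C.triD[OF T] by simp
  qed
  show "X \<in> ?N" if "retract C X Y \<and> Y \<in> ?N" for X Y
    using that C.compact_retract[of \<kappa> Y X] D.thick_retract[OF N functor_retract[OF F C.category_axioms, of X Y]] by simp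
  show "X \<odot>\<^bsub>C\<^esub> Y \<in> ?N" if "C.compact X \<and> Y \<in> ?N" for X Y
  proof -
    have c: "C.compact X" "C.compact Y" and n: "fobj F Y \<in> N" using that by auto
    have "fobj F X \<odot>\<^bsub>D\<^esub> fobj F Y \<in> N" by (rule D.thick_tensor[OF N image_compact[OF c(1)] n])
    then have "fobj F (X \<odot>\<^bsub>C\<^esub> Y) \<in> N"
      by (rule D.thick_retract[OF N mu_retract(2)[OF C.compact_obj[OF c(1)] C.compact_obj[OF c(2)]]])
    then show ?thesis using C.compact_tensor[OF c] by simp
  qed
  show "C.compact X" if "X \<in> ?N" for X using that by simp
qed

lemma Spc_map_eq: "Spc_map (compact_part \<kappa> C) F Q = {x. C.compact x \<and> fobj F x \<in> Q}"
  by (simp add: Spc_map_def)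

lemma unit_image_retract: "retract D (unit D) (fobj F (unit C))" "retract D (fobj F (unit C)) (unit D)"
  using D.iso_retract[of \<epsilon>] by simp_all

lemma Spc_map_prime:
  assumes Q: "Q \<in> prime_ideals (compact_part \<kappa> D)"
  shows "Spc_map (compact_part \<kappa> C) F Q \<in> prime_ideals (compact_part \<kappa> C)"
  unfolding Spc_map_eq
proof (rule C.prime_idealsI)
  note T = D.ideal_thick[OF D.prime_idealsD(1)[OF Q]]
  show "C.ideal {x. C.compact x \<and> fobj F x \<in> Q}" by (rule ideal_preimage[OF T])
  show "unit C \<notin> {x. C.compact x \<and> fobj F x \<in> Q}"
    using D.thick_retract[OF T unit_image_retract(1)] D.prime_idealsD(2)[OF Q] by blast
  fix X Y assume c: "C.compact X" "C.compact Y" and "X \<odot>\<^bsub>C\<^esub> Y \<in> {x. C.compact x \<and> fobj F x \<in> Q}"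
  then have "fobj F X \<odot>\<^bsub>D\<^esub> fobj F Y \<in> Q"
    using D.thick_retract[OF T mu_retract(1)[OF C.compact_obj[OF c(1)] C.compact_obj[OF c(2)]]] by simp
  then show "X \<in> {x. C.compact x \<and> fobj F x \<in> Q} \<or> Y \<in> {x. C.compact x \<and> fobj F x \<in> Q}"
    using D.prime_idealsD(3)[OF Q image_compact[OF c(1)] image_compact[OF c(2)]] c by simp
qed

text \<open>The assumption \<open>sep\<close> says that the ideal generated by the image of
  \<open>P\<close> misses the images of all objects outside \<open>P\<close>. These images generate
  a multiplicative set, and a prime separating it from that ideal lies over
  \<open>P\<close>.\<close>

lemma Spc_map_lift:
  assumes P: "P \<in> prime_ideals (compact_part \<kappa> C)"
    and sep: "\<And>a. C.compact a \<Longrightarrow> a \<notin> P \<Longrightarrow> \<exists>A. D.ideal A \<and> fobj F ` P \<subseteq> A \<and> fobj F a \<notin> A"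
  obtains Q where "Q \<in> prime_ideals (compact_part \<kappa> D)" "Spc_map (compact_part \<kappa> C) F Q = P"
proof -
  let ?P = "{x. D.compact x \<and> (\<forall>A \<in> {A. D.ideal A \<and> fobj F ` P \<subseteq> A}. x \<in> A)}"
  \<comment> \<open>The functor preserves tensor products only up to isomorphism, so the bare images
    are not literally closed under tensor; allowing objects that have an image as a retract repairs
    this.\<close>
  let ?M = "{y. D.compact y \<and> (\<exists>a. C.compact a \<and> a \<notin> P \<and> retract D (fobj F a) y)}"
  have cP: "C.compact a" if "a \<in> P" for a by (rule C.ideal_compact[OF C.prime_idealsD(1)[OF P] that])
  have iP: "D.ideal ?P" by (rule D.ideal_Inter) blast
  have M: "fobj F a \<in> ?M" if "C.compact a" "a \<notin> P" for a
    using that image_compact[OF that(1)] C.compact_obj[OF that(1)] D.retract_refl[of "fobj F a"] by auto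
  have Mt: "m \<odot>\<^bsub>D\<^esub> n \<in> ?M" if mn: "m \<in> ?M" "n \<in> ?M" for m n
  proof -
    obtain a where a: "C.compact a" "a \<notin> P" "retract D (fobj F a) m" using mn(1) by blast
    obtain b where b: "C.compact b" "b \<notin> P" "retract D (fobj F b) n" using mn(2) by blast
    have "retract D (fobj F (a \<odot>\<^bsub>C\<^esub> b)) (fobj F a \<odot>\<^bsub>D\<^esub> fobj F b)"
      by (rule mu_retract(2)[OF C.compact_obj[OF a(1)] C.compact_obj[OF b(1)]])
    then have "retract D (fobj F (a \<odot>\<^bsub>C\<^esub> b)) (m \<odot>\<^bsub>D\<^esub> n)"
      by (rule D.retract_trans[OF _ D.tensor_retract[OF a(3) b(3)]])
    moreover have "a \<odot>\<^bsub>C\<^esub> b \<notin> P" using C.prime_idealsD(3)[OF P a(1) b(1)] a(2) b(2) by blast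
    ultimately show ?thesis using C.compact_tensor[OF a(1) b(1)] D.compact_tensor[of m n] mn by blast
  qed
  have d: "?P \<inter> ?M = {}"
  proof (rule equals0I)
    fix y assume y: "y \<in> ?P \<inter> ?M"
    then obtain a where a: "C.compact a" "a \<notin> P" "retract D (fobj F a) y" by blast
    obtain A where A: "D.ideal A" "fobj F ` P \<subseteq> A" "fobj F a \<notin> A" using sep[OF a(1,2)] by blast
    have "y \<in> A" using y A(1,2) by blast
    then show False using D.thick_retract[OF D.ideal_thick[OF A(1)] a(3)] A(3) by blast
  qed
  obtain Q where Q: "Q \<in> prime_ideals (compact_part \<kappa> D)" "?P \<subseteq> Q" "Q \<inter> ?M = {}"
    by (rule D.prime_ideal_exists[OF iP M[OF C.compact_unit C.prime_idealsD(2)[OF P]] _ Mt d]) blast+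
  have "fobj F a \<in> Q \<longleftrightarrow> a \<in> P" if a: "C.compact a" for a
  proof
    assume "fobj F a \<in> Q" then show "a \<in> P" using M[OF a] Q(3) by blast
  next
    assume "a \<in> P"
    then have "fobj F a \<in> ?P" using image_compact[OF a] by blast
    then show "fobj F a \<in> Q" using Q(2) by blast
  qed
  then have "Spc_map (compact_part \<kappa> C) F Q = P" unfolding Spc_map_eq using cP by blast
  then show ?thesis using that Q(1) by blast
qed

text \<open>The core representative \<open>a'\<close> enters because the retraction of
  \<open>R\<close> is available only for objects of the core, while the object \<open>a\<close>
  supplied by the lifting argument is an arbitrary compact one.\<close>

lemma image_vanishes:
  assumes R: "R \<in> obj C" "\<And>b. b \<in> P \<Longrightarrow> C.compact b" "\<And>b. b \<in> P \<Longrightarrow> zero_object C (R \<odot>\<^bsub>C\<^esub> b)"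
    and a: "\<And>A. D.ideal A \<Longrightarrow> fobj F ` P \<subseteq> A \<Longrightarrow> fobj F a \<in> A" "C.compact a"
    and a': "\<And>A. C.ideal A \<Longrightarrow> a \<in> A \<Longrightarrow> a' \<in> A" and E: "E \<in> obj C" "retract C R ((a' \<odot>\<^bsub>C\<^esub> E) \<odot>\<^bsub>C\<^esub> R)"
  shows "zero_object D (fobj F R)"
proof -
  let ?A = "{x. D.compact x \<and> zero_object D (x \<odot>\<^bsub>D\<^esub> fobj F R)}"
  have A: "D.ideal ?A" by (rule D.ideal_annihilator) (use R in simp)
  have "fobj F b \<in> ?A" if b: "b \<in> P" for b
  proof -
    have bo: "b \<in> obj C" by (rule C.compact_obj[OF R(2)[OF b]])
    have "zero_object C (b \<odot>\<^bsub>C\<^esub> R)" by (rule C.zero_objectI_retract[OF C.tensor_comm_retract[OF bo R(1)] R(3)[OF b]])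
    then have "zero_object D (fobj F (b \<odot>\<^bsub>C\<^esub> R))" by (rule image_zero)
    then have "zero_object D (fobj F b \<odot>\<^bsub>D\<^esub> fobj F R)" by (rule D.zero_objectI_retract[OF mu_retract(1)[OF bo R(1)]])
    then show ?thesis using image_compact[OF R(2)[OF b]] by simp
  qed
  then have "fobj F a \<in> ?A" by (intro a(1)[OF A]) blast
  then have "a \<in> {x. C.compact x \<and> fobj F x \<in> ?A}" using a(2) by simp
  then have "a' \<in> {x. C.compact x \<and> fobj F x \<in> ?A}" by (rule a'[OF ideal_preimage[OF D.ideal_thick[OF A]]])
  then have c: "C.compact a'" and z: "zero_object D (fobj F a' \<odot>\<^bsub>D\<^esub> fobj F R)" by simp_all
  have ao: "a' \<in> obj C" by (rule C.compact_obj[OF c])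
  note E(2)
  also have "retract C ((a' \<odot>\<^bsub>C\<^esub> E) \<odot>\<^bsub>C\<^esub> R) ((E \<odot>\<^bsub>C\<^esub> a') \<odot>\<^bsub>C\<^esub> R)"
    by (intro C.tensor_retract C.retract_refl C.tensor_comm_retract) fact+
  also have "retract C ((E \<odot>\<^bsub>C\<^esub> a') \<odot>\<^bsub>C\<^esub> R) (E \<odot>\<^bsub>C\<^esub> (a' \<odot>\<^bsub>C\<^esub> R))" by (intro C.tensor_assoc_retract) fact+
  finally have "retract D (fobj F R) (fobj F (E \<odot>\<^bsub>C\<^esub> (a' \<odot>\<^bsub>C\<^esub> R)))" by (rule functor_retract[OF F C.category_axioms])
  also have "retract D (fobj F (E \<odot>\<^bsub>C\<^esub> (a' \<odot>\<^bsub>C\<^esub> R))) (fobj F E \<odot>\<^bsub>D\<^esub> fobj F (a' \<odot>\<^bsub>C\<^esub> R))"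
    by (rule mu_retract(2)) (use E ao R in auto)
  also have "retract D (fobj F E \<odot>\<^bsub>D\<^esub> fobj F (a' \<odot>\<^bsub>C\<^esub> R)) (fobj F E \<odot>\<^bsub>D\<^esub> (fobj F a' \<odot>\<^bsub>D\<^esub> fobj F R))"
    by (intro D.tensor_retract D.retract_refl mu_retract(2)) (use E ao R in auto)
  finally show ?thesis by (rule D.zero_objectI_retract) (rule D.zero_tensor(2)[OF z], use E in simp)
qed

end

section \<open>Surjectivity on spectra\<close>

lemma rigid_tt_categoryI:
  assumes "inaccessible \<kappa>" "rigidly_compactly_generated \<kappa> C"
  shows "rigid_tt_category C \<kappa>"
proof -
  interpret tt_category C using assms(2) by (simp add: rigidly_compactly_generated_def)
  show ?thesis by unfold_locales (use assms in \<open>auto simp: rigidly_compactly_generated_def\<close>)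
qed

lemma geometricE:
  assumes "inaccessible \<kappa>" "geometric_functor \<kappa> C D F"
  obtains \<epsilon> \<mu> where "geometric C D \<kappa> F \<epsilon> \<mu>"
proof -
  have r: "rigidly_compactly_generated \<kappa> C" "rigidly_compactly_generated \<kappa> D" and e: "exact_functor C D F"
    and s: "strong_symmetric_monoidal_functor C D F" using assms(2) by (auto simp: geometric_functor_def)
  interpret C: rigid_tt_category C \<kappa> by (rule rigid_tt_categoryI[OF assms(1) r(1)])
  interpret D: rigid_tt_category D \<kappa> by (rule rigid_tt_categoryI[OF assms(1) r(2)])
  obtain \<epsilon> \<mu> where sm: "strong_monoidal C D F \<epsilon> \<mu>"
    by (rule strong_monoidalE[OF s C.symmetric_monoidal_category_axioms D.symmetric_monoidal_category_axioms])
  have "geometric C D \<kappa> F \<epsilon> \<mu>"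
    by (intro geometric.intro geometric_axioms.intro C.rigid_tt_category_axioms D.rigid_tt_category_axioms sm e)
  then show ?thesis by (rule that)
qed

lemma topspace_Spc_compact_part:
  assumes "inaccessible \<kappa>" "rigidly_compactly_generated \<kappa> C"
  shows "topspace (Spc (compact_part \<kappa> C)) = prime_ideals (compact_part \<kappa> C)"
proof -
  interpret rigid_tt_category C \<kappa> by (rule rigid_tt_categoryI[OF assms])
  obtain Z where "zero_object C Z" using ex_zero_object by blast
  then show ?thesis by (intro topspace_Spc[of _ Z]) (simp add: zero_object_compact_part)
qed

theorem theorem1p4:
  fixes \<kappa> :: "'u rel"
    and T :: "('o, 'm) tt_data"
    and I :: "'i set"
    and S :: "'i \<Rightarrow> ('p, 'n) tt_data"
    and F :: "'i \<Rightarrow> ('o, 'm, 'p, 'n) fctr"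
  assumes "inaccessible \<kappa>"
    and "rigidly_compactly_generated \<kappa> T"
    and "\<And>i. i \<in> I \<Longrightarrow> rigidly_compactly_generated \<kappa> (S i)"
    and "\<And>i. i \<in> I \<Longrightarrow> geometric_functor \<kappa> T (S i) (F i)"
    and "jointly_nil_conservative T I S F"
  shows "(\<lambda>(i, Q). Spc_map (compact_part \<kappa> T) (F i) Q) `
           topspace (sum_topology (\<lambda>i. Spc (compact_part \<kappa> (S i))) I)
         = topspace (Spc (compact_part \<kappa> T))"
proof -
  let ?K = "compact_part \<kappa> T" and ?K' = "\<lambda>i. compact_part \<kappa> (S i)"
  have top: "topspace (sum_topology (\<lambda>i. Spc (?K' i)) I) = Sigma I (\<lambda>i. prime_ideals (?K' i))"
    using topspace_Spc_compact_part[OF assms(1,3)] by (auto simp: topspace_sum_topology)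
  have prime: "Spc_map ?K (F i) Q \<in> prime_ideals ?K" if i: "i \<in> I" and Q: "Q \<in> prime_ideals (?K' i)" for i Q
  proof -
    obtain \<epsilon> \<mu> where "geometric T (S i) \<kappa> (F i) \<epsilon> \<mu>" by (rule geometricE[OF assms(1) assms(4)[OF i]])
    then interpret geometric T "S i" \<kappa> "F i" \<epsilon> \<mu> .
    show ?thesis by (rule Spc_map_prime[OF Q])
  qed
  interpret rigid_tt_category T \<kappa> by (rule rigid_tt_categoryI[OF assms(1,2)])
  obtain G where G: "small \<kappa> G" "\<forall>g \<in> G. compact g"
    "\<forall>X \<in> obj T. (\<forall>g \<in> G. Hom T g X = {zero_arr T g X}) \<longrightarrow> zero_object T X"
    using assms(2) unfolding rigidly_compactly_generated_def compactly_generated_def by (elim conjE exE) (rule that)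
  obtain T0 where T0: "triangulated_core T \<kappa> T0" by (rule ex_core[OF G(1)]) (use G in auto)
  interpret core: rigid_core T \<kappa> T0 by (intro rigid_core.intro rigid_tt_category_axioms T0)
  have lift: "\<exists>i \<in> I. \<exists>Q \<in> prime_ideals (?K' i). Spc_map ?K (F i) Q = P" if P: "P \<in> prime_ideals ?K" for P
  proof (rule ccontr)
    assume n: "\<not> ?thesis"
    obtain R \<eta> where R: "weak_ring T R \<eta>" "\<not> zero_object T R" "\<And>b. b \<in> P \<Longrightarrow> zero_object T (R \<odot>\<^bsub>T\<^esub> b)"
      "\<And>a. a \<in> T0 \<Longrightarrow> a \<notin> P \<Longrightarrow> \<exists>D \<in> obj T. retract T R ((a \<odot>\<^bsub>T\<^esub> D) \<odot>\<^bsub>T\<^esub> R)"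
      by (rule core.weak_ring_at_prime[OF P]) (rule that)
    note iP = prime_idealsD(1)[OF P]
    have Ro: "R \<in> obj T" using R(1) by (simp add: weak_ring_def)
    have "zero_object (S i) (fobj (F i) R)" if i: "i \<in> I" for i
    proof -
      obtain \<epsilon> \<mu> where "geometric T (S i) \<kappa> (F i) \<epsilon> \<mu>" by (rule geometricE[OF assms(1) assms(4)[OF i]])
      then interpret f: geometric T "S i" \<kappa> "F i" \<epsilon> \<mu> .
      \<comment> \<open>Since \<open>P\<close> has no preimage for this \<open>i\<close>, the
        separation hypothesis of \<open>f.Spc_map_lift\<close> must fail. The witness may depend on
        \<open>i\<close>, whereas \<open>R\<close> was fixed before \<open>i\<close>.\<close>
      have "\<exists>a. compact a \<and> a \<notin> P \<and> (\<forall>A. f.D.ideal A \<longrightarrow> fobj (F i) ` P \<subseteq> A \<longrightarrow> fobj (F i) a \<in> A)"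
      proof (rule ccontr)
        assume no: "\<not> ?thesis"
        obtain Q where "Q \<in> prime_ideals (?K' i)" "Spc_map ?K (F i) Q = P"
          by (rule f.Spc_map_lift[OF P]) (use no in blast)
        then show False using n i by blast
      qed
      then obtain a where a: "compact a" "a \<notin> P"
        and aA: "\<forall>A. f.D.ideal A \<longrightarrow> fobj (F i) ` P \<subseteq> A \<longrightarrow> fobj (F i) a \<in> A" by (elim exE conjE)
      \<comment> \<open>The representative lies in the same ideals as \<open>a\<close>; in
        particular it is outside \<open>P\<close>, so \<open>R\<close> is a retract of a product
        with it.\<close>
      obtain a' where a': "a' \<in> T0" "\<And>A. ideal A \<Longrightarrow> a' \<in> A \<longleftrightarrow> a \<in> A"
        by (rule core.core_representative[OF a(1)]) (rule that)
      obtain E where E: "E \<in> obj T" "retract T R ((a' \<odot>\<^bsub>T\<^esub> E) \<odot>\<^bsub>T\<^esub> R)"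
        using R(4)[OF a'(1)] a'(2)[OF iP] a(2) by blast
      show ?thesis
      proof (rule f.image_vanishes[OF Ro _ R(3) _ a(1) _ E])
        show "compact b" if "b \<in> P" for b by (rule ideal_compact[OF iP that])
        show "fobj (F i) a \<in> A" if "f.D.ideal A" "fobj (F i) ` P \<subseteq> A" for A using aA that by blast
        show "a' \<in> A" if "ideal A" "a \<in> A" for A using a'(2)[OF that(1)] that(2) by blast
      qed
    qed
    then have "zero_object T R" using assms(5) R(1) unfolding jointly_nil_conservative_def by blast
    then show False using R(2) by blast
  qed
  show ?thesis unfolding top topspace_Spc_compact_part[OF assms(1,2)]
  proof (intro equalityI subsetI)
    show "P \<in> prime_ideals ?K" if "P \<in> (\<lambda>(i, Q). Spc_map ?K (F i) Q) ` Sigma I (\<lambda>i. prime_ideals (?K' i))" for P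
      using that prime by auto
    show "P \<in> (\<lambda>(i, Q). Spc_map ?K (F i) Q) ` Sigma I (\<lambda>i. prime_ideals (?K' i))" if P: "P \<in> prime_ideals ?K" for P
    proof -
      obtain i Q where "i \<in> I" "Q \<in> prime_ideals (?K' i)" "Spc_map ?K (F i) Q = P" using lift[OF P] by blast
      then show ?thesis by (intro image_eqI[of _ _ "(i, Q)"]) auto
    qed
  qed
qed

end
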